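(* Let $0<\alpha<1$, $\gamma\ge0$ with $0<\alpha+\gamma\le1$, and let $(X^{(\alpha,\gamma)}_t,\ t\ge0)$ be the stretched non-local Pearson diffusion associated with one of the three Pearson diffusions (Ornstein-Uhlenbeck, Cox-Ingersoll-Ross, Jacobi) with state space $S$, generator $\mathcal{G}$, stationary density $\boldsymbol{m}$ and orthonormal polynomials $Q_n$. Let $h\in L_2(\boldsymbol{m}(x)dx)$ be such that the series $\sum_na_nQ_n$, where $a_n=\int_Sh(x)Q_n(x)\boldsymbol{m}(x)\,dx$, converges to $h$ uniformly on finite intervals contained in $S$. Then the function $$g_{\alpha,\gamma}(t,y)=\mathbb{E}\left[h\left(X^{(\alpha,\gamma)}_t\right)\,\middle|\,X^{(\alpha,\gamma)}_0=y\right]$$ solves the fractional Cauchy problem $$\mathcal{D}^{(\alpha,\gamma)}_tg(t,y)=\mathcal{G}g(t,y),\qquad g(0,y)=h(y).$$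
   Context: For $0<\alpha<1$, $\gamma\ge0$: $\mathcal{D}^{(\alpha,\gamma)}_t f(t)=\frac{t^{-\gamma}}{\Gamma(1-\alpha)}\int_0^t\frac{f'(s)}{(t-s)^{\alpha}}\,ds$. "Solves" means the equation holds pointwise for $t>0$, $y\in S$, and the initial condition holds. Pearson diffusions: drift $\mu(x)$, diffusion coefficient $D(x)$, generator $\mathcal{G}g=\mu g'+Dg''$. (OU) $S=\mathbb{R}$, $D(x)=\theta\sigma^2$, $\mu(x)=-\theta(x-\mu_0)$, $\theta,\sigma^2>0$, $\mu_0\in\mathbb{R}$; $\boldsymbol{m}(x)=\frac{1}{\sqrt{2\pi\sigma^2}}e^{-(x-\mu_0)^2/(2\sigma^2)}$; $\lambda_n=\theta n$ (Hermite polynomials). (CIR) $S=(0,\infty)$, $D(x)=\theta x/a$, $\mu(x)=-\theta(x-b/a)$, $\theta,a,b>0$; $\boldsymbol{m}(x)=\frac{a^b}{\Gamma(b)}x^{b-1}e^{-ax}$; $\lambda_n=\theta n$ (Laguerre polynomials $L_n^{b-1}(ax)$). (Jacobi) $S=(-1,1)$, $D(x)=1-x^2$, $\mu(x)=-(a+b+2)x+b-a$, $a,b>-1$; $\boldsymbol{m}(x)=\frac{(1-x)^a(1+x)^b}{B(a+1,b+1)2^{a+b+1}}$ (here $B(\cdot,\cdot)$ is the beta function); $\lambda_n=n(n+a+b+1)$ (Jacobi polynomials $P_n^{(a,b)}$). In each case $Q_n$ is the corresponding degree-$n$ polynomial, $\mathcal{G}Q_n=-\lambda_nQ_n$, normalized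 so that $\int_S Q_nQ_k\boldsymbol{m}\,dx=\delta_{nk}$. The Pearson diffusion $(X_t,t\ge0)$ is the time-homogeneous Markov process on $S$ with transition density $\boldsymbol{p}(x,t;y)=\boldsymbol{m}(x)\sum_{n\ge0}e^{-\lambda_nt}Q_n(x)Q_n(y)$. Time change: let $(\sigma^\alpha_s,s\ge0)$ be the $\alpha$-stable subordinator with $\mathbb{E}e^{-\lambda\sigma^\alpha_s}=e^{-s\lambda^\alpha}$, $Z=\int_0^\infty(1-\sigma^\alpha_s)_+^{\gamma}\,ds$ (with $(u)_+^\gamma=u^\gamma$ for $u>0$ and $0$ for $u\le 0$), and $Z^{(\alpha,\gamma)}_t=t^{\alpha+\gamma}Z$. The stretched non-local Pearson diffusion is $X^{(\alpha,\gamma)}_t:=X_{Z^{(\alpha,\gamma)}_t}$, where $Z$ is independent of $(X_t)$. A known fact: $\mathbb{E}e^{zZ}=\operatorname{E}_{\alpha,1+\gamma/\alpha,\gamma/\alpha}(z)$ for all $z\in\mathbb{C}$, where the Kilbas-Saigo function is $\operatorname{E}_{a,m,l}(z)=\sum_{n\ge0}c_nz^n$, $c_0=1$, $c_n=\prod_{k=0}^{n-1}\frac{\Gamma[1+a(km+l)]}{\Gamma[1+a(km+l+1)]}$. *)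

theory Defs
  imports "HOL-Probability.Probability"
begin

section \<open>Pearson diffusions with discrete spectrum\<close>

text \<open>Parameters: \<open>OU \<theta> \<sigma>\<^sup>2 \<mu>\<^sub>0\<close> (the second argument is the variance itself),
  \<open>CIR \<theta> a b\<close> and \<open>Jacobi a b\<close>.\<close>

datatype pearson = OU real real real | CIR real real real | Jacobi real real

fun admissible :: "pearson \<Rightarrow> bool" where
  "admissible (OU \<theta> v \<mu>\<^sub>0) \<longleftrightarrow> \<theta> > 0 \<and> v > 0"
| "admissible (CIR \<theta> a b) \<longleftrightarrow> \<theta> > 0 \<and> a > 0 \<and> b > 0"
| "admissible (Jacobi a b) \<longleftrightarrow> a > -1 \<and> b > -1"

fun state_space :: "pearson \<Rightarrow> real set" where
  "state_space (OU \<theta> v \<mu>\<^sub>0) = UNIV"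
| "state_space (CIR \<theta> a b) = {0<..}"
| "state_space (Jacobi a b) = {-1<..<1}"

fun drift :: "pearson \<Rightarrow> real \<Rightarrow> real" where
  "drift (OU \<theta> v \<mu>\<^sub>0) x = - \<theta> * (x - \<mu>\<^sub>0)"
| "drift (CIR \<theta> a b) x = - \<theta> * (x - b / a)"
| "drift (Jacobi a b) x = - (a + b + 2) * x + b - a"

fun diffusion_coeff :: "pearson \<Rightarrow> real \<Rightarrow> real" where
  "diffusion_coeff (OU \<theta> v \<mu>\<^sub>0) x = \<theta> * v"
| "diffusion_coeff (CIR \<theta> a b) x = \<theta> * x / a"
| "diffusion_coeff (Jacobi a b) x = 1 - x\<^sup>2"

fun stationary_density :: "pearson \<Rightarrow> real \<Rightarrow> real" where
  "stationary_density (OU \<theta> v \<mu>\<^sub>0) x = 1 / sqrt (2 * pi * v) * exp (- (x - \<mu>\<^sub>0)\<^sup>2 / (2 * v))"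
| "stationary_density (CIR \<theta> a b) x = a powr b / Gamma b * x powr (b - 1) * exp (- a * x)"
| "stationary_density (Jacobi a b) x =
     (1 - x) powr a * (1 + x) powr b / (Beta (a + 1) (b + 1) * 2 powr (a + b + 1))"

fun eigenvalue :: "pearson \<Rightarrow> nat \<Rightarrow> real" where
  "eigenvalue (OU \<theta> v \<mu>\<^sub>0) n = \<theta> * real n"
| "eigenvalue (CIR \<theta> a b) n = \<theta> * real n"
| "eigenvalue (Jacobi a b) n = real n * (real n + a + b + 1)"

text \<open>The probabilists' Hermite polynomials, orthogonal with respect to \<open>exp (- x\<^sup>2 / 2)\<close>.\<close>

fun hermite_poly :: "nat \<Rightarrow> real \<Rightarrow> real" where
  "hermite_poly 0 x = 1"
| "hermite_poly (Suc 0) x = x"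
| "hermite_poly (Suc (Suc n)) x = x * hermite_poly (Suc n) x - real (Suc n) * hermite_poly n x"

definition laguerre_poly :: "real \<Rightarrow> nat \<Rightarrow> real \<Rightarrow> real" where
  "laguerre_poly c n x = (\<Sum>i\<le>n. (-1) ^ i * ((real n + c) gchoose (n - i)) * x ^ i / fact i)"

definition jacobi_poly :: "real \<Rightarrow> real \<Rightarrow> nat \<Rightarrow> real \<Rightarrow> real" where
  "jacobi_poly a b n x =
     (\<Sum>i\<le>n. ((real n + a) gchoose (n - i)) * ((real n + b) gchoose i)
        * ((x - 1) / 2) ^ i * ((x + 1) / 2) ^ (n - i))"

fun classical_poly :: "pearson \<Rightarrow> nat \<Rightarrow> real \<Rightarrow> real" where
  "classical_poly (OU \<theta> v \<mu>\<^sub>0) n x = hermite_poly n ((x - \<mu>\<^sub>0) / sqrt v)"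
| "classical_poly (CIR \<theta> a b) n x = laguerre_poly (b - 1) n (a * x)"
| "classical_poly (Jacobi a b) n x = jacobi_poly a b n x"

definition Q_poly :: "pearson \<Rightarrow> nat \<Rightarrow> real \<Rightarrow> real" where
  "Q_poly d n x = classical_poly d n x /
     sqrt (LINT z:state_space d|lborel. (classical_poly d n z)\<^sup>2 * stationary_density d z)"

definition transition_density :: "pearson \<Rightarrow> real \<Rightarrow> real \<Rightarrow> real \<Rightarrow> real" where
  "transition_density d x t y =
     stationary_density d x * (\<Sum>n. exp (- eigenvalue d n * t) * Q_poly d n x * Q_poly d n y)"

definition generator :: "pearson \<Rightarrow> (real \<Rightarrow> real) \<Rightarrow> real \<Rightarrow> real" where
  "generator d f x = drift d x * deriv f x + diffusion_coeff d x * deriv (deriv f) x"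

definition L2_stationary :: "pearson \<Rightarrow> (real \<Rightarrow> real) \<Rightarrow> bool" where
  "L2_stationary d h \<longleftrightarrow>
     set_borel_measurable lborel (state_space d) h \<and>
     set_integrable lborel (state_space d) (\<lambda>x. (h x)\<^sup>2 * stationary_density d x)"

definition fourier_coeff :: "pearson \<Rightarrow> (real \<Rightarrow> real) \<Rightarrow> nat \<Rightarrow> real" where
  "fourier_coeff d h n =
     (LINT x:state_space d|lborel. h x * Q_poly d n x * stationary_density d x)"


section \<open>The processes\<close>

text \<open>The \<open>\<sigma>\<close>-algebra on \<open>space M\<close> generated by the variables \<open>X u\<close>, \<open>u \<in> I\<close>.\<close>

definition generated_algebra ::
    "'a measure \<Rightarrow> real set \<Rightarrow> (real \<Rightarrow> 'a \<Rightarrow> real) \<Rightarrow> 'a measure" where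
  "generated_algebra M I X =
     vimage_algebra (space M) (\<lambda>\<omega>. \<lambda>u\<in>I. X u \<omega>) (PiM I (\<lambda>_. borel))"

text \<open>\<open>P y\<close> is the law under which the process starts at \<open>y\<close>, so that an expectation under
  \<open>P y\<close> is the conditional expectation given \<open>X\<^sub>0 = y\<close>, defined for every \<open>y\<close> of the state space.

  Evaluating \<open>X\<close> at an independent random time requires the process to be measurable jointly
  in time and outcome.  With respect to a larger \<open>\<sigma>\<close>-algebra than the one generated by \<open>X\<close>
  this would not be enough: \<open>X\<close> could be altered at the random time itself without changing its
  finite-dimensional distributions or its independence of that time.  Continuous paths
  would imply the condition, but they are not required: for \<open>CIR\<close> with \<open>b < 1\<close> and for \<open>Jacobi\<close>
  with \<open>a < 0\<close> or \<open>b < 0\<close> the continuous version reaches the boundary, which does not belong to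
  the state space.\<close>

definition pearson_diffusion ::
    "pearson \<Rightarrow> (real \<Rightarrow> 'a measure) \<Rightarrow> (real \<Rightarrow> 'a \<Rightarrow> real) \<Rightarrow> bool" where
  "pearson_diffusion d P X \<longleftrightarrow> (\<forall>y\<in>state_space d.
     prob_space (P y) \<and>
     (\<forall>t\<ge>0. X t \<in> borel_measurable (P y)) \<and>
     (\<forall>t\<ge>0. \<forall>\<omega>\<in>space (P y). X t \<omega> \<in> state_space d) \<and>
     (\<lambda>(t, \<omega>). X t \<omega>) \<in> borel_measurable
        (restrict_space borel {0..} \<Otimes>\<^sub>M generated_algebra (P y) {0..} X) \<and>
     (AE \<omega> in P y. X 0 \<omega> = y) \<and>
     (\<forall>s t B. 0 \<le> s \<longrightarrow> s < t \<longrightarrow> B \<in> sets borel \<longrightarrow>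
        (AE \<omega> in P y.
           real_cond_exp (P y) (generated_algebra (P y) {0..s} X)
             (indicator (X t -` B \<inter> space (P y))) \<omega>
           = (LINT x:B \<inter> state_space d|lborel. transition_density d x (t - s) (X s \<omega>)))))"

definition stable_subordinator ::
    "real \<Rightarrow> 'a measure \<Rightarrow> (real \<Rightarrow> 'a \<Rightarrow> real) \<Rightarrow> bool" where
  "stable_subordinator \<alpha> M \<sigma> \<longleftrightarrow>
     prob_space M \<and>
     (\<forall>s\<ge>0. \<sigma> s \<in> borel_measurable M) \<and>
     (\<forall>\<omega>\<in>space M. \<sigma> 0 \<omega> = 0 \<and> mono_on {0..} (\<lambda>s. \<sigma> s \<omega>) \<and>
        (\<forall>s\<ge>0. continuous (at_right s) (\<lambda>s. \<sigma> s \<omega>))) \<and>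
     (\<forall>t :: nat \<Rightarrow> real. \<forall>n. 0 \<le> t 0 \<longrightarrow> mono t \<longrightarrow>
        prob_space.indep_vars M (\<lambda>_. borel) (\<lambda>i \<omega>. \<sigma> (t (Suc i)) \<omega> - \<sigma> (t i) \<omega>) {..<n}) \<and>
     (\<forall>s\<ge>0. \<forall>r\<ge>0. distr M borel (\<lambda>\<omega>. \<sigma> (s + r) \<omega> - \<sigma> s \<omega>) = distr M borel (\<sigma> r)) \<and>
     (\<forall>s\<ge>0. \<forall>l\<ge>0. (LINT \<omega>|M. exp (- l * \<sigma> s \<omega>)) = exp (- s * l powr \<alpha>))"

definition Z_var :: "real \<Rightarrow> (real \<Rightarrow> 'a \<Rightarrow> real) \<Rightarrow> 'a \<Rightarrow> real" where
  "Z_var \<gamma> \<sigma> \<omega> =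
     (LINT s:{0..}|lborel. if 1 - \<sigma> s \<omega> > 0 then (1 - \<sigma> s \<omega>) powr \<gamma> else 0)"

definition independent_of_process ::
    "'a measure \<Rightarrow> (real \<Rightarrow> 'a \<Rightarrow> real) \<Rightarrow> ('a \<Rightarrow> real) \<Rightarrow> bool" where
  "independent_of_process M X Z \<longleftrightarrow>
     prob_space.indep_set M (sets (generated_algebra M {0..} X))
       (sets (vimage_algebra (space M) Z borel))"

definition stretched_process ::
    "real \<Rightarrow> real \<Rightarrow> (real \<Rightarrow> 'a \<Rightarrow> real) \<Rightarrow> (real \<Rightarrow> 'a \<Rightarrow> real) \<Rightarrow> real \<Rightarrow> 'a \<Rightarrow> real" where
  "stretched_process \<alpha> \<gamma> X \<sigma> t \<omega> = X (t powr (\<alpha> + \<gamma>) * Z_var \<gamma> \<sigma> \<omega>) \<omega>"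


section \<open>The fractional Cauchy problem\<close>

text \<open>The integral is the Henstock-Kurzweil integral.  It contains the improper Riemann integral
  at both endpoints; this matters because \<open>f'\<close> need not be absolutely integrable near \<open>0\<close>.\<close>

definition stretched_caputo :: "real \<Rightarrow> real \<Rightarrow> (real \<Rightarrow> real) \<Rightarrow> real \<Rightarrow> real" where
  "stretched_caputo \<alpha> \<gamma> f t =
     t powr (- \<gamma>) / Gamma (1 - \<alpha>) * integral {0..t} (\<lambda>s. deriv f s / (t - s) powr \<alpha>)"

text \<open>Since \<open>deriv\<close> and \<open>integral\<close> are total functions, the existence of all derivatives and
  integrals that occur in the equation is made explicit.\<close>

definition solves_fractional_cauchy ::
    "real \<Rightarrow> real \<Rightarrow> pearson \<Rightarrow> (real \<Rightarrow> real) \<Rightarrow> (real \<Rightarrow> real \<Rightarrow> real) \<Rightarrow> bool" where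
  "solves_fractional_cauchy \<alpha> \<gamma> d h g \<longleftrightarrow>
     (\<forall>y\<in>state_space d. g 0 y = h y) \<and>
     (\<forall>t>0. \<forall>y\<in>state_space d.
        (\<lambda>s. g s y) differentiable (at t) \<and>
        (\<lambda>s. deriv (\<lambda>r. g r y) s / (t - s) powr \<alpha>) integrable_on {0..t} \<and>
        g t differentiable (at y) \<and>
        deriv (g t) differentiable (at y) \<and>
        stretched_caputo \<alpha> \<gamma> (\<lambda>s. g s y) t = generator d (g t) y)"

end

theory Submission
  imports Defs "HOL-Real_Asymp.Real_Asymp"
begin

text \<open>Expanding \<open>h = \<Sum>\<^sub>n a\<^sub>n Q\<^sub>n\<close> gives \<open>g(t, y) = \<Sum>\<^sub>n a\<^sub>n Q\<^sub>n(y) F(\<lambda>\<^sub>n t\<^sup>\<kappa>)\<close> with \<open>\<kappa> = \<alpha> + \<gamma>\<close> and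
  \<open>F(z) = E e\<^sup>-\<^sup>z\<^sup>Z\<close>.  The Markov property of the subordinator at time \<open>s\<close> and its potential measure
  \<open>v\<^sup>\<alpha>\<^sup>-\<^sup>1 / \<Gamma>(\<alpha>) dv\<close> turn \<open>F\<close> into the solution of a Volterra equation, from which every mode
  \<open>F(\<lambda> t\<^sup>\<kappa>)\<close> solves the fractional equation with \<open>-\<lambda>\<close> in place of the generator; no power
  series of Kilbas-Saigo type is needed.

  Evaluation at the random time is justified without asymptotics of the polynomials: point
  evaluation is continuous for the energy norm of the diffusion, hence
  \<open>\<Sum>\<^sub>n Q\<^sub>n(y)\<^sup>2 / (1 + \<lambda>\<^sub>n) < \<infinity>\<close>, and \<open>F(z) \<le> C / (1 + z)\<close>.

  The series \<open>\<Sum>\<^sub>n a\<^sub>n Q\<^sub>n\<close> need not converge absolutely.  Since \<open>\<lambda>\<^sub>n\<close> increases and \<open>F\<close> is monotone,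
  Abel summation transfers its uniform convergence to \<open>g\<close>, to \<open>s \<partial>g/\<partial>s\<close>, and from there to the Caputo
  integrals.  The partial sums and their images under the generator then both converge locally
  uniformly, and the generator, being a Sturm-Liouville operator, is closed under such limits.\<close>

section \<open>Uniqueness of Laplace transforms\<close>

text \<open>The Caputo operator meets a series that converges only conditionally and whose time
  derivative may fail to be integrable at 0. Everything is therefore reduced to sup norms:
  integration by parts on the first half of {0..t} trades the derivative for g itself, and the
  derivative is estimated only on the second half. For one mode, 1 - F(\<lambda> t^\<kappa>) has two
  representations: the Volterra equation makes it the fractional integral of order \<alpha> of
  \<lambda> t^\<gamma> F(\<lambda> t^\<kappa>), the fundamental theorem makes it the ordinary
  integral of minus the time derivative. Applying fractional integration of order 1 - \<alpha> to
  both and then differentiating yields the fractional equation. The decay of F matches the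
  summability in n: the expected squared norm of the kernel at the random time c Z is the sum of
  Q_n(y)^2 F(2 c \<lambda>_n), which the weights 1 / (1 + \<lambda>_n) dominate. Each y carries its
  own measure, so the law of Z is derived from the Laplace exponent alone, through Riemann sums of
  independent increments.\<close>

lemma integral_continuous_eq_if_moments_eq:
  fixes N1 N2 :: "real measure" and f :: "real \<Rightarrow> real"
  assumes "finite_measure N1" "finite_measure N2"
    and sets [measurable_cong]: "sets N1 = sets borel" "sets N2 = sets borel"
    and ae: "AE x in N1. x \<in> {0..1}" "AE x in N2. x \<in> {0..1}"
    and mom: "\<And>k. (LINT x|N1. x ^ k) = (LINT x|N2. x ^ k)"
    and f: "continuous_on UNIV f" and bnd: "\<And>x. \<bar>f x\<bar> \<le> B"
  shows "(LINT x|N1. f x) = (LINT x|N2. f x)"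
proof -
  interpret N1: finite_measure N1 by fact
  interpret N2: finite_measure N2 by fact
  have [measurable]: "f \<in> borel_measurable borel" using f by (rule borel_measurable_continuous_onI)
  have fi: "integrable N1 f" "integrable N2 f"
    using bnd by (auto intro!: N1.integrable_const_bound[of _ B] N2.integrable_const_bound[of _ B])
  have "AE x in N1. norm (x ^ k) \<le> 1" "AE x in N2. norm (x ^ k) \<le> 1" for k
    by (rule eventually_mono[OF ae(1)], simp add: power_le_one)
       (rule eventually_mono[OF ae(2)], simp add: power_le_one)
  then have pow: "integrable N1 (\<lambda>x. x ^ k)" "integrable N2 (\<lambda>x. x ^ k)" for k
    by (auto intro!: N1.integrable_const_bound N2.integrable_const_bound)
  have bound: "\<bar>(LINT x|N1. f x) - (LINT x|N2. f x)\<bar> \<le> e * (measure N1 UNIV + measure N2 UNIV)"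
    if "e > 0" for e
  proof -
    obtain g where g: "real_polynomial_function g" "\<And>x. x \<in> {0..1} \<Longrightarrow> \<bar>f x - g x\<bar> < e"
      by (rule Stone_Weierstrass_real_polynomial_function
          [OF compact_Icc continuous_on_subset[OF f subset_UNIV] \<open>e > 0\<close>]) blast
    obtain a n where ga: "g = (\<lambda>x. \<Sum>i\<le>n. a i * x ^ i)"
      using g(1) real_polynomial_function_iff_sum by blast
    have gi: "integrable N1 g" "integrable N2 g" unfolding ga using pow by auto
    have eq: "(LINT x|N1. g x) = (LINT x|N2. g x)"
      unfolding ga using pow mom by (simp add: Bochner_Integration.integral_sum)
    have *: "\<bar>(LINT x|N. f x) - (LINT x|N. g x)\<bar> \<le> e * measure N UNIV"
      if N: "finite_measure N" "sets N = sets borel" "AE x in N. x \<in> {0..1}"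
        "integrable N f" "integrable N g" for N
    proof -
      interpret N: finite_measure N by fact
      have sp: "space N = UNIV" using sets_eq_imp_space_eq[OF N(2)] by simp
      have "\<bar>(LINT x|N. f x) - (LINT x|N. g x)\<bar> = \<bar>LINT x|N. f x - g x\<bar>"
        using N by simp
      also have "\<dots> \<le> (LINT x|N. \<bar>f x - g x\<bar>)" by simp
      also have "\<dots> \<le> (LINT x|N. e)"
      proof (rule integral_mono_AE)
        show "AE x in N. \<bar>f x - g x\<bar> \<le> e"
          using N(3) by (rule eventually_mono) (use g(2) less_imp_le in blast)
      qed (use N in auto)
      finally show ?thesis by (simp add: sp mult.commute)
    qed
    show ?thesis
      using *[of N1] *[of N2] assms(1-6) fi gi eq by (simp add: algebra_simps abs_le_iff)
  qed
  then have le: "\<bar>(LINT x|N1. f x) - (LINT x|N2. f x)\<bar> \<le> 0 + e" if "e > 0" for e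
  proof -
    \<comment> \<open>Dividing by \<open>1 + m\<close> instead of \<open>m\<close> covers the case
      of zero total mass.\<close>
    define m where "m = measure N1 UNIV + measure N2 UNIV"
    have m: "m \<ge> 0" by (simp add: m_def)
    have "\<bar>(LINT x|N1. f x) - (LINT x|N2. f x)\<bar> \<le> e / (1 + m) * m"
      unfolding m_def using that m[unfolded m_def] by (intro bound divide_pos_pos add_pos_nonneg) auto
    also have "\<dots> \<le> e" using that m by (simp add: field_simps)
    finally show ?thesis by simp
  qed
  have "\<bar>(LINT x|N1. f x) - (LINT x|N2. f x)\<bar> \<le> 0" by (rule field_le_epsilon) (rule le)
  then show ?thesis by simp
qed

text \<open>The distribution function at x is the limit of integrals of continuous ramps that are 1
  up to x and then fall to 0 with slope -n.\<close>

lemma measure_eqI_moments: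
  fixes N1 N2 :: "real measure"
  assumes fin: "finite_measure N1" "finite_measure N2"
    and sets [measurable_cong]: "sets N1 = sets borel" "sets N2 = sets borel"
    and ae: "AE x in N1. x \<in> {0..1}" "AE x in N2. x \<in> {0..1}"
    and mom: "\<And>k. (LINT x|N1. x ^ k) = (LINT x|N2. x ^ k)"
  shows "N1 = N2"
proof (rule cdf_unique')
  show fb: "finite_borel_measure N1" "finite_borel_measure N2"
    using fin sets by (auto simp: finite_borel_measure_def finite_borel_measure_axioms_def)
  show "cdf N1 = cdf N2"
  proof
    fix x
    define f where "f n t = max 0 (min 1 (1 - real n * (t - x)))" for n t
    have cont: "continuous_on UNIV (f n)" for n unfolding f_def by (intro continuous_intros)
    have bnd: "\<bar>f n t\<bar> \<le> 1" for n t unfolding f_def by auto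
    have lim: "(\<lambda>n. f n t) \<longlonglongrightarrow> indicator {..x} t" for t
    proof (cases "t \<le> x")
      case True
      then have "f n t = 1" for n unfolding f_def
        by (simp add: max_def min_def mult_le_0_iff)
      then show ?thesis using True by simp
    next
      case False
      then obtain m where m: "real m * (t - x) > 1" using ex_less_of_nat_mult[of "t - x" 1] by auto
      have "f n t = 0" if "n \<ge> m" for n
      proof -
        have "real m * (t - x) \<le> real n * (t - x)" using that False by (intro mult_right_mono) auto
        then show ?thesis using m unfolding f_def by auto
      qed
      then show ?thesis using False
        by (intro tendsto_eventually) (auto simp: eventually_sequentially)
    qed
    have conv: "(\<lambda>n. LINT t|N. f n t) \<longlonglongrightarrow> cdf N x" if N: "finite_borel_measure N" for N
    proof -
      interpret finite_borel_measure N by fact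
      have [measurable_cong]: "sets N = sets borel" by (rule M_is_borel)
      have [measurable]: "f n \<in> borel_measurable N" for n
        using borel_measurable_continuous_onI[OF cont[of n]] by simp
      have "(\<lambda>n. LINT t|N. f n t) \<longlonglongrightarrow> (LINT t|N. indicator {..x} t)"
        using lim bnd by (intro integral_dominated_convergence[where w="\<lambda>_. 1"]) auto
      then show ?thesis by (simp add: cdf_def)
    qed
    have "(LINT t|N1. f n t) = (LINT t|N2. f n t)" for n
      by (rule integral_continuous_eq_if_moments_eq[OF fin sets ae mom cont bnd])
    then show "cdf N1 x = cdf N2 x"
      using LIMSEQ_unique[OF conv[OF fb(1)]] conv[OF fb(2)] by simp
  qed
qed

text \<open>Weighting by exp (-x) and substituting y = exp (-x) gives a finite measure on {0..1}
  whose k-th moment is the Laplace transform at k + 1. The weight admits infinite measures, such as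
  the potential measure of the subordinator.\<close>

lemma measure_eqI_laplace:
  fixes M1 M2 :: "real measure"
  assumes sets: "sets M1 = sets borel" "sets M2 = sets borel"
    and ae: "AE x in M1. 0 \<le> x" "AE x in M2. 0 \<le> x"
    and lap: "\<And>l. l > 0 \<Longrightarrow> (\<integral>\<^sup>+x. ennreal (exp (- l * x)) \<partial>M1) = (\<integral>\<^sup>+x. ennreal (exp (- l * x)) \<partial>M2)"
    and fin: "(\<integral>\<^sup>+x. ennreal (exp (- x)) \<partial>M1) < \<infinity>"
  shows "M1 = M2"
proof -
  define T where "T M = distr (density M (\<lambda>x. ennreal (exp (- x)))) borel (\<lambda>x::real. exp (- x))" for M
  have nnT: "(\<integral>\<^sup>+y. g y \<partial>T M) = (\<integral>\<^sup>+x. ennreal (exp (- x)) * g (exp (- x)) \<partial>M)"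
    if M: "sets M = sets borel" and [measurable]: "g \<in> borel_measurable borel" for M g
  proof -
    note [measurable_cong] = M
    show ?thesis unfolding T_def by (simp add: nn_integral_distr nn_integral_density)
  qed
  have finT: "finite_measure (T M)"
    if M: "sets M = sets borel" "(\<integral>\<^sup>+x. ennreal (exp (- x)) \<partial>M) < \<infinity>" for M
  proof
    have "emeasure (T M) (space (T M)) = (\<integral>\<^sup>+y. 1 \<partial>T M)" by simp
    also have "\<dots> = (\<integral>\<^sup>+x. ennreal (exp (- x)) \<partial>M)" using nnT[OF M(1), of "\<lambda>_. 1"] by simp
    finally show "emeasure (T M) (space (T M)) \<noteq> \<infinity>" using M by simp
  qed
  have setsT: "sets (T M) = sets borel" for M by (simp add: T_def)
  have aeT: "AE y in T M. y \<in> {0..1}" if M: "sets M = sets borel" and "AE x in M. 0 \<le> x" for M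
  proof -
    note [measurable_cong] = M
    show ?thesis unfolding T_def using that(2)
      by (auto simp: AE_distr_iff AE_density elim!: eventually_mono)
  qed
  have momT: "ennreal (LINT y|T M. y ^ k) = (\<integral>\<^sup>+x. ennreal (exp (- real (Suc k) * x)) \<partial>M)"
    if M: "sets M = sets borel" "AE x in M. 0 \<le> x" "(\<integral>\<^sup>+x. ennreal (exp (- x)) \<partial>M) < \<infinity>" for M k
  proof -
    interpret finite_measure "T M" using finT M by blast
    note [measurable_cong] = setsT[of M]
    have "integrable (T M) (\<lambda>x. x ^ k)"
      by (rule integrable_const_bound[of _ 1])
         (rule eventually_mono[OF aeT[OF M(1,2)]], simp_all add: power_le_one)
    then have "ennreal (LINT y|T M. y ^ k) = (\<integral>\<^sup>+y. ennreal (y ^ k) \<partial>T M)"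
      by (subst nn_integral_eq_integral) (auto intro: eventually_mono[OF aeT[OF M(1,2)]])
    also have "\<dots> = (\<integral>\<^sup>+x. ennreal (exp (- real (Suc k) * x)) \<partial>M)"
      by (subst nnT[OF M(1)], simp, rule nn_integral_cong)
         (simp add: ennreal_mult[symmetric] exp_of_nat_mult[symmetric] exp_add[symmetric] algebra_simps)
    finally show ?thesis .
  qed
  have fin2: "(\<integral>\<^sup>+x. ennreal (exp (- x)) \<partial>M2) < \<infinity>" using lap[of 1] fin by simp
  have nonneg: "(LINT y|T M. y ^ k) \<ge> 0" if "sets M = sets borel" "AE x in M. 0 \<le> x" for M k
    by (intro integral_nonneg_AE eventually_mono[OF aeT[OF that]]) simp
  have "T M1 = T M2"
  proof (rule measure_eqI_moments)
    fix k
    have "ennreal (LINT y|T M1. y ^ k) = ennreal (LINT y|T M2. y ^ k)"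
      using momT[OF sets(1) ae(1) fin] momT[OF sets(2) ae(2) fin2] lap[of "real (Suc k)"] by simp
    then show "(LINT y|T M1. y ^ k) = (LINT y|T M2. y ^ k)"
      using nonneg sets ae by (simp add: ennreal_inj)
  qed (use finT aeT setsT sets ae fin fin2 in auto)
  \<comment> \<open>Inverts the passage from M to \<open>T M\<close>: x = - ln y undoes the
    substitution, 1 / y the weight.\<close>
  have pull: "emeasure M A = (\<integral>\<^sup>+y. indicator A (- ln y) * ennreal (1 / y) \<partial>T M)"
    if M: "sets M = sets borel" and A: "A \<in> sets borel" for M A
  proof -
    note [measurable] = A
    note [measurable_cong] = M
    have "(\<integral>\<^sup>+y. indicator A (- ln y) * ennreal (1 / y) \<partial>T M)
       = (\<integral>\<^sup>+x. ennreal (exp (- x)) * (indicator A x * ennreal (1 / exp (- x))) \<partial>M)"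
      by (subst nnT[OF M]) auto
    also have "\<dots> = (\<integral>\<^sup>+x. indicator A x \<partial>M)"
      by (rule nn_integral_cong)
         (simp add: indicator_def ennreal_mult[symmetric] exp_minus field_simps)
    finally show ?thesis using A M by simp
  qed
  show ?thesis
    by (rule measure_eqI) (use pull sets \<open>T M1 = T M2\<close> in auto)
qed

text \<open>The nonnegative function \<open>a\<close> has primitive \<open>- A\<close> without being continuous, so the
  fundamental theorem of calculus does not apply directly; instead \<open>A\<close> pushes \<open>a(s) ds\<close>
  forward to Lebesgue measure on \<open>{0..A 0}\<close>.\<close>

lemma nn_integral_exp_tail:
  fixes a :: "real \<Rightarrow> real" and l c T :: real
  assumes [measurable]: "a \<in> borel_measurable borel"
    and a: "\<And>s. 0 \<le> a s" "\<And>s. a s \<le> c" "\<And>s. s < 0 \<Longrightarrow> a s = 0" "\<And>s. T \<le> s \<Longrightarrow> a s = 0"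
    and l: "l > 0"
  defines "A \<equiv> \<lambda>s. LINT r|lborel. indicator {s..} r * a r"
  shows "ennreal (1 - exp (- l * A 0)) = (\<integral>\<^sup>+s. ennreal (l * a s * exp (- l * A s)) \<partial>lborel)"
proof -
  define T' where "T' = max T 0 + 1"
  have T': "T' > 0" "\<And>s. T' \<le> s \<Longrightarrow> a s = 0" using a(4) by (auto simp: T'_def)
  have c: "c \<ge> 0" using a(1,2)[of 0] by linarith
  have aint: "integrable lborel a"
  proof (rule Bochner_Integration.integrable_bound[where f="\<lambda>s. indicator {0..T'} s * c"])
    have "a s = 0" if "\<not> (0 \<le> s \<and> s \<le> T')" for s
      using that a(3)[of s] T'(2)[of s] by force
    then show "AE s in lborel. norm (a s) \<le> norm (indicator {0..T'} s * c)"
      using a c by (intro AE_I2) (auto simp: indicator_def)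
    show "integrable lborel (\<lambda>s. indicator {0..T'} s * c)"
      by (intro integrable_mult_left integrable_real_indicator) (auto simp: emeasure_lborel_Icc_eq)
  qed auto
  have int: "integrable lborel (\<lambda>r. indicator S r * a r)" if "S \<in> sets borel" for S
    using integrable_mult_indicator[OF _ aint, of S] that by simp
  have diff: "A s - A t = (LINT r|lborel. indicator {s..<t} r * a r)" if "s \<le> t" for s t
  proof -
    have "A s - A t = (LINT r|lborel. indicator {s..} r * a r - indicator {t..} r * a r)"
      unfolding A_def by (intro Bochner_Integration.integral_diff[symmetric] int) auto
    also have "\<dots> = (LINT r|lborel. indicator {s..<t} r * a r)"
      using that by (intro Bochner_Integration.integral_cong) (auto simp: indicator_def)
    finally show ?thesis .
  qed
  have diff_le: "0 \<le> A s - A t" "A s - A t \<le> c * (t - s)" if "s \<le> t" for s t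
  proof -
    show "0 \<le> A s - A t" unfolding diff[OF that] using a by (auto intro!: integral_nonneg_AE)
    have "A s - A t \<le> (LINT r|lborel. indicator {s..<t} r * c)" unfolding diff[OF that]
    proof (intro integral_mono int)
      show "integrable lborel (\<lambda>r. indicator {s..<t} r * c)" using that
        by (intro integrable_mult_left integrable_real_indicator) auto
    qed (use a in \<open>auto simp: indicator_def\<close>)
    then show "A s - A t \<le> c * (t - s)" using that by (simp add: mult.commute)
  qed
  have anti: "antimono A" using diff_le(1) by (auto simp: antimono_def)
  then have [measurable]: "A \<in> borel_measurable borel"
    using borel_measurable_mono[of "\<lambda>s. - A s"] borel_measurable_uminus_eq[of A borel]
    by (auto simp: monotone_def)
  have lip: "c-lipschitz_on UNIV A"
  proof (rule lipschitz_onI)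
    fix s t :: real
    show "dist (A s) (A t) \<le> c * dist s t"
      using diff_le[of s t] diff_le[of t s] by (cases "s \<le> t") (auto simp: dist_real_def abs_if)
  qed (use c in auto)
  have cont: "continuous_on UNIV A" by (rule lipschitz_on_continuous_on[OF lip])
  have A_end: "A s = 0" if "T' \<le> s" for s
  proof -
    have "A s = (LINT r::real|lborel. 0)" unfolding A_def using T'(2) that
      by (intro Bochner_Integration.integral_cong) (auto simp: indicator_def)
    then show ?thesis by simp
  qed
  have A0: "A s = A 0" if "s \<le> 0" for s
    unfolding A_def using that a(3)
    by (intro Bochner_Integration.integral_cong) (auto simp: indicator_def)
  have A_nonneg: "0 \<le> A s" for s unfolding A_def using a by (auto intro!: integral_nonneg_AE)
  have A_le: "A s \<le> A 0" for s using antimonoD[OF anti, of 0 s] A0[of s] by (cases "s \<ge> 0") auto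
  define N where "N = distr (density lborel (\<lambda>s. ennreal (a s))) borel A"
  define U where "U = density lborel (indicator {0..A 0} :: real \<Rightarrow> ennreal)"
  have mass: "emeasure N {..u} = (\<integral>\<^sup>+s. ennreal (a s) * indicator {s. A s \<le> u} s \<partial>lborel)" for u
    unfolding N_def
    by (subst emeasure_distr) (auto simp: emeasure_density vimage_def intro!: nn_integral_cong)
  have tail: "(\<integral>\<^sup>+s. ennreal (a s) * indicator {t..} s \<partial>lborel) = ennreal (A t)" for t
  proof -
    have "ennreal (A t) = (\<integral>\<^sup>+s. ennreal (indicator {t..} s * a s) \<partial>lborel)"
      unfolding A_def using a by (intro nn_integral_eq_integral[symmetric] int) auto
    also have "\<dots> = (\<integral>\<^sup>+s. ennreal (a s) * indicator {t..} s \<partial>lborel)"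
      by (intro nn_integral_cong) (auto simp: indicator_def)
    finally show ?thesis by simp
  qed
  have massU: "emeasure U {..u} = ennreal (min u (A 0))" for u
  proof -
    have "emeasure U {..u} = emeasure lborel ({0..A 0} \<inter> {..u})"
      unfolding U_def by (subst emeasure_density) (auto simp: indicator_inter_arith[symmetric] )
    also have "{0..A 0} \<inter> {..u} = {0..min u (A 0)}" by auto
    also have "emeasure lborel \<dots> = ennreal (min u (A 0))"
      using A_nonneg[of 0] by (cases "u \<ge> 0") (auto simp: min_def ennreal_neg)
    finally show ?thesis .
  qed
  have massN: "emeasure N {..u} = ennreal (min u (A 0))" for u
  proof -
    consider "u < 0" | "0 \<le> u" "u \<le> A 0" | "A 0 < u" by linarith
    then show ?thesis
    proof cases
      case 1
      then have "{s. A s \<le> u} = {}" using A_nonneg by (auto simp: not_le intro: less_le_trans)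
      then show ?thesis using 1 by (simp add: mass min_def ennreal_neg)
    next
      case 2
      have "\<exists>t\<ge>0. t \<le> T' \<and> A t = u"
        using 2 T'(1) A_end[of T'] cont by (intro IVT2') (auto intro: continuous_on_subset)
      then obtain t where t: "A t = u" by blast
      \<comment> \<open>\<open>A\<close> is only weakly decreasing, so
        \<open>{s. A s \<le> u}\<close> can be larger than \<open>{t..}\<close>. Its part in the
        nonnegative reals starts at the first point \<open>t0\<close> where \<open>A\<close> has
        dropped to u, and the mass beyond \<open>t0\<close> is \<open>A t0\<close>, at most u; the
        excess is thus null.\<close>
      have eq: "(\<integral>\<^sup>+s. ennreal (a s) * indicator {s. A s \<le> u} s \<partial>lborel) =
          (\<integral>\<^sup>+s. ennreal (a s) * indicator {t..} s \<partial>lborel)"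
      proof (rule antisym)
        show "(\<integral>\<^sup>+s. ennreal (a s) * indicator {t..} s \<partial>lborel) \<le>
          (\<integral>\<^sup>+s. ennreal (a s) * indicator {s. A s \<le> u} s \<partial>lborel)"
          using antimonoD[OF anti] t by (intro nn_integral_mono) (auto simp: indicator_def)
        have "emeasure N {..u} \<le> ennreal u"
        proof -
          have "bdd_below {s. 0 \<le> s \<and> A s \<le> u}" by (auto intro: bdd_belowI[of _ 0])
          define t0 where "t0 = Inf {s. 0 \<le> s \<and> A s \<le> u}"
          have cl: "closed {s. 0 \<le> s \<and> A s \<le> u}"
            by (intro closed_Collect_conj closed_Collect_le continuous_intros continuous_on_subset[OF cont]) auto
          have "T' \<in> {s. 0 \<le> s \<and> A s \<le> u}" using T' A_end 2 by auto
          then have "t0 \<in> {s. 0 \<le> s \<and> A s \<le> u}" unfolding t0_def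
            using cl \<open>bdd_below _\<close> by (intro closed_contains_Inf) auto
          then have t0: "A t0 \<le> u" by auto
          have "emeasure N {..u} \<le> (\<integral>\<^sup>+s. ennreal (a s) * indicator {t0..} s \<partial>lborel)"
            unfolding mass
          proof (intro nn_integral_mono)
            fix s
            show "ennreal (a s) * indicator {s. A s \<le> u} s \<le> ennreal (a s) * indicator {t0..} s"
            proof (cases "s \<ge> 0 \<and> A s \<le> u")
              case True
              then have "t0 \<le> s" unfolding t0_def using \<open>bdd_below _\<close> by (intro cInf_lower) auto
              then show ?thesis by (simp add: indicator_def)
            next
              case False
              then show ?thesis using a(3)[of s] by (auto simp: indicator_def)
            qed
          qed
          also have "\<dots> \<le> ennreal u" unfolding tail using t0 by (rule ennreal_leI)
          finally show ?thesis .
        qed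
        then show "(\<integral>\<^sup>+s. ennreal (a s) * indicator {s. A s \<le> u} s \<partial>lborel) \<le>
          (\<integral>\<^sup>+s. ennreal (a s) * indicator {t..} s \<partial>lborel)"
          unfolding tail t mass .
      qed
      show ?thesis unfolding mass eq tail t using 2 by simp
    next
      case 3
      have "emeasure N {..u} = (\<integral>\<^sup>+s. ennreal (a s) * indicator {0..} s \<partial>lborel)"
        unfolding mass using le_less_trans[OF A_le 3, THEN less_imp_le] a(3)
        by (intro nn_integral_cong) (auto simp: indicator_def)
      then show ?thesis using 3 unfolding tail by simp
    qed
  qed
  have fin: "finite_borel_measure N" "finite_borel_measure U"
  proof -
    have "emeasure N UNIV \<noteq> \<infinity>"
    proof -
      have "emeasure N (space N) = emeasure N {..A 0}"
      proof (rule emeasure_eq_AE)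
        have "AE u in N. u \<le> A 0" unfolding N_def using A_le by (subst AE_distr_iff) auto
        then show "AE u in N. u \<in> space N \<longleftrightarrow> u \<in> {..A 0}"
          by (rule eventually_mono) (simp add: N_def)
      qed (auto simp: N_def)
      then show ?thesis unfolding massN by (simp add: N_def)
    qed
    moreover have "emeasure U UNIV \<noteq> \<infinity>"
      by (subst U_def) (simp add: emeasure_density emeasure_lborel_Icc_eq)
    ultimately show "finite_borel_measure N" "finite_borel_measure U"
      by (auto intro!: finite_borel_measure.intro finite_measureI finite_borel_measure_axioms.intro
          simp: N_def U_def)
  qed
  have "N = U"
    by (rule cdf_unique'[OF fin]) (auto simp: cdf_def fun_eq_iff measure_def massN massU)
  have "(\<integral>\<^sup>+s. ennreal (l * a s * exp (- l * A s)) \<partial>lborel) = (\<integral>\<^sup>+u. ennreal (l * exp (- l * u)) \<partial>N)"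
    unfolding N_def using a l
    by (simp add: nn_integral_distr nn_integral_density ennreal_mult[symmetric] mult_ac)
  also have "\<dots> = (\<integral>\<^sup>+u. ennreal (l * exp (- l * u)) * indicator {0..A 0} u \<partial>lborel)"
    unfolding \<open>N = U\<close> U_def by (simp add: nn_integral_density mult_ac)
  also have "\<dots> = ennreal (- exp (- l * A 0) - (- exp (- l * 0)))"
    using A_nonneg l
    by (intro nn_integral_FTC_Icc) (auto intro!: derivative_eq_intros)
  finally show ?thesis by simp
qed

section \<open>Occupation integrals of the subordinator\<close>

definition pos_powr :: "real \<Rightarrow> real \<Rightarrow> real" where
  "pos_powr \<gamma> x = (if x > 0 then x powr \<gamma> else 0)"

lemma pos_powr_measurable [measurable]: "pos_powr \<gamma> \<in> borel_measurable borel"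
  unfolding pos_powr_def[abs_def] by measurable

lemma pos_powr_nonneg [simp]: "0 \<le> pos_powr \<gamma> x"
  by (simp add: pos_powr_def)

lemma pos_powr_mono: "\<gamma> \<ge> 0 \<Longrightarrow> x \<le> y \<Longrightarrow> pos_powr \<gamma> x \<le> pos_powr \<gamma> y"
  by (auto simp: pos_powr_def intro: powr_mono2)

text \<open>The integral \<open>\<integral>\<^sub>0\<^sup>\<infinity> (x - \<sigma>\<^sub>s)\<^sub>+\<^sup>\<gamma> ds\<close>, so that \<open>Z\<close> is its value at \<open>x = 1\<close>.\<close>

definition occupation :: "real \<Rightarrow> (real \<Rightarrow> 'a \<Rightarrow> real) \<Rightarrow> real \<Rightarrow> 'a \<Rightarrow> real" where
  "occupation \<gamma> \<sigma> x \<omega> = (LINT s|lborel. indicator {0..} s * pos_powr \<gamma> (x - \<sigma> s \<omega>))"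

lemma Z_var_eq_occupation: "Z_var \<gamma> \<sigma> = occupation \<gamma> \<sigma> 1"
  by (simp add: Z_var_def occupation_def set_lebesgue_integral_def pos_powr_def fun_eq_iff)

text \<open>On each cell the error lies between 0 and h times the drop of \<open>a\<close> across
  the cell, and the drops telescope. Right endpoints are used because the subordinator at positive
  multiples of h is a sum of increments.\<close>

lemma riemann_sum_antimono:
  fixes a :: "real \<Rightarrow> real"
  assumes [measurable]: "a \<in> borel_measurable borel"
    and anti: "\<And>s t. 0 \<le> s \<Longrightarrow> s \<le> t \<Longrightarrow> a t \<le> a s" and nonneg: "\<And>s. 0 \<le> a s" and h: "h > 0"
  defines "J \<equiv> \<lambda>N. LINT s|lborel. indicator {0..<real N * h} s * a s"
  shows "0 \<le> J N - (\<Sum>k<N. h * a (real (Suc k) * h))"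
    and "J N - (\<Sum>k<N. h * a (real (Suc k) * h)) \<le> h * (a 0 - a (real N * h))"
proof -
  have int: "integrable lborel (\<lambda>s. indicator {u..<v} s * a s)" if "0 \<le> u" "u \<le> v" for u v
  proof (rule Bochner_Integration.integrable_bound)
    show "integrable lborel (\<lambda>s. indicator {u..<v} s * a 0)"
      using that by (intro integrable_mult_left integrable_real_indicator) auto
    show "AE s in lborel. norm (indicator {u..<v} s * a s) \<le> norm (indicator {u..<v} s * a 0)"
      using that nonneg anti[of 0] by (intro AE_I2) (auto simp: indicator_def)
  qed auto
  have step: "J (Suc N) = J N + (LINT s|lborel. indicator {real N * h..<real (Suc N) * h} s * a s)" for N
  proof -
    have N: "0 \<le> real N * h" "real N * h \<le> real (Suc N) * h" using h by (auto simp: algebra_simps)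
    have "indicator {0..<real (Suc N) * h} s * a s =
      indicator {0..<real N * h} s * a s + indicator {real N * h..<real (Suc N) * h} s * a s" for s
      using N by (auto simp: indicator_def)
    then show ?thesis
      unfolding J_def using N by (simp add: Bochner_Integration.integral_add int)
  qed
  have const: "(LINT s|lborel. indicator {real N * h..<real (Suc N) * h} s * c) = h * c" for N c
    using h by (simp add: algebra_simps)
  have ci: "integrable lborel (\<lambda>s. indicator {real N * h..<real (Suc N) * h} s * c)" for N and c :: real
    using h by (intro integrable_mult_left integrable_real_indicator) auto
  have Nh: "real N * h \<ge> 0" "real N * h \<le> real (Suc N) * h" for N
    using h by (auto simp: algebra_simps)
  have lo: "h * a (real (Suc N) * h) \<le> (LINT s|lborel. indicator {real N * h..<real (Suc N) * h} s * a s)" for N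
  proof -
    have "(LINT s|lborel. indicator {real N * h..<real (Suc N) * h} s * a (real (Suc N) * h))
       \<le> (LINT s|lborel. indicator {real N * h..<real (Suc N) * h} s * a s)"
    proof (intro integral_mono ci int Nh)
      fix s show "indicator {real N * h..<real (Suc N) * h} s * a (real (Suc N) * h)
        \<le> indicator {real N * h..<real (Suc N) * h} s * a s"
      using Nh(1)[of N] anti[of s "real (Suc N) * h"] by (auto simp: indicator_def)
    qed
    then show ?thesis unfolding const .
  qed
  have hi: "(LINT s|lborel. indicator {real N * h..<real (Suc N) * h} s * a s) \<le> h * a (real N * h)" for N
  proof -
    have "(LINT s|lborel. indicator {real N * h..<real (Suc N) * h} s * a s)
        \<le> (LINT s|lborel. indicator {real N * h..<real (Suc N) * h} s * a (real N * h))"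
    proof (intro integral_mono ci int Nh)
      fix s show "indicator {real N * h..<real (Suc N) * h} s * a s
        \<le> indicator {real N * h..<real (Suc N) * h} s * a (real N * h)"
        using Nh(1)[of N] anti[of "real N * h" s] by (auto simp: indicator_def)
    qed
    then show ?thesis unfolding const .
  qed
  have "0 \<le> J N - (\<Sum>k<N. h * a (real (Suc k) * h)) \<and>
    J N - (\<Sum>k<N. h * a (real (Suc k) * h)) \<le> h * (a 0 - a (real N * h))"
  proof (induction N)
    case 0 show ?case by (simp add: J_def)
  next
    case (Suc N)
    then show ?case using lo[of N] hi[of N] unfolding step by (simp add: right_diff_distrib)
  qed
  then show "0 \<le> J N - (\<Sum>k<N. h * a (real (Suc k) * h))"
    and "J N - (\<Sum>k<N. h * a (real (Suc k) * h)) \<le> h * (a 0 - a (real N * h))" by blast+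
qed

text \<open>Independence enters as the product form of the joint law, so that U and V may take
  values in arbitrary spaces. For a functional of a whole path, V is the identity map into the
  sigma-algebra of the process.\<close>

lemma (in prob_space) nn_integral_indep_pair:
  assumes [measurable]: "U \<in> measurable M S" "V \<in> measurable M T" "f \<in> borel_measurable (S \<Otimes>\<^sub>M T)"
    and eq: "distr M S U \<Otimes>\<^sub>M distr M T V = distr M (S \<Otimes>\<^sub>M T) (\<lambda>x. (U x, V x))"
  shows "(\<integral>\<^sup>+\<omega>. f (U \<omega>, V \<omega>) \<partial>M) = (\<integral>\<^sup>+\<omega>. \<integral>\<^sup>+\<omega>'. f (U \<omega>, V \<omega>') \<partial>M \<partial>M)"
proof -
  interpret U: prob_space "distr M S U" by (rule prob_space_distr) simp
  interpret V: prob_space "distr M T V" by (rule prob_space_distr) simp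
  interpret P: pair_sigma_finite "distr M S U" "distr M T V" ..
  have "(\<integral>\<^sup>+\<omega>. f (U \<omega>, V \<omega>) \<partial>M) = (\<integral>\<^sup>+p. f p \<partial>(distr M S U \<Otimes>\<^sub>M distr M T V))"
    unfolding eq by (simp add: nn_integral_distr)
  also have "\<dots> = (\<integral>\<^sup>+u. \<integral>\<^sup>+v. f (u, v) \<partial>distr M T V \<partial>distr M S U)"
    by (intro V.nn_integral_fst[symmetric]) simp
  also have "\<dots> = (\<integral>\<^sup>+\<omega>. \<integral>\<^sup>+\<omega>'. f (U \<omega>, V \<omega>') \<partial>M \<partial>M)"
    by (subst nn_integral_distr) (auto intro!: nn_integral_cong simp: nn_integral_distr)
  finally show ?thesis .
qed

section \<open>The stable subordinator: paths, restart, scaling and Riemann sums\<close>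

locale subordinator = prob_space M for M :: "'a measure" +
  fixes \<alpha> :: real and \<sigma> :: "real \<Rightarrow> 'a \<Rightarrow> real"
  assumes stable: "stable_subordinator \<alpha> M \<sigma>" and \<alpha>: "0 < \<alpha>" "\<alpha> < 1"
begin

lemma \<sigma>_measurable: "0 \<le> s \<Longrightarrow> \<sigma> s \<in> borel_measurable M"
  and \<sigma>_zero: "\<omega> \<in> space M \<Longrightarrow> \<sigma> 0 \<omega> = 0"
  and \<sigma>_mono: "\<omega> \<in> space M \<Longrightarrow> 0 \<le> s \<Longrightarrow> s \<le> t \<Longrightarrow> \<sigma> s \<omega> \<le> \<sigma> t \<omega>"
  and \<sigma>_right_cont: "\<omega> \<in> space M \<Longrightarrow> 0 \<le> s \<Longrightarrow> ((\<lambda>s. \<sigma> s \<omega>) \<longlongrightarrow> \<sigma> s \<omega>) (at_right s)"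
  and \<sigma>_indep: "0 \<le> \<tau> 0 \<Longrightarrow> mono \<tau> \<Longrightarrow>
    indep_vars (\<lambda>_. borel) (\<lambda>i \<omega>. \<sigma> (\<tau> (Suc i)) \<omega> - \<sigma> (\<tau> i) \<omega>) {..<n}"
  and \<sigma>_stationary: "0 \<le> s \<Longrightarrow> 0 \<le> r \<Longrightarrow> distr M borel (\<lambda>\<omega>. \<sigma> (s + r) \<omega> - \<sigma> s \<omega>) = distr M borel (\<sigma> r)"
  and \<sigma>_laplace: "0 \<le> s \<Longrightarrow> 0 \<le> l \<Longrightarrow> (LINT \<omega>|M. exp (- l * \<sigma> s \<omega>)) = exp (- s * l powr \<alpha>)"
  using stable unfolding stable_subordinator_def by (auto simp: mono_on_def continuous_within)

lemma \<sigma>_nonneg: "\<omega> \<in> space M \<Longrightarrow> 0 \<le> s \<Longrightarrow> 0 \<le> \<sigma> s \<omega>"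
  using \<sigma>_mono[of \<omega> 0 s] \<sigma>_zero[of \<omega>] by simp

lemma \<sigma>_laplace_nn:
  assumes "0 \<le> s" "0 \<le> l"
  shows "(\<integral>\<^sup>+\<omega>. ennreal (exp (- l * \<sigma> s \<omega>)) \<partial>M) = ennreal (exp (- s * l powr \<alpha>))"
proof -
  have [measurable]: "\<sigma> s \<in> borel_measurable M" using assms(1) by (rule \<sigma>_measurable)
  have "integrable M (\<lambda>\<omega>. exp (- l * \<sigma> s \<omega>))"
    by (rule integrable_const_bound[of _ 1]) (use \<sigma>_nonneg assms in auto)
  then show ?thesis using \<sigma>_laplace[OF assms] by (simp add: nn_integral_eq_integral)
qed

text \<open>A right-continuous process is the limit of processes that are constant on the cells of a
  time grid and sampled to the right. The argument \<open>max 0 s\<close> extends \<sigma> to all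
  real times, so that the plain Borel algebra can be used.\<close>

lemma \<sigma>_jointly_measurable: "(\<lambda>(s, \<omega>). \<sigma> (max 0 s) \<omega>) \<in> borel_measurable (borel \<Otimes>\<^sub>M M)"
proof (rule borel_measurable_LIMSEQ_real)
  \<comment> \<open>Floor plus one is strictly above s, so that \<open>g n s\<close> approaches s
    within \<open>at_right\<close>.\<close>
  define g where "g n s = real (nat \<lfloor>real (Suc n) * max 0 s\<rfloor> + 1) / real (Suc n)" for n and s :: real
  fix p :: "real \<times> 'a" assume "p \<in> space (borel \<Otimes>\<^sub>M M)"
  then obtain s \<omega> where p: "p = (s, \<omega>)" and \<omega>: "\<omega> \<in> space M" by (auto simp: space_pair_measure)
  define s' where "s' = max 0 s"
  have s': "s' \<ge> 0" by (simp add: s'_def)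
  have g: "s' < g n s" "g n s \<le> s' + 1 / real (Suc n)" for n
  proof -
    have pos: "0 \<le> real (Suc n) * s'" using s' by simp
    have eq: "real (nat \<lfloor>real (Suc n) * s'\<rfloor> + 1) = of_int \<lfloor>real (Suc n) * s'\<rfloor> + 1"
      using pos by (simp add: of_nat_nat)
    have "real (Suc n) * s' < of_int \<lfloor>real (Suc n) * s'\<rfloor> + 1"
      "of_int \<lfloor>real (Suc n) * s'\<rfloor> \<le> real (Suc n) * s'" by linarith+
    then show "s' < g n s" "g n s \<le> s' + 1 / real (Suc n)"
      unfolding g_def s'_def[symmetric] eq by (simp_all add: field_simps del: of_nat_Suc)
  qed
  have "filterlim (\<lambda>n. g n s) (at_right s') sequentially"
  proof (rule tendsto_imp_filterlim_at_right)
    show "(\<lambda>n. g n s) \<longlonglongrightarrow> s'"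
    proof (rule tendsto_sandwich[OF _ _ tendsto_const])
      show "(\<lambda>n. s' + 1 / real (Suc n)) \<longlonglongrightarrow> s'"
        using LIMSEQ_inverse_real_of_nat_add[of s'] by (simp add: inverse_eq_divide)
      show "\<forall>\<^sub>F n in sequentially. s' \<le> g n s"
        using g(1) by (intro always_eventually allI less_imp_le)
      show "\<forall>\<^sub>F n in sequentially. g n s \<le> s' + 1 / real (Suc n)"
        using g(2) by (intro always_eventually allI)
    qed
  qed (use g in auto)
  then have "(\<lambda>n. \<sigma> (g n s) \<omega>) \<longlonglongrightarrow> \<sigma> s' \<omega>"
    by (rule filterlim_compose[OF \<sigma>_right_cont[OF \<omega> s']])
  then show "(\<lambda>n. case p of (s, \<omega>) \<Rightarrow> \<sigma> (g n s) \<omega>) \<longlonglongrightarrow> (case p of (s, \<omega>) \<Rightarrow> \<sigma> (max 0 s) \<omega>)"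
    by (simp add: p s'_def)
next
  fix n :: nat
  have [measurable]: "(\<lambda>\<omega>. \<sigma> (real (k + 1) / real (Suc n)) \<omega>) \<in> borel_measurable M" for k
    by (rule \<sigma>_measurable) simp
  show "(\<lambda>(s, \<omega>). \<sigma> (real (nat \<lfloor>real (Suc n) * max 0 s\<rfloor> + 1) / real (Suc n)) \<omega>)
      \<in> borel_measurable (borel \<Otimes>\<^sub>M M)"
    unfolding split_beta
    by (rule measurable_compose_countable[where f="\<lambda>k p. \<sigma> (real (k + 1) / real (Suc n)) (snd p)"
          and g="\<lambda>p. nat \<lfloor>real (Suc n) * max 0 (fst p)\<rfloor>"]) measurable
qed

lemma \<sigma>_jointly_measurable' [measurable (raw)]:
  assumes [measurable]: "f \<in> borel_measurable N" "g \<in> measurable N M"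
  shows "(\<lambda>x. \<sigma> (max 0 (f x)) (g x)) \<in> borel_measurable N"
  using measurable_compose[of "\<lambda>x. (f x, g x)", OF _ \<sigma>_jointly_measurable] by simp

lemma occupation_max:
  "occupation \<gamma> \<sigma> x \<omega> = (LINT s|lborel. indicator {0..} s * pos_powr \<gamma> (x - \<sigma> (max 0 s) \<omega>))"
  unfolding occupation_def by (intro Bochner_Integration.integral_cong) (auto simp: indicator_def max_def)

lemma occupation_measurable [measurable]: "occupation \<gamma> \<sigma> x \<in> borel_measurable M"
  unfolding occupation_max[abs_def] by measurable

lemma occupation_nonneg: "0 \<le> occupation \<gamma> \<sigma> x \<omega>"
  unfolding occupation_def by (intro integral_nonneg_AE) auto

text \<open>Chernoff's bound with parameter 1, where the Laplace exponent equals 1 for every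
  \<alpha>.\<close>

lemma prob_\<sigma>_le: "0 \<le> s \<Longrightarrow> prob {\<omega> \<in> space M. \<sigma> s \<omega> \<le> x} \<le> exp (x - s)"
proof -
  assume s: "0 \<le> s"
  have [measurable]: "\<sigma> s \<in> borel_measurable M" using s by (rule \<sigma>_measurable)
  have int: "integrable M (\<lambda>\<omega>. exp x * exp (- 1 * \<sigma> s \<omega>))"
    by (rule integrable_mult_right, rule integrable_const_bound[of _ 1]) (use \<sigma>_nonneg s in auto)
  have "prob {\<omega> \<in> space M. \<sigma> s \<omega> \<le> x} = (LINT \<omega>|M. indicator {\<omega> \<in> space M. \<sigma> s \<omega> \<le> x} \<omega>)"
    by simp
  also have "\<dots> \<le> (LINT \<omega>|M. exp x * exp (- 1 * \<sigma> s \<omega>))"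
  proof (rule integral_mono[OF _ int])
    fix \<omega> assume "\<omega> \<in> space M"
    then show "indicator {\<omega> \<in> space M. \<sigma> s \<omega> \<le> x} \<omega> \<le> exp x * exp (- 1 * \<sigma> s \<omega>)"
      by (auto simp: indicator_def exp_add[symmetric])
  qed (auto intro!: integrable_real_indicator simp: emeasure_eq_measure)
  also have "\<dots> = exp x * (LINT \<omega>|M. exp (- 1 * \<sigma> s \<omega>))" by (rule integral_mult_right_zero)
  also have "\<dots> = exp (x - s)" unfolding \<sigma>_laplace[OF s zero_le_one] by (simp add: exp_add[symmetric])
  finally show ?thesis .
qed

text \<open>By the Chernoff bound the event that \<sigma> stays below m at all integer times is
  null. Along almost every path the integrand of the occupation integral therefore vanishes after a
  finite time.\<close>

lemma AE_\<sigma>_unbounded: "AE \<omega> in M. \<forall>x. \<exists>T\<ge>0. x \<le> \<sigma> T \<omega>"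
proof -
  have "AE \<omega> in M. \<exists>T\<ge>0. real m \<le> \<sigma> T \<omega>" for m
  proof -
    define B where "B = (\<Inter>n. {\<omega> \<in> space M. \<sigma> (real n) \<omega> \<le> real m})"
    have [measurable]: "\<sigma> (real n) \<in> borel_measurable M" for n by (rule \<sigma>_measurable) simp
    have [measurable]: "B \<in> sets M" unfolding B_def by measurable
    have "(\<lambda>n. exp (real m - real n)) \<longlonglongrightarrow> 0" by real_asymp
    moreover have "prob B \<le> exp (real m - real n)" for n
      using prob_\<sigma>_le[of "real n" "real m"] finite_measure_mono[of B "{\<omega> \<in> space M. \<sigma> (real n) \<omega> \<le> real m}"]
      unfolding B_def by force
    ultimately have "prob B \<le> 0" by (intro LIMSEQ_le_const) auto
    then have "B \<in> null_sets M" by (auto simp: null_sets_def emeasure_eq_measure measure_le_0_iff)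
    then have "AE \<omega> in M. \<omega> \<notin> B" by (rule AE_not_in)
    then show ?thesis
    proof (rule AE_mp, intro AE_I2 impI)
      fix \<omega> assume "\<omega> \<in> space M" "\<omega> \<notin> B"
      then obtain n where "\<not> \<sigma> (real n) \<omega> \<le> real m" unfolding B_def by auto
      then show "\<exists>T\<ge>0. real m \<le> \<sigma> T \<omega>" by (intro exI[of _ "real n"]) auto
    qed
  qed
  then have "AE \<omega> in M. \<forall>m::nat. \<exists>T\<ge>0. real m \<le> \<sigma> T \<omega>" by (simp add: AE_all_countable)
  then show ?thesis
  proof (rule eventually_mono, intro allI)
    fix \<omega> x assume *: "\<forall>m::nat. \<exists>T\<ge>0. real m \<le> \<sigma> T \<omega>"
    obtain m :: nat where "x \<le> real m" using real_arch_simple by blast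
    with * show "\<exists>T\<ge>0. x \<le> \<sigma> T \<omega>" by (meson order_trans)
  qed
qed


lemma subordinator_shift:
  assumes s: "0 \<le> s"
  shows "subordinator M \<alpha> (\<lambda>r \<omega>. \<sigma> (s + r) \<omega> - \<sigma> s \<omega>)"
proof -
  have [measurable]: "\<sigma> r \<in> borel_measurable M" if "0 \<le> r" for r using that by (rule \<sigma>_measurable)
  have 1: "continuous (at_right r) (\<lambda>r. \<sigma> (s + r) \<omega> - \<sigma> s \<omega>)" if "\<omega> \<in> space M" "0 \<le> r" for \<omega> r
  proof -
    have "filterlim (\<lambda>r. s + r) (at_right (s + r)) (at_right r)"
      by (rule filterlim_at_withinI) (auto intro!: tendsto_intros simp: eventually_at_filter)
    then have "((\<lambda>r. \<sigma> (s + r) \<omega>) \<longlongrightarrow> \<sigma> (s + r) \<omega>) (at_right r)"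
      using that s by (intro filterlim_compose[OF \<sigma>_right_cont[of \<omega> "s + r"]]) auto
    then show ?thesis unfolding continuous_within by (intro tendsto_intros)
  qed
  have 2: "distr M borel (\<lambda>\<omega>. \<sigma> (s + (u + r)) \<omega> - \<sigma> s \<omega> - (\<sigma> (s + u) \<omega> - \<sigma> s \<omega>)) =
      distr M borel (\<lambda>\<omega>. \<sigma> (s + r) \<omega> - \<sigma> s \<omega>)" if "0 \<le> u" "0 \<le> r" for u r
    using \<sigma>_stationary[of "s + u" r] \<sigma>_stationary[of s r] s that by (simp add: add.assoc)
  have 3: "(LINT \<omega>|M. exp (- l * (\<sigma> (s + r) \<omega> - \<sigma> s \<omega>))) = exp (- r * l powr \<alpha>)"
    if "0 \<le> r" "0 \<le> l" for r l
  proof -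
    have "(LINT \<omega>|M. exp (- l * (\<sigma> (s + r) \<omega> - \<sigma> s \<omega>))) =
        (LINT x|distr M borel (\<lambda>\<omega>. \<sigma> (s + r) \<omega> - \<sigma> s \<omega>). exp (- l * x))"
      using s that by (subst integral_distr) auto
    also have "\<dots> = (LINT \<omega>|M. exp (- l * \<sigma> r \<omega>))"
      unfolding \<sigma>_stationary[OF s that(1)] using that by (subst integral_distr) auto
    finally show ?thesis using \<sigma>_laplace[OF that] by simp
  qed
  have 4: "indep_vars (\<lambda>_. borel) (\<lambda>i \<omega>. \<sigma> (s + t (Suc i)) \<omega> - \<sigma> s \<omega> - (\<sigma> (s + t i) \<omega> - \<sigma> s \<omega>)) {..<n}"
    if "0 \<le> t 0" "mono t" for t :: "nat \<Rightarrow> real" and n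
    using \<sigma>_indep[of "\<lambda>i. s + t i" n] that s by (auto simp: mono_def)
  have "stable_subordinator \<alpha> M (\<lambda>r \<omega>. \<sigma> (s + r) \<omega> - \<sigma> s \<omega>)"
    unfolding stable_subordinator_def
    using 1 2 3 4 s \<sigma>_mono prob_space_axioms by (auto simp: mono_on_def)
  then show ?thesis using \<alpha> by unfold_locales auto
qed

text \<open>Self-similarity: dividing by c replaces l by l / c in the Laplace exponent, and the time
  factor \<open>c powr \<alpha>\<close> compensates for it.\<close>

lemma subordinator_scale:
  assumes c: "0 < c"
  shows "subordinator M \<alpha> (\<lambda>r \<omega>. \<sigma> (c powr \<alpha> * r) \<omega> / c)"
proof -
  define b where "b = c powr \<alpha>"
  have b: "b > 0" using c by (simp add: b_def)
  have [measurable]: "\<sigma> r \<in> borel_measurable M" if "0 \<le> r" for r using that by (rule \<sigma>_measurable)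
  have 1: "continuous (at_right r) (\<lambda>r. \<sigma> (b * r) \<omega> / c)" if "\<omega> \<in> space M" "0 \<le> r" for \<omega> r
  proof -
    have "filterlim (\<lambda>r. b * r) (at_right (b * r)) (at_right r)"
      using b by (intro filterlim_at_withinI) (auto intro!: tendsto_intros simp: eventually_at_filter)
    then have "((\<lambda>r. \<sigma> (b * r) \<omega>) \<longlongrightarrow> \<sigma> (b * r) \<omega>) (at_right r)"
      using that b by (intro filterlim_compose[OF \<sigma>_right_cont[of \<omega> "b * r"]]) auto
    then show ?thesis unfolding continuous_within using c by (intro tendsto_intros) auto
  qed
  have 2: "distr M borel (\<lambda>\<omega>. \<sigma> (b * (u + r)) \<omega> / c - \<sigma> (b * u) \<omega> / c) =
      distr M borel (\<lambda>\<omega>. \<sigma> (b * r) \<omega> / c)" if "0 \<le> u" "0 \<le> r" for u r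
  proof -
    have "distr M borel (\<lambda>\<omega>. (\<sigma> (b * u + b * r) \<omega> - \<sigma> (b * u) \<omega>) / c) =
      distr (distr M borel (\<lambda>\<omega>. \<sigma> (b * u + b * r) \<omega> - \<sigma> (b * u) \<omega>)) borel (\<lambda>x. x / c)"
      using that b by (subst distr_distr) (auto simp: o_def)
    also have "\<dots> = distr (distr M borel (\<sigma> (b * r))) borel (\<lambda>x. x / c)"
      using that b by (subst \<sigma>_stationary) auto
    also have "\<dots> = distr M borel (\<lambda>\<omega>. \<sigma> (b * r) \<omega> / c)"
      using that b by (subst distr_distr) (auto simp: o_def)
    finally show ?thesis by (simp add: diff_divide_distrib distrib_left)
  qed
  have 3: "(LINT \<omega>|M. exp (- l * (\<sigma> (b * r) \<omega> / c))) = exp (- r * l powr \<alpha>)"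
    if "0 \<le> r" "0 \<le> l" for r l
    using \<sigma>_laplace[of "b * r" "l / c"] b c that by (simp add: powr_divide b_def)
  have 4: "indep_vars (\<lambda>_. borel) (\<lambda>i \<omega>. \<sigma> (b * t (Suc i)) \<omega> / c - \<sigma> (b * t i) \<omega> / c) {..<n}"
    if "0 \<le> t 0" "mono t" for t :: "nat \<Rightarrow> real" and n
  proof -
    have "indep_vars (\<lambda>_. borel) (\<lambda>i \<omega>. (\<sigma> (b * t (Suc i)) \<omega> - \<sigma> (b * t i) \<omega>) / c) {..<n}"
      using that b
      by (intro indep_vars_compose2[OF \<sigma>_indep[of "\<lambda>i. b * t i" n], of "\<lambda>_ x. x / c"]) (auto simp: mono_def)
    then show ?thesis by (simp add: diff_divide_distrib)
  qed
  have "stable_subordinator \<alpha> M (\<lambda>r \<omega>. \<sigma> (b * r) \<omega> / c)"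
    unfolding stable_subordinator_def
    using 1 2 3 4 b c \<sigma>_mono \<sigma>_zero prob_space_axioms
    by (auto simp: mono_on_def intro!: divide_right_mono)
  then show ?thesis using \<alpha> unfolding b_def by unfold_locales auto
qed

text \<open>Collects, for one path, what \<open>nn_integral_exp_tail\<close> and
  \<open>riemann_sum_antimono\<close> ask of their integrand.\<close>

lemma path_facts:
  fixes x \<gamma> :: real and \<omega> :: 'a
  assumes \<omega>: "\<omega> \<in> space M" and unb: "\<forall>x. \<exists>T\<ge>0. x \<le> \<sigma> T \<omega>" and \<gamma>: "\<gamma> \<ge> 0"
  defines "a \<equiv> \<lambda>s. indicator {0..} s * pos_powr \<gamma> (x - \<sigma> (max 0 s) \<omega>)"
  obtains T where "T \<ge> 0" "a \<in> borel_measurable borel" "\<And>s. 0 \<le> a s" "\<And>s. a s \<le> pos_powr \<gamma> x"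
    "\<And>s. s < 0 \<Longrightarrow> a s = 0" "\<And>s. T \<le> s \<Longrightarrow> a s = 0" "\<And>s t. 0 \<le> s \<Longrightarrow> s \<le> t \<Longrightarrow> a t \<le> a s"
proof -
  obtain T where T: "T \<ge> 0" "x \<le> \<sigma> T \<omega>" using unb by blast
  show ?thesis
  proof (rule that[OF T(1)])
    show "a \<in> borel_measurable borel" unfolding a_def using \<omega> by measurable
    show "0 \<le> a s" "s < 0 \<Longrightarrow> a s = 0" for s by (auto simp: a_def)
    show "a s \<le> pos_powr \<gamma> x" for s
    proof (cases "0 \<le> s")
      case True
      then show ?thesis using \<sigma>_nonneg[OF \<omega> True] by (auto simp: a_def intro!: pos_powr_mono \<gamma>)
    qed (auto simp: a_def)
    show "a s = 0" if "T \<le> s" for s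
      using \<sigma>_mono[OF \<omega> T(1) that] T that by (auto simp: a_def pos_powr_def)
    show "a t \<le> a s" if "0 \<le> s" "s \<le> t" for s t
      using that \<sigma>_mono[OF \<omega> that] by (auto simp: a_def intro!: pos_powr_mono \<gamma>)
  qed
qed

text \<open>Mesh 1 / (j + 1) and (j + 1)^2 cells: the mesh shrinks while the covered interval {0..j
  + 1} exhausts the half-line.\<close>

definition riemann :: "real \<Rightarrow> nat \<Rightarrow> real \<Rightarrow> 'a \<Rightarrow> real" where
  "riemann \<gamma> j x \<omega> = (\<Sum>k<(Suc j)\<^sup>2. (1 / real (Suc j)) * pos_powr \<gamma> (x - \<sigma> (real (Suc k) * (1 / real (Suc j))) \<omega>))"

lemma riemann_nonneg: "0 \<le> riemann \<gamma> j x \<omega>"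
  unfolding riemann_def by (intro sum_nonneg mult_nonneg_nonneg) auto

lemma riemann_tendsto:
  assumes \<omega>: "\<omega> \<in> space M" and unb: "\<forall>x. \<exists>T\<ge>0. x \<le> \<sigma> T \<omega>" and \<gamma>: "\<gamma> \<ge> 0"
  shows "(\<lambda>j. riemann \<gamma> j x \<omega>) \<longlonglongrightarrow> occupation \<gamma> \<sigma> x \<omega>"
proof -
  define a where "a s = indicator {0..} s * pos_powr \<gamma> (x - \<sigma> (max 0 s) \<omega>)" for s
  obtain T where T: "T \<ge> 0" "a \<in> borel_measurable borel" "\<And>s. 0 \<le> a s" "\<And>s. a s \<le> pos_powr \<gamma> x"
    "\<And>s. s < 0 \<Longrightarrow> a s = 0" "\<And>s. T \<le> s \<Longrightarrow> a s = 0" "\<And>s t. 0 \<le> s \<Longrightarrow> s \<le> t \<Longrightarrow> a t \<le> a s"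
    using path_facts[OF assms, of x] unfolding a_def[abs_def] by blast
  have R: "riemann \<gamma> j x \<omega> = (\<Sum>k<(Suc j)\<^sup>2. (1 / real (Suc j)) * a (real (Suc k) * (1 / real (Suc j))))" for j
    unfolding riemann_def a_def by (intro sum.cong refl arg_cong2[where f="(*)"]) (auto simp: max_def)
  have bd: "\<bar>riemann \<gamma> j x \<omega> - occupation \<gamma> \<sigma> x \<omega>\<bar> \<le> (1 / real (Suc j)) * pos_powr \<gamma> x" if "T \<le> real (Suc j)" for j
  proof -
    have N: "real ((Suc j)\<^sup>2) * (1 / real (Suc j)) = real (Suc j)" unfolding power2_eq_square of_nat_mult by (simp del: of_nat_Suc)
    have J: "occupation \<gamma> \<sigma> x \<omega> = (LINT s|lborel. indicator {0..<real (Suc j)} s * a s)"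
      unfolding occupation_max using T(6) that
      by (intro Bochner_Integration.integral_cong) (auto simp: a_def indicator_def)
    have "(1 / real (Suc j)) * (a 0 - a (real (Suc j))) \<le> (1 / real (Suc j)) * pos_powr \<gamma> x"
      using T(3)[of "real (Suc j)"] T(4)[of 0] by (intro mult_left_mono) auto
    then show ?thesis
      using riemann_sum_antimono[OF T(2,7,3), of "1 / real (Suc j)" "(Suc j)\<^sup>2"]
      unfolding R J N by simp
  qed
  have ev: "\<forall>\<^sub>F j in sequentially. norm (riemann \<gamma> j x \<omega> - occupation \<gamma> \<sigma> x \<omega>) \<le> (1 / real (Suc j)) * pos_powr \<gamma> x"
    using eventually_ge_at_top[of "nat \<lceil>T\<rceil>"]
  proof (rule eventually_mono)
    fix j assume "nat \<lceil>T\<rceil> \<le> j"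
    then have "T \<le> real (Suc j)" by linarith
    from bd[OF this] show "norm (riemann \<gamma> j x \<omega> - occupation \<gamma> \<sigma> x \<omega>) \<le> (1 / real (Suc j)) * pos_powr \<gamma> x"
      by simp
  qed
  have "(\<lambda>j. (1 / real (Suc j)) * pos_powr \<gamma> x) \<longlonglongrightarrow> 0"
    using tendsto_mult_right[OF LIMSEQ_inverse_real_of_nat, of "pos_powr \<gamma> x"] by (simp add: inverse_eq_divide)
  with ev have "(\<lambda>j. riemann \<gamma> j x \<omega> - occupation \<gamma> \<sigma> x \<omega>) \<longlonglongrightarrow> 0" by (rule Lim_null_comparison)
  then show ?thesis by (simp add: LIM_zero_iff)
qed

end

text \<open>The same Riemann sum as a function of the increments alone, which makes its law and its
  dependence structure accessible.\<close>

definition walk_sum :: "real \<Rightarrow> nat \<Rightarrow> real \<Rightarrow> (nat \<Rightarrow> real) \<Rightarrow> real" where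
  "walk_sum \<gamma> j x z = (\<Sum>k<(Suc j)\<^sup>2. (1 / real (Suc j)) * pos_powr \<gamma> (x - (\<Sum>i\<le>k. z i)))"

lemma walk_sum_measurable [measurable (raw)]:
  assumes [measurable]: "f \<in> borel_measurable N" "g \<in> measurable N (PiM {..<(Suc j)\<^sup>2} (\<lambda>_. borel))"
  shows "(\<lambda>\<omega>. walk_sum \<gamma> j (f \<omega>) (g \<omega>)) \<in> borel_measurable N"
proof -
  have [measurable]: "(\<lambda>\<omega>. g \<omega> i) \<in> borel_measurable N" if "i < (Suc j)\<^sup>2" for i
    using measurable_compose[OF assms(2) measurable_component_singleton[of i]] that by simp
  have [measurable]: "(\<lambda>\<omega>. \<Sum>i\<le>k. g \<omega> i) \<in> borel_measurable N" if "k < (Suc j)\<^sup>2" for k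
    using that by (intro borel_measurable_sum) auto
  show ?thesis unfolding walk_sum_def by (intro borel_measurable_sum) measurable
qed

text \<open>The kernel of the Riemann-Liouville integral of order a, extended by 0 so that the
  fractional integral becomes a convolution on the whole line.\<close>

definition frac_kernel :: "real \<Rightarrow> real \<Rightarrow> real" where
  "frac_kernel a v = (if v > 0 then v powr (a - 1) / Gamma a else 0)"

lemma frac_kernel_measurable [measurable]: "frac_kernel a \<in> borel_measurable borel"
  unfolding frac_kernel_def[abs_def] by measurable

lemma frac_kernel_nonneg: "a > 0 \<Longrightarrow> 0 \<le> frac_kernel a v"
  by (simp add: frac_kernel_def Gamma_real_nonneg)

text \<open>Euler's integral for Gamma after the substitution t = l v; the single point v = 0 is
  discarded.\<close>

lemma laplace_frac_kernel:
  assumes a: "a > 0" and l: "l > 0"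
  shows "(\<integral>\<^sup>+v. ennreal (frac_kernel a v) * ennreal (exp (- l * v)) \<partial>lborel) = ennreal (l powr (- a))"
proof -
  have G: "Gamma a > 0" using a by (rule Gamma_real_pos)
  have "ennreal (Gamma a) = (\<integral>\<^sup>+t. ennreal (indicator {0..} t * t powr (a - 1) / exp t) \<partial>lborel)"
    by (rule Gamma_conv_nn_integral_real[OF a])
  also have "\<dots> = ennreal \<bar>l\<bar> * (\<integral>\<^sup>+v. ennreal (indicator {0..} (0 + l * v) * (0 + l * v) powr (a - 1) / exp (0 + l * v)) \<partial>lborel)"
    using l by (intro nn_integral_real_affine) auto
  also have "\<dots> = (\<integral>\<^sup>+v. ennreal (l powr a * Gamma a) * (ennreal (frac_kernel a v) * ennreal (exp (- l * v))) \<partial>lborel)"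
  proof (subst nn_integral_cmult[symmetric], simp, rule nn_integral_cong_AE, rule AE_mp[OF AE_lborel_singleton[of 0]], intro AE_I2 impI)
    fix v :: real assume "v \<noteq> 0"
    show "ennreal \<bar>l\<bar> * ennreal (indicator {0..} (0 + l * v) * (0 + l * v) powr (a - 1) / exp (0 + l * v))
      = ennreal (l powr a * Gamma a) * (ennreal (frac_kernel a v) * ennreal (exp (- l * v)))"
    proof (cases "v > 0")
      case True
      have "l * (l * v) powr (a - 1) = l powr a * v powr (a - 1)"
        using l True by (simp add: powr_mult powr_diff)
      then show ?thesis
        using True l G
        by (simp add: frac_kernel_def ennreal_mult[symmetric] exp_minus field_simps)
    next
      case False
      with \<open>v \<noteq> 0\<close> have "v < 0" by simp
      then have "l * v < 0" using l by (simp add: mult_less_0_iff)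
      then show ?thesis using False by (simp add: frac_kernel_def indicator_def)
    qed
  qed
  also have "\<dots> = ennreal (l powr a * Gamma a) * (\<integral>\<^sup>+v. ennreal (frac_kernel a v) * ennreal (exp (- l * v)) \<partial>lborel)"
    by (rule nn_integral_cmult) simp
  finally have eq: "ennreal (Gamma a) = ennreal (l powr a * Gamma a) *
    (\<integral>\<^sup>+v. ennreal (frac_kernel a v) * ennreal (exp (- l * v)) \<partial>lborel)" .
  have "ennreal (l powr (- a)) = ennreal (1 / (l powr a * Gamma a)) * ennreal (Gamma a)"
    using G l by (simp add: ennreal_mult[symmetric] powr_minus field_simps)
  also have "\<dots> = (\<integral>\<^sup>+v. ennreal (frac_kernel a v) * ennreal (exp (- l * v)) \<partial>lborel)"
    unfolding eq mult.assoc[symmetric] using G l by (simp add: ennreal_mult[symmetric])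
  finally show ?thesis ..
qed

lemma nn_integral_exp_atLeast:
  assumes "c > (0::real)"
  shows "(\<integral>\<^sup>+s. ennreal (exp (- s * c)) * indicator {0..} s \<partial>lborel) = ennreal (1 / c)"
proof -
  have "((\<lambda>s. - exp (- s * c) / c) \<longlongrightarrow> 0) at_top" using assms by real_asymp
  then have "(\<integral>\<^sup>+s. ennreal (exp (- s * c)) * indicator {0..} s \<partial>lborel) = ennreal (0 - (- exp (- 0 * c) / c))"
    using assms by (intro nn_integral_FTC_atLeast) (auto intro!: derivative_eq_intros)
  then show ?thesis by simp
qed

section \<open>The law of the occupation integral, the potential measure and the Volterra
  equation\<close>

context subordinator begin

lemma distr_\<sigma>_unique:
  assumes "subordinator M' \<alpha> \<sigma>'" and s: "0 \<le> s"
  shows "distr M' borel (\<sigma>' s) = distr M borel (\<sigma> s)"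
proof -
  interpret S: subordinator M' \<alpha> \<sigma>' by fact
  have [measurable]: "\<sigma> s \<in> borel_measurable M" "\<sigma>' s \<in> borel_measurable M'"
    using s by (auto intro: \<sigma>_measurable S.\<sigma>_measurable)
  show ?thesis
  proof (rule measure_eqI_laplace)
    show "AE x in distr M' borel (\<sigma>' s). 0 \<le> x" "AE x in distr M borel (\<sigma> s). 0 \<le> x"
      using s by (auto simp: AE_distr_iff intro!: AE_I2 \<sigma>_nonneg S.\<sigma>_nonneg)
    show "(\<integral>\<^sup>+x. ennreal (exp (- l * x)) \<partial>distr M' borel (\<sigma>' s)) = (\<integral>\<^sup>+x. ennreal (exp (- l * x)) \<partial>distr M borel (\<sigma> s))"
      if "l > 0" for l
      using that s \<sigma>_laplace_nn[of s l] S.\<sigma>_laplace_nn[of s l] by (simp add: nn_integral_distr)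
    have "(\<integral>\<^sup>+x. ennreal (exp (- 1 * x)) \<partial>distr M' borel (\<sigma>' s)) = ennreal (exp (- s * 1 powr \<alpha>))"
      using s S.\<sigma>_laplace_nn[of s 1] by (simp add: nn_integral_distr)
    then show "(\<integral>\<^sup>+x. ennreal (exp (- x)) \<partial>distr M' borel (\<sigma>' s)) < \<infinity>" by simp
  qed auto
qed

lemma \<sigma>_eq_sum_increments:
  "\<omega> \<in> space M \<Longrightarrow> \<sigma> (real (Suc k) * h) \<omega> = (\<Sum>i\<le>k. \<sigma> (real (Suc i) * h) \<omega> - \<sigma> (real i * h) \<omega>)"
  by (induction k) (simp_all add: \<sigma>_zero)

lemma riemann_eq_walk_sum:
  assumes "\<omega> \<in> space M"
  shows "riemann \<gamma> j x \<omega> = walk_sum \<gamma> j x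
    (\<lambda>i\<in>{..<(Suc j)\<^sup>2}. \<sigma> (real (Suc i) * (1 / real (Suc j))) \<omega> - \<sigma> (real i * (1 / real (Suc j))) \<omega>)"
proof -
  let ?h = "1 / real (Suc j)"
  let ?z = "\<lambda>i\<in>{..<(Suc j)\<^sup>2}. \<sigma> (real (Suc i) * ?h) \<omega> - \<sigma> (real i * ?h) \<omega>"
  have "\<sigma> (real (Suc k) * ?h) \<omega> = (\<Sum>i\<le>k. ?z i)" if "k < (Suc j)\<^sup>2" for k
    by (rule trans[OF \<sigma>_eq_sum_increments[OF assms]], rule sum.cong) (use that in auto)
  then show ?thesis unfolding riemann_def walk_sum_def by (intro sum.cong) (simp_all only: lessThan_iff)
qed

lemma distr_increments:
  assumes h: "h > 0" and n: "n > 0"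
  shows "distr M (PiM {..<n} (\<lambda>_. borel)) (\<lambda>\<omega>. \<lambda>i\<in>{..<n}. \<sigma> (real (Suc i) * h) \<omega> - \<sigma> (real i * h) \<omega>) =
    PiM {..<n} (\<lambda>_. distr M borel (\<sigma> h))"
proof -
  have [measurable]: "\<sigma> r \<in> borel_measurable M" if "0 \<le> r" for r using that by (rule \<sigma>_measurable)
  have "indep_vars (\<lambda>_. borel) (\<lambda>i \<omega>. \<sigma> (real (Suc i) * h) \<omega> - \<sigma> (real i * h) \<omega>) {..<n}"
    using h by (intro \<sigma>_indep[of "\<lambda>i. real i * h"]) (auto simp: mono_def intro!: mult_right_mono)
  moreover have "random_variable borel (\<lambda>\<omega>. \<sigma> (real (Suc i) * h) \<omega> - \<sigma> (real i * h) \<omega>)" for i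
    using h by (intro borel_measurable_diff) auto
  ultimately have "distr M (PiM {..<n} (\<lambda>_. borel)) (\<lambda>\<omega>. \<lambda>i\<in>{..<n}. \<sigma> (real (Suc i) * h) \<omega> - \<sigma> (real i * h) \<omega>) =
    PiM {..<n} (\<lambda>i. distr M borel (\<lambda>\<omega>. \<sigma> (real (Suc i) * h) \<omega> - \<sigma> (real i * h) \<omega>))"
    using n by (subst indep_vars_iff_distr_eq_PiM[symmetric]) auto
  also have "\<dots> = PiM {..<n} (\<lambda>_. distr M borel (\<sigma> h))"
    using h \<sigma>_stationary[of "real i * h" h for i]
    by (intro PiM_cong refl) (simp add: distrib_right add.commute)
  finally show ?thesis .
qed

lemma riemann_measurable [measurable]: "riemann \<gamma> j x \<in> borel_measurable M"
proof -
  have [measurable]: "\<sigma> r \<in> borel_measurable M" if "0 \<le> r" for r using that by (rule \<sigma>_measurable)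
  have [measurable]: "\<sigma> (real (Suc k) * (1 / real (Suc j))) \<in> borel_measurable M" for k by simp
  show ?thesis unfolding riemann_def[abs_def] by (intro borel_measurable_sum) measurable
qed

text \<open>The increments over the grid are independent with a common law, and that law is fixed by
  its Laplace transform. The two subordinators may live on different probability spaces.\<close>

lemma riemann_law:
  assumes "subordinator M' \<alpha> \<sigma>'"
  shows "(\<integral>\<^sup>+\<omega>. ennreal (exp (- l * subordinator.riemann \<sigma>' \<gamma> j x \<omega>)) \<partial>M') =
    (\<integral>\<^sup>+\<omega>. ennreal (exp (- l * riemann \<gamma> j x \<omega>)) \<partial>M)"
proof -
  interpret S: subordinator M' \<alpha> \<sigma>' by fact
  let ?h = "1 / real (Suc j)" and ?n = "(Suc j)\<^sup>2"
  have law: "(\<integral>\<^sup>+\<omega>. ennreal (exp (- l * subordinator.riemann \<tau> \<gamma> j x \<omega>)) \<partial>N) =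
    (\<integral>\<^sup>+z. ennreal (exp (- l * walk_sum \<gamma> j x z)) \<partial>PiM {..<?n} (\<lambda>_. distr N borel (\<tau> ?h)))"
    if "subordinator N \<alpha> \<tau>" for N :: "'c measure" and \<tau>
  proof -
    interpret T: subordinator N \<alpha> \<tau> by fact
    have [measurable]: "\<tau> r \<in> borel_measurable N" if "0 \<le> r" for r using that by (rule T.\<sigma>_measurable)
    have [measurable]: "(\<lambda>\<omega>. \<lambda>i\<in>{..<?n}. \<tau> (real (Suc i) * ?h) \<omega> - \<tau> (real i * ?h) \<omega>) \<in>
      measurable N (PiM {..<?n} (\<lambda>_. borel))"
      by (intro measurable_restrict borel_measurable_diff) auto
    have "(\<integral>\<^sup>+\<omega>. ennreal (exp (- l * T.riemann \<gamma> j x \<omega>)) \<partial>N) =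
      (\<integral>\<^sup>+z. ennreal (exp (- l * walk_sum \<gamma> j x z)) \<partial>distr N (PiM {..<?n} (\<lambda>_. borel))
        (\<lambda>\<omega>. \<lambda>i\<in>{..<?n}. \<tau> (real (Suc i) * ?h) \<omega> - \<tau> (real i * ?h) \<omega>))"
      by (subst nn_integral_distr) (auto intro!: nn_integral_cong simp: T.riemann_eq_walk_sum)
    then show ?thesis by (subst (asm) T.distr_increments) auto
  qed
  have "distr M' borel (\<sigma>' ?h) = distr M borel (\<sigma> ?h)" by (rule distr_\<sigma>_unique[OF assms]) simp
  then show ?thesis
    unfolding law[OF assms] law[OF subordinator_axioms] by (simp only:)
qed

lemma riemann_laplace_tendsto:
  assumes "\<gamma> \<ge> 0" "l \<ge> 0"
  shows "(\<lambda>j. \<integral>\<^sup>+\<omega>. ennreal (exp (- l * riemann \<gamma> j x \<omega>)) \<partial>M) \<longlonglongrightarrow>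
    (\<integral>\<^sup>+\<omega>. ennreal (exp (- l * occupation \<gamma> \<sigma> x \<omega>)) \<partial>M)"
proof (rule nn_integral_dominated_convergence[where w="\<lambda>_. 1"])
  show "AE \<omega> in M. (\<lambda>j. ennreal (exp (- l * riemann \<gamma> j x \<omega>))) \<longlonglongrightarrow> ennreal (exp (- l * occupation \<gamma> \<sigma> x \<omega>))"
    using AE_\<sigma>_unbounded
    by (rule AE_mp) (auto intro!: AE_I2 tendsto_intros riemann_tendsto assms)
  show "AE \<omega> in M. ennreal (exp (- l * riemann \<gamma> j x \<omega>)) \<le> 1" for j
    using assms riemann_nonneg by (intro AE_I2) simp
qed (auto simp: emeasure_space_1)

definition occ_laplace :: "real \<Rightarrow> real \<Rightarrow> real \<Rightarrow> real" where
  "occ_laplace \<gamma> l x = (LINT \<omega>|M. exp (- l * occupation \<gamma> \<sigma> x \<omega>))"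

lemma occ_laplace_nn:
  assumes "l \<ge> 0"
  shows "ennreal (occ_laplace \<gamma> l x) = (\<integral>\<^sup>+\<omega>. ennreal (exp (- l * occupation \<gamma> \<sigma> x \<omega>)) \<partial>M)"
proof -
  have "integrable M (\<lambda>\<omega>. exp (- l * occupation \<gamma> \<sigma> x \<omega>))"
    by (rule integrable_const_bound[of _ 1]) (use assms occupation_nonneg in auto)
  then show ?thesis unfolding occ_laplace_def by (subst nn_integral_eq_integral) auto
qed

lemma occ_laplace_nonneg: "0 \<le> occ_laplace \<gamma> l x"
  unfolding occ_laplace_def by (intro integral_nonneg_AE) auto

text \<open>Inherited from the Riemann sums. It is applied to restarted and to rescaled
  subordinators and to the measures that belong to different starting points.\<close>

lemma occ_laplace_unique:
  assumes "subordinator M' \<alpha> \<sigma>'" "\<gamma> \<ge> 0" "l \<ge> 0"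
  shows "(LINT \<omega>|M'. exp (- l * occupation \<gamma> \<sigma>' x \<omega>)) = occ_laplace \<gamma> l x"
proof -
  interpret S: subordinator M' \<alpha> \<sigma>' by fact
  have "ennreal (S.occ_laplace \<gamma> l x) = ennreal (occ_laplace \<gamma> l x)"
    unfolding S.occ_laplace_nn[OF assms(3)] occ_laplace_nn[OF assms(3)]
    using S.riemann_laplace_tendsto[OF assms(2,3), of x] riemann_laplace_tendsto[OF assms(2,3), of x]
    unfolding riemann_law[OF assms(1)] by (rule LIMSEQ_unique)
  then show ?thesis unfolding S.occ_laplace_def[symmetric]
    using occ_laplace_nonneg S.occ_laplace_nonneg by (simp add: ennreal_inj)
qed

text \<open>The time substitution s = x^\<alpha> r turns the occupation integral at level x into
  x^(\<alpha> + \<gamma>) times that of the rescaled subordinator at level 1: one factor x^\<alpha>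
  comes from ds and one factor x^\<gamma> from the integrand.\<close>

lemma occ_laplace_scale:
  assumes x: "x > 0" and \<gamma>: "\<gamma> \<ge> 0" and l: "l \<ge> 0"
  shows "occ_laplace \<gamma> l x = occ_laplace \<gamma> (l * x powr (\<alpha> + \<gamma>)) 1"
proof -
  define \<tau> where "\<tau> r \<omega> = \<sigma> (x powr \<alpha> * r) \<omega> / x" for r \<omega>
  have occ: "occupation \<gamma> \<sigma> x \<omega> = x powr (\<alpha> + \<gamma>) * occupation \<gamma> \<tau> 1 \<omega>" for \<omega>
  proof -
    have p: "pos_powr \<gamma> (x - \<sigma> s \<omega>) = x powr \<gamma> * pos_powr \<gamma> (1 - \<sigma> s \<omega> / x)" for s
    proof -
      have "x - \<sigma> s \<omega> = x * (1 - \<sigma> s \<omega> / x)" using x by (simp add: field_simps)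
      then show ?thesis using x
        by (simp add: pos_powr_def powr_mult zero_less_mult_iff)
    qed
    have eq: "indicator {0..} (0 + x powr \<alpha> * r) * pos_powr \<gamma> (x - \<sigma> (0 + x powr \<alpha> * r) \<omega>) =
        x powr \<gamma> * (indicator {0..} r * pos_powr \<gamma> (1 - \<tau> r \<omega>))" for r
      unfolding p \<tau>_def using x by (auto simp: indicator_def zero_le_mult_iff)
    have "occupation \<gamma> \<sigma> x \<omega> = \<bar>x powr \<alpha>\<bar> *\<^sub>R
       (LINT r|lborel. indicator {0..} (0 + x powr \<alpha> * r) * pos_powr \<gamma> (x - \<sigma> (0 + x powr \<alpha> * r) \<omega>))"
      unfolding occupation_def using x by (intro lborel_integral_real_affine) auto
    also have "\<dots> = \<bar>x powr \<alpha>\<bar> *\<^sub>R (x powr \<gamma> * (LINT r|lborel. indicator {0..} r * pos_powr \<gamma> (1 - \<tau> r \<omega>)))"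
      by (simp only: eq integral_mult_right_zero)
    finally show ?thesis unfolding occupation_def by (simp add: powr_add)
  qed
  have "occ_laplace \<gamma> l x = (LINT \<omega>|M. exp (- (l * x powr (\<alpha> + \<gamma>)) * occupation \<gamma> \<tau> 1 \<omega>))"
    unfolding occ_laplace_def occ by (simp add: mult.assoc)
  also have "\<dots> = occ_laplace \<gamma> (l * x powr (\<alpha> + \<gamma>)) 1"
    using l by (intro occ_laplace_unique \<gamma> subordinator_scale[OF x, folded \<tau>_def]) auto
  finally show ?thesis .
qed

lemma occupation_jointly_measurable [measurable (raw)]:
  assumes [measurable]: "f \<in> borel_measurable N" "g \<in> measurable N M"
  shows "(\<lambda>x. occupation \<gamma> \<sigma> (f x) (g x)) \<in> borel_measurable N"
  unfolding occupation_max by measurable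

lemma occ_laplace_measurable [measurable]: "occ_laplace \<gamma> l \<in> borel_measurable borel"
  unfolding occ_laplace_def[abs_def] by measurable

text \<open>The Laplace transform of the potential measure is the integral of exp (-s l^\<alpha>)
  ds, that is l^(-\<alpha>), which is also that of \<open>frac_kernel \<alpha>\<close>. Both
  measures are infinite, which is why the uniqueness theorem was stated with extended-valued
  integrals.\<close>

lemma potential_measure:
  assumes [measurable]: "g \<in> borel_measurable borel"
  shows "(\<integral>\<^sup>+s. indicator {0..} s * (\<integral>\<^sup>+\<omega>. g (\<sigma> (max 0 s) \<omega>) \<partial>M) \<partial>lborel) =
    (\<integral>\<^sup>+v. ennreal (frac_kernel \<alpha> v) * g v \<partial>lborel)"
proof -
  define U where "U = distr (density lborel (indicator {0..} :: real \<Rightarrow> ennreal) \<Otimes>\<^sub>M M) borel (\<lambda>p. \<sigma> (max 0 (fst p)) (snd p))"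
  define V where "V = density lborel (\<lambda>v. ennreal (frac_kernel \<alpha> v))"
  have U: "(\<integral>\<^sup>+v. g v \<partial>U) = (\<integral>\<^sup>+s. indicator {0..} s * (\<integral>\<^sup>+\<omega>. g (\<sigma> (max 0 s) \<omega>) \<partial>M) \<partial>lborel)"
    if [measurable]: "g \<in> borel_measurable borel" for g
  proof -
    have "(\<integral>\<^sup>+v. g v \<partial>U) = (\<integral>\<^sup>+p. g (\<sigma> (max 0 (fst p)) (snd p)) \<partial>(density lborel (indicator {0..}) \<Otimes>\<^sub>M M))"
      unfolding U_def by (intro nn_integral_distr) measurable
    also have "\<dots> = (\<integral>\<^sup>+s. \<integral>\<^sup>+\<omega>. g (\<sigma> (max 0 s) \<omega>) \<partial>M \<partial>density lborel (indicator {0..}))"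
      by (subst nn_integral_fst[symmetric]) auto
    also have "\<dots> = (\<integral>\<^sup>+s. indicator {0..} s * (\<integral>\<^sup>+\<omega>. g (\<sigma> (max 0 s) \<omega>) \<partial>M) \<partial>lborel)"
      by (intro nn_integral_density) measurable
    finally show ?thesis .
  qed
  have V: "(\<integral>\<^sup>+v. g v \<partial>V) = (\<integral>\<^sup>+v. ennreal (frac_kernel \<alpha> v) * g v \<partial>lborel)"
    if [measurable]: "g \<in> borel_measurable borel" for g
    unfolding V_def by (intro nn_integral_density) measurable
  have Ul: "(\<integral>\<^sup>+v. ennreal (exp (- l * v)) \<partial>U) = ennreal (l powr (- \<alpha>))" if l: "l > 0" for l
  proof -
    have "(\<integral>\<^sup>+v. ennreal (exp (- l * v)) \<partial>U) = (\<integral>\<^sup>+s. ennreal (exp (- s * l powr \<alpha>)) * indicator {0..} s \<partial>lborel)"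
    proof (subst U, simp, rule nn_integral_cong)
      fix s :: real
      show "indicator {0..} s * (\<integral>\<^sup>+\<omega>. ennreal (exp (- l * \<sigma> (max 0 s) \<omega>)) \<partial>M) =
        ennreal (exp (- s * l powr \<alpha>)) * indicator {0..} s"
        using l \<sigma>_laplace_nn[of s l] by (cases "s \<ge> 0") (simp_all add: max_def)
    qed
    also have "\<dots> = ennreal (1 / l powr \<alpha>)" using l by (intro nn_integral_exp_atLeast) auto
    finally show ?thesis by (simp add: powr_minus_divide)
  qed
  have "U = V"
  proof (rule measure_eqI_laplace)
    show "sets U = sets borel" "sets V = sets borel" by (auto simp: U_def V_def)
    have "AE p in density lborel (indicator {0..}) \<Otimes>\<^sub>M M. 0 \<le> \<sigma> (max 0 (fst p)) (snd p)"
      by (intro AE_I2) (auto simp: space_pair_measure intro!: \<sigma>_nonneg)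
    then show "AE x in U. 0 \<le> x" unfolding U_def by (subst AE_distr_iff) auto
    show "AE x in V. 0 \<le> x" unfolding V_def
      by (subst AE_density) (auto simp: frac_kernel_def split: if_splits)
    show "(\<integral>\<^sup>+x. ennreal (exp (- l * x)) \<partial>U) = (\<integral>\<^sup>+x. ennreal (exp (- l * x)) \<partial>V)" if "l > 0" for l
      using Ul[OF that] laplace_frac_kernel[OF \<alpha>(1) that] by (subst V) auto
    show "(\<integral>\<^sup>+x. ennreal (exp (- x)) \<partial>U) < \<infinity>" using Ul[of 1] by simp
  qed
  then show ?thesis using U[OF assms] V[OF assms] by simp
qed


text \<open>The Markov property of the occupation integral is inherited from Riemann sums, which
  depend on finitely many independent increments only.\<close>

lemma walk_markov:
  assumes s: "0 \<le> s" and \<gamma>: "\<gamma> \<ge> 0" and [measurable]: "G \<in> borel_measurable borel"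
  defines "\<tau> \<equiv> \<lambda>r \<omega>. \<sigma> (s + r) \<omega> - \<sigma> s \<omega>"
  shows "(\<integral>\<^sup>+\<omega>. ennreal (G (\<sigma> s \<omega>)) * ennreal (exp (- l * subordinator.riemann \<tau> \<gamma> j (x - \<sigma> s \<omega>) \<omega>)) \<partial>M) =
    (\<integral>\<^sup>+\<omega>. ennreal (G (\<sigma> s \<omega>)) *
      (\<integral>\<^sup>+\<omega>'. ennreal (exp (- l * subordinator.riemann \<tau> \<gamma> j (x - \<sigma> s \<omega>) \<omega>')) \<partial>M) \<partial>M)"
proof -
  interpret T: subordinator M \<alpha> \<tau> unfolding \<tau>_def by (rule subordinator_shift[OF s])
  define h where "h = 1 / real (Suc j)"
  define n where "n = (Suc j)\<^sup>2"
  \<comment> \<open>The grid behind s is preceded by the single step from 0 to s. As \<sigma> starts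
    at 0, the increment \<open>\<eta> 0\<close> is \<sigma> at time s, and the later ones are the
    increments of the restarted subordinator.\<close>
  define t where "t i = (case i of 0 \<Rightarrow> 0 | Suc k \<Rightarrow> s + real k * h)" for i
  define \<eta> where "\<eta> i \<omega> = \<sigma> (t (Suc i)) \<omega> - \<sigma> (t i) \<omega>" for i \<omega>
  have h: "h > 0" by (simp add: h_def)
  have t0: "t 0 = 0" by (simp add: t_def)
  have "incseq t" using s h by (intro incseq_SucI) (auto simp: t_def split: nat.split)
  then have ind: "indep_vars (\<lambda>_. borel) \<eta> {..<Suc n}"
    unfolding \<eta>_def using t0 by (intro \<sigma>_indep) auto
  have "indep_var (PiM {0} (\<lambda>_. borel)) (\<lambda>\<omega>. restrict (\<lambda>i. \<eta> i \<omega>) {0})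
      (PiM {1..n} (\<lambda>_. borel)) (\<lambda>\<omega>. restrict (\<lambda>i. \<eta> i \<omega>) {1..n})"
    by (rule indep_var_restrict[OF ind]) auto
  moreover have "(\<lambda>z. \<lambda>i\<in>{..<n}. z (Suc i)) \<in> measurable (PiM {1..n} (\<lambda>_. borel :: real measure)) (PiM {..<n} (\<lambda>_. borel :: real measure))"
    by (intro measurable_restrict measurable_component_singleton) auto
  ultimately have "indep_var (PiM {0} (\<lambda>_. borel)) ((\<lambda>z. z) \<circ> (\<lambda>\<omega>. restrict (\<lambda>i. \<eta> i \<omega>) {0}))
      (PiM {..<n} (\<lambda>_. borel)) ((\<lambda>z. \<lambda>i\<in>{..<n}. z (Suc i)) \<circ> (\<lambda>\<omega>. restrict (\<lambda>i. \<eta> i \<omega>) {1..n}))"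
    by (intro indep_var_compose) auto
  moreover have "(\<lambda>z. \<lambda>i\<in>{..<n}. z (Suc i)) \<circ> (\<lambda>\<omega>. restrict (\<lambda>i. \<eta> i \<omega>) {1..n}) =
      (\<lambda>\<omega>. \<lambda>i\<in>{..<n}. \<tau> (real (Suc i) * h) \<omega> - \<tau> (real i * h) \<omega>)"
    by (auto simp: fun_eq_iff \<eta>_def t_def \<tau>_def restrict_def)
  ultimately have iv: "indep_var (PiM {0} (\<lambda>_. borel)) (\<lambda>\<omega>. restrict (\<lambda>i. \<eta> i \<omega>) {0}) (PiM {..<n} (\<lambda>_. borel))
      (\<lambda>\<omega>. \<lambda>i\<in>{..<n}. \<tau> (real (Suc i) * h) \<omega> - \<tau> (real i * h) \<omega>)" by (simp add: o_def)
  have \<eta>0: "\<eta> 0 \<omega> = \<sigma> s \<omega>" if "\<omega> \<in> space M" for \<omega>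
    using that by (simp add: \<eta>_def t_def \<sigma>_zero)
  define f where "f = (\<lambda>(w, z). ennreal (G (w (0::nat))) * ennreal (exp (- l * walk_sum \<gamma> j (x - w 0) z)))"
  have "(\<lambda>w. w 0) \<in> measurable (PiM {0::nat} (\<lambda>_. borel)) (borel :: real measure)"
    by (rule measurable_component_singleton) simp
  then have [measurable]: "(\<lambda>p. fst p 0) \<in> borel_measurable (PiM {0::nat} (\<lambda>_. borel :: real measure) \<Otimes>\<^sub>M N)" for N
    by (rule measurable_compose[OF measurable_fst])
  have "f \<in> borel_measurable (PiM {0} (\<lambda>_. borel) \<Otimes>\<^sub>M PiM {..<n} (\<lambda>_. borel))"
    unfolding f_def split_beta n_def by measurable
  then have E: "(\<integral>\<^sup>+\<omega>. f (restrict (\<lambda>i. \<eta> i \<omega>) {0}, \<lambda>i\<in>{..<n}. \<tau> (real (Suc i) * h) \<omega> - \<tau> (real i * h) \<omega>) \<partial>M) =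
    (\<integral>\<^sup>+\<omega>. \<integral>\<^sup>+\<omega>'. f (restrict (\<lambda>i. \<eta> i \<omega>) {0}, \<lambda>i\<in>{..<n}. \<tau> (real (Suc i) * h) \<omega>' - \<tau> (real i * h) \<omega>') \<partial>M \<partial>M)"
    using iv unfolding indep_var_distribution_eq by (elim conjE) (rule nn_integral_indep_pair)
  have R: "T.riemann \<gamma> j y \<omega> = walk_sum \<gamma> j y (\<lambda>i\<in>{..<n}. \<tau> (real (Suc i) * h) \<omega> - \<tau> (real i * h) \<omega>)"
    if "\<omega> \<in> space M" for y \<omega>
    unfolding T.riemann_eq_walk_sum[OF that] h_def n_def ..
  have "(\<integral>\<^sup>+\<omega>. ennreal (G (\<sigma> s \<omega>)) * ennreal (exp (- l * T.riemann \<gamma> j (x - \<sigma> s \<omega>) \<omega>)) \<partial>M) =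
    (\<integral>\<^sup>+\<omega>. f (restrict (\<lambda>i. \<eta> i \<omega>) {0}, \<lambda>i\<in>{..<n}. \<tau> (real (Suc i) * h) \<omega> - \<tau> (real i * h) \<omega>) \<partial>M)"
    by (intro nn_integral_cong) (simp add: f_def \<eta>0 R)
  also have "\<dots> = (\<integral>\<^sup>+\<omega>. \<integral>\<^sup>+\<omega>'. f (restrict (\<lambda>i. \<eta> i \<omega>) {0}, \<lambda>i\<in>{..<n}. \<tau> (real (Suc i) * h) \<omega>' - \<tau> (real i * h) \<omega>') \<partial>M \<partial>M)"
    by (rule E)
  also have "\<dots> = (\<integral>\<^sup>+\<omega>. \<integral>\<^sup>+\<omega>'. ennreal (G (\<sigma> s \<omega>)) * ennreal (exp (- l * T.riemann \<gamma> j (x - \<sigma> s \<omega>) \<omega>')) \<partial>M \<partial>M)"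
    by (intro nn_integral_cong) (simp add: f_def \<eta>0 R)
  also have "\<dots> = (\<integral>\<^sup>+\<omega>. ennreal (G (\<sigma> s \<omega>)) * (\<integral>\<^sup>+\<omega>'. ennreal (exp (- l * T.riemann \<gamma> j (x - \<sigma> s \<omega>) \<omega>')) \<partial>M) \<partial>M)"
    by (intro nn_integral_cong nn_integral_cmult) measurable
  finally show ?thesis .
qed

text \<open>The value of \<sigma> at time s cancels in the level and in the restarted path, so that
  only the integration variable is translated.\<close>

lemma occupation_shift:
  assumes \<omega>: "\<omega> \<in> space M" and s: "0 \<le> s"
  shows "occupation \<gamma> (\<lambda>r \<omega>. \<sigma> (s + r) \<omega> - \<sigma> s \<omega>) (x - \<sigma> s \<omega>) \<omega> =
    (LINT r|lborel. indicator {s..} r * (indicator {0..} r * pos_powr \<gamma> (x - \<sigma> (max 0 r) \<omega>)))"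
proof -
  have "(LINT r|lborel. indicator {s..} r * (indicator {0..} r * pos_powr \<gamma> (x - \<sigma> (max 0 r) \<omega>))) =
    \<bar>1\<bar> *\<^sub>R (LINT r|lborel. indicator {s..} (s + 1 * r) * (indicator {0..} (s + 1 * r) * pos_powr \<gamma> (x - \<sigma> (max 0 (s + 1 * r)) \<omega>)))"
    by (rule lborel_integral_real_affine) simp
  also have "\<dots> = (LINT r|lborel. indicator {0..} r * pos_powr \<gamma> (x - \<sigma> s \<omega> - (\<sigma> (s + r) \<omega> - \<sigma> s \<omega>)))"
    using s by simp (intro Bochner_Integration.integral_cong refl, auto simp: indicator_def max_def)
  finally show ?thesis unfolding occupation_def by simp
qed

text \<open>Limit of \<open>walk_markov\<close> on both sides. The constant B dominates, because the
  exponentials are at most 1; the inner expectation on the right converges to the transform of the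
  original subordinator by \<open>occ_laplace_unique\<close>.\<close>

lemma occupation_markov:
  assumes s: "0 \<le> s" and \<gamma>: "\<gamma> \<ge> 0" and l: "l \<ge> 0" and G[measurable]: "G \<in> borel_measurable borel"
    and B: "\<And>u. G u \<le> B"
  shows "(\<integral>\<^sup>+\<omega>. ennreal (G (\<sigma> s \<omega>)) *
      ennreal (exp (- l * (LINT r|lborel. indicator {s..} r * (indicator {0..} r * pos_powr \<gamma> (x - \<sigma> (max 0 r) \<omega>))))) \<partial>M) =
    (\<integral>\<^sup>+\<omega>. ennreal (G (\<sigma> s \<omega>)) * ennreal (occ_laplace \<gamma> l (x - \<sigma> s \<omega>)) \<partial>M)"
proof -
  define \<tau> where "\<tau> r \<omega> = \<sigma> (s + r) \<omega> - \<sigma> s \<omega>" for r \<omega>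
  interpret T: subordinator M \<alpha> \<tau> unfolding \<tau>_def by (rule subordinator_shift[OF s])
  have [measurable]: "\<sigma> s \<in> borel_measurable M" using s by (rule \<sigma>_measurable)
  have [measurable]: "(\<lambda>(u, \<omega>). T.riemann \<gamma> j (x - u) \<omega>) \<in> borel_measurable (borel \<Otimes>\<^sub>M M)" for j
  proof -
    have [measurable]: "\<tau> (real (Suc k) * (1 / real (Suc j))) \<in> borel_measurable M" for k
      by (rule T.\<sigma>_measurable) simp
    show ?thesis unfolding T.riemann_def split_beta by (intro borel_measurable_sum) measurable
  qed
  have [measurable]: "(\<lambda>\<omega>. T.riemann \<gamma> j (x - \<sigma> s \<omega>) \<omega>) \<in> borel_measurable M" for j
    using measurable_compose[of "\<lambda>\<omega>. (\<sigma> s \<omega>, \<omega>)" M "borel \<Otimes>\<^sub>M M" "\<lambda>(u, \<omega>). T.riemann \<gamma> j (x - u) \<omega>"] by simp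
  have [measurable]: "(\<lambda>u. \<integral>\<^sup>+\<omega>'. ennreal (exp (- l * T.riemann \<gamma> j (x - u) \<omega>')) \<partial>M) \<in> borel_measurable borel" for j
    by measurable
  have B0: "ennreal (G u) * ennreal (exp (- l * T.riemann \<gamma> j y \<omega>)) \<le> ennreal B" for u y \<omega> j
  proof -
    have "ennreal (G u) * ennreal (exp (- l * T.riemann \<gamma> j y \<omega>)) \<le> ennreal B * 1"
      using B l T.riemann_nonneg by (intro mult_mono ennreal_leI) auto
    then show ?thesis by simp
  qed
  have lim1: "(\<lambda>j. \<integral>\<^sup>+\<omega>. ennreal (G (\<sigma> s \<omega>)) * ennreal (exp (- l * T.riemann \<gamma> j (x - \<sigma> s \<omega>) \<omega>)) \<partial>M) \<longlonglongrightarrow>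
    (\<integral>\<^sup>+\<omega>. ennreal (G (\<sigma> s \<omega>)) * ennreal (exp (- l * occupation \<gamma> \<tau> (x - \<sigma> s \<omega>) \<omega>)) \<partial>M)"
  proof (rule nn_integral_dominated_convergence[where w="\<lambda>_. ennreal B"])
    show "AE \<omega> in M. (\<lambda>j. ennreal (G (\<sigma> s \<omega>)) * ennreal (exp (- l * T.riemann \<gamma> j (x - \<sigma> s \<omega>) \<omega>)))
        \<longlonglongrightarrow> ennreal (G (\<sigma> s \<omega>)) * ennreal (exp (- l * occupation \<gamma> \<tau> (x - \<sigma> s \<omega>) \<omega>))"
      using T.AE_\<sigma>_unbounded
      by (rule AE_mp) (auto intro!: AE_I2 tendsto_intros ennreal_tendsto_cmult T.riemann_tendsto \<gamma>)
    show "AE \<omega> in M. ennreal (G (\<sigma> s \<omega>)) * ennreal (exp (- l * T.riemann \<gamma> j (x - \<sigma> s \<omega>) \<omega>)) \<le> ennreal B" for j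
      by (intro AE_I2 B0)
  qed (auto simp: emeasure_space_1)
  have lim2: "(\<lambda>j. \<integral>\<^sup>+\<omega>. ennreal (G (\<sigma> s \<omega>)) * (\<integral>\<^sup>+\<omega>'. ennreal (exp (- l * T.riemann \<gamma> j (x - \<sigma> s \<omega>) \<omega>')) \<partial>M) \<partial>M) \<longlonglongrightarrow>
    (\<integral>\<^sup>+\<omega>. ennreal (G (\<sigma> s \<omega>)) * ennreal (occ_laplace \<gamma> l (x - \<sigma> s \<omega>)) \<partial>M)"
  proof (rule nn_integral_dominated_convergence[where w="\<lambda>_. ennreal B"])
    have "(\<lambda>j. \<integral>\<^sup>+\<omega>'. ennreal (exp (- l * T.riemann \<gamma> j y \<omega>')) \<partial>M) \<longlonglongrightarrow> ennreal (occ_laplace \<gamma> l y)" for y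
      using T.riemann_laplace_tendsto[OF \<gamma> l, of y]
      unfolding T.occ_laplace_nn[OF l, symmetric] T.occ_laplace_def
      by (simp only: occ_laplace_unique[OF T.subordinator_axioms \<gamma> l])
    then show "AE \<omega> in M. (\<lambda>j. ennreal (G (\<sigma> s \<omega>)) * (\<integral>\<^sup>+\<omega>'. ennreal (exp (- l * T.riemann \<gamma> j (x - \<sigma> s \<omega>) \<omega>')) \<partial>M))
        \<longlonglongrightarrow> ennreal (G (\<sigma> s \<omega>)) * ennreal (occ_laplace \<gamma> l (x - \<sigma> s \<omega>))"
      by (intro AE_I2 ennreal_tendsto_cmult) auto
    show "AE \<omega> in M. ennreal (G (\<sigma> s \<omega>)) * (\<integral>\<^sup>+\<omega>'. ennreal (exp (- l * T.riemann \<gamma> j (x - \<sigma> s \<omega>) \<omega>')) \<partial>M) \<le> ennreal B" for j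
    proof (intro AE_I2)
      fix \<omega>
      have "(\<integral>\<^sup>+\<omega>'. ennreal (exp (- l * T.riemann \<gamma> j (x - \<sigma> s \<omega>) \<omega>')) \<partial>M) \<le> (\<integral>\<^sup>+\<omega>'. 1 \<partial>M)"
        using l T.riemann_nonneg by (intro nn_integral_mono) auto
      then have "ennreal (G (\<sigma> s \<omega>)) * (\<integral>\<^sup>+\<omega>'. ennreal (exp (- l * T.riemann \<gamma> j (x - \<sigma> s \<omega>) \<omega>')) \<partial>M) \<le> ennreal B * 1"
        using B by (intro mult_mono ennreal_leI) (auto simp: emeasure_space_1)
      then show "ennreal (G (\<sigma> s \<omega>)) * (\<integral>\<^sup>+\<omega>'. ennreal (exp (- l * T.riemann \<gamma> j (x - \<sigma> s \<omega>) \<omega>')) \<partial>M) \<le> ennreal B" by simp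
    qed
  qed (auto simp: emeasure_space_1)
  have "(\<integral>\<^sup>+\<omega>. ennreal (G (\<sigma> s \<omega>)) * ennreal (exp (- l * occupation \<gamma> \<tau> (x - \<sigma> s \<omega>) \<omega>)) \<partial>M) =
    (\<integral>\<^sup>+\<omega>. ennreal (G (\<sigma> s \<omega>)) * ennreal (occ_laplace \<gamma> l (x - \<sigma> s \<omega>)) \<partial>M)"
    using lim1 lim2 unfolding walk_markov[OF s \<gamma> G, folded \<tau>_def[abs_def]] by (rule LIMSEQ_unique)
  then show ?thesis
    unfolding \<tau>_def[abs_def] by (simp add: occupation_shift[OF _ s] cong: nn_integral_cong_simp)
qed

text \<open>Here \<open>1 - e\<^sup>-\<^sup>l\<^sup>A = \<integral> l a(s) e\<^sup>-\<^sup>l\<^sup>A\<^sup>(\<^sup>s\<^sup>) ds\<close> with \<open>A(s)\<close> the occupation integral restarted at time \<open>s\<close>;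
  the Markov property evaluates the expectation, and the potential measure of \<open>\<sigma>\<close> turns
  \<open>ds\<close> into \<open>frac_kernel \<alpha> v dv\<close>.\<close>

lemma volterra:
  assumes x: "x > 0" and \<gamma>: "\<gamma> \<ge> 0" and l: "l > 0"
  shows "ennreal (1 - occ_laplace \<gamma> l x) =
    (\<integral>\<^sup>+v. ennreal (frac_kernel \<alpha> v) * ennreal (l * pos_powr \<gamma> (x - v) * occ_laplace \<gamma> l (x - v)) \<partial>lborel)"
proof -
  define a where "a \<omega> s = indicator {0..} s * pos_powr \<gamma> (x - \<sigma> (max 0 s) \<omega>)" for \<omega> s
  define A where "A \<omega> s = (LINT r|lborel. indicator {s..} r * a \<omega> r)" for \<omega> s
  \<comment> \<open>The cut at 0 makes G bounded, as \<open>occupation_markov\<close> requires; it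
    loses nothing, because \<sigma> is nonnegative.\<close>
  define G where "G u = (if 0 \<le> u then l * pos_powr \<gamma> (x - u) else 0)" for u
  have [measurable]: "G \<in> borel_measurable borel" unfolding G_def[abs_def] by measurable
  have B: "G u \<le> l * pos_powr \<gamma> x" for u
    using l by (auto simp: G_def intro!: mult_left_mono pos_powr_mono \<gamma>)
  have meas: "(\<lambda>(s, \<omega>). ennreal (l * a \<omega> s * exp (- l * A \<omega> s))) \<in> borel_measurable (lborel \<Otimes>\<^sub>M M)"
    unfolding A_def a_def split_beta indicator_def atLeast_iff by measurable
  interpret P: pair_sigma_finite lborel M ..
  have A0: "A \<omega> 0 = occupation \<gamma> \<sigma> x \<omega>" for \<omega>
    unfolding A_def a_def occupation_max by (intro Bochner_Integration.integral_cong) (auto simp: indicator_def)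
  have int: "integrable M (\<lambda>\<omega>. exp (- l * occupation \<gamma> \<sigma> x \<omega>))"
    by (rule integrable_const_bound[of _ 1]) (use l occupation_nonneg in auto)
  have "ennreal (1 - occ_laplace \<gamma> l x) = ennreal (LINT \<omega>|M. 1 - exp (- l * occupation \<gamma> \<sigma> x \<omega>))"
    unfolding occ_laplace_def using int by (simp add: prob_space)
  also have "\<dots> = (\<integral>\<^sup>+\<omega>. ennreal (1 - exp (- l * A \<omega> 0)) \<partial>M)"
    unfolding A0 using int l occupation_nonneg by (subst nn_integral_eq_integral) (auto intro!: AE_I2)
  also have "\<dots> = (\<integral>\<^sup>+\<omega>. \<integral>\<^sup>+s. ennreal (l * a \<omega> s * exp (- l * A \<omega> s)) \<partial>lborel \<partial>M)"
  proof (rule nn_integral_cong_AE, rule AE_mp[OF AE_\<sigma>_unbounded], intro AE_I2 impI)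
    fix \<omega> assume \<omega>: "\<omega> \<in> space M" and unb: "\<forall>x. \<exists>T\<ge>0. x \<le> \<sigma> T \<omega>"
    obtain T where T: "T \<ge> 0" "a \<omega> \<in> borel_measurable borel" "\<And>s. 0 \<le> a \<omega> s" "\<And>s. a \<omega> s \<le> pos_powr \<gamma> x"
      "\<And>s. s < 0 \<Longrightarrow> a \<omega> s = 0" "\<And>s. T \<le> s \<Longrightarrow> a \<omega> s = 0"
      "\<And>s t. 0 \<le> s \<Longrightarrow> s \<le> t \<Longrightarrow> a \<omega> t \<le> a \<omega> s"
      by (rule path_facts[OF \<omega> unb \<gamma>, of x, folded a_def]) (rule that; assumption)
    show "ennreal (1 - exp (- l * A \<omega> 0)) = (\<integral>\<^sup>+s. ennreal (l * a \<omega> s * exp (- l * A \<omega> s)) \<partial>lborel)"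
      unfolding A_def by (rule nn_integral_exp_tail[OF T(2-6) l])
  qed
  also have "\<dots> = (\<integral>\<^sup>+s. \<integral>\<^sup>+\<omega>. ennreal (l * a \<omega> s * exp (- l * A \<omega> s)) \<partial>M \<partial>lborel)"
    by (rule P.Fubini'[OF meas])
  also have "\<dots> = (\<integral>\<^sup>+s. indicator {0..} s * (\<integral>\<^sup>+\<omega>. ennreal (G (\<sigma> (max 0 s) \<omega>)) * ennreal (occ_laplace \<gamma> l (x - \<sigma> (max 0 s) \<omega>)) \<partial>M) \<partial>lborel)"
  proof (rule nn_integral_cong)
    fix s :: real
    show "(\<integral>\<^sup>+\<omega>. ennreal (l * a \<omega> s * exp (- l * A \<omega> s)) \<partial>M) =
      indicator {0..} s * (\<integral>\<^sup>+\<omega>. ennreal (G (\<sigma> (max 0 s) \<omega>)) * ennreal (occ_laplace \<gamma> l (x - \<sigma> (max 0 s) \<omega>)) \<partial>M)"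
    proof (cases "s \<ge> 0")
      case True
      have "(\<integral>\<^sup>+\<omega>. ennreal (l * a \<omega> s * exp (- l * A \<omega> s)) \<partial>M) =
        (\<integral>\<^sup>+\<omega>. ennreal (G (\<sigma> s \<omega>)) * ennreal (exp (- l * (LINT r|lborel. indicator {s..} r * (indicator {0..} r * pos_powr \<gamma> (x - \<sigma> (max 0 r) \<omega>))))) \<partial>M)"
        using True l
        by (intro nn_integral_cong) (auto simp: G_def A_def a_def max_def ennreal_mult[symmetric] \<sigma>_nonneg)
      also have "\<dots> = (\<integral>\<^sup>+\<omega>. ennreal (G (\<sigma> s \<omega>)) * ennreal (occ_laplace \<gamma> l (x - \<sigma> s \<omega>)) \<partial>M)"
        using l B by (intro occupation_markov True \<gamma>) auto
      finally show ?thesis using True by (simp add: max_def)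
    qed (simp add: a_def)
  qed
  also have "\<dots> = (\<integral>\<^sup>+v. ennreal (frac_kernel \<alpha> v) * (ennreal (G v) * ennreal (occ_laplace \<gamma> l (x - v))) \<partial>lborel)"
    by (rule potential_measure) measurable
  also have "\<dots> = (\<integral>\<^sup>+v. ennreal (frac_kernel \<alpha> v) * ennreal (l * pos_powr \<gamma> (x - v) * occ_laplace \<gamma> l (x - v)) \<partial>lborel)"
    using l by (intro nn_integral_cong)
      (auto simp: G_def frac_kernel_def ennreal_mult[symmetric] occ_laplace_nonneg)
  finally show ?thesis .
qed


text \<open>Tonelli and the potential measure turn the expectation into the integral of the
  fractional kernel against (1 - v)^\<gamma> on {0..1}, and the bound e * exp (-v) reduces it to the
  Laplace transform of the kernel at 1.\<close>

lemma integrable_occupation: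
  assumes \<gamma>: "\<gamma> \<ge> 0"
  shows "integrable M (occupation \<gamma> \<sigma> 1)"
proof (rule integrableI_bounded)
  interpret P: pair_sigma_finite lborel M ..
  let ?a = "\<lambda>\<omega> s. indicator {0..} s * pos_powr \<gamma> (1 - \<sigma> (max 0 s) \<omega>)"
  have "(\<integral>\<^sup>+\<omega>. ennreal (norm (occupation \<gamma> \<sigma> 1 \<omega>)) \<partial>M) \<le> (\<integral>\<^sup>+\<omega>. \<integral>\<^sup>+s. ennreal (?a \<omega> s) \<partial>lborel \<partial>M)"
  proof (rule nn_integral_mono)
    fix \<omega> assume [measurable]: "\<omega> \<in> space M"
    show "ennreal (norm (occupation \<gamma> \<sigma> 1 \<omega>)) \<le> (\<integral>\<^sup>+s. ennreal (?a \<omega> s) \<partial>lborel)"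
    proof (cases "integrable lborel (?a \<omega>)")
      case True
      then have "(\<integral>\<^sup>+s. ennreal (?a \<omega> s) \<partial>lborel) = ennreal (LINT s|lborel. ?a \<omega> s)"
        by (intro nn_integral_eq_integral) auto
      then show ?thesis using occupation_nonneg[of \<gamma> 1 \<omega>] unfolding occupation_max by simp
    next
      \<comment> \<open>The Bochner integral of a non-integrable function is 0, so the inequality is
        trivial on such a path.\<close>
      case False
      then show ?thesis unfolding occupation_max by (simp add: not_integrable_integral_eq)
    qed
  qed
  also have "\<dots> = (\<integral>\<^sup>+s. \<integral>\<^sup>+\<omega>. ennreal (?a \<omega> s) \<partial>M \<partial>lborel)"
    by (rule P.Fubini') measurable
  also have "\<dots> = (\<integral>\<^sup>+s. indicator {0..} s * (\<integral>\<^sup>+\<omega>. ennreal (pos_powr \<gamma> (1 - \<sigma> (max 0 s) \<omega>)) \<partial>M) \<partial>lborel)"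
    by (intro nn_integral_cong) (simp add: indicator_def)
  also have "\<dots> = (\<integral>\<^sup>+v. ennreal (frac_kernel \<alpha> v) * ennreal (pos_powr \<gamma> (1 - v)) \<partial>lborel)"
    by (rule potential_measure) measurable
  also have "\<dots> \<le> (\<integral>\<^sup>+v. ennreal (exp 1) * (ennreal (frac_kernel \<alpha> v) * ennreal (exp (- 1 * v))) \<partial>lborel)"
  proof (rule nn_integral_mono)
    fix v :: real
    have "pos_powr \<gamma> (1 - v) \<le> exp 1 * exp (- 1 * v)" if "v > 0"
    proof (cases "v < 1")
      case True
      have "pos_powr \<gamma> (1 - v) \<le> 1" using True that \<gamma> powr_mono2[of \<gamma> "1 - v" 1] by (simp add: pos_powr_def)
      also have "\<dots> \<le> exp 1 * exp (- 1 * v)" using True by (simp add: exp_add[symmetric])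
      finally show ?thesis .
    qed (simp add: pos_powr_def)
    then have "frac_kernel \<alpha> v * pos_powr \<gamma> (1 - v) \<le> frac_kernel \<alpha> v * (exp 1 * exp (- 1 * v))"
      using mult_left_mono[OF _ frac_kernel_nonneg[OF \<alpha>(1), of v]]
      by (cases "v > 0") (blast, simp add: frac_kernel_def)
    then have "ennreal (frac_kernel \<alpha> v * pos_powr \<gamma> (1 - v)) \<le> ennreal (exp 1 * (frac_kernel \<alpha> v * exp (- 1 * v)))"
      by (intro ennreal_leI) (simp add: mult_ac)
    then show "ennreal (frac_kernel \<alpha> v) * ennreal (pos_powr \<gamma> (1 - v)) \<le>
        ennreal (exp 1) * (ennreal (frac_kernel \<alpha> v) * ennreal (exp (- 1 * v)))"
      using frac_kernel_nonneg[OF \<alpha>(1), of v] by (simp add: ennreal_mult)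
  qed
  also have "\<dots> = ennreal (exp 1) * ennreal (1 powr (- \<alpha>))"
    by (subst nn_integral_cmult, simp, subst laplace_frac_kernel) (use \<alpha> in auto)
  also have "\<dots> < \<infinity>" by (simp add: ennreal_mult_less_top)
  finally show "(\<integral>\<^sup>+\<omega>. ennreal (norm (occupation \<gamma> \<sigma> 1 \<omega>)) \<partial>M) < \<infinity>" .
qed measurable

text \<open>\<open>K = - F'\<close> for the Laplace transform \<open>F\<close> of \<open>Z\<close>.\<close>

definition F :: "real \<Rightarrow> real \<Rightarrow> real" where
  "F \<gamma> z = (LINT \<omega>|M. exp (- z * occupation \<gamma> \<sigma> 1 \<omega>))"

definition K :: "real \<Rightarrow> real \<Rightarrow> real" where
  "K \<gamma> z = (LINT \<omega>|M. occupation \<gamma> \<sigma> 1 \<omega> * exp (- z * occupation \<gamma> \<sigma> 1 \<omega>))"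

section \<open>Regularity, monotonicity and decay of the Laplace transform of Z\<close>

lemma integrable_exp_occupation: "0 \<le> z \<Longrightarrow> integrable M (\<lambda>\<omega>. exp (- z * occupation \<gamma> \<sigma> x \<omega>))"
  by (rule integrable_const_bound[of _ 1]) (use occupation_nonneg in auto)

lemma occupation_exp_le: "0 \<le> z \<Longrightarrow> occupation \<gamma> \<sigma> x \<omega> * exp (- (z * occupation \<gamma> \<sigma> x \<omega>)) \<le> occupation \<gamma> \<sigma> x \<omega>"
  using occupation_nonneg[of \<gamma> x \<omega>] by (intro mult_right_le_one_le) auto

lemma integrable_occupation_exp:
  "\<gamma> \<ge> 0 \<Longrightarrow> 0 \<le> z \<Longrightarrow> integrable M (\<lambda>\<omega>. occupation \<gamma> \<sigma> 1 \<omega> * exp (- z * occupation \<gamma> \<sigma> 1 \<omega>))"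
  by (rule Bochner_Integration.integrable_bound[OF integrable_occupation[of \<gamma>]])
     (auto intro!: AE_I2 occupation_exp_le simp: abs_mult abs_of_nonneg[OF occupation_nonneg])

lemma F_0: "F \<gamma> 0 = 1"
  by (simp add: F_def prob_space)

lemma F_nonneg: "0 \<le> F \<gamma> z"
  unfolding F_def by (intro integral_nonneg_AE) auto

lemma F_antimono: "0 \<le> z \<Longrightarrow> z \<le> z' \<Longrightarrow> F \<gamma> z' \<le> F \<gamma> z"
  unfolding F_def by (intro integral_mono integrable_exp_occupation) (auto intro!: mult_right_mono occupation_nonneg)

lemma F_le_1: "0 \<le> z \<Longrightarrow> F \<gamma> z \<le> 1"
  using F_antimono[of 0 z] by (simp add: F_0)

lemma F_continuous: "continuous_on {0..} (F \<gamma>)"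
  unfolding continuous_on_sequentially
proof (intro allI ballI impI, elim conjE)
  fix z :: "nat \<Rightarrow> real" and a assume z: "a \<in> {0..}" "\<forall>n. z n \<in> {0..}" "z \<longlonglongrightarrow> a"
  show "(F \<gamma> \<circ> z) \<longlonglongrightarrow> F \<gamma> a" unfolding F_def o_def
    by (rule integral_dominated_convergence[where w="\<lambda>_. 1"])
       (use z occupation_nonneg in \<open>auto intro!: AE_I2 tendsto_intros\<close>)
qed

lemma K_nonneg: "0 \<le> K \<gamma> z"
  unfolding K_def using occupation_nonneg by (intro integral_nonneg_AE) auto

lemma K_bound: "\<gamma> \<ge> 0 \<Longrightarrow> 0 \<le> z \<Longrightarrow> K \<gamma> z \<le> K \<gamma> 0"
  unfolding K_def using occupation_nonneg
  by (intro integral_mono integrable_occupation_exp) (auto intro!: occupation_exp_le)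

lemma K_continuous:
  assumes \<gamma>: "\<gamma> \<ge> 0"
  shows "continuous_on {0..} (K \<gamma>)"
  unfolding continuous_on_sequentially
proof (intro allI ballI impI, elim conjE)
  fix z :: "nat \<Rightarrow> real" and a assume z: "a \<in> {0..}" "\<forall>n. z n \<in> {0..}" "z \<longlonglongrightarrow> a"
  show "(K \<gamma> \<circ> z) \<longlonglongrightarrow> K \<gamma> a" unfolding K_def o_def
  proof (rule integral_dominated_convergence[where w="occupation \<gamma> \<sigma> 1"])
    show "AE \<omega> in M. norm (occupation \<gamma> \<sigma> 1 \<omega> * exp (- z n * occupation \<gamma> \<sigma> 1 \<omega>)) \<le> occupation \<gamma> \<sigma> 1 \<omega>" for n
      using z(2) occupation_exp_le[of "z n" \<gamma> 1] by (simp add: abs_mult occupation_nonneg)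
    show "AE \<omega> in M. (\<lambda>n. occupation \<gamma> \<sigma> 1 \<omega> * exp (- z n * occupation \<gamma> \<sigma> 1 \<omega>)) \<longlonglongrightarrow>
        occupation \<gamma> \<sigma> 1 \<omega> * exp (- a * occupation \<gamma> \<sigma> 1 \<omega>)"
      using z(3) by (intro AE_I2 tendsto_intros)
  qed (use integrable_occupation[OF \<gamma>] in auto)
qed

text \<open>Differentiation under the expectation: exp (-u) is 1-Lipschitz on nonnegative u, so the
  difference quotients are dominated by the integrable Z.\<close>

lemma F_deriv:
  assumes \<gamma>: "\<gamma> \<ge> 0" and z: "z > 0"
  shows "(F \<gamma> has_real_derivative - K \<gamma> z) (at z)"
proof -
  let ?Z = "occupation \<gamma> \<sigma> 1"
  \<comment> \<open>Difference quotients are taken over positive arguments only, where the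
    exponentials are bounded and thus integrable.\<close>
  have at: "at z = at z within {0<..}" using z by (simp add: at_within_open[of z "{0<..}"])
  have "((\<lambda>y. (F \<gamma> y - F \<gamma> z) / (y - z)) \<longlongrightarrow> - K \<gamma> z) (at z within {0<..})"
    unfolding tendsto_at_iff_sequentially
  proof (intro allI impI)
    fix y :: "nat \<Rightarrow> real" assume y: "\<forall>i. y i \<in> {0<..} - {z}" and lim: "y \<longlonglongrightarrow> z"
    have q: "(F \<gamma> (y i) - F \<gamma> z) / (y i - z) = (LINT \<omega>|M. (exp (- y i * ?Z \<omega>) - exp (- z * ?Z \<omega>)) / (y i - z))" for i
    proof -
      have "0 \<le> y i" using y by (auto intro: less_imp_le)
      then show ?thesis using z integrable_exp_occupation[of "y i"] integrable_exp_occupation[of z]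
        unfolding F_def by simp
    qed
    have "(\<lambda>i. LINT \<omega>|M. (exp (- y i * ?Z \<omega>) - exp (- z * ?Z \<omega>)) / (y i - z)) \<longlonglongrightarrow> (LINT \<omega>|M. - (?Z \<omega> * exp (- z * ?Z \<omega>)))"
    proof (rule integral_dominated_convergence[where w="?Z"])
      show "AE \<omega> in M. (\<lambda>i. (exp (- y i * ?Z \<omega>) - exp (- z * ?Z \<omega>)) / (y i - z)) \<longlonglongrightarrow> - (?Z \<omega> * exp (- z * ?Z \<omega>))"
      proof (rule AE_I2)
        fix \<omega>
        have "((\<lambda>u. exp (- u * ?Z \<omega>)) has_real_derivative - (?Z \<omega> * exp (- z * ?Z \<omega>))) (at z)"
          by (auto intro!: derivative_eq_intros)
        then have "((\<lambda>u. (exp (- u * ?Z \<omega>) - exp (- z * ?Z \<omega>)) / (u - z)) \<longlongrightarrow> - (?Z \<omega> * exp (- z * ?Z \<omega>))) (at z)"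
          by (simp add: has_field_derivative_iff)
        then show "(\<lambda>i. (exp (- y i * ?Z \<omega>) - exp (- z * ?Z \<omega>)) / (y i - z)) \<longlonglongrightarrow> - (?Z \<omega> * exp (- z * ?Z \<omega>))"
          using y lim unfolding tendsto_at_iff_sequentially by (auto simp: o_def)
      qed
      show "AE \<omega> in M. norm ((exp (- y i * ?Z \<omega>) - exp (- z * ?Z \<omega>)) / (y i - z)) \<le> ?Z \<omega>" for i
      proof (rule AE_I2)
        fix \<omega>
        have lip: "\<bar>exp (- u) - exp (- v)\<bar> \<le> \<bar>u - v\<bar>" if "0 \<le> u" "0 \<le> v" for u v :: real
        proof -
          have *: "exp (- u) - exp (- v) \<le> v - u" if "0 \<le> u" "u \<le> v" for u v :: real
          proof -
            have "1 - exp (- (v - u)) \<le> v - u" using exp_ge_add_one_self[of "- (v - u)"] by linarith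
            then have "exp (- u) * (1 - exp (- (v - u))) \<le> 1 * (v - u)"
              using that by (intro mult_mono) auto
            then show ?thesis by (simp add: right_diff_distrib exp_add[symmetric])
          qed
          show ?thesis using *[of u v] *[of v u] that by (cases "u \<le> v") auto
        qed
        have yp: "y i > 0" "y i \<noteq> z" using y by auto
        have "\<bar>exp (- (y i * ?Z \<omega>)) - exp (- (z * ?Z \<omega>))\<bar> \<le> \<bar>y i * ?Z \<omega> - z * ?Z \<omega>\<bar>"
          using yp z occupation_nonneg[of \<gamma> 1 \<omega>] by (intro lip mult_nonneg_nonneg) auto
        also have "\<dots> = \<bar>y i - z\<bar> * ?Z \<omega>"
          using occupation_nonneg[of \<gamma> 1 \<omega>] by (simp add: left_diff_distrib[symmetric] abs_mult)
        finally show "norm ((exp (- y i * ?Z \<omega>) - exp (- z * ?Z \<omega>)) / (y i - z)) \<le> ?Z \<omega>"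
          using yp by (simp add: divide_le_eq mult.commute)
      qed
    qed (use integrable_occupation[OF \<gamma>] in auto)
    then show "((\<lambda>y. (F \<gamma> y - F \<gamma> z) / (y - z)) \<circ> y) \<longlonglongrightarrow> - K \<gamma> z"
      unfolding o_def q by (simp add: K_def)
  qed
  then show ?thesis unfolding has_field_derivative_iff at .
qed

text \<open>Writing \<open>z e\<^sup>-\<^sup>z\<close> as the difference of the decreasing functions \<open>(1 + z) e\<^sup>-\<^sup>z\<close> and
  \<open>e\<^sup>-\<^sup>z\<close> makes Abel summation applicable to the time derivative.\<close>

lemma F_plus_K_antimono:
  assumes \<gamma>: "\<gamma> \<ge> 0" and "0 \<le> z" "z \<le> z'"
  shows "F \<gamma> z' + z' * K \<gamma> z' \<le> F \<gamma> z + z * K \<gamma> z"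
proof -
  let ?Z = "occupation \<gamma> \<sigma> 1"
  have eq: "F \<gamma> z + z * K \<gamma> z = (LINT \<omega>|M. (1 + z * ?Z \<omega>) * exp (- z * ?Z \<omega>))" if "0 \<le> z" for z
    using integrable_exp_occupation[OF that, of \<gamma> 1] integrable_occupation_exp[OF \<gamma> that]
    unfolding F_def K_def by (simp add: distrib_right mult.assoc)
  have int: "integrable M (\<lambda>\<omega>. (1 + z * ?Z \<omega>) * exp (- z * ?Z \<omega>))" if "0 \<le> z" for z
    using integrable_exp_occupation[OF that, of \<gamma> 1] integrable_occupation_exp[OF \<gamma> that]
    by (simp add: distrib_right mult.assoc)
  have dec: "(1 + v) * exp (- v) \<le> (1 + u) * exp (- u)" if "0 \<le> u" "u \<le> v" for u v :: real
  proof (rule DERIV_nonpos_imp_nonincreasing[OF that(2)])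
    fix x assume "u \<le> x" "x \<le> v"
    then show "\<exists>y. ((\<lambda>x. (1 + x) * exp (- x)) has_real_derivative y) (at x) \<and> y \<le> 0"
      using that by (intro exI[of _ "- x * exp (- x)"]) (auto intro!: derivative_eq_intros simp: algebra_simps)
  qed
  have z': "0 \<le> z'" using assms by simp
  have le: "z * ?Z \<omega> \<le> z' * ?Z \<omega>" "0 \<le> z * ?Z \<omega>" for \<omega>
    using assms occupation_nonneg[of \<gamma> 1 \<omega>] by (auto intro: mult_right_mono)
  show ?thesis unfolding eq[OF assms(2)] eq[OF z']
  proof (rule integral_mono[OF int[OF z'] int[OF assms(2)]])
    fix \<omega>
    show "(1 + z' * ?Z \<omega>) * exp (- z' * ?Z \<omega>) \<le> (1 + z * ?Z \<omega>) * exp (- z * ?Z \<omega>)"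
      using dec[OF le(2,1), of \<omega>] by simp
  qed
qed

lemma F_eq_occ_laplace: "F \<gamma> z = occ_laplace \<gamma> z 1"
  by (simp add: F_def occ_laplace_def)

text \<open>Self-similarity moves the level into the argument, so that the Volterra equation closes
  on the single function F.\<close>

lemma F_volterra:
  assumes x: "x > 0" and \<gamma>: "\<gamma> \<ge> 0" and l: "l > 0"
  shows "ennreal (1 - F \<gamma> (l * x powr (\<alpha> + \<gamma>))) =
    (\<integral>\<^sup>+v. ennreal (frac_kernel \<alpha> v) * ennreal (l * pos_powr \<gamma> (x - v) * F \<gamma> (l * (x - v) powr (\<alpha> + \<gamma>))) \<partial>lborel)"
proof -
  have eq: "occ_laplace \<gamma> l y = F \<gamma> (l * y powr (\<alpha> + \<gamma>))" if "y > 0" for y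
    using occ_laplace_scale[OF that \<gamma>, of l] l by (simp add: F_eq_occ_laplace)
  show ?thesis
    using volterra[OF x \<gamma> l] x eq
    by (auto simp: pos_powr_def intro!: nn_integral_cong cong: if_cong)
qed

text \<open>At x = 1 the left side of the Volterra equation is at most 1. For v in {1/4..1/2} the
  integrand on the right is at least a constant times l F(l), because F is decreasing and its
  argument there is at most l. Hence l F(l) is bounded.\<close>

lemma F_decay:
  assumes \<gamma>: "\<gamma> \<ge> 0"
  obtains C where "C > 0" "\<And>z. z \<ge> 0 \<Longrightarrow> F \<gamma> z \<le> C / (1 + z)"
proof -
  \<comment> \<open>1/4 is the length of the strip, (1/2)^\<gamma> bounds (1 - v)^\<gamma> and 1 /
    Gamma \<alpha> bounds the kernel from below on it.\<close>
  define c where "c = (1/4) * ((1/2) powr \<gamma> / Gamma \<alpha>)"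
  have G: "Gamma \<alpha> > 0" using \<alpha> by (intro Gamma_real_pos)
  have c: "c > 0" using G by (simp add: c_def)
  have le: "c * (l * F \<gamma> l) \<le> 1" if l: "l > 0" for l
  proof -
    have "ennreal (c * (l * F \<gamma> l)) = (\<integral>\<^sup>+v. ennreal ((1/2) powr \<gamma> / Gamma \<alpha> * (l * F \<gamma> l)) * indicator {1/4..1/2::real} v \<partial>lborel)"
      using G l F_nonneg[of \<gamma> l]
      by (subst nn_integral_cmult_indicator) (simp_all add: c_def ennreal_mult[symmetric] mult_ac)
    also have "\<dots> \<le> (\<integral>\<^sup>+v. ennreal (frac_kernel \<alpha> v) * ennreal (l * pos_powr \<gamma> (1 - v) * F \<gamma> (l * (1 - v) powr (\<alpha> + \<gamma>))) \<partial>lborel)"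
    proof (rule nn_integral_mono)
      fix v :: real
      show "ennreal ((1/2) powr \<gamma> / Gamma \<alpha> * (l * F \<gamma> l)) * indicator {1/4..1/2} v \<le>
        ennreal (frac_kernel \<alpha> v) * ennreal (l * pos_powr \<gamma> (1 - v) * F \<gamma> (l * (1 - v) powr (\<alpha> + \<gamma>)))"
      proof (cases "v \<in> {1/4..1/2}")
        case True
        then have v: "0 < v" "v \<le> 1/2" by auto
        have "v powr (\<alpha> - 1) \<ge> 1 powr (\<alpha> - 1)" using v \<alpha> by (intro powr_mono2') auto
        then have k: "1 / Gamma \<alpha> \<le> frac_kernel \<alpha> v" using v G by (simp add: frac_kernel_def divide_right_mono)
        have p: "(1/2) powr \<gamma> \<le> pos_powr \<gamma> (1 - v)" using v \<gamma> by (auto simp: pos_powr_def intro!: powr_mono2)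
        have "(1 - v) powr (\<alpha> + \<gamma>) \<le> 1 powr (\<alpha> + \<gamma>)" using v \<alpha> \<gamma> by (intro powr_mono2) auto
        then have "F \<gamma> l \<le> F \<gamma> (l * (1 - v) powr (\<alpha> + \<gamma>))"
          using l by (intro F_antimono) auto
        then have "(1 / Gamma \<alpha>) * (l * (1/2) powr \<gamma> * F \<gamma> l) \<le>
          frac_kernel \<alpha> v * (l * pos_powr \<gamma> (1 - v) * F \<gamma> (l * (1 - v) powr (\<alpha> + \<gamma>)))"
          using k p l F_nonneg frac_kernel_nonneg[OF \<alpha>(1)] G by (intro mult_mono) auto
        then have "ennreal ((1 / Gamma \<alpha>) * (l * (1/2) powr \<gamma> * F \<gamma> l)) \<le>
          ennreal (frac_kernel \<alpha> v * (l * pos_powr \<gamma> (1 - v) * F \<gamma> (l * (1 - v) powr (\<alpha> + \<gamma>))))"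
          by (rule ennreal_leI)
        then show ?thesis
          using True l F_nonneg frac_kernel_nonneg[OF \<alpha>(1)] by (simp add: ennreal_mult[symmetric] mult_ac)
      qed simp
    qed
    also have "\<dots> = ennreal (1 - F \<gamma> l)" using F_volterra[of 1, OF _ \<gamma> l] by simp
    also have "\<dots> \<le> ennreal 1" using F_nonneg[of \<gamma> l] by (intro ennreal_leI) auto
    finally show ?thesis by simp
  qed
  have "F \<gamma> z \<le> (1 + 1 / c) / (1 + z)" if z: "z \<ge> 0" for z
  proof -
    have "z * F \<gamma> z \<le> 1 / c" using le[of z] c z by (cases "z = 0") (auto simp: field_simps)
    then have "(1 + z) * F \<gamma> z \<le> 1 + 1 / c" using F_le_1[OF z, of \<gamma>] by (simp add: distrib_right)
    then show ?thesis using z by (simp add: pos_le_divide_eq mult.commute)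
  qed
  then show ?thesis using c that[of "1 + 1 / c"] by (simp add: add_pos_pos)
qed

text \<open>The probability of Z = 0 is at most F(n) for every n. Strict positivity is essential,
  since transition densities describe the diffusion at positive times only.\<close>

lemma AE_occupation_pos:
  assumes \<gamma>: "\<gamma> \<ge> 0"
  shows "AE \<omega> in M. 0 < occupation \<gamma> \<sigma> 1 \<omega>"
proof -
  let ?Z = "occupation \<gamma> \<sigma> 1"
  obtain C where C: "C > 0" "\<And>z. z \<ge> 0 \<Longrightarrow> F \<gamma> z \<le> C / (1 + z)" using F_decay[OF \<gamma>] by blast
  have le: "prob {\<omega> \<in> space M. ?Z \<omega> = 0} \<le> F \<gamma> (real n)" for n
  proof -
    have "(LINT \<omega>|M. indicator {\<omega> \<in> space M. ?Z \<omega> = 0} \<omega>) \<le> F \<gamma> (real n)"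
      unfolding F_def
    proof (rule integral_mono)
      show "integrable M (\<lambda>\<omega>. exp (- real n * ?Z \<omega>))" by (rule integrable_exp_occupation) simp
      show "integrable M (\<lambda>\<omega>. indicator {\<omega> \<in> space M. ?Z \<omega> = 0} \<omega> :: real)"
        by (rule integrable_const_bound[of _ 1]) (auto simp: indicator_def)
    qed (auto simp: indicator_def)
    then show ?thesis by simp
  qed
  have "prob {\<omega> \<in> space M. ?Z \<omega> = 0} \<le> C / (1 + real n)" for n
    by (rule order_trans[OF le C(2)]) simp
  moreover have "(\<lambda>n. C / (1 + real n)) \<longlonglongrightarrow> 0" by real_asymp
  ultimately have "prob {\<omega> \<in> space M. ?Z \<omega> = 0} \<le> 0" by (intro LIMSEQ_le_const) auto
  then have "prob {\<omega> \<in> space M. ?Z \<omega> = 0} = 0" by (simp add: measure_le_0_iff)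
  then have "{\<omega> \<in> space M. ?Z \<omega> = 0} \<in> null_sets M" by (auto simp: null_sets_def emeasure_eq_measure)
  then have "AE \<omega> in M. \<omega> \<notin> {\<omega> \<in> space M. ?Z \<omega> = 0}" by (rule AE_not_in)
  then show ?thesis
  proof (rule AE_mp, intro AE_I2 impI)
    fix \<omega> assume "\<omega> \<in> space M" "\<omega> \<notin> {\<omega> \<in> space M. ?Z \<omega> = 0}"
    then show "0 < ?Z \<omega>" using occupation_nonneg[of \<gamma> 1 \<omega>] by simp
  qed
qed

end

section \<open>The fractional equation for a single mode\<close>

definition nn_conv :: "(real \<Rightarrow> ennreal) \<Rightarrow> (real \<Rightarrow> ennreal) \<Rightarrow> real \<Rightarrow> ennreal" where
  "nn_conv p g x = (\<integral>\<^sup>+v. p v * g (x - v) \<partial>lborel)"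

lemma nn_conv_measurable [measurable]:
  assumes [measurable]: "p \<in> borel_measurable borel" "g \<in> borel_measurable borel"
  shows "nn_conv p g \<in> borel_measurable borel"
  unfolding nn_conv_def[abs_def] by measurable

lemma nn_integral_reflect:
  assumes [measurable]: "f \<in> borel_measurable borel"
  shows "(\<integral>\<^sup>+v. f v \<partial>lborel) = (\<integral>\<^sup>+v. f (x - v :: real) \<partial>lborel)"
  using nn_integral_real_affine[of f "-1" x] by simp

lemma nn_conv_commute:
  assumes [measurable]: "p \<in> borel_measurable borel" "g \<in> borel_measurable borel"
  shows "nn_conv p g = nn_conv g p"
proof
  fix x show "nn_conv p g x = nn_conv g p x"
    unfolding nn_conv_def by (subst nn_integral_reflect[of _ x]) (simp_all add: mult.commute)
qed

lemma nn_conv_assoc: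
  assumes [measurable]: "p \<in> borel_measurable borel" "g \<in> borel_measurable borel" "r \<in> borel_measurable borel"
  shows "nn_conv p (nn_conv g r) = nn_conv (nn_conv p g) r"
proof
  fix x
  have "nn_conv p (nn_conv g r) x = (\<integral>\<^sup>+u. \<integral>\<^sup>+v. p u * (g v * r (x - u - v)) \<partial>lborel \<partial>lborel)"
    unfolding nn_conv_def by (subst nn_integral_cmult) auto
  also have "\<dots> = (\<integral>\<^sup>+u. \<integral>\<^sup>+w. p u * (g (w - u) * r (x - w)) \<partial>lborel \<partial>lborel)"
  proof (rule nn_integral_cong)
    fix u :: real
    show "(\<integral>\<^sup>+v. p u * (g v * r (x - u - v)) \<partial>lborel) = (\<integral>\<^sup>+w. p u * (g (w - u) * r (x - w)) \<partial>lborel)"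
      by (subst nn_integral_real_affine[of _ 1 "- u"]) (auto simp: algebra_simps)
  qed
  also have "\<dots> = (\<integral>\<^sup>+w. \<integral>\<^sup>+u. p u * (g (w - u) * r (x - w)) \<partial>lborel \<partial>lborel)"
    by (rule lborel_pair.Fubini') measurable
  also have "\<dots> = (\<integral>\<^sup>+w. (\<integral>\<^sup>+u. p u * g (w - u) \<partial>lborel) * r (x - w) \<partial>lborel)"
    by (subst nn_integral_multc[symmetric]) (auto simp: mult.assoc)
  finally show "nn_conv p (nn_conv g r) x = nn_conv (nn_conv p g) r x"
    unfolding nn_conv_def .
qed

text \<open>The substitution s = x u makes the domain of integration independent of x. This yields a
  Beta integral when f is a power, and continuity in x by dominated convergence when f is a mode
  rate.\<close>

lemma nn_integral_Beta_scaled: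
  assumes x: "x > 0" and ab: "a > 0" "b > 0" and f [measurable]: "f \<in> borel_measurable borel"
  shows "nn_conv (\<lambda>v. ennreal (frac_kernel a v)) (\<lambda>s. f s * indicator {0<..} s) x =
    (\<integral>\<^sup>+u. ennreal (x powr a * (1 - u) powr (a - 1) / Gamma a) * f (x * u) * indicator {0<..<1} u \<partial>lborel)"
proof -
  have "nn_conv (\<lambda>v. ennreal (frac_kernel a v)) (\<lambda>s. f s * indicator {0<..} s) x =
      (\<integral>\<^sup>+s. ennreal (frac_kernel a (x - s)) * (f s * indicator {0<..} s) \<partial>lborel)"
    unfolding nn_conv_def by (subst nn_integral_reflect[of _ x]) auto
  also have "\<dots> = ennreal \<bar>x\<bar> * (\<integral>\<^sup>+u. ennreal (frac_kernel a (x - (0 + x * u))) * (f (0 + x * u) * indicator {0<..} (0 + x * u)) \<partial>lborel)"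
    using x by (intro nn_integral_real_affine) auto
  also have "\<dots> = (\<integral>\<^sup>+u. ennreal (x powr a * (1 - u) powr (a - 1) / Gamma a) * f (x * u) * indicator {0<..<1} u \<partial>lborel)"
  proof (subst nn_integral_cmult[symmetric], simp, rule nn_integral_cong)
    fix u :: real
    have e: "x - x * u = x * (1 - u)" by (simp add: algebra_simps)
    show "ennreal \<bar>x\<bar> * (ennreal (frac_kernel a (x - (0 + x * u))) * (f (0 + x * u) * indicator {0<..} (0 + x * u))) =
      ennreal (x powr a * (1 - u) powr (a - 1) / Gamma a) * f (x * u) * indicator {0<..<1} u"
    proof (cases "u \<in> {0<..<1}")
      case True
      have "x * (x * (1 - u)) powr (a - 1) = x powr a * (1 - u) powr (a - 1)"
        using x True by (simp add: powr_mult powr_diff)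
      then have "x * frac_kernel a (x - x * u) = x powr a * (1 - u) powr (a - 1) / Gamma a"
        using x True unfolding frac_kernel_def e by simp
      then have "ennreal \<bar>x\<bar> * ennreal (frac_kernel a (x - x * u)) = ennreal (x powr a * (1 - u) powr (a - 1) / Gamma a)"
        using x frac_kernel_nonneg[OF ab(1)] by (simp add: ennreal_mult[symmetric])
      then show ?thesis using x True by (simp add: mult.assoc[symmetric])
    next
      case False
      then have "frac_kernel a (x - x * u) = 0 \<or> \<not> (0 < x * u)"
        using x unfolding frac_kernel_def e by (auto simp: zero_less_mult_iff)
      then show ?thesis using False by (auto simp: indicator_def)
    qed
  qed
  finally show ?thesis .
qed

lemma nn_integral_Beta:
  assumes "a > 0" "b > 0"
  shows "(\<integral>\<^sup>+u. ennreal ((1 - u) powr (a - 1) * u powr (b - 1)) * indicator {0<..<1::real} u \<partial>lborel) = ennreal (Beta a b)"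
proof -
  have "((\<lambda>t. t powr (b - 1) * (1 - t) powr (a - 1)) has_integral Beta b a) {0<..<1}"
    using has_integral_Beta_real[OF assms(2,1)] by (simp add: has_integral_Icc_iff_Ioo)
  then have "(\<integral>\<^sup>+u. ennreal (indicator {0<..<1} u * (u powr (b - 1) * (1 - u) powr (a - 1))) \<partial>lborel) = ennreal (Beta b a)"
    by (intro nn_integral_has_integral_lebesgue) auto
  moreover have "ennreal (indicator {0<..<1} u * (u powr (b - 1) * (1 - u) powr (a - 1))) =
    ennreal ((1 - u) powr (a - 1) * u powr (b - 1)) * indicator {0<..<1} u" for u :: real
    by (auto simp: indicator_def mult.commute)
  ultimately show ?thesis by (simp add: Beta_commute)
qed

text \<open>The semigroup property of fractional integration, in the one case needed:
  \<open>I\<^sup>1\<^sup>-\<^sup>\<alpha> I\<^sup>\<alpha>\<close> is ordinary integration.\<close>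

lemma frac_kernel_conv:
  assumes \<alpha>: "0 < \<alpha>" "\<alpha> < 1"
  shows "nn_conv (\<lambda>v. ennreal (frac_kernel (1 - \<alpha>) v)) (\<lambda>v. ennreal (frac_kernel \<alpha> v)) = indicator {0<..}"
proof
  fix x :: real
  show "nn_conv (\<lambda>v. ennreal (frac_kernel (1 - \<alpha>) v)) (\<lambda>v. ennreal (frac_kernel \<alpha> v)) x = indicator {0<..} x"
  proof (cases "x > 0")
    case True
    have G: "Gamma \<alpha> > 0" "Gamma (1 - \<alpha>) > 0" using \<alpha> by (auto intro!: Gamma_real_pos)
    have "nn_conv (\<lambda>v. ennreal (frac_kernel (1 - \<alpha>) v)) (\<lambda>v. ennreal (frac_kernel \<alpha> v)) x =
      nn_conv (\<lambda>v. ennreal (frac_kernel (1 - \<alpha>) v)) (\<lambda>v. ennreal (v powr (\<alpha> - 1) / Gamma \<alpha>) * indicator {0<..} v) x"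
      unfolding nn_conv_def by (intro nn_integral_cong) (auto simp: frac_kernel_def indicator_def)
    also have "\<dots> = (\<integral>\<^sup>+u. ennreal (x powr (1 - \<alpha>) * (1 - u) powr (1 - \<alpha> - 1) / Gamma (1 - \<alpha>)) *
        ennreal ((x * u) powr (\<alpha> - 1) / Gamma \<alpha>) * indicator {0<..<1} u \<partial>lborel)"
      by (rule nn_integral_Beta_scaled[OF True, of _ \<alpha>]) (use \<alpha> in auto)
    also have "\<dots> = (\<integral>\<^sup>+u. ennreal (1 / (Gamma \<alpha> * Gamma (1 - \<alpha>))) *
      (ennreal ((1 - u) powr (1 - \<alpha> - 1) * u powr (\<alpha> - 1)) * indicator {0<..<1} u) \<partial>lborel)"
    proof (rule nn_integral_cong)
      fix u :: real
      show "ennreal (x powr (1 - \<alpha>) * (1 - u) powr (1 - \<alpha> - 1) / Gamma (1 - \<alpha>)) *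
        ennreal ((x * u) powr (\<alpha> - 1) / Gamma \<alpha>) * indicator {0<..<1} u =
        ennreal (1 / (Gamma \<alpha> * Gamma (1 - \<alpha>))) *
        (ennreal ((1 - u) powr (1 - \<alpha> - 1) * u powr (\<alpha> - 1)) * indicator {0<..<1} u)"
      proof (cases "u \<in> {0<..<1}")
        case u: True
        have "x powr (1 - \<alpha>) * (x * u) powr (\<alpha> - 1) = u powr (\<alpha> - 1)"
          using True u by (simp add: powr_mult powr_add[symmetric] mult.assoc[symmetric])
        then have "x powr (1 - \<alpha>) * (1 - u) powr (1 - \<alpha> - 1) / Gamma (1 - \<alpha>) * ((x * u) powr (\<alpha> - 1) / Gamma \<alpha>) =
          1 / (Gamma \<alpha> * Gamma (1 - \<alpha>)) * ((1 - u) powr (1 - \<alpha> - 1) * u powr (\<alpha> - 1))"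
          by (simp add: field_simps)
        then show ?thesis using G u by (simp add: ennreal_mult[symmetric])
      qed simp
    qed
    also have "\<dots> = ennreal (1 / (Gamma \<alpha> * Gamma (1 - \<alpha>))) * ennreal (Beta (1 - \<alpha>) \<alpha>)"
      by (subst nn_integral_cmult, simp, subst nn_integral_Beta) (use \<alpha> in auto)
    also have "\<dots> = 1" using G by (simp add: ennreal_mult[symmetric] Beta_def)
    finally show ?thesis using True by simp
  next
    case False
    then have "(\<integral>\<^sup>+v. ennreal (frac_kernel (1 - \<alpha>) v) * ennreal (frac_kernel \<alpha> (x - v)) \<partial>lborel) = (\<integral>\<^sup>+v. 0 \<partial>(lborel :: real measure))"
      by (intro nn_integral_cong) (auto simp: frac_kernel_def)
    then show ?thesis using False by (simp add: nn_conv_def)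
  qed
qed

text \<open>If the densities differed at x, two constants between their values would separate them
  on an interval to the right of x, and the integrals over it would differ.\<close>

lemma continuous_eq_if_integrals_eq:
  fixes g1 g2 :: "real \<Rightarrow> real"
  assumes cont: "continuous_on {0<..} g1" "continuous_on {0<..} g2"
    and eq: "\<And>a b. 0 < a \<Longrightarrow> a < b \<Longrightarrow>
      (\<integral>\<^sup>+s. ennreal (g1 s) * indicator {a..<b} s \<partial>lborel) = (\<integral>\<^sup>+s. ennreal (g2 s) * indicator {a..<b} s \<partial>lborel)"
    and nonneg: "\<And>s. s > 0 \<Longrightarrow> 0 \<le> g1 s" "\<And>s. s > 0 \<Longrightarrow> 0 \<le> g2 s" and x: "x > 0"
  shows "g1 x = g2 x"
proof -
  have False if c: "continuous_on {0<..} f1" "continuous_on {0<..} f2"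
    and e: "\<And>a b. 0 < a \<Longrightarrow> a < b \<Longrightarrow>
      (\<integral>\<^sup>+s. ennreal (f1 s) * indicator {a..<b} s \<partial>lborel) = (\<integral>\<^sup>+s. ennreal (f2 s) * indicator {a..<b} s \<partial>lborel)"
    and n: "\<And>s. s > 0 \<Longrightarrow> 0 \<le> f1 s" and lt: "f1 x < f2 x" for f1 f2 :: "real \<Rightarrow> real"
  proof -
    \<comment> \<open>One third and two thirds of the way between the two values.\<close>
    define c1 c2 where "c1 = (2 * f1 x + f2 x) / 3" and "c2 = (f1 x + 2 * f2 x) / 3"
    have cc: "f1 x < c1" "c1 < c2" "c2 < f2 x" "0 \<le> c1" using lt n[OF x] by (auto simp: c1_def c2_def)
    have "isCont f1 x" "isCont f2 x" using c x by (auto simp: continuous_on_eq_continuous_at)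
    then have "\<forall>\<^sub>F s in at x. f1 s < c1" "\<forall>\<^sub>F s in at x. c2 < f2 s"
      using cc by (auto simp: isCont_def intro: order_tendstoD)
    then have "\<forall>\<^sub>F s in at x. f1 s < c1 \<and> c2 < f2 s" by (rule eventually_conj)
    then obtain d where d: "d > 0" "\<And>s. s \<noteq> x \<Longrightarrow> dist s x < d \<Longrightarrow> f1 s < c1 \<and> c2 < f2 s"
      unfolding eventually_at by auto
    have near: "f1 s \<le> c1 \<and> c2 \<le> f2 s" if "s \<in> {x..<x + d}" for s
      using d(2)[of s] that cc by (cases "s = x") (auto simp: dist_real_def less_imp_le)
    have "ennreal (c2 * d) = (\<integral>\<^sup>+s. ennreal c2 * indicator {x..<x + d} s \<partial>lborel)"
      using d cc by (simp add: nn_integral_cmult_indicator ennreal_mult)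
    also have "\<dots> \<le> (\<integral>\<^sup>+s. ennreal (f2 s) * indicator {x..<x + d} s \<partial>lborel)"
      using near by (intro nn_integral_mono) (auto simp: indicator_def intro!: ennreal_leI)
    also have "\<dots> = (\<integral>\<^sup>+s. ennreal (f1 s) * indicator {x..<x + d} s \<partial>lborel)"
      using e[of x "x + d"] x d by simp
    also have "\<dots> \<le> (\<integral>\<^sup>+s. ennreal c1 * indicator {x..<x + d} s \<partial>lborel)"
      using near by (intro nn_integral_mono) (auto simp: indicator_def intro!: ennreal_leI)
    also have "\<dots> = ennreal (c1 * d)"
      using d cc by (simp add: nn_integral_cmult_indicator ennreal_mult)
    finally have "c2 * d \<le> c1 * d" using cc d by (subst (asm) ennreal_le_iff) auto
    then show False using cc d by simp
  qed
  from this[OF cont eq nonneg(1)] this[OF cont(2,1) eq[symmetric] nonneg(2)] show ?thesis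
    by (cases "g1 x" "g2 x" rule: linorder_cases) auto
qed

lemma nn_conv_indicator:
  assumes [measurable]: "g \<in> borel_measurable borel"
  shows "nn_conv (indicator {0<..}) g x = (\<integral>\<^sup>+u. g u * indicator {..<x} u \<partial>lborel)"
  unfolding nn_conv_def
  by (subst nn_integral_reflect[of _ x]) (auto intro!: nn_integral_cong simp: indicator_def)

text \<open>The integral up to a is subtracted from the one up to b; in extended reals this
  cancellation requires it to be finite.\<close>

lemma nn_integral_Ico_eq:
  fixes w \<phi> :: "real \<Rightarrow> ennreal"
  assumes [measurable]: "w \<in> borel_measurable borel" "\<phi> \<in> borel_measurable borel"
    and eq: "\<And>x. (\<integral>\<^sup>+u. w u * indicator {..<x} u \<partial>lborel) = (\<integral>\<^sup>+u. \<phi> u * indicator {..<x} u \<partial>lborel)"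
    and fin: "(\<integral>\<^sup>+u. \<phi> u * indicator {..<a} u \<partial>lborel) \<noteq> \<infinity>" and ab: "a < b"
  shows "(\<integral>\<^sup>+s. w s * indicator {a..<b} s \<partial>lborel) = (\<integral>\<^sup>+s. \<phi> s * indicator {a..<b} s \<partial>lborel)"
proof -
  have split: "(\<integral>\<^sup>+u. g u * indicator {..<b} u \<partial>lborel) =
    (\<integral>\<^sup>+u. g u * indicator {..<a} u \<partial>lborel) + (\<integral>\<^sup>+u. g u * indicator {a..<b} u \<partial>lborel)"
    if [measurable]: "g \<in> borel_measurable borel" for g :: "real \<Rightarrow> ennreal"
    using ab by (subst nn_integral_add[symmetric]) (auto intro!: nn_integral_cong simp: indicator_def)
  have "(\<integral>\<^sup>+u. \<phi> u * indicator {..<a} u \<partial>lborel) + (\<integral>\<^sup>+s. w s * indicator {a..<b} s \<partial>lborel) =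
    (\<integral>\<^sup>+u. w u * indicator {..<b} u \<partial>lborel)"
    unfolding split[OF assms(1)] eq[of a] ..
  also have "\<dots> = (\<integral>\<^sup>+u. \<phi> u * indicator {..<a} u \<partial>lborel) + (\<integral>\<^sup>+s. \<phi> s * indicator {a..<b} s \<partial>lborel)"
    unfolding eq by (rule split[OF assms(2)])
  finally have "(\<integral>\<^sup>+u. \<phi> u * indicator {..<a} u \<partial>lborel) + (\<integral>\<^sup>+s. w s * indicator {a..<b} s \<partial>lborel) =
    (\<integral>\<^sup>+u. \<phi> u * indicator {..<a} u \<partial>lborel) + (\<integral>\<^sup>+s. \<phi> s * indicator {a..<b} s \<partial>lborel)" .
  then show ?thesis using fin by (auto simp: ennreal_add_left_cancel)
qed

section \<open>Modes, their rates and their Caputo integrals\<close>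

context subordinator begin

lemma F_measurable [measurable]: "F \<gamma> \<in> borel_measurable borel"
  unfolding F_def[abs_def] by measurable

lemma K_measurable [measurable]: "K \<gamma> \<in> borel_measurable borel"
  unfolding K_def[abs_def] by measurable

definition mode :: "real \<Rightarrow> real \<Rightarrow> real \<Rightarrow> real" where
  "mode \<gamma> l s = F \<gamma> (l * s powr (\<alpha> + \<gamma>))"

text \<open>Minus the time derivative of \<open>mode\<close>: with this sign it is nonnegative and
  fits the extended-valued convolutions.\<close>

definition mode_rate :: "real \<Rightarrow> real \<Rightarrow> real \<Rightarrow> real" where
  "mode_rate \<gamma> l s = l * (\<alpha> + \<gamma>) * s powr (\<alpha> + \<gamma> - 1) * K \<gamma> (l * s powr (\<alpha> + \<gamma>))"

lemma mode_measurable [measurable]: "mode \<gamma> l \<in> borel_measurable borel"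
  and mode_rate_measurable [measurable]: "mode_rate \<gamma> l \<in> borel_measurable borel"
  unfolding mode_def[abs_def] mode_rate_def[abs_def] by measurable

lemma mode_0: "mode \<gamma> l 0 = 1"
  by (simp add: mode_def F_0)

lemma mode_continuous:
  assumes \<gamma>: "\<gamma> \<ge> 0" and l: "l \<ge> 0"
  shows "continuous_on {0..} (mode \<gamma> l)"
proof -
  have "continuous_on {0..} (\<lambda>s. l * s powr (\<alpha> + \<gamma>))"
    using \<alpha> \<gamma> by (intro continuous_on_mult_left continuous_on_powr' continuous_intros) auto
  moreover have "(\<lambda>s. l * s powr (\<alpha> + \<gamma>)) ` {0..} \<subseteq> {0..}" using l by auto
  ultimately show ?thesis
    unfolding mode_def by (rule continuous_on_compose2[OF F_continuous])
qed

lemma mode_deriv: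
  assumes \<gamma>: "\<gamma> \<ge> 0" and l: "l \<ge> 0" and s: "s > 0"
  shows "(mode \<gamma> l has_real_derivative - mode_rate \<gamma> l s) (at s)"
proof (cases "l = 0")
  case True
  then show ?thesis by (simp add: mode_def[abs_def] mode_rate_def)
next
  case False
  have "(F \<gamma> has_real_derivative - K \<gamma> (l * s powr (\<alpha> + \<gamma>))) (at (l * s powr (\<alpha> + \<gamma>)))"
    using False l s by (intro F_deriv \<gamma>) auto
  moreover have "((\<lambda>s. l * s powr (\<alpha> + \<gamma>)) has_real_derivative l * ((\<alpha> + \<gamma>) * s powr (\<alpha> + \<gamma> - 1))) (at s)"
    using s by (auto intro!: derivative_eq_intros)
  ultimately have "((\<lambda>s. F \<gamma> (l * s powr (\<alpha> + \<gamma>))) has_real_derivative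
      - K \<gamma> (l * s powr (\<alpha> + \<gamma>)) * (l * ((\<alpha> + \<gamma>) * s powr (\<alpha> + \<gamma> - 1)))) (at s)"
    by (rule DERIV_chain2)
  then show ?thesis by (simp add: mode_def[abs_def] mode_rate_def mult_ac)
qed

lemma mode_bounds: "0 \<le> l \<Longrightarrow> 0 \<le> mode \<gamma> l s" "0 \<le> l \<Longrightarrow> mode \<gamma> l s \<le> 1"
  unfolding mode_def by (simp_all add: F_nonneg F_le_1)

lemma mode_rate_nonneg: "\<gamma> \<ge> 0 \<Longrightarrow> 0 \<le> l \<Longrightarrow> 0 \<le> mode_rate \<gamma> l s"
  unfolding mode_rate_def using \<alpha> K_nonneg by (intro mult_nonneg_nonneg) auto

text \<open>Both the function under the fractional integral in the Volterra equation and, up to sign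
  and the factor t^\<gamma>, the right-hand side of the fractional equation.\<close>

definition mode_source :: "real \<Rightarrow> real \<Rightarrow> real \<Rightarrow> ennreal" where
  "mode_source \<gamma> l u = ennreal (l * pos_powr \<gamma> u * mode \<gamma> l u)"

lemma mode_source_measurable [measurable]: "mode_source \<gamma> l \<in> borel_measurable borel"
  unfolding mode_source_def[abs_def] by measurable

text \<open>Two representations of one function, as a fractional integral of order \<alpha> by the
  Volterra equation and as an ordinary integral by the fundamental theorem. Comparing them is the
  source of the fractional equation.\<close>

lemma one_minus_mode_conv:
  assumes \<gamma>: "\<gamma> \<ge> 0" and l: "l > 0"
  shows "(\<lambda>x. ennreal (1 - mode \<gamma> l x) * indicator {0<..} x) =
      nn_conv (\<lambda>v. ennreal (frac_kernel \<alpha> v)) (mode_source \<gamma> l)"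
    and "(\<lambda>x. ennreal (1 - mode \<gamma> l x) * indicator {0<..} x) =
      nn_conv (indicator {0<..}) (\<lambda>s. ennreal (mode_rate \<gamma> l s) * indicator {0<..} s)"
proof -
  show "(\<lambda>x. ennreal (1 - mode \<gamma> l x) * indicator {0<..} x) =
      nn_conv (\<lambda>v. ennreal (frac_kernel \<alpha> v)) (mode_source \<gamma> l)"
  proof
    fix x :: real
    show "ennreal (1 - mode \<gamma> l x) * indicator {0<..} x = nn_conv (\<lambda>v. ennreal (frac_kernel \<alpha> v)) (mode_source \<gamma> l) x"
    proof (cases "x > 0")
      case True
      then show ?thesis using F_volterra[OF True \<gamma> l] by (simp add: nn_conv_def mode_source_def mode_def)
    next
      case False
      then have "nn_conv (\<lambda>v. ennreal (frac_kernel \<alpha> v)) (mode_source \<gamma> l) x = (\<integral>\<^sup>+v. 0 \<partial>(lborel :: real measure))"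
        unfolding nn_conv_def by (intro nn_integral_cong) (auto simp: frac_kernel_def mode_source_def pos_powr_def)
      then show ?thesis using False by simp
    qed
  qed
  show "(\<lambda>x. ennreal (1 - mode \<gamma> l x) * indicator {0<..} x) =
      nn_conv (indicator {0<..}) (\<lambda>s. ennreal (mode_rate \<gamma> l s) * indicator {0<..} s)"
  proof
    fix x :: real
    have "nn_conv (indicator {0<..}) (\<lambda>s. ennreal (mode_rate \<gamma> l s) * indicator {0<..} s) x =
      (\<integral>\<^sup>+u. ennreal (mode_rate \<gamma> l u) * indicator {0<..} u * indicator {..<x} u \<partial>lborel)"
      by (rule nn_conv_indicator) measurable
    also have "\<dots> = (\<integral>\<^sup>+u. ennreal (indicator {0..x} u * mode_rate \<gamma> l u) \<partial>lborel)"
      by (rule nn_integral_cong_AE, rule AE_mp[OF AE_lborel_singleton[of x]], rule AE_mp[OF AE_lborel_singleton[of 0]])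
         (auto simp: indicator_def)
    also have "\<dots> = ennreal (1 - mode \<gamma> l x) * indicator {0<..} x"
    proof (cases "x > 0")
      case True
      \<comment> \<open>The rate may blow up at 0, so the derivative is taken in the interior only
        and continuity of the mode suffices at the ends.\<close>
      have "((mode_rate \<gamma> l) has_integral (1 - mode \<gamma> l x) - (1 - mode \<gamma> l 0)) {0..x}"
      proof (rule fundamental_theorem_of_calculus_interior)
        show "continuous_on {0..x} (\<lambda>x. 1 - mode \<gamma> l x)"
          using mode_continuous[OF \<gamma>, of l] l by (intro continuous_intros) (auto elim: continuous_on_subset)
        show "((\<lambda>x. 1 - mode \<gamma> l x) has_vector_derivative mode_rate \<gamma> l s) (at s)" if "s \<in> {0<..<x}" for s
          using that l \<gamma> mode_deriv[of \<gamma> l s]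
          by (auto intro!: derivative_eq_intros simp: has_real_derivative_iff_has_vector_derivative[symmetric])
      qed (use True in auto)
      then show ?thesis using True \<gamma> l mode_rate_nonneg
        by (subst nn_integral_has_integral_lebesgue[of _ _ "1 - mode \<gamma> l x"]) (auto simp: mode_0)
    next
      case False
      \<comment> \<open>For x = 0 the point u = 0 remains; there the rate is 0, because
        \<open>0 powr b\<close> is 0 for every b.\<close>
      then have z: "indicator {0..x} u * mode_rate \<gamma> l u = 0" for u
        by (cases "u = 0") (auto simp: indicator_def mode_rate_def)
      show ?thesis unfolding z using False by simp
    qed
    finally show "ennreal (1 - mode \<gamma> l x) * indicator {0<..} x =
      nn_conv (indicator {0<..}) (\<lambda>s. ennreal (mode_rate \<gamma> l s) * indicator {0<..} s) x" ..
  qed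
qed

text \<open>Kept extended-valued so that associativity of convolution (Tonelli) needs no
  integrability; finiteness comes out of \<open>mode_caputo_primitive\<close>.\<close>

definition mode_caputo :: "real \<Rightarrow> real \<Rightarrow> real \<Rightarrow> ennreal" where
  "mode_caputo \<gamma> l = nn_conv (\<lambda>v. ennreal (frac_kernel (1 - \<alpha>) v)) (\<lambda>s. ennreal (mode_rate \<gamma> l s) * indicator {0<..} s)"

lemma mode_caputo_measurable [measurable]: "mode_caputo \<gamma> l \<in> borel_measurable borel"
  unfolding mode_caputo_def by measurable

text \<open>With I^a for fractional integration of order a: I^1 I^(1-\<alpha>) rate = I^(1-\<alpha>)
  I^1 rate = I^(1-\<alpha>) I^\<alpha> source = I^1 source. The middle equality compares the two
  representations of 1 - mode.\<close>

lemma mode_caputo_primitive: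
  assumes \<gamma>: "\<gamma> \<ge> 0" and l: "l > 0"
  shows "nn_conv (indicator {0<..}) (mode_caputo \<gamma> l) = nn_conv (indicator {0<..}) (mode_source \<gamma> l)"
proof -
  let ?k = "\<lambda>a v. ennreal (frac_kernel a v)"
  let ?d = "\<lambda>s. ennreal (mode_rate \<gamma> l s) * indicator {0<..} s"
  have "nn_conv (indicator {0<..}) (nn_conv (?k (1 - \<alpha>)) ?d) = nn_conv (nn_conv (indicator {0<..}) (?k (1 - \<alpha>))) ?d"
    by (rule nn_conv_assoc) measurable
  also have "nn_conv (indicator {0<..}) (?k (1 - \<alpha>)) = nn_conv (?k (1 - \<alpha>)) (indicator {0<..})"
    by (rule nn_conv_commute) measurable
  also have "nn_conv (nn_conv (?k (1 - \<alpha>)) (indicator {0<..})) ?d = nn_conv (?k (1 - \<alpha>)) (nn_conv (indicator {0<..}) ?d)"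
    by (rule nn_conv_assoc[symmetric]) measurable
  also have "nn_conv (indicator {0<..}) ?d = nn_conv (?k \<alpha>) (mode_source \<gamma> l)"
    using one_minus_mode_conv[OF \<gamma> l] by simp
  also have "nn_conv (?k (1 - \<alpha>)) (nn_conv (?k \<alpha>) (mode_source \<gamma> l)) = nn_conv (nn_conv (?k (1 - \<alpha>)) (?k \<alpha>)) (mode_source \<gamma> l)"
    by (rule nn_conv_assoc) measurable
  also have "nn_conv (?k (1 - \<alpha>)) (?k \<alpha>) = indicator {0<..}" by (rule frac_kernel_conv) (use \<alpha> in auto)
  finally show ?thesis unfolding mode_caputo_def .
qed

text \<open>Equal primitives determine a density only almost everywhere, whereas the equation is
  claimed at every t. A continuous finite version of the Caputo integral closes this gap.\<close>

lemma mode_caputo_real: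
  assumes \<gamma>: "\<gamma> \<ge> 0" and l: "l > 0"
  obtains w where "continuous_on {0<..} w" "\<And>x. x > 0 \<Longrightarrow> 0 \<le> w x" "\<And>x. x > 0 \<Longrightarrow> mode_caputo \<gamma> l x = ennreal (w x)"
proof -
  define \<kappa> where "\<kappa> = \<alpha> + \<gamma>"
  have \<kappa>: "\<kappa> > 0" using \<alpha> \<gamma> by (simp add: \<kappa>_def)
  have G: "Gamma (1 - \<alpha>) > 0" using \<alpha> by (auto intro!: Gamma_real_pos)
  \<comment> \<open>After scaling to the unit interval, \<open>c\<close> is the integrable Beta
    weight and \<open>A\<close> below collects the powers of x. What is left is \<open>K\<close>,
    which is continuous and bounded by its value at 0, so dominated convergence applies.\<close>
  define c where "c u = indicator {0<..<1} u * ((1 - u) powr (1 - \<alpha> - 1) * u powr (\<kappa> - 1))" for u :: real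
  have c0: "0 \<le> c u" for u by (simp add: c_def)
  have [measurable]: "c \<in> borel_measurable borel" unfolding c_def[abs_def] by measurable
  have cint: "integrable lborel c"
  proof (rule integrableI_bounded)
    have "(\<integral>\<^sup>+u. ennreal (norm (c u)) \<partial>lborel) = (\<integral>\<^sup>+u. ennreal ((1 - u) powr (1 - \<alpha> - 1) * u powr (\<kappa> - 1)) * indicator {0<..<1::real} u \<partial>lborel)"
      by (intro nn_integral_cong) (auto simp: c_def indicator_def)
    also have "\<dots> = ennreal (Beta (1 - \<alpha>) \<kappa>)" by (rule nn_integral_Beta) (use \<alpha> \<kappa> in auto)
    finally show "(\<integral>\<^sup>+u. ennreal (norm (c u)) \<partial>lborel) < \<infinity>" by simp
  qed measurable
  define A where "A x = x powr (1 - \<alpha>) * (l * \<kappa> * x powr (\<kappa> - 1)) / Gamma (1 - \<alpha>)" for x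
  define J where "J x = (LINT u|lborel. c u * K \<gamma> (l * (x * u) powr \<kappa>))" for x
  have arg: "0 \<le> l * (x * u) powr \<kappa>" for x u using l by simp
  have Kb: "norm (c u * K \<gamma> (l * (x * u) powr \<kappa>)) \<le> c u * K \<gamma> 0" for x u
    using K_bound[OF \<gamma> arg] K_nonneg c0 by (auto simp: abs_mult intro!: mult_left_mono)
  have Jint: "integrable lborel (\<lambda>u. c u * K \<gamma> (l * (x * u) powr \<kappa>))" for x
    by (rule Bochner_Integration.integrable_bound[OF integrable_mult_left[OF cint, of "K \<gamma> 0"]])
       (use Kb K_nonneg c0 in \<open>auto intro!: AE_I2 simp: abs_mult\<close>)
  have J0: "0 \<le> J x" for x unfolding J_def using c0 K_nonneg by (intro integral_nonneg_AE) auto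
  have A0: "0 \<le> A x" for x using l \<kappa> G by (simp add: A_def)
  have "continuous_on {0<..} J" unfolding continuous_on_sequentially
  proof (intro allI ballI impI, elim conjE)
    fix x :: "nat \<Rightarrow> real" and a assume x: "a \<in> {0<..}" "\<forall>n. x n \<in> {0<..}" "x \<longlonglongrightarrow> a"
    show "(J \<circ> x) \<longlonglongrightarrow> J a" unfolding J_def o_def
    proof (rule integral_dominated_convergence[where w="\<lambda>u. c u * K \<gamma> 0"])
      show "integrable lborel (\<lambda>u. c u * K \<gamma> 0)" by (rule integrable_mult_left[OF cint])
      show "AE u in lborel. norm (c u * K \<gamma> (l * (x n * u) powr \<kappa>)) \<le> c u * K \<gamma> 0" for n
        using Kb by (intro AE_I2)
      show "AE u in lborel. (\<lambda>n. c u * K \<gamma> (l * (x n * u) powr \<kappa>)) \<longlonglongrightarrow> c u * K \<gamma> (l * (a * u) powr \<kappa>)"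
      proof (intro AE_I2)
        fix u :: real
        show "(\<lambda>n. c u * K \<gamma> (l * (x n * u) powr \<kappa>)) \<longlonglongrightarrow> c u * K \<gamma> (l * (a * u) powr \<kappa>)"
        proof (cases "u \<in> {0<..<1}")
          case True
          have "(\<lambda>n. l * (x n * u) powr \<kappa>) \<longlonglongrightarrow> l * (a * u) powr \<kappa>"
            using x True by (intro tendsto_intros) auto
          then have "(\<lambda>n. K \<gamma> (l * (x n * u) powr \<kappa>)) \<longlonglongrightarrow> K \<gamma> (l * (a * u) powr \<kappa>)"
            using K_continuous[OF \<gamma>] arg by (intro continuous_on_tendsto_compose[of "{0..}" "K \<gamma>"]) auto
          then show ?thesis by (intro tendsto_intros)
        qed (simp add: c_def)
      qed
    qed measurable
  qed
  moreover have "continuous_on {0<..} A" unfolding A_def using G by (intro continuous_intros) auto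
  ultimately have cont: "continuous_on {0<..} (\<lambda>x. A x * J x)" by (rule continuous_on_mult[rotated])
  have "mode_caputo \<gamma> l x = ennreal (A x * J x)" if x: "x > 0" for x
  proof -
    have "mode_caputo \<gamma> l x = (\<integral>\<^sup>+u. ennreal (x powr (1 - \<alpha>) * (1 - u) powr (1 - \<alpha> - 1) / Gamma (1 - \<alpha>)) *
      ennreal (mode_rate \<gamma> l (x * u)) * indicator {0<..<1} u \<partial>lborel)"
      unfolding mode_caputo_def by (rule nn_integral_Beta_scaled[OF x, of _ 1]) (use \<alpha> in auto)
    also have "\<dots> = (\<integral>\<^sup>+u. ennreal (A x * (c u * K \<gamma> (l * (x * u) powr \<kappa>))) \<partial>lborel)"
    proof (rule nn_integral_cong)
      fix u :: real
      show "ennreal (x powr (1 - \<alpha>) * (1 - u) powr (1 - \<alpha> - 1) / Gamma (1 - \<alpha>)) *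
        ennreal (mode_rate \<gamma> l (x * u)) * indicator {0<..<1} u = ennreal (A x * (c u * K \<gamma> (l * (x * u) powr \<kappa>)))"
      proof (cases "u \<in> {0<..<1}")
        case True
        have "x powr (1 - \<alpha>) * (1 - u) powr (1 - \<alpha> - 1) / Gamma (1 - \<alpha>) * mode_rate \<gamma> l (x * u) =
          A x * (c u * K \<gamma> (l * (x * u) powr \<kappa>))"
          using True x by (simp add: mode_rate_def A_def c_def \<kappa>_def[symmetric] powr_mult)
        then show ?thesis using True G by (simp add: ennreal_mult'[symmetric])
      qed (simp add: c_def)
    qed
    also have "\<dots> = ennreal (LINT u|lborel. A x * (c u * K \<gamma> (l * (x * u) powr \<kappa>)))"
      using Jint A0 c0 K_nonneg by (intro nn_integral_eq_integral) auto
    finally show ?thesis unfolding J_def by simp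
  qed
  then show ?thesis using cont A0 J0 by (intro that[of "\<lambda>x. A x * J x"]) auto
qed

text \<open>Equal primitives give equal integrals over all {a..<b}, the common primitive of the
  source being finite; two continuous densities with equal integrals agree everywhere.\<close>

lemma mode_caputo_eq:
  assumes \<gamma>: "\<gamma> \<ge> 0" and l: "l > 0" and t: "t > 0"
  shows "mode_caputo \<gamma> l t = ennreal (l * t powr \<gamma> * mode \<gamma> l t)"
proof -
  obtain w where w: "continuous_on {0<..} w" "\<And>x. x > 0 \<Longrightarrow> 0 \<le> w x" "\<And>x. x > 0 \<Longrightarrow> mode_caputo \<gamma> l x = ennreal (w x)"
    using mode_caputo_real[OF \<gamma> l] by blast
  have src: "mode_source \<gamma> l x = ennreal (l * x powr \<gamma> * mode \<gamma> l x)" if "x > 0" for x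
    using that by (simp add: mode_source_def pos_powr_def)
  have eq: "(\<integral>\<^sup>+u. mode_caputo \<gamma> l u * indicator {..<x} u \<partial>lborel) = (\<integral>\<^sup>+u. mode_source \<gamma> l u * indicator {..<x} u \<partial>lborel)" for x
    using fun_cong[OF mode_caputo_primitive[OF \<gamma> l], of x] by (simp add: nn_conv_indicator)
  have fin: "(\<integral>\<^sup>+u. mode_source \<gamma> l u * indicator {..<a} u \<partial>lborel) \<noteq> \<infinity>" if a: "a > 0" for a
  proof -
    have "(\<integral>\<^sup>+u. mode_source \<gamma> l u * indicator {..<a} u \<partial>lborel) \<le> (\<integral>\<^sup>+u. ennreal (l * a powr \<gamma>) * indicator {0..a} u \<partial>lborel)"
    proof (rule nn_integral_mono)
      fix u :: real
      show "mode_source \<gamma> l u * indicator {..<a} u \<le> ennreal (l * a powr \<gamma>) * indicator {0..a} u"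
      proof (cases "u \<in> {0<..<a}")
        case True
        have "l * u powr \<gamma> * mode \<gamma> l u \<le> l * a powr \<gamma> * 1"
          using True l \<gamma> mode_bounds[of l \<gamma> u] by (intro mult_mono) (auto intro!: powr_mono2)
        then show ?thesis using True src[of u] by (auto intro!: ennreal_leI)
      qed (auto simp: mode_source_def pos_powr_def indicator_def)
    qed
    also have "\<dots> < \<infinity>" using a by (simp add: nn_integral_cmult_indicator ennreal_mult_less_top)
    finally show ?thesis by simp
  qed
  have "w t = l * t powr \<gamma> * mode \<gamma> l t"
  proof (rule continuous_eq_if_integrals_eq[OF w(1)])
    show "continuous_on {0<..} (\<lambda>t. l * t powr \<gamma> * mode \<gamma> l t)"
      using mode_continuous[OF \<gamma>, of l] l by (intro continuous_intros) (auto elim: continuous_on_subset)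
    fix a b :: real assume ab: "0 < a" "a < b"
    have "(\<integral>\<^sup>+s. ennreal (w s) * indicator {a..<b} s \<partial>lborel) = (\<integral>\<^sup>+s. mode_caputo \<gamma> l s * indicator {a..<b} s \<partial>lborel)"
      using ab w(3) by (intro nn_integral_cong) (auto simp: indicator_def)
    also have "\<dots> = (\<integral>\<^sup>+s. mode_source \<gamma> l s * indicator {a..<b} s \<partial>lborel)"
      by (rule nn_integral_Ico_eq[OF _ _ eq fin]) (use ab in auto)
    also have "\<dots> = (\<integral>\<^sup>+s. ennreal (l * s powr \<gamma> * mode \<gamma> l s) * indicator {a..<b} s \<partial>lborel)"
      using ab src by (intro nn_integral_cong) (auto simp: indicator_def)
    finally show "(\<integral>\<^sup>+s. ennreal (w s) * indicator {a..<b} s \<partial>lborel) =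
      (\<integral>\<^sup>+s. ennreal (l * s powr \<gamma> * mode \<gamma> l s) * indicator {a..<b} s \<partial>lborel)" .
  qed (use w(2) l t mode_bounds in auto)
  then show ?thesis using w(3)[OF t] by simp
qed

lemma mode_fractional_ode:
  assumes \<gamma>: "\<gamma> \<ge> 0" and l: "l \<ge> 0" and t: "t > 0"
  shows "((\<lambda>s. - mode_rate \<gamma> l s / (t - s) powr \<alpha>) has_integral - l * Gamma (1 - \<alpha>) * t powr \<gamma> * mode \<gamma> l t) {0..t}"
proof (cases "l = 0")
  case True
  then show ?thesis by (simp add: mode_rate_def)
next
  case False
  then have l': "l > 0" using l by simp
  have G: "Gamma (1 - \<alpha>) > 0" using \<alpha> by (auto intro!: Gamma_real_pos)
  \<comment> \<open>The endpoints, where the rate or the kernel can be singular, are cut off; they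
    do not affect the integral.\<close>
  define g where "g s = indicator {0<..<t} s * (mode_rate \<gamma> l s * (t - s) powr (- \<alpha>) / Gamma (1 - \<alpha>))" for s
  have [measurable]: "g \<in> borel_measurable borel" unfolding g_def[abs_def] by measurable
  have "mode_caputo \<gamma> l t = (\<integral>\<^sup>+s. ennreal (mode_rate \<gamma> l s) * indicator {0<..} s * ennreal (frac_kernel (1 - \<alpha>) (t - s)) \<partial>lborel)"
    unfolding mode_caputo_def by (subst nn_conv_commute) (auto simp: nn_conv_def)
  also have "\<dots> = (\<integral>\<^sup>+s. ennreal (g s) \<partial>lborel)"
    using mode_rate_nonneg[OF \<gamma> l]
    by (intro nn_integral_cong) (auto simp: g_def frac_kernel_def indicator_def ennreal_mult'[symmetric])
  finally have "(\<integral>\<^sup>+s. ennreal (g s) \<partial>lborel) = ennreal (l * t powr \<gamma> * mode \<gamma> l t)"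
    using mode_caputo_eq[OF \<gamma> l' t] by simp
  then have "(g has_integral l * t powr \<gamma> * mode \<gamma> l t) UNIV"
    using mode_rate_nonneg[OF \<gamma> l] l mode_bounds[of l \<gamma> t] G
    by (intro nn_integral_has_integral) (auto simp: g_def)
  then have "((\<lambda>s. (- Gamma (1 - \<alpha>)) * g s) has_integral (- Gamma (1 - \<alpha>)) * (l * t powr \<gamma> * mode \<gamma> l t)) UNIV"
    by (rule has_integral_mult_right)
  moreover have "(\<lambda>s. (- Gamma (1 - \<alpha>)) * g s) = (\<lambda>s. if s \<in> {0<..<t} then - mode_rate \<gamma> l s / (t - s) powr \<alpha> else 0)"
    using G by (auto simp: g_def fun_eq_iff powr_minus field_simps)
  ultimately have "((\<lambda>s. - mode_rate \<gamma> l s / (t - s) powr \<alpha>) has_integral (- Gamma (1 - \<alpha>)) * (l * t powr \<gamma> * mode \<gamma> l t)) {0<..<t}"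
    by (simp only: has_integral_restrict_UNIV)
  then show ?thesis by (simp add: has_integral_Icc_iff_Ioo mult_ac)
qed

end

section \<open>Uniform limits\<close>

text \<open>Summation by parts moves the differences onto the weights b; these differences are
  nonnegative and telescope, so their total is at most \<open>b M\<close>, which is at most
  1.\<close>

lemma abel_summation_bound:
  fixes b c :: "nat \<Rightarrow> real"
  assumes S: "\<And>k. M \<le> k \<Longrightarrow> \<bar>\<Sum>n=M..<k. c n\<bar> \<le> e"
    and b: "\<And>n. b (Suc n) \<le> b n" "\<And>n. 0 \<le> b n" "\<And>n. b n \<le> 1" and k: "M \<le> k"
  shows "\<bar>\<Sum>n=M..<k. c n * b n\<bar> \<le> e"
proof -
  have e: "0 \<le> e" using S[of M] by simp
  have "(\<Sum>n=M..<k. c n * b n) = (\<Sum>n=M..<k. c n) * b k + (\<Sum>n=M..<k. (\<Sum>i=M..<Suc n. c i) * (b n - b (Suc n)))"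
    using k by (induction k rule: dec_induct) (auto simp: algebra_simps)
  also have "\<bar>\<dots>\<bar> \<le> \<bar>\<Sum>n=M..<k. c n\<bar> * b k + (\<Sum>n=M..<k. \<bar>\<Sum>i=M..<Suc n. c i\<bar> * (b n - b (Suc n)))"
    using b by (intro order_trans[OF abs_triangle_ineq] add_mono order_trans[OF sum_abs] sum_mono)
      (auto simp: abs_mult abs_of_nonneg)
  also have "\<dots> \<le> e * b k + (\<Sum>n=M..<k. e * (b n - b (Suc n)))"
  proof (intro add_mono mult_right_mono sum_mono)
    fix n assume "n \<in> {M..<k}"
    then show "\<bar>\<Sum>i=M..<Suc n. c i\<bar> \<le> e" by (intro S) auto
  qed (use S b k in auto)
  also have "(\<Sum>n=M..<k. e * (b n - b (Suc n))) = e * (b M - b k)"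
    using k by (induction k rule: dec_induct) (auto simp: algebra_simps)
  also have "e * b k + e * (b M - b k) = e * b M" by (simp add: algebra_simps)
  also have "\<dots> \<le> e" using e b(3)[of M] by (simp add: mult_left_le)
  finally show ?thesis .
qed

lemma sum_lessThan_diff_real:
  fixes c :: "nat \<Rightarrow> real"
  shows "M \<le> k \<Longrightarrow> (\<Sum>n<k. c n) - (\<Sum>n<M. c n) = (\<Sum>n=M..<k. c n)"
  by (induction k rule: dec_induct) auto

text \<open>The coefficients depend on y alone and the weights on x alone. The bound for a block
  depends on the coefficients only, so that the convergence in y carries over uniformly to the
  product.\<close>

lemma abel_uniformly_convergent:
  fixes b :: "nat \<Rightarrow> 'x \<Rightarrow> real" and c :: "nat \<Rightarrow> 'y \<Rightarrow> real"
  assumes h: "uniform_limit Y (\<lambda>N y. \<Sum>n<N. c n y) h sequentially"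
    and b: "\<And>n x. x \<in> X \<Longrightarrow> b (Suc n) x \<le> b n x" "\<And>n x. x \<in> X \<Longrightarrow> 0 \<le> b n x" "\<And>n x. x \<in> X \<Longrightarrow> b n x \<le> 1"
  shows "uniformly_convergent_on (X \<times> Y) (\<lambda>N p. \<Sum>n<N. c n (snd p) * b n (fst p))"
proof (rule Cauchy_uniformly_convergent, rule uniformly_Cauchy_onI')
  fix e :: real assume e: "e > 0"
  have "uniformly_Cauchy_on Y (\<lambda>N y. \<Sum>n<N. c n y)"
    using h by (intro uniformly_convergent_Cauchy) (auto simp: uniformly_convergent_on_def)
  then obtain M where M: "\<And>y m n. y \<in> Y \<Longrightarrow> m \<ge> M \<Longrightarrow> n \<ge> M \<Longrightarrow> dist (\<Sum>i<m. c i y) (\<Sum>i<n. c i y) < e / 2"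
    using e unfolding uniformly_Cauchy_on_def by (meson half_gt_zero)
  show "\<exists>M. \<forall>p\<in>X \<times> Y. \<forall>m\<ge>M. \<forall>n>m. dist (\<Sum>n<m. c n (snd p) * b n (fst p)) (\<Sum>n<n. c n (snd p) * b n (fst p)) < e"
  proof (intro exI[of _ M] ballI allI impI)
    fix p m n assume p: "p \<in> X \<times> Y" and mn: "M \<le> m" "m < (n::nat)"
    have "\<bar>\<Sum>i=m..<n. c i (snd p) * b i (fst p)\<bar> \<le> e / 2"
    proof (rule abel_summation_bound)
      fix k assume "m \<le> k"
      then show "\<bar>\<Sum>n=m..<k. c n (snd p)\<bar> \<le> e / 2"
        using M[of "snd p" k m] p mn by (auto simp: dist_real_def sum_lessThan_diff_real)
    qed (use b p mn in auto)
    then show "dist (\<Sum>n<m. c n (snd p) * b n (fst p)) (\<Sum>n<n. c n (snd p) * b n (fst p)) < e"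
      using e mn sum_lessThan_diff_real[of m n "\<lambda>i. c i (snd p) * b i (fst p)"]
      by (simp add: dist_real_def abs_minus_commute)
  qed
qed

lemma uniform_limit_bounded_mult:
  fixes F :: "nat \<Rightarrow> 'a \<Rightarrow> real"
  assumes F: "uniform_limit S F G sequentially" and k: "\<And>x. x \<in> S \<Longrightarrow> \<bar>k x\<bar> \<le> B"
  shows "uniform_limit S (\<lambda>n x. k x * F n x) (\<lambda>x. k x * G x) sequentially"
proof (rule uniform_limitI)
  fix e :: real assume e: "e > 0"
  \<comment> \<open>B may be zero, and even negative when S is empty.\<close>
  define B' where "B' = \<bar>B\<bar> + 1"
  have B': "B' > 0" by (simp add: B'_def)
  have "\<forall>\<^sub>F n in sequentially. \<forall>x\<in>S. dist (F n x) (G x) < e / B'"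
    using F e B' by (intro uniform_limitD) auto
  then show "\<forall>\<^sub>F n in sequentially. \<forall>x\<in>S. dist (k x * F n x) (k x * G x) < e"
  proof (rule eventually_mono, intro ballI)
    fix n x assume *: "\<forall>x\<in>S. dist (F n x) (G x) < e / B'" and x: "x \<in> S"
    have "dist (k x * F n x) (k x * G x) = \<bar>k x\<bar> * dist (F n x) (G x)"
      by (simp add: dist_real_def right_diff_distrib[symmetric] abs_mult)
    also have "\<dots> \<le> B' * dist (F n x) (G x)"
      using k[OF x] by (intro mult_right_mono) (auto simp: B'_def)
    also have "\<dots> < e" using * x B' by (simp add: pos_less_divide_eq mult.commute)
    finally show "dist (k x * F n x) (k x * G x) < e" .
  qed
qed

lemma has_real_derivative_uniform_limit:
  fixes f :: "nat \<Rightarrow> real \<Rightarrow> real"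
  assumes S: "convex S"
    and d: "\<And>n x. x \<in> S \<Longrightarrow> (f n has_real_derivative f' n x) (at x within S)"
    and u: "uniform_limit S f' g' sequentially"
    and p: "\<And>x. x \<in> S \<Longrightarrow> (\<lambda>n. f n x) \<longlonglongrightarrow> g x" and x: "x \<in> S"
  shows "(g has_real_derivative g' x) (at x within S)"
proof -
  have "\<exists>G. \<forall>x\<in>S. (\<lambda>n. f n x) \<longlonglongrightarrow> G x \<and> (G has_derivative (*) (g' x)) (at x within S)"
  proof (rule has_derivative_sequence[OF S])
    show "(f n has_derivative (*) (f' n x)) (at x within S)" if "x \<in> S" for n x
      using d[OF that] by (simp add: has_field_derivative_def)
    show "\<forall>\<^sub>F n in sequentially. \<forall>x\<in>S. \<forall>h. norm (f' n x * h - g' x * h) \<le> e * norm h" if "e > 0" for e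
    proof -
      have "\<forall>\<^sub>F n in sequentially. \<forall>x\<in>S. dist (f' n x) (g' x) < e" using u that by (rule uniform_limitD)
      then show ?thesis
      proof (rule eventually_mono, intro ballI allI)
        fix n x h assume *: "\<forall>x\<in>S. dist (f' n x) (g' x) < e" "x \<in> S"
        then have "\<bar>f' n x - g' x\<bar> \<le> e" by (auto simp: dist_real_def intro: less_imp_le)
        then show "norm (f' n x * h - g' x * h) \<le> e * norm h"
          by (simp add: left_diff_distrib[symmetric] abs_mult mult_right_mono)
      qed
    qed
  qed (use x p in auto)
  then obtain G where G: "\<And>x. x \<in> S \<Longrightarrow> (\<lambda>n. f n x) \<longlonglongrightarrow> G x"
    "\<And>x. x \<in> S \<Longrightarrow> (G has_derivative (*) (g' x)) (at x within S)" by blast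
  have eq: "G x = g x" if "x \<in> S" for x using LIMSEQ_unique[OF G(1)[OF that] p[OF that]] .
  have "(g has_derivative (*) (g' x)) (at x within S)"
    by (rule has_derivative_transform[OF x _ G(2)[OF x]]) (simp add: eq)
  then show ?thesis by (simp add: has_field_derivative_def)
qed

text \<open>A sequence that converges together with its images under a Sturm-Liouville operator
  \<open>D f'' + \<mu> f' = (D m f')' / m\<close> has convergent derivatives: the mean value theorem bounds
  \<open>f'\<close> at one point by \<open>f\<close> and then everywhere by the operator.\<close>

lemma sturm_liouville_closed:
  fixes f f' f'' :: "nat \<Rightarrow> real \<Rightarrow> real" and D \<mu> m :: "real \<Rightarrow> real"
  assumes uv: "u < v"
    and d1: "\<And>n x. x \<in> {u..v} \<Longrightarrow> (f n has_real_derivative f' n x) (at x)"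
    and d2: "\<And>n x. x \<in> {u..v} \<Longrightarrow> (f' n has_real_derivative f'' n x) (at x)"
    and cont: "continuous_on {u..v} D" "continuous_on {u..v} \<mu>" "continuous_on {u..v} m"
    and pos: "\<And>x. x \<in> {u..v} \<Longrightarrow> 0 < D x" "\<And>x. x \<in> {u..v} \<Longrightarrow> 0 < m x"
    and Dm: "\<And>x. x \<in> {u..v} \<Longrightarrow> ((\<lambda>x. D x * m x) has_real_derivative \<mu> x * m x) (at x)"
    and lim: "uniform_limit {u..v} f g sequentially"
      "uniform_limit {u..v} (\<lambda>n x. \<mu> x * f' n x + D x * f'' n x) w sequentially"
  obtains g1 g2 where "\<And>x. x \<in> {u..v} \<Longrightarrow> (g has_real_derivative g1 x) (at x within {u..v})"
    "\<And>x. x \<in> {u..v} \<Longrightarrow> (g1 has_real_derivative g2 x) (at x within {u..v})"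
    "\<And>x. x \<in> {u..v} \<Longrightarrow> \<mu> x * g1 x + D x * g2 x = w x"
proof -
  let ?G = "\<lambda>n x. \<mu> x * f' n x + D x * f'' n x"
  let ?P = "\<lambda>x. D x * m x"
  have ne: "{u..v} \<noteq> {}" using uv by auto
  have Pc: "continuous_on {u..v} ?P" using cont by (intro continuous_intros)
  obtain x0 where x0: "x0 \<in> {u..v}" "\<And>x. x \<in> {u..v} \<Longrightarrow> ?P x0 \<le> ?P x"
    using continuous_attains_inf[OF compact_Icc ne Pc] by blast
  obtain x1 where x1: "\<And>x. x \<in> {u..v} \<Longrightarrow> ?P x \<le> ?P x1"
    using continuous_attains_sup[OF compact_Icc ne Pc] by blast
  obtain x2 where x2: "x2 \<in> {u..v}" "\<And>x. x \<in> {u..v} \<Longrightarrow> m x \<le> m x2"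
    using continuous_attains_sup[OF compact_Icc ne cont(3)] by blast
  define p0 p1 m1 where "p0 = ?P x0" and "p1 = ?P x1" and "m1 = m x2"
  have p0: "p0 > 0" using pos x0(1) by (simp add: p0_def)
  have p1: "p1 > 0" using p0 x1[OF x0(1)] unfolding p0_def p1_def by linarith
  have m1: "m1 > 0" using pos(2) x2(1) by (simp add: m1_def)
  \<comment> \<open>With E the difference of two members of the sequence: at a mean value point |E'|
    is at most 2 e / (v - u), which \<open>p1\<close> multiplies; from there
    \<open>D * m * E'\<close> changes by at most \<open>m1 * e * (v - u)\<close>; and division by
    the minimum \<open>p0\<close> of \<open>D * m\<close> isolates E'.\<close>
  define C where "C = (p1 * (2 / (v - u)) + (v - u) * m1) / p0"
  have C: "C > 0" using p0 p1 m1 uv unfolding C_def by (intro divide_pos_pos add_pos_pos mult_pos_pos) auto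
  have bound: "\<bar>f' i x - f' j x\<bar> \<le> C * e"
    if e: "\<And>x. x \<in> {u..v} \<Longrightarrow> \<bar>f i x - f j x\<bar> \<le> e" "\<And>x. x \<in> {u..v} \<Longrightarrow> \<bar>?G i x - ?G j x\<bar> \<le> e"
      and x: "x \<in> {u..v}" for i j x e
  proof -
    define E where "E x = f i x - f j x" for x
    define E' where "E' x = f' i x - f' j x" for x
    have e0: "0 \<le> e" using e(1)[OF x] by linarith
    have "\<exists>z. u < z \<and> z < v \<and> E v - E u = (v - u) * E' z"
      unfolding E_def E'_def using uv by (intro MVT2 derivative_intros d1) auto
    then obtain z where z: "u < z" "z < v" "E v - E u = (v - u) * E' z" by blast
    have "\<bar>(v - u) * E' z\<bar> \<le> 2 * e" using e(1)[of u] e(1)[of v] uv unfolding z(3)[symmetric] E_def by auto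
    then have Ez: "\<bar>E' z\<bar> \<le> 2 * e / (v - u)" using uv by (simp add: abs_mult field_simps)
    \<comment> \<open>Since (D m)' = \<mu> m, the derivative of D m E' is m times the operator
      applied to E.\<close>
    have dP: "((\<lambda>x. ?P x * E' x) has_real_derivative m y * (?G i y - ?G j y)) (at y)" if "y \<in> {u..v}" for y
      unfolding E'_def by (rule derivative_eq_intros Dm[OF that] d2[OF that] refl)+ (simp add: algebra_simps)
    have "norm (?P x * E' x - ?P z * E' z) \<le> (m1 * e) * norm (x - z)"
    proof (rule differentiable_bound[OF convex_closed_interval[of u v, unfolded box_real]])
      show "((\<lambda>x. ?P x * E' x) has_derivative (*) (m y * (?G i y - ?G j y))) (at y within {u..v})" if "y \<in> {u..v}" for y
        using has_field_derivative_at_within[OF dP[OF that]] by (simp add: has_field_derivative_def)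
      show "onorm ((*) (m y * (?G i y - ?G j y))) \<le> m1 * e" if "y \<in> {u..v}" for y
      proof -
        have "\<bar>m y * (?G i y - ?G j y)\<bar> \<le> m1 * e" unfolding abs_mult
          using x2(2)[OF that] pos(2)[OF that] e(2)[OF that] m1 by (intro mult_mono) (auto simp: m1_def)
        then show ?thesis by (intro onorm_bound) (auto simp: abs_mult mult_right_mono m1 e0 less_imp_le)
      qed
    qed (use x z in auto)
    also have "\<dots> \<le> (m1 * e) * (v - u)" using x z m1 e0 by (intro mult_left_mono) auto
    finally have "\<bar>?P x * E' x\<bar> \<le> \<bar>?P z * E' z\<bar> + (m1 * e) * (v - u)" by simp
    also have "\<bar>?P z * E' z\<bar> \<le> p1 * (2 * e / (v - u))"
      unfolding abs_mult[of "?P z"] using x1[of z] z Ez pos[of z] p1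
      by (intro mult_mono) (auto simp: p1_def abs_mult)
    finally have "\<bar>?P x * E' x\<bar> \<le> p1 * (2 * e / (v - u)) + (m1 * e) * (v - u)" by simp
    also have "\<dots> = p0 * (C * e)" using p0 by (simp add: C_def field_simps)
    finally have "\<bar>?P x * E' x\<bar> \<le> p0 * (C * e)" .
    moreover have "p0 * \<bar>E' x\<bar> \<le> \<bar>?P x * E' x\<bar>"
      unfolding abs_mult[of "?P x"] using x0(2)[OF x] p0 by (intro mult_right_mono) (auto simp: p0_def)
    ultimately have "p0 * \<bar>E' x\<bar> \<le> p0 * (C * e)" by linarith
    then show ?thesis using p0 by (simp add: E'_def)
  qed
  have "uniformly_Cauchy_on {u..v} f'"
  proof (rule uniformly_Cauchy_onI)
    fix e :: real assume e: "e > 0"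
    define \<delta> where "\<delta> = e / (2 * C)"
    have \<delta>: "\<delta> > 0" using e C by (simp add: \<delta>_def)
    have "uniformly_Cauchy_on {u..v} f" "uniformly_Cauchy_on {u..v} ?G"
      using lim by (auto intro!: uniformly_convergent_Cauchy simp: uniformly_convergent_on_def)
    with \<delta> obtain M1 M2 where
      M1: "\<And>x i j. x \<in> {u..v} \<Longrightarrow> i \<ge> M1 \<Longrightarrow> j \<ge> M1 \<Longrightarrow> dist (f i x) (f j x) < \<delta>" and
      M2: "\<And>x i j. x \<in> {u..v} \<Longrightarrow> i \<ge> M2 \<Longrightarrow> j \<ge> M2 \<Longrightarrow> dist (?G i x) (?G j x) < \<delta>"
      unfolding uniformly_Cauchy_on_def by meson
    show "\<exists>M. \<forall>x\<in>{u..v}. \<forall>m\<ge>M. \<forall>n\<ge>M. dist (f' m x) (f' n x) < e"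
    proof (intro exI[of _ "max M1 M2"] ballI allI impI)
      fix x i j assume x: "x \<in> {u..v}" and ij: "max M1 M2 \<le> i" "max M1 M2 \<le> j"
      have "\<bar>f' i x - f' j x\<bar> \<le> C * \<delta>"
      proof (rule bound[OF _ _ x])
        fix y assume y: "y \<in> {u..v}"
        show "\<bar>f i y - f j y\<bar> \<le> \<delta>" using M1[OF y, of i j] ij by (simp add: dist_real_def)
        show "\<bar>?G i y - ?G j y\<bar> \<le> \<delta>" using M2[OF y, of i j] ij by (simp add: dist_real_def)
      qed
      also have "\<dots> < e" using C e by (simp add: \<delta>_def)
      finally show "dist (f' i x) (f' j x) < e" by (simp add: dist_real_def)
    qed
  qed
  then obtain g1 where g1: "uniform_limit {u..v} f' g1 sequentially"
    using Cauchy_uniformly_convergent unfolding uniformly_convergent_on_def by blast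
  \<comment> \<open>The operator is solved for the second derivative; uniform convergence of f''
    then follows from that of f' and of the operator values.\<close>
  define g2 where "g2 x = 1 / D x * w x - \<mu> x / D x * g1 x" for x
  have bdd: "\<exists>B. \<forall>x\<in>{u..v}. \<bar>k x\<bar> \<le> B" if "continuous_on {u..v} k" for k :: "real \<Rightarrow> real"
  proof -
    have "continuous_on {u..v} (\<lambda>x. \<bar>k x\<bar>)" using that by (intro continuous_intros)
    from continuous_attains_sup[OF compact_Icc ne this] show ?thesis by blast
  qed
  have Dne: "\<forall>x\<in>{u..v}. D x \<noteq> 0" using pos(1) by force
  have "continuous_on {u..v} (\<lambda>x. 1 / D x)" by (intro continuous_on_divide cont continuous_on_const Dne)
  from bdd[OF this] obtain B1 where B1: "\<And>x. x \<in> {u..v} \<Longrightarrow> \<bar>1 / D x\<bar> \<le> B1" by blast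
  have "continuous_on {u..v} (\<lambda>x. \<mu> x / D x)" by (intro continuous_on_divide cont Dne)
  from bdd[OF this] obtain B2 where B2: "\<And>x. x \<in> {u..v} \<Longrightarrow> \<bar>\<mu> x / D x\<bar> \<le> B2" by blast
  note B = B1 B2
  have L: "uniform_limit {u..v} (\<lambda>n x. 1 / D x * ?G n x - \<mu> x / D x * f' n x) (\<lambda>x. 1 / D x * w x - \<mu> x / D x * g1 x) sequentially"
    by (rule uniform_limit_minus[OF uniform_limit_bounded_mult[where k="\<lambda>x. 1 / D x" and F="?G" and G=w and B=B1, OF lim(2) B(1)]
        uniform_limit_bounded_mult[where k="\<lambda>x. \<mu> x / D x" and F=f' and G=g1 and B=B2, OF g1 B(2)]])
  have "1 / D x * ?G n x - \<mu> x / D x * f' n x = f'' n x" if "x \<in> {u..v}" for n x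
    using pos(1)[OF that] by (simp add: field_simps)
  then have g2: "uniform_limit {u..v} f'' g2 sequentially"
    using L unfolding g2_def[abs_def] uniform_limit_iff by simp
  show ?thesis
  proof (rule that)
    fix x assume x: "x \<in> {u..v}"
    show "(g has_real_derivative g1 x) (at x within {u..v})"
      by (rule has_real_derivative_uniform_limit[OF convex_closed_interval[of u v, unfolded box_real] _ g1 tendsto_uniform_limitI[OF lim(1)] x])
         (use d1 in \<open>auto intro: has_field_derivative_at_within\<close>)
    show "(g1 has_real_derivative g2 x) (at x within {u..v})"
      by (rule has_real_derivative_uniform_limit[OF convex_closed_interval[of u v, unfolded box_real] _ g2 tendsto_uniform_limitI[OF g1] x])
         (use d2 in \<open>auto intro: has_field_derivative_at_within\<close>)
    show "\<mu> x * g1 x + D x * g2 x = w x" using pos(1)[OF x] by (simp add: g2_def field_simps)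
  qed
qed

text \<open>On {0..t/2} the kernel is smooth and integration by parts leaves only e itself, whatever
  e' does near 0. On {t/2..t} the kernel is singular but integrable and e' is bounded. The constant
  depends on \<alpha> and t alone, so the estimate can be applied uniformly to a family of
  functions.\<close>

lemma caputo_integral_bound:
  fixes \<alpha> t :: real
  assumes \<alpha>: "0 < \<alpha>" "\<alpha> < 1" and t: "t > 0"
  obtains C where "C \<ge> 0"
    "\<And>e e' A B. continuous_on {0..t} e \<Longrightarrow> (\<And>s. 0 < s \<Longrightarrow> s \<le> t \<Longrightarrow> (e has_real_derivative e' s) (at s)) \<Longrightarrow>
      continuous_on {0<..t} e' \<Longrightarrow> (\<And>s. s \<in> {0..t} \<Longrightarrow> \<bar>e s\<bar> \<le> A) \<Longrightarrow> (\<And>s. s \<in> {t/2..t} \<Longrightarrow> \<bar>e' s\<bar> \<le> B) \<Longrightarrow>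
      (\<lambda>s. e' s / (t - s) powr \<alpha>) integrable_on {0..t} \<and>
      \<bar>integral {0..t} (\<lambda>s. e' s / (t - s) powr \<alpha>)\<bar> \<le> C * (A + B)"
proof -
  define k where "k s = (t - s) powr (- \<alpha>)" for s
  \<comment> \<open>The two boundary terms of the integration by parts, then the length t/2 times
    the maximum of the kernel's derivative, attained at t/2. \<open>C2\<close> is the integral of
    the kernel over {t/2..t}.\<close>
  define C1 where "C1 = k (t/2) + k 0 + (t/2) * (\<alpha> * (t/2) powr (- \<alpha> - 1))"
  define C2 where "C2 = (t/2) powr (1 - \<alpha>) / (1 - \<alpha>)"
  have C12: "0 \<le> C1" "0 \<le> C2" using \<alpha> t by (auto simp: C1_def C2_def k_def)
  show ?thesis
  proof (rule that[of "max C1 C2"])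
    show "0 \<le> max C1 C2" using C12 by simp
    fix e e' :: "real \<Rightarrow> real" and A B :: real
    assume ec: "continuous_on {0..t} e"
      and ed: "\<And>s. 0 < s \<Longrightarrow> s \<le> t \<Longrightarrow> (e has_real_derivative e' s) (at s)"
      and e'c: "continuous_on {0<..t} e'"
      and A: "\<And>s. s \<in> {0..t} \<Longrightarrow> \<bar>e s\<bar> \<le> A" and B: "\<And>s. s \<in> {t/2..t} \<Longrightarrow> \<bar>e' s\<bar> \<le> B"
    have A0: "0 \<le> A" using A[of 0] t by auto
    have B0: "0 \<le> B" using B[of t] t by auto
    let ?j = "\<lambda>s. e s * (\<alpha> * (t - s) powr (- \<alpha> - 1))"
    have jc: "continuous_on {0..t/2} ?j"
      using t by (intro continuous_intros continuous_on_subset[OF ec]) auto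
    have "((\<lambda>s. e' s * k s + ?j s) has_integral (e (t/2) * k (t/2) - e 0 * k 0)) {0..t/2}"
    proof (rule fundamental_theorem_of_calculus_interior)
      show "continuous_on {0..t/2} (\<lambda>s. e s * k s)"
        unfolding k_def using t by (intro continuous_intros continuous_on_subset[OF ec]) auto
      fix s assume s: "s \<in> {0<..<t/2}"
      have "((\<lambda>s. e s * k s) has_real_derivative e' s * k s + ?j s) (at s)"
        unfolding k_def using s t by (auto intro!: derivative_eq_intros ed simp: field_simps)
      then show "((\<lambda>s. e s * k s) has_vector_derivative e' s * k s + ?j s) (at s)"
        by (simp add: has_real_derivative_iff_has_vector_derivative)
    qed (use t in auto)
    moreover have ji: "?j integrable_on {0..t/2}" using jc by (rule integrable_continuous_real)
    \<comment> \<open>Integrability of the first part arises as a difference of two integrable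
      functions; the Henstock-Kurzweil integral allows e' to oscillate without bound at 0
      here.\<close>
    ultimately have I1: "((\<lambda>s. e' s * k s) has_integral (e (t/2) * k (t/2) - e 0 * k 0 - integral {0..t/2} ?j)) {0..t/2}"
      using has_integral_diff[of "\<lambda>s. e' s * k s + ?j s" _ "{0..t/2}" ?j] by (auto dest: integrable_integral)
    have jb: "norm (integral {0..t/2} ?j) \<le> (A * (\<alpha> * (t/2) powr (- \<alpha> - 1))) * (t/2 - 0)"
    proof (rule integral_bound)
      fix s assume s: "s \<in> {0..t/2}"
      have "(t - s) powr (- \<alpha> - 1) \<le> (t/2) powr (- \<alpha> - 1)" using s t \<alpha> by (intro powr_mono2') auto
      then show "norm (?j s) \<le> A * (\<alpha> * (t/2) powr (- \<alpha> - 1))"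
        using A[of s] s t \<alpha> A0 by (simp add: abs_mult) (intro mult_mono mult_left_mono, auto)
    qed (use t jc in auto)
    have b1: "\<bar>integral {0..t/2} (\<lambda>s. e' s * k s)\<bar> \<le> C1 * A"
    proof -
      have "\<bar>integral {0..t/2} (\<lambda>s. e' s * k s)\<bar> \<le> \<bar>e (t/2)\<bar> * k (t/2) + \<bar>e 0\<bar> * k 0 + \<bar>integral {0..t/2} ?j\<bar>"
        unfolding integral_unique[OF I1] by (auto simp: k_def abs_mult intro!: order_trans[OF abs_triangle_ineq4] add_mono)
      also have "\<dots> \<le> A * k (t/2) + A * k 0 + (A * (\<alpha> * (t/2) powr (- \<alpha> - 1))) * (t/2 - 0)"
        using jb A[of "t/2"] A[of 0] t by (intro add_mono mult_right_mono) (auto simp: k_def)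
      also have "\<dots> = C1 * A" by (simp add: C1_def algebra_simps)
      finally show ?thesis .
    qed
    have kint: "(k has_integral - ((t - t) powr (1 - \<alpha>) / (1 - \<alpha>)) - - ((t - t/2) powr (1 - \<alpha>) / (1 - \<alpha>))) {t/2..t}"
    proof (rule fundamental_theorem_of_calculus_interior)
      show "continuous_on {t/2..t} (\<lambda>s. - ((t - s) powr (1 - \<alpha>) / (1 - \<alpha>)))"
        using \<alpha> by (intro continuous_intros continuous_on_powr') auto
      fix s assume s: "s \<in> {t/2<..<t}"
      have "((\<lambda>s. - ((t - s) powr (1 - \<alpha>) / (1 - \<alpha>))) has_real_derivative k s) (at s)"
      proof -
        have "((\<lambda>s. t - s) has_real_derivative - 1) (at s)" by (auto intro!: derivative_eq_intros)
        then have "((\<lambda>s. (t - s) powr (1 - \<alpha>)) has_real_derivative (1 - \<alpha>) * (t - s) powr (1 - \<alpha> - of_nat 1) * - 1) (at s)"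
          using s by (intro DERIV_fun_powr) auto
        then have "((\<lambda>s. - ((t - s) powr (1 - \<alpha>) / (1 - \<alpha>))) has_real_derivative
            - ((1 - \<alpha>) * (t - s) powr (1 - \<alpha> - of_nat 1) * - 1 / (1 - \<alpha>))) (at s)"
          by (intro DERIV_minus DERIV_cdivide)
        then show ?thesis using \<alpha> by (simp add: k_def)
      qed
      then show "((\<lambda>s. - ((t - s) powr (1 - \<alpha>) / (1 - \<alpha>))) has_vector_derivative k s) (at s)"
        by (simp add: has_real_derivative_iff_has_vector_derivative)
    qed (use t in auto)
    then have kI: "(k has_integral C2) {t/2..t}" by (simp add: C2_def)
    then have kI': "(k has_integral C2) {t/2<..<t}" by (simp add: has_integral_Icc_iff_Ioo)
    have "(\<lambda>s. e' s * k s) integrable_on {t/2<..<t}"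
    proof (rule measurable_bounded_by_integrable_imp_integrable)
      have "continuous_on {t/2<..<t} (\<lambda>s. e' s * k s)"
        unfolding k_def using t by (intro continuous_intros continuous_on_subset[OF e'c]) auto
      then show "(\<lambda>s. e' s * k s) \<in> borel_measurable (lebesgue_on {t/2<..<t})"
        by (intro continuous_imp_measurable_on_sets_lebesgue) auto
      show "(\<lambda>s. B * k s) integrable_on {t/2<..<t}"
        using has_integral_mult_right[OF kI', of B] by blast
      fix s assume "s \<in> {t/2<..<t}"
      then show "norm (e' s * k s) \<le> B * k s" using B[of s] by (auto simp: abs_mult k_def intro!: mult_right_mono)
    qed auto
    then have i2: "(\<lambda>s. e' s * k s) integrable_on {t/2..t}" by (simp add: integrable_on_Icc_iff_Ioo)
    have "norm (integral {t/2..t} (\<lambda>s. e' s * k s)) \<le> integral {t/2..t} (\<lambda>s. B * k s)"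
    proof (rule integral_norm_bound_integral[OF i2])
      show "(\<lambda>s. B * k s) integrable_on {t/2..t}" using has_integral_mult_right[OF kI, of B] by blast
      fix s assume "s \<in> {t/2..t}"
      then show "norm (e' s * k s) \<le> B * k s" using B[of s] by (auto simp: abs_mult k_def intro!: mult_right_mono)
    qed
    also have "\<dots> = C2 * B"
      by (subst integral_unique[OF has_integral_mult_right[OF kI, of B]]) (rule mult.commute)
    finally have b2: "\<bar>integral {t/2..t} (\<lambda>s. e' s * k s)\<bar> \<le> C2 * B" by simp
    have i1: "(\<lambda>s. e' s * k s) integrable_on {0..t/2}" using I1 by blast
    have tot: "(\<lambda>s. e' s * k s) integrable_on {0..t}"
      by (rule Henstock_Kurzweil_Integration.integrable_combine[OF _ _ i1 i2]) (use t in auto)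
    have "integral {0..t} (\<lambda>s. e' s * k s) = integral {0..t/2} (\<lambda>s. e' s * k s) + integral {t/2..t} (\<lambda>s. e' s * k s)"
      using t tot by (intro Henstock_Kurzweil_Integration.integral_combine[symmetric]) auto
    then have "\<bar>integral {0..t} (\<lambda>s. e' s * k s)\<bar> \<le> C1 * A + C2 * B" using b1 b2 by linarith
    also have "\<dots> \<le> max C1 C2 * A + max C1 C2 * B" using A0 B0 by (intro add_mono mult_right_mono) auto
    finally have "\<bar>integral {0..t} (\<lambda>s. e' s * k s)\<bar> \<le> max C1 C2 * (A + B)" by (simp add: distrib_left)
    moreover have "(\<lambda>s. e' s * k s) = (\<lambda>s. e' s / (t - s) powr \<alpha>)"
      by (simp add: k_def powr_minus divide_inverse)
    ultimately show "(\<lambda>s. e' s / (t - s) powr \<alpha>) integrable_on {0..t} \<and>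
      \<bar>integral {0..t} (\<lambda>s. e' s / (t - s) powr \<alpha>)\<bar> \<le> max C1 C2 * (A + B)" using tot by simp
  qed
qed

section \<open>The orthonormal polynomials\<close>

lemma gbinomial_step: "of_nat (Suc k) * (r gchoose Suc k) = (r - of_nat k) * (r gchoose k)" for r :: real
  using gbinomial_mult_1[of r k] by (simp add: algebra_simps)

section \<open>Hermite polynomials\<close>

fun hermite_p :: "nat \<Rightarrow> real poly" where
  "hermite_p 0 = 1"
| "hermite_p (Suc 0) = [:0, 1:]"
| "hermite_p (Suc (Suc n)) = [:0, 1:] * hermite_p (Suc n) - smult (real (Suc n)) (hermite_p n)"

lemma poly_hermite_p: "poly (hermite_p n) x = hermite_poly n x"
  by (induction n rule: hermite_p.induct) simp_all

lemma pderiv_hermite_p: "pderiv (hermite_p (Suc n)) = smult (real (Suc n)) (hermite_p n)"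
proof (induction n rule: hermite_p.induct)
  case (3 n)
  have "pderiv (hermite_p (Suc (Suc (Suc n)))) = hermite_p (Suc (Suc n)) + [:0, 1:] * pderiv (hermite_p (Suc (Suc n)))
      - smult (real (Suc (Suc n))) (pderiv (hermite_p (Suc n)))"
    by (simp add: pderiv_mult pderiv_diff pderiv_smult pderiv_pCons)
  also have "\<dots> = hermite_p (Suc (Suc n)) + smult (real (Suc (Suc n))) ([:0, 1:] * hermite_p (Suc n) - smult (real (Suc n)) (hermite_p n))"
    unfolding 3 by (simp add: smult_diff_right)
  also have "\<dots> = smult (real (Suc (Suc (Suc n)))) (hermite_p (Suc (Suc n)))"
    unfolding hermite_p.simps(3)[symmetric] of_nat_Suc[of "Suc (Suc n)"] smult_add_left
    by (simp del: hermite_p.simps)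
  finally show ?case .
qed (simp_all add: pderiv_pCons pderiv_diff pderiv_mult)

text \<open>Applying the derivative rule twice lowers the degree by 1 and by 2, which turns the
  three-term recurrence into the differential equation.\<close>

lemma hermite_p_ode: "poly (pderiv (pderiv (hermite_p n))) x - x * poly (pderiv (hermite_p n)) x = - real n * poly (hermite_p n) x"
proof (cases n)
  case 0 then show ?thesis by simp
next
  case (Suc k)
  show ?thesis
  proof (cases k)
    case 0
    then show ?thesis using Suc by (simp add: pderiv_pCons)
  next
    case (Suc m)
    show ?thesis unfolding \<open>n = Suc k\<close> Suc pderiv_hermite_p
      by (simp add: pderiv_hermite_p pderiv_smult algebra_simps del: of_nat_Suc)
  qed
qed

lemma hermite_p_nonzero: "hermite_p n \<noteq> 0"
proof (induction n)
  case (Suc n)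
  then show ?case using pderiv_hermite_p[of n] by (metis of_nat_0_eq_iff old.nat.distinct(2) pderiv_0 smult_eq_0_iff)
qed simp

section \<open>Laguerre polynomials\<close>

definition laguerre_p :: "real \<Rightarrow> nat \<Rightarrow> real poly" where
  "laguerre_p c n = (\<Sum>i\<le>n. monom ((-1) ^ i * ((real n + c) gchoose (n - i)) / fact i) i)"

lemma poly_laguerre_p: "poly (laguerre_p c n) x = laguerre_poly c n x"
  unfolding laguerre_p_def laguerre_poly_def by (simp add: poly_sum poly_monom mult_ac)

lemma coeff_laguerre_p: "coeff (laguerre_p c n) i = (if i \<le> n then (-1) ^ i * ((real n + c) gchoose (n - i)) / fact i else 0)"
  unfolding laguerre_p_def by (simp add: coeff_sum if_distrib cong: if_cong)

lemma laguerre_p_nonzero: "laguerre_p c n \<noteq> 0"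
proof -
  have "coeff (laguerre_p c n) n \<noteq> 0" by (simp add: coeff_laguerre_p)
  then show ?thesis by auto
qed

text \<open>The coefficient of x^i in Laguerre's equation x p'' + (c + 1 - x) p' + n p = 0.\<close>

lemma coeff_laguerre_step:
  "real (Suc i) * (real i + c + 1) * coeff (laguerre_p c n) (Suc i) + (real n - real i) * coeff (laguerre_p c n) i = 0"
proof (cases "i < n")
  case True
  define k where "k = n - Suc i"
  have k: "n - i = Suc k" "real n = real i + real k + 1" using True by (auto simp: k_def of_nat_diff)
  have "(real n - real i) * ((real n + c) gchoose (n - i)) = (real i + c + 1) * ((real n + c) gchoose k)"
    using gbinomial_step[of k "real n + c"] k by (simp add: algebra_simps)
  then have "(real i + c + 1) * ((real n + c) gchoose k) = (real n - real i) * ((real n + c) gchoose (n - i))" ..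
  note g = this
  have f: "real (Suc i) / fact (Suc i) = 1 / fact i" by (simp add: field_simps del: of_nat_Suc)
  have "real (Suc i) * (real i + c + 1) * ((-1) ^ Suc i * ((real n + c) gchoose k) / fact (Suc i)) =
    - ((-1) ^ i * ((real i + c + 1) * ((real n + c) gchoose k)) * (real (Suc i) / fact (Suc i)))"
    by (simp add: mult_ac del: of_nat_Suc fact_Suc)
  also have "\<dots> = - ((-1) ^ i * ((real n - real i) * ((real n + c) gchoose (n - i))) / fact i)"
    unfolding f g by simp
  finally have "real (Suc i) * (real i + c + 1) * ((-1) ^ Suc i * ((real n + c) gchoose k) / fact (Suc i)) =
    - ((-1) ^ i * ((real n - real i) * ((real n + c) gchoose (n - i))) / fact i)" .
  then show ?thesis using True by (simp add: coeff_laguerre_p k_def[symmetric] mult_ac del: of_nat_Suc fact_Suc)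
next
  case False
  then show ?thesis by (auto simp: coeff_laguerre_p)
qed

lemma laguerre_p_ode:
  "x * poly (pderiv (pderiv (laguerre_p c n))) x + (c + 1 - x) * poly (pderiv (laguerre_p c n)) x = - real n * poly (laguerre_p c n) x"
proof -
  let ?p = "laguerre_p c n"
  have "pCons 0 (pderiv (pderiv ?p)) + smult (c + 1) (pderiv ?p) - pCons 0 (pderiv ?p) + smult (real n) ?p = 0"
  proof (rule poly_eqI)
    fix i
    show "coeff (pCons 0 (pderiv (pderiv ?p)) + smult (c + 1) (pderiv ?p) - pCons 0 (pderiv ?p) + smult (real n) ?p) i = coeff 0 i"
      using coeff_laguerre_step[of i c n] by (cases i) (simp_all add: coeff_pderiv algebra_simps)
  qed
  then have "poly (pCons 0 (pderiv (pderiv ?p)) + smult (c + 1) (pderiv ?p) - pCons 0 (pderiv ?p) + smult (real n) ?p) x = 0"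
    by simp
  then show ?thesis by (simp add: algebra_simps)
qed

section \<open>Jacobi polynomials, expanded in powers of u = (x - 1) / 2 and v = (x + 1) / 2\<close>

definition jacobi_term :: "nat \<Rightarrow> nat \<Rightarrow> real poly" where
  "jacobi_term i j = [:-1/2, 1/2:] ^ i * [:1/2, 1/2:] ^ j"

definition jacobi_p :: "real \<Rightarrow> real \<Rightarrow> nat \<Rightarrow> real poly" where
  "jacobi_p a b n = (\<Sum>i\<le>n. smult (((real n + a) gchoose (n - i)) * ((real n + b) gchoose i)) (jacobi_term i (n - i)))"

lemma poly_jacobi_term: "poly (jacobi_term i j) x = ((x - 1) / 2) ^ i * ((x + 1) / 2) ^ j"
proof -
  have "poly [:-1/2, 1/2:] x = (x - 1) / 2" "poly [:1/2, 1/2:] x = (x + 1) / 2" by (simp_all add: field_simps)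
  then show ?thesis by (simp only: jacobi_term_def poly_mult poly_power)
qed

lemma poly_jacobi_p: "poly (jacobi_p a b n) x = jacobi_poly a b n x"
  unfolding jacobi_p_def jacobi_poly_def by (simp add: poly_sum poly_jacobi_term mult.assoc)

lemma pderiv_jacobi_term:
  "pderiv (jacobi_term i j) = smult (real i / 2) (jacobi_term (i - 1) j) + smult (real j / 2) (jacobi_term i (j - 1))"
proof -
  have P: "pderiv (P ^ k) = smult (real k / 2) (P ^ (k - 1))" if "pderiv P = [:1/2:]" for P :: "real poly" and k
    using that by (simp add: pderiv_power)
  have "pderiv ([:-1/2, 1/2:] ^ i) = smult (real i / 2) ([:-1/2, 1/2:] ^ (i - 1) :: real poly)"
    "pderiv ([:1/2, 1/2:] ^ j) = smult (real j / 2) ([:1/2, 1/2:] ^ (j - 1) :: real poly)"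
    by (intro P; simp add: pderiv_pCons)+
  then show ?thesis unfolding jacobi_term_def pderiv_mult by (simp add: mult.commute add.commute)
qed

lemma pderiv_sum: "pderiv (sum f A) = (\<Sum>x\<in>A. pderiv (f x :: real poly))"
  by (induction A rule: infinite_finite_induct) (simp_all add: pderiv_add)

text \<open>Here 1 - x^2 = -4 u v, and the drift is linear in u and v. Applied to u^i v^j with i + j
  = n, the operator leaves v - u = 1 times two neighbouring terms of total degree n - 1, so that a
  sum over i can telescope.\<close>

lemma jacobi_term_ode:
  fixes a b x :: real
  assumes n: "i + j = n"
  defines "u \<equiv> (x - 1) / 2" and "v \<equiv> (x + 1) / 2"
  shows "(- (a + b + 2) * x + b - a) * poly (pderiv (jacobi_term i j)) x + (1 - x\<^sup>2) * poly (pderiv (pderiv (jacobi_term i j))) x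
      + real n * (real n + a + b + 1) * poly (jacobi_term i j) x =
    real j * (real j + b) * (u ^ i * v ^ (j - 1)) - real i * (real i + a) * (u ^ (i - 1) * v ^ j)"
proof -
  \<comment> \<open>For small i or j the truncated exponents are wrong, but every such power carries
    a factor i, i (i - 1), j or j (j - 1) that vanishes then.\<close>
  define A1 A2 B1 B2 where "A1 = u ^ (i - 1)" and "A2 = u ^ (i - 2)" and "B1 = v ^ (j - 1)" and "B2 = v ^ (j - 2)"
  have ui: "real i * u ^ i = real i * (u * A1)" by (cases i) (auto simp: A1_def)
  have vj: "real j * v ^ j = real j * (v * B1)" by (cases j) (auto simp: B1_def)
  have ii: "real i * real (i - 1) = real i * (real i - 1)" by (cases i) auto
  have jj: "real j * real (j - 1) = real j * (real j - 1)" by (cases j) auto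
  have u2: "real i * (real i - 1) * (u * A2) = real i * (real i - 1) * A1"
    by (cases i; cases "i - 1") (auto simp: A1_def A2_def)
  have v2: "real j * (real j - 1) * (v * B2) = real j * (real j - 1) * B1"
    by (cases j; cases "j - 1") (auto simp: B1_def B2_def)
  have x: "x = u + v" and vu: "v - u = 1" by (auto simp: u_def v_def field_simps)
  have D: "1 - x\<^sup>2 = - 4 * u * v" by (simp add: u_def v_def power2_eq_square field_simps)
  have M: "- (a + b + 2) * x + b - a = - 2 * (a + 1) * v - 2 * (b + 1) * u"
    by (simp add: u_def v_def field_simps)
  have T: "poly (jacobi_term k l) x = u ^ k * v ^ l" for k l by (simp add: poly_jacobi_term u_def v_def)
  have d0: "poly (jacobi_term i j) x = u ^ i * v ^ j" by (simp add: poly_jacobi_term u_def v_def)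
  have d1: "poly (pderiv (jacobi_term i j)) x = real i / 2 * (A1 * v ^ j) + real j / 2 * (u ^ i * B1)"
    by (simp add: pderiv_jacobi_term poly_jacobi_term u_def v_def A1_def B1_def)
  have d2: "poly (pderiv (pderiv (jacobi_term i j))) x =
    real i * (real i - 1) / 4 * (A2 * v ^ j) + real i * real j / 2 * (A1 * B1) + real j * (real j - 1) / 4 * (u ^ i * B2)"
    unfolding ii[symmetric] jj[symmetric]
    by (simp add: pderiv_jacobi_term pderiv_add pderiv_smult T A1_def A2_def B1_def B2_def
        diff_diff_left numeral_2_eq_2 algebra_simps)
  have e1: "u * v * (real i * (real i - 1) * (A2 * v ^ j)) = real i * (real i - 1) * (A1 * (v * v ^ j))"
  proof -
    have "u * v * (real i * (real i - 1) * (A2 * v ^ j)) = (real i * (real i - 1) * (u * A2)) * (v * v ^ j)" by (simp only: mult_ac)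
    then show ?thesis unfolding u2 by (simp only: mult_ac)
  qed
  have e2: "u * v * (real j * (real j - 1) * (u ^ i * B2)) = real j * (real j - 1) * (u * u ^ i * B1)"
  proof -
    have "u * v * (real j * (real j - 1) * (u ^ i * B2)) = (real j * (real j - 1) * (v * B2)) * (u * u ^ i)" by (simp only: mult_ac)
    then show ?thesis unfolding v2 by (simp only: mult_ac)
  qed
  have e3: "u * v * (real i * real j * (A1 * B1)) = real i * real j * (u ^ i * v ^ j)"
  proof -
    have "u * v * (real i * real j * (A1 * B1)) = (real i * (u * A1)) * (real j * (v * B1))" by (simp only: mult_ac)
    then show ?thesis unfolding ui[symmetric] vj[symmetric] by (simp only: mult_ac)
  qed
  have e4: "u * (real i * (A1 * v ^ j)) = real i * (u ^ i * v ^ j)"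
  proof -
    have "u * (real i * (A1 * v ^ j)) = (real i * (u * A1)) * v ^ j" by (simp only: mult_ac)
    then show ?thesis unfolding ui[symmetric] by (simp only: mult_ac)
  qed
  have e5: "v * (real j * (u ^ i * B1)) = real j * (u ^ i * v ^ j)"
  proof -
    have "v * (real j * (u ^ i * B1)) = (real j * (v * B1)) * u ^ i" by (simp only: mult_ac)
    then show ?thesis unfolding vj[symmetric] by (simp only: mult_ac)
  qed
  \<comment> \<open>The powers become opaque, so that the identities e1 to e5 act as rewrite rules
    and the rest is polynomial algebra.\<close>
  define U V p q where "U = u ^ i" and "V = v ^ j" and "p = real i" and "q = real j"
  note e = e1[folded U_def V_def p_def q_def] e2[folded U_def V_def p_def q_def] e3[folded U_def V_def p_def q_def]
    e4[folded U_def V_def p_def q_def] e5[folded U_def V_def p_def q_def]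
  have "(- 2 * (a + 1) * v - 2 * (b + 1) * u) * (p / 2 * (A1 * V) + q / 2 * (U * B1)) +
    (- 4 * u * v) * (p * (p - 1) / 4 * (A2 * V) + p * q / 2 * (A1 * B1) + q * (q - 1) / 4 * (U * B2)) +
    (p + q) * (p + q + a + b + 1) * (U * V) =
    - (a + 1) * v * (p * (A1 * V)) - (b + 1) * (u * (p * (A1 * V))) - (a + 1) * (v * (q * (U * B1))) - (b + 1) * u * (q * (U * B1))
    - u * v * (p * (p - 1) * (A2 * V)) - 2 * (u * v * (p * q * (A1 * B1))) - u * v * (q * (q - 1) * (U * B2))
    + (p + q) * (p + q + a + b + 1) * (U * V)"
    by (simp add: field_simps)
  also have "\<dots> = - (a + 1) * v * (p * (A1 * V)) - (b + 1) * (p * (U * V)) - (a + 1) * (q * (U * V)) - (b + 1) * u * (q * (U * B1))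
    - p * (p - 1) * (A1 * (v * V)) - 2 * (p * q * (U * V)) - q * (q - 1) * (u * U * B1)
    + (p + q) * (p + q + a + b + 1) * (U * V)"
    unfolding e ..
  also have "\<dots> = (p + a) * (p * (U * V)) + (q + b) * (q * (U * V)) - v * (p * (p + a) * (A1 * V)) - u * (q * (q + b) * (U * B1))"
    by (simp add: algebra_simps)
  \<comment> \<open>The terms U V are expanded back with a factor u or v, so that v - u can be
    factored out.\<close>
  also have "\<dots> = (p + a) * (u * (p * (A1 * V))) + (q + b) * (v * (q * (U * B1))) - v * (p * (p + a) * (A1 * V)) - u * (q * (q + b) * (U * B1))"
    unfolding e ..
  also have "\<dots> = (v - u) * (q * (q + b) * (U * B1)) - (v - u) * (p * (p + a) * (A1 * V))"
    by (simp add: algebra_simps)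
  finally show ?thesis
    unfolding D M d0 d1 d2 n[symmetric] of_nat_add vu using vu
    by (simp add: U_def V_def p_def q_def A1_def B1_def)
qed

text \<open>The two neighbours left by \<open>jacobi_term_ode\<close> cancel between consecutive
  indices: c_i A_i = c_(i+1) B_(i+1), by one step in each of the two binomial coefficients. The end
  terms A_n and B_0 are 0.\<close>

lemma jacobi_p_ode:
  "(- (a + b + 2) * x + b - a) * poly (pderiv (jacobi_p a b n)) x + (1 - x\<^sup>2) * poly (pderiv (pderiv (jacobi_p a b n))) x =
    - (real n * (real n + a + b + 1)) * poly (jacobi_p a b n) x"
proof -
  define c where "c i = ((real n + a) gchoose (n - i)) * ((real n + b) gchoose i)" for i
  define u v where "u = (x - 1) / 2" and "v = (x + 1) / 2"
  define A where "A i = real (n - i) * (real (n - i) + b) * (u ^ i * v ^ (n - i - 1))" for i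
  define B where "B i = real i * (real i + a) * (u ^ (i - 1) * v ^ (n - i))" for i
  let ?L = "\<lambda>p. (- (a + b + 2) * x + b - a) * poly (pderiv p) x + (1 - x\<^sup>2) * poly (pderiv (pderiv p)) x
      + real n * (real n + a + b + 1) * poly p x"
  have J: "jacobi_p a b n = (\<Sum>i\<le>n. smult (c i) (jacobi_term i (n - i)))" by (simp add: jacobi_p_def c_def)
  have lin: "m1 * poly (pderiv (\<Sum>i\<le>n. smult (c i) (T i))) x + m2 * poly (pderiv (pderiv (\<Sum>i\<le>n. smult (c i) (T i)))) x
      + m3 * poly (\<Sum>i\<le>n. smult (c i) (T i)) x =
    (\<Sum>i\<le>n. c i * (m1 * poly (pderiv (T i)) x + m2 * poly (pderiv (pderiv (T i))) x + m3 * poly (T i) x))" for m1 m2 m3 T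
    by (simp add: pderiv_sum pderiv_smult poly_sum sum.distrib sum_distrib_left distrib_left mult.left_commute)
  have "?L (jacobi_p a b n) = (\<Sum>i\<le>n. c i * ?L (jacobi_term i (n - i)))"
    unfolding J by (rule lin)
  also have "\<dots> = (\<Sum>i\<le>n. c i * (A i - B i))"
  proof (intro sum.cong refl)
    fix i assume i: "i \<in> {..n}"
    then have "i + (n - i) = n" by simp
    from jacobi_term_ode[OF this, of a b x]
    show "c i * ?L (jacobi_term i (n - i)) = c i * (A i - B i)" by (simp add: A_def B_def u_def v_def)
  qed
  also have "\<dots> = (\<Sum>i\<le>n. c i * A i) - (\<Sum>i\<le>n. c i * B i)"
    by (simp add: right_diff_distrib sum_subtractf)
  also have "(\<Sum>i\<le>n. c i * A i) = (\<Sum>i<n. c i * A i)"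
    by (simp add: lessThan_Suc_atMost[symmetric] A_def)
  also have "\<dots> = (\<Sum>i<n. c (Suc i) * B (Suc i))"
  proof (intro sum.cong refl)
    fix i assume i: "i \<in> {..<n}"
    define k where "k = n - Suc i"
    have k: "n - i = Suc k" "real n = real i + real k + 1" using i by (auto simp: k_def of_nat_diff)
    have g1: "real (Suc k) * ((real n + a) gchoose Suc k) = (real i + 1 + a) * ((real n + a) gchoose k)"
      using gbinomial_step[of k "real n + a"] k by (simp add: algebra_simps)
    have g2: "(real (Suc k) + b) * ((real n + b) gchoose i) = real (Suc i) * ((real n + b) gchoose Suc i)"
      using gbinomial_step[of i "real n + b"] k by (simp add: algebra_simps)
    have "c i * (real (Suc k) * (real (Suc k) + b)) =
      (real (Suc k) * ((real n + a) gchoose Suc k)) * ((real (Suc k) + b) * ((real n + b) gchoose i))"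
      by (simp only: c_def k mult_ac)
    also have "\<dots> = c (Suc i) * (real (Suc i) * (real (Suc i) + a))"
      unfolding g1 g2 by (simp add: c_def k_def[symmetric] mult_ac add_ac)
    finally have "c i * (real (Suc k) * (real (Suc k) + b)) * (u ^ i * v ^ k) = c (Suc i) * (real (Suc i) * (real (Suc i) + a)) * (u ^ i * v ^ k)"
      by simp
    then show "c i * A i = c (Suc i) * B (Suc i)"
      unfolding A_def B_def k_def[symmetric] k(1) by (simp add: mult.assoc del: of_nat_Suc)
  qed
  also have "\<dots> = (\<Sum>i\<le>n. c i * B i)"
    using sum.lessThan_Suc_shift[of "\<lambda>i. c i * B i" n] by (simp add: lessThan_Suc_atMost B_def)
  finally have "?L (jacobi_p a b n) = 0" by simp
  then show ?thesis by (simp add: algebra_simps)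
qed

text \<open>At x = 1 only the term i = 0 survives; its binomial coefficient is a product of positive
  factors when a > -1.\<close>

lemma jacobi_p_nonzero:
  assumes "a > -1"
  shows "jacobi_p a b n \<noteq> 0"
proof -
  have "poly (jacobi_p a b n) 1 = (\<Sum>i\<le>n. if i = 0 then (real n + a) gchoose n else 0)"
    unfolding poly_jacobi_p jacobi_poly_def by (intro sum.cong refl) (auto simp: power_0_left)
  also have "\<dots> = ((real n + a) gchoose n)" by simp
  also have "\<dots> > 0"
    unfolding gbinomial_prod_rev using assms by (intro divide_pos_pos prod_pos) auto
  finally show ?thesis by auto
qed

section \<open>Common description of the three families\<close>

fun lower_end :: "pearson \<Rightarrow> ereal" where
  "lower_end (OU \<theta> v \<mu>\<^sub>0) = -\<infinity>"
| "lower_end (CIR \<theta> a b) = ereal 0"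
| "lower_end (Jacobi a b) = ereal (-1)"

fun upper_end :: "pearson \<Rightarrow> ereal" where
  "upper_end (OU \<theta> v \<mu>\<^sub>0) = \<infinity>"
| "upper_end (CIR \<theta> a b) = \<infinity>"
| "upper_end (Jacobi a b) = ereal 1"

lemma state_space_eq_einterval: "state_space d = einterval (lower_end d) (upper_end d)"
  by (cases d) (auto simp: einterval_def)

lemma lower_less_upper: "lower_end d < upper_end d"
  by (cases d) auto

lemma state_space_open: "open (state_space d)" and state_space_borel [measurable]: "state_space d \<in> sets borel"
  by (cases d; simp)+

fun classical_p :: "pearson \<Rightarrow> nat \<Rightarrow> real poly" where
  "classical_p (OU \<theta> v \<mu>\<^sub>0) n = pcompose (hermite_p n) [:- \<mu>\<^sub>0 / sqrt v, 1 / sqrt v:]"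
| "classical_p (CIR \<theta> a b) n = pcompose (laguerre_p (b - 1) n) [:0, a:]"
| "classical_p (Jacobi a b) n = jacobi_p a b n"

lemma poly_classical_p: "poly (classical_p d n) x = classical_poly d n x"
  by (cases d) (simp_all add: poly_pcompose poly_hermite_p poly_laguerre_p poly_jacobi_p diff_divide_distrib mult.commute)

lemma classical_p_nonzero: "admissible d \<Longrightarrow> classical_p d n \<noteq> 0"
  by (cases d) (auto simp: hermite_p_nonzero laguerre_p_nonzero jacobi_p_nonzero pcompose_eq_0_iff)

lemma classical_p_ode:
  assumes adm: "admissible d"
  shows "drift d x * poly (pderiv (classical_p d n)) x + diffusion_coeff d x * poly (pderiv (pderiv (classical_p d n))) x =
    - eigenvalue d n * poly (classical_p d n) x"
proof (cases d)
  case (OU \<theta> v \<mu>\<^sub>0)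
  define s where "s = sqrt v"
  have s: "s > 0" "s * s = v" using adm OU by (auto simp: s_def)
  define z where "z = (x - \<mu>\<^sub>0) / s"
  have x: "x - \<mu>\<^sub>0 = s * z" using s by (simp add: z_def)
  have z: "- \<mu>\<^sub>0 / s + x * (1 / s) = z" using s by (simp add: z_def diff_divide_distrib)
  let ?H = "hermite_p n"
  have d1: "poly (pderiv (classical_p d n)) x = poly (pderiv ?H) z / s"
    and d2: "poly (pderiv (pderiv (classical_p d n))) x = poly (pderiv (pderiv ?H)) z / (s * s)"
    and d0: "poly (classical_p d n) x = poly ?H z"
    unfolding OU using s z
    by (simp_all add: s_def[symmetric] pderiv_pcompose pderiv_mult pderiv_smult pderiv_pCons poly_pcompose)
  have "drift d x * (poly (pderiv ?H) z / s) + diffusion_coeff d x * (poly (pderiv (pderiv ?H)) z / (s * s)) =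
      \<theta> * (poly (pderiv (pderiv ?H)) z - z * poly (pderiv ?H) z)"
    unfolding OU using s x adm OU by (simp add: right_diff_distrib)
  then show ?thesis unfolding d0 d1 d2 hermite_p_ode by (simp add: OU)
next
  case (CIR \<theta> a b)
  have a: "a > 0" using adm CIR by simp
  let ?L = "laguerre_p (b - 1) n"
  have d1: "poly (pderiv (classical_p d n)) x = poly (pderiv ?L) (a * x) * a"
    and d2: "poly (pderiv (pderiv (classical_p d n))) x = poly (pderiv (pderiv ?L)) (a * x) * a * a"
    and d0: "poly (classical_p d n) x = poly ?L (a * x)"
    unfolding CIR by (simp_all add: pderiv_pcompose pderiv_mult pderiv_smult pderiv_pCons poly_pcompose mult_ac)
  have "drift d x * (poly (pderiv ?L) (a * x) * a) + diffusion_coeff d x * (poly (pderiv (pderiv ?L)) (a * x) * a * a) =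
      \<theta> * ((a * x) * poly (pderiv (pderiv ?L)) (a * x) + ((b - 1) + 1 - a * x) * poly (pderiv ?L) (a * x))"
    unfolding CIR using a by (simp add: field_simps)
  then show ?thesis unfolding d0 d1 d2 laguerre_p_ode by (simp add: CIR)
next
  case (Jacobi a b)
  then show ?thesis using jacobi_p_ode[of a b x n] by simp
qed

lemma density_measurable [measurable]: "stationary_density d \<in> borel_measurable borel"
proof (cases d)
  case (OU \<theta> v \<mu>\<^sub>0)
  have "stationary_density d = (\<lambda>x. 1 / sqrt (2 * pi * v) * exp (- (x - \<mu>\<^sub>0)\<^sup>2 / (2 * v)))" by (simp add: OU fun_eq_iff)
  then show ?thesis by simp
next
  case (CIR \<theta> a b)
  have "stationary_density d = (\<lambda>x. a powr b / Gamma b * x powr (b - 1) * exp (- a * x))" by (simp add: CIR fun_eq_iff)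
  then show ?thesis by simp
next
  case (Jacobi a b)
  have "stationary_density d = (\<lambda>x. (1 - x) powr a * (1 + x) powr b / (Beta (a + 1) (b + 1) * 2 powr (a + b + 1)))"
    by (simp add: Jacobi fun_eq_iff)
  then show ?thesis by simp
qed

lemma Beta_real_pos: "a > 0 \<Longrightarrow> b > 0 \<Longrightarrow> Beta a b > (0::real)"
  unfolding Beta_def by (intro divide_pos_pos mult_pos_pos Gamma_real_pos) auto

lemma density_pos: "admissible d \<Longrightarrow> x \<in> state_space d \<Longrightarrow> 0 < stationary_density d x"
  by (cases d) (auto intro!: mult_pos_pos divide_pos_pos Gamma_real_pos Beta_real_pos)

lemma diffusion_pos: "admissible d \<Longrightarrow> x \<in> state_space d \<Longrightarrow> 0 < diffusion_coeff d x"
proof (cases d)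
  case (Jacobi a b)
  assume "x \<in> state_space d"
  then have "\<bar>x\<bar> < 1" using Jacobi by auto
  then show ?thesis using Jacobi by (simp add: abs_square_less_1)
qed auto

lemma drift_continuous: "continuous_on A (drift d)" and diffusion_continuous: "continuous_on A (diffusion_coeff d)"
proof -
  have "continuous_on A (drift d) \<and> continuous_on A (diffusion_coeff d)"
  proof (cases d)
    case (OU \<theta> v \<mu>\<^sub>0)
    have "drift d = (\<lambda>x. - \<theta> * (x - \<mu>\<^sub>0))" "diffusion_coeff d = (\<lambda>x. \<theta> * v)" by (auto simp: OU)
    then show ?thesis by (auto intro!: continuous_intros)
  next
    case (CIR \<theta> a b)
    have "drift d = (\<lambda>x. - \<theta> * (x - b / a))" "diffusion_coeff d = (\<lambda>x. \<theta> / a * x)" by (auto simp: CIR)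
    then show ?thesis by (simp only:) (intro conjI continuous_intros)
  next
    case (Jacobi a b)
    have "drift d = (\<lambda>x. - (a + b + 2) * x + b - a)" "diffusion_coeff d = (\<lambda>x. 1 - x\<^sup>2)" by (auto simp: Jacobi)
    then show ?thesis by (simp only:) (intro conjI continuous_intros)
  qed
  then show "continuous_on A (drift d)" "continuous_on A (diffusion_coeff d)" by auto
qed

lemma density_deriv:
  assumes adm: "admissible d" and x: "x \<in> state_space d"
  shows "(stationary_density d has_real_derivative (case d of OU \<theta> v \<mu>\<^sub>0 \<Rightarrow> - (x - \<mu>\<^sub>0) / v
    | CIR \<theta> a b \<Rightarrow> (b - 1) / x - a | Jacobi a b \<Rightarrow> b / (1 + x) - a / (1 - x)) * stationary_density d x) (at x)"
proof (cases d)
  case (OU \<theta> v \<mu>\<^sub>0)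
  define c where "c = 1 / sqrt (2 * pi * v)"
  have "stationary_density d = (\<lambda>x. c * exp (- (x - \<mu>\<^sub>0)\<^sup>2 / (2 * v)))" by (simp add: OU c_def fun_eq_iff)
  moreover have "((\<lambda>x. c * exp (- (x - \<mu>\<^sub>0)\<^sup>2 / (2 * v))) has_real_derivative
     - (x - \<mu>\<^sub>0) / v * (c * exp (- (x - \<mu>\<^sub>0)\<^sup>2 / (2 * v)))) (at x)"
    using adm OU by (auto intro!: derivative_eq_intros simp: field_simps power2_eq_square)
  ultimately show ?thesis using OU by simp
next
  case (CIR \<theta> a b)
  then have x0: "x > 0" using x by simp
  define c where "c = a powr b / Gamma b"
  have "stationary_density d = (\<lambda>x. c * x powr (b - 1) * exp (- a * x))" by (simp add: CIR c_def fun_eq_iff)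
  moreover have "((\<lambda>x. c * x powr (b - 1) * exp (- a * x)) has_real_derivative
     ((b - 1) / x - a) * (c * x powr (b - 1) * exp (- a * x))) (at x)"
  proof -
    have p: "x powr (b - 1 - 1) = x powr (b - 1) / x" using x0 by (simp only: powr_diff[of x "b - 1" 1] powr_one)
    have "((\<lambda>x. x powr (b - 1)) has_real_derivative (b - 1) * x powr (b - 1 - 1)) (at x)"
      using x0 by (rule has_real_derivative_powr)
    then have "((\<lambda>x. c * x powr (b - 1) * exp (- a * x)) has_real_derivative
       c * ((b - 1) * x powr (b - 1 - 1)) * exp (- a * x) + (exp (- a * x) * (- a)) * (c * x powr (b - 1))) (at x)"
      by (intro DERIV_mult DERIV_cmult) (auto intro!: derivative_eq_intros)
    then show ?thesis unfolding p using x0 by (simp add: algebra_simps power2_eq_square)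
  qed
  ultimately show ?thesis using CIR by simp
next
  case (Jacobi a b)
  then have x1: "x < 1" "- 1 < x" using x by auto
  define c where "c = 1 / (Beta (a + 1) (b + 1) * 2 powr (a + b + 1))"
  have "stationary_density d = (\<lambda>x. (1 - x) powr a * (1 + x) powr b * c)" by (simp add: Jacobi c_def fun_eq_iff)
  moreover have "((\<lambda>x. (1 - x) powr a * (1 + x) powr b * c) has_real_derivative
     (b / (1 + x) - a / (1 - x)) * ((1 - x) powr a * (1 + x) powr b * c)) (at x)"
  proof -
    have p: "(1 - x) powr (a - of_nat 1) = (1 - x) powr a / (1 - x)" "(1 + x) powr (b - of_nat 1) = (1 + x) powr b / (1 + x)"
      using x1 by (simp_all add: powr_diff)
    have "((\<lambda>x. (1 - x) powr a) has_real_derivative a * (1 - x) powr (a - of_nat 1) * (- 1)) (at x)"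
      "((\<lambda>x. (1 + x) powr b) has_real_derivative b * (1 + x) powr (b - of_nat 1) * 1) (at x)"
      using x1 by (auto intro!: DERIV_fun_powr derivative_eq_intros)
    then have "((\<lambda>x. (1 - x) powr a * (1 + x) powr b * c) has_real_derivative
      (a * (1 - x) powr (a - of_nat 1) * (- 1) * (1 + x) powr b + b * (1 + x) powr (b - of_nat 1) * 1 * (1 - x) powr a) * c) (at x)"
      by (intro DERIV_mult DERIV_cmult_right)
    then show ?thesis unfolding p by (simp add: algebra_simps)
  qed
  ultimately show ?thesis using Jacobi by simp
qed

text \<open>The stationary Fokker-Planck equation integrated once, that is, zero probability flux.
  It makes the generator symmetric in L2 of the stationary density.\<close>

lemma diffusion_density_deriv:
  assumes adm: "admissible d" and x: "x \<in> state_space d"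
  shows "((\<lambda>x. diffusion_coeff d x * stationary_density d x) has_real_derivative drift d x * stationary_density d x) (at x)"
proof (cases d)
  case (OU \<theta> v \<mu>\<^sub>0)
  have "diffusion_coeff d = (\<lambda>x. \<theta> * v)" by (simp add: OU fun_eq_iff)
  moreover have "((\<lambda>x. \<theta> * v * stationary_density d x) has_real_derivative \<theta> * v * (- (x - \<mu>\<^sub>0) / v * stationary_density d x)) (at x)"
    using DERIV_cmult[OF density_deriv[OF adm x], of "\<theta> * v"] unfolding OU pearson.case .
  moreover have "\<theta> * v * (- (x - \<mu>\<^sub>0) / v * stationary_density d x) = drift d x * stationary_density d x"
  proof -
    have "\<theta> * v * (- (x - \<mu>\<^sub>0) / v) = drift d x" using adm by (simp add: OU) (simp add: algebra_simps)
    then show ?thesis by (simp only: mult.assoc[symmetric])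
  qed
  ultimately show ?thesis by simp
next
  case (CIR \<theta> a b)
  have D: "diffusion_coeff d = (\<lambda>x. (\<theta> / a) * x)" by (simp add: CIR fun_eq_iff)
  have "((\<lambda>x. (\<theta> / a) * x) has_real_derivative (\<theta> / a)) (at x)" by (rule DERIV_cmult_Id)
  from DERIV_mult[OF this density_deriv[OF adm x]] have
    "((\<lambda>x. (\<theta> / a) * x * stationary_density d x) has_real_derivative (\<theta> / a) * stationary_density d x +
      ((b - 1) / x - a) * stationary_density d x * ((\<theta> / a) * x)) (at x)" by (simp add: CIR)
  moreover have "(\<theta> / a) * stationary_density d x + ((b - 1) / x - a) * stationary_density d x * ((\<theta> / a) * x) =
    drift d x * stationary_density d x"
  proof -
    have "(\<theta> / a) + ((b - 1) / x - a) * ((\<theta> / a) * x) = drift d x"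
      using x adm unfolding CIR by (simp add: field_simps)
    then have "((\<theta> / a) + ((b - 1) / x - a) * ((\<theta> / a) * x)) * stationary_density d x = drift d x * stationary_density d x" by simp
    then show ?thesis by (simp only: distrib_right distrib_left mult_ac)
  qed
  ultimately show ?thesis unfolding D by simp
next
  case (Jacobi a b)
  have D: "diffusion_coeff d = (\<lambda>x. 1 - x\<^sup>2)" by (simp add: Jacobi fun_eq_iff)
  have "((\<lambda>x. 1 - x\<^sup>2) has_real_derivative - 2 * x) (at x)" by (auto intro!: derivative_eq_intros)
  from DERIV_mult[OF this density_deriv[OF adm x]] have
    "((\<lambda>x. (1 - x\<^sup>2) * stationary_density d x) has_real_derivative - 2 * x * stationary_density d x +
      (b / (1 + x) - a / (1 - x)) * stationary_density d x * (1 - x\<^sup>2)) (at x)" by (simp add: Jacobi)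
  moreover have "- 2 * x * stationary_density d x + (b / (1 + x) - a / (1 - x)) * stationary_density d x * (1 - x\<^sup>2) =
    drift d x * stationary_density d x"
  proof -
    have f: "1 - x\<^sup>2 = (1 + x) * (1 - x)" by (simp add: power2_eq_square algebra_simps)
    have "- 2 * x + (b / (1 + x) - a / (1 - x)) * (1 - x\<^sup>2) = - 2 * x + b * (1 - x) - a * (1 + x)"
      using x unfolding Jacobi f by (simp add: left_diff_distrib)
    also have "\<dots> = drift d x" unfolding Jacobi by (simp add: algebra_simps)
    finally have "(- 2 * x + (b / (1 + x) - a / (1 - x)) * (1 - x\<^sup>2)) * stationary_density d x = drift d x * stationary_density d x" by simp
    then show ?thesis by (simp only: distrib_right distrib_left mult_ac)
  qed
  ultimately show ?thesis unfolding D by simp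
qed

lemma density_continuous: "admissible d \<Longrightarrow> continuous_on (state_space d) (stationary_density d)"
  using density_deriv by (intro continuous_at_imp_continuous_on ballI) (rule DERIV_isCont)

section \<open>Integrability and boundary behaviour of polynomials against the density\<close>

lemma set_integrable_poly_if_monomials:
  assumes "\<And>k. set_integrable lborel S (\<lambda>x. (x - c) ^ k * m x :: real)"
  shows "set_integrable lborel S (\<lambda>x. poly p x * m x)"
proof -
  \<comment> \<open>The expansion is about c, because Gaussian moments are available about the
    mean.\<close>
  define q where "q = pcompose p [:c, 1:]"
  have "poly p x = (\<Sum>i\<le>degree q. coeff q i * (x - c) ^ i)" for x
  proof -
    have "poly p x = poly q (x - c)" by (simp add: q_def poly_pcompose)
    then show ?thesis by (simp add: poly_altdef)
  qed
  then have "(\<lambda>x. poly p x * m x) = (\<lambda>x. \<Sum>i\<le>degree q. coeff q i * ((x - c) ^ i * m x))"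
    by (simp add: sum_distrib_right mult.assoc)
  moreover have "set_integrable lborel S (\<lambda>x. \<Sum>i\<le>degree q. coeff q i * ((x - c) ^ i * m x))"
    using set_integrable_mult_right[OF assms] unfolding set_integrable_def scaleR_sum_right
    by (intro Bochner_Integration.integrable_sum) auto
  ultimately show ?thesis by simp
qed

lemma poly_density_integrable:
  assumes adm: "admissible d"
  shows "set_integrable lborel (state_space d) (\<lambda>x. poly p x * stationary_density d x)"
proof (cases d)
  case (OU \<theta> v \<mu>\<^sub>0)
  have v: "v > 0" using adm OU by simp
  have n: "stationary_density d x = normal_density \<mu>\<^sub>0 (sqrt v) x" for x
    using v by (simp add: OU normal_density_def)
  have "integrable lborel (\<lambda>x. normal_density \<mu>\<^sub>0 (sqrt v) x * (x - \<mu>\<^sub>0) ^ k)" for k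
  proof (cases "even k")
    case True
    then obtain j where "k = 2 * j" by blast
    then show ?thesis using normal_moment_even[of "sqrt v" \<mu>\<^sub>0 j] v by (auto simp: has_bochner_integral_iff)
  next
    case False
    then obtain j where "k = 2 * j + 1" by (blast elim: oddE)
    then show ?thesis using normal_moment_odd[of "sqrt v" \<mu>\<^sub>0 j] v by (auto simp: has_bochner_integral_iff)
  qed
  then have "set_integrable lborel (state_space d) (\<lambda>x. (x - \<mu>\<^sub>0) ^ k * stationary_density d x)" for k
    unfolding OU n[unfolded OU] by (simp add: set_integrable_def mult.commute)
  then show ?thesis by (rule set_integrable_poly_if_monomials)
next
  case (CIR \<theta> a b)
  have ab: "a > 0" "b > 0" using adm CIR by auto
  have "set_integrable lborel (state_space d) (\<lambda>x. (x - 0) ^ k * stationary_density d x)" for k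
  proof -
    define e where "e = b + real k"
    have e: "e > 0" using ab by (simp add: e_def)
    have G: "Gamma e > 0" "Gamma b > 0" using e ab by (auto intro: Gamma_real_pos)
    \<comment> \<open>Up to a constant, the k-th moment of the Gamma density is the Laplace
      transform at a of the fractional kernel of order b + k.\<close>
    have int: "integrable lborel (\<lambda>x. frac_kernel e x * exp (- a * x))"
    proof (rule integrableI_bounded)
      have "(\<integral>\<^sup>+x. ennreal (norm (frac_kernel e x * exp (- a * x))) \<partial>lborel) =
        (\<integral>\<^sup>+x. ennreal (frac_kernel e x) * ennreal (exp (- a * x)) \<partial>lborel)"
        using frac_kernel_nonneg[OF e] by (intro nn_integral_cong) (simp add: abs_mult ennreal_mult[symmetric])
      also have "\<dots> = ennreal (a powr (- e))" by (rule laplace_frac_kernel[OF e ab(1)])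
      finally show "(\<integral>\<^sup>+x. ennreal (norm (frac_kernel e x * exp (- a * x))) \<partial>lborel) < \<infinity>" by simp
    qed measurable
    have "indicator (state_space d) x *\<^sub>R ((x - 0) ^ k * stationary_density d x) =
      (a powr b / Gamma b * Gamma e) * (frac_kernel e x * exp (- a * x))" for x
    proof (cases "x > 0")
      case True
      have "x ^ k * x powr (b - 1) = x powr (e - 1)"
        using True by (simp add: powr_realpow[symmetric] powr_add[symmetric] e_def algebra_simps)
      then show ?thesis using True G by (simp add: CIR frac_kernel_def)
    qed (simp add: CIR frac_kernel_def)
    then show ?thesis unfolding set_integrable_def using integrable_mult_right[OF int] by simp
  qed
  then show ?thesis by (rule set_integrable_poly_if_monomials)
next
  case (Jacobi a b)
  have ab: "a > -1" "b > -1" using adm Jacobi by auto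
  define c where "c = 1 / (Beta (a + 1) (b + 1) * 2 powr (a + b + 1))"
  have c: "c > 0" using ab by (auto simp: c_def intro!: mult_pos_pos Beta_real_pos)
  \<comment> \<open>The density without its normalisation; x = -1 + 2 u turns its integral into a
    Beta integral. As |x| < 1, the function w times a constant dominates every monomial times the
    density.\<close>
  define w where "w x = indicator {-1<..<1} x * ((1 - x) powr a * (1 + x) powr b)" for x :: real
  have [measurable]: "w \<in> borel_measurable borel" unfolding w_def[abs_def] by measurable
  have w0: "0 \<le> w x" for x by (simp add: w_def)
  have int: "integrable lborel w"
  proof (rule integrableI_bounded)
    have "(\<integral>\<^sup>+x. ennreal (norm (w x)) \<partial>lborel) = ennreal \<bar>2\<bar> * (\<integral>\<^sup>+u. ennreal (norm (w (-1 + 2 * u))) \<partial>lborel)"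
      by (rule nn_integral_real_affine) auto
    also have "(\<integral>\<^sup>+u. ennreal (norm (w (-1 + 2 * u))) \<partial>lborel) =
      (\<integral>\<^sup>+u. ennreal (2 powr (a + b)) * (ennreal ((1 - u) powr (a + 1 - 1) * u powr (b + 1 - 1)) * indicator {0<..<1} u) \<partial>lborel)"
    proof (rule nn_integral_cong)
      fix u :: real
      show "ennreal (norm (w (-1 + 2 * u))) = ennreal (2 powr (a + b)) * (ennreal ((1 - u) powr (a + 1 - 1) * u powr (b + 1 - 1)) * indicator {0<..<1} u)"
      proof (cases "u \<in> {0<..<1}")
        case True
        have e: "1 - (-1 + 2 * u) = 2 * (1 - u)" "1 + (-1 + 2 * u) = 2 * u" by auto
        have "w (-1 + 2 * u) = 2 powr (a + b) * ((1 - u) powr (a + 1 - 1) * u powr (b + 1 - 1))"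
        proof -
          have "(2 * (1 - u)) powr a = 2 powr a * (1 - u) powr a" "(2 * u) powr b = 2 powr b * u powr b"
            using True by (intro powr_mult; simp)+
          then show ?thesis unfolding w_def e using True by (simp add: powr_add)
        qed
        then show ?thesis using True by (simp add: ennreal_mult[symmetric])
      qed (auto simp: w_def indicator_def)
    qed
    also have "\<dots> = ennreal (2 powr (a + b)) * ennreal (Beta (a + 1) (b + 1))"
      by (subst nn_integral_cmult, simp, subst nn_integral_Beta) (use ab in auto)
    finally show "(\<integral>\<^sup>+x. ennreal (norm (w x)) \<partial>lborel) < \<infinity>" by (simp add: ennreal_mult_less_top)
  qed measurable
  have "set_integrable lborel (state_space d) (\<lambda>x. (x - 0) ^ k * stationary_density d x)" for k
    unfolding set_integrable_def
  proof (rule Bochner_Integration.integrable_bound[OF integrable_mult_left[OF int, of c]])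
    show "AE x in lborel. norm (indicator (state_space d) x *\<^sub>R ((x - 0) ^ k * stationary_density d x)) \<le> norm (w x * c)"
    proof (rule AE_I2)
      fix x :: real
      show "norm (indicator (state_space d) x *\<^sub>R ((x - 0) ^ k * stationary_density d x)) \<le> norm (w x * c)"
      proof (cases "x \<in> {-1<..<1}")
        case True
        have m: "stationary_density d x = w x * c" using True by (simp add: Jacobi w_def c_def)
        have "\<bar>x\<bar> ^ k \<le> 1" using True by (intro power_le_one) auto
        then have "\<bar>x\<bar> ^ k * (w x * c) \<le> 1 * (w x * c)" using w0 c by (intro mult_right_mono) auto
        then show ?thesis using w0[of x] c by (simp add: m abs_mult power_abs indicator_def)
      qed (simp add: Jacobi)
    qed
  qed measurable
  then show ?thesis by (rule set_integrable_poly_if_monomials)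
qed

lemma poly_exp_tendsto_0:
  assumes c: "c > (0::real)"
  shows "((\<lambda>x. poly p x * exp (- c * x)) \<longlongrightarrow> 0) at_top"
proof -
  have "((\<lambda>x. x ^ k * exp (- c * x)) \<longlongrightarrow> 0) at_top" for k
  proof -
    have "filterlim (\<lambda>x. c * x) at_top at_top" using c by real_asymp
    from filterlim_compose[OF tendsto_power_div_exp_0[of k] this]
    have "((\<lambda>x. (1 / c ^ k) * ((c * x) ^ k / exp (c * x))) \<longlongrightarrow> (1 / c ^ k) * 0) at_top" by (intro tendsto_mult tendsto_const)
    moreover have "(1 / c ^ k) * ((c * x) ^ k / exp (c * x)) = x ^ k * exp (- c * x)" for x
      using c by (simp add: power_mult_distrib exp_minus field_simps)
    ultimately show ?thesis by simp
  qed
  then have "((\<lambda>x. \<Sum>i\<le>degree p. coeff p i * (x ^ i * exp (- c * x))) \<longlongrightarrow> (\<Sum>i\<le>degree p. coeff p i * 0)) at_top"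
    by (intro tendsto_sum tendsto_mult tendsto_const)
  then show ?thesis by (simp add: poly_altdef sum_distrib_right mult.assoc)
qed

lemma poly_gauss_tendsto_0:
  assumes v: "v > (0::real)"
  shows "((\<lambda>x. poly p x * exp (- (x - \<mu>\<^sub>0)\<^sup>2 / (2 * v))) \<longlongrightarrow> 0) at_top"
proof -
  \<comment> \<open>One factor exp (-x) is split off to absorb the polynomial; the Gaussian still
    beats the compensating exp x.\<close>
  have "((\<lambda>x. exp (x - (x - \<mu>\<^sub>0)\<^sup>2 / (2 * v))) \<longlongrightarrow> 0) at_top" using v by real_asymp
  from tendsto_mult[OF poly_exp_tendsto_0[of 1 p] this]
  have "((\<lambda>x. poly p x * exp (- 1 * x) * exp (x - (x - \<mu>\<^sub>0)\<^sup>2 / (2 * v))) \<longlongrightarrow> 0) at_top" by simp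
  moreover have "poly p x * exp (- 1 * x) * exp (x - (x - \<mu>\<^sub>0)\<^sup>2 / (2 * v)) = poly p x * exp (- (x - \<mu>\<^sub>0)\<^sup>2 / (2 * v))" for x
  proof -
    have "exp (- 1 * x) * exp (x - (x - \<mu>\<^sub>0)\<^sup>2 / (2 * v)) = exp (- (x - \<mu>\<^sub>0)\<^sup>2 / (2 * v))"
      by (simp add: exp_add[symmetric])
    then show ?thesis by (simp only: mult.assoc)
  qed
  ultimately show ?thesis by (simp only:)
qed

text \<open>These are the boundary terms of Green's formula. At a finite endpoint the density itself
  may blow up, but the diffusion coefficient adds one power there: x^(b-1) becomes x^b, and the
  Jacobi exponents become a + 1 and b + 1, all positive. The form with extended reals is that of the
  fundamental theorem on open intervals.\<close>

lemma poly_density_boundary: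
  assumes adm: "admissible d"
  defines "f \<equiv> \<lambda>p x. diffusion_coeff d x * stationary_density d x * poly p x"
  shows "((f p \<circ> real_of_ereal) \<longlongrightarrow> 0) (at_right (lower_end d))"
    and "((f p \<circ> real_of_ereal) \<longlongrightarrow> 0) (at_left (upper_end d))"
proof -
  have "((f p \<circ> real_of_ereal) \<longlongrightarrow> 0) (at_right (lower_end d)) \<and> ((f p \<circ> real_of_ereal) \<longlongrightarrow> 0) (at_left (upper_end d))"
  proof (cases d)
    case (OU \<theta> v \<mu>\<^sub>0)
    have v: "v > 0" using adm OU by simp
    define c where "c = \<theta> * v * (1 / sqrt (2 * pi * v))"
    have f: "f p = (\<lambda>x. c * (poly p x * exp (- (x - \<mu>\<^sub>0)\<^sup>2 / (2 * v))))"
      by (simp add: f_def OU c_def fun_eq_iff)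
    have "((\<lambda>x. c * (poly p x * exp (- (x - \<mu>\<^sub>0)\<^sup>2 / (2 * v)))) \<longlongrightarrow> c * 0) at_top"
      by (intro tendsto_mult tendsto_const poly_gauss_tendsto_0 v)
    moreover have "((\<lambda>x. c * (poly p x * exp (- (x - \<mu>\<^sub>0)\<^sup>2 / (2 * v)))) \<longlongrightarrow> 0) at_bot"
    proof (subst filterlim_at_bot_mirror)
      have "((\<lambda>x. c * (poly (pcompose p [:0, -1:]) x * exp (- (x - (- \<mu>\<^sub>0))\<^sup>2 / (2 * v)))) \<longlongrightarrow> c * 0) at_top"
        by (intro tendsto_mult tendsto_const poly_gauss_tendsto_0 v)
      moreover have "(x - (- \<mu>\<^sub>0))\<^sup>2 = (- x - \<mu>\<^sub>0)\<^sup>2" for x by (simp add: power2_eq_square algebra_simps)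
      ultimately show "((\<lambda>x. c * (poly p (- x) * exp (- (- x - \<mu>\<^sub>0)\<^sup>2 / (2 * v)))) \<longlongrightarrow> 0) at_top"
        by (simp add: poly_pcompose)
    qed
    ultimately show ?thesis unfolding f by (simp add: OU ereal_tendsto_simps)
  next
    case (CIR \<theta> a b)
    have ab: "a > 0" "b > 0" using adm CIR by auto
    define c where "c = (\<theta> / a) * (a powr b / Gamma b)"
    have f: "f p x = c * (x powr b * exp (- a * x) * poly p x)" if "x > 0" for x
    proof -
      have "x * x powr (b - 1) = x powr b" using that by (simp add: powr_diff)
      then have "c * (x * x powr (b - 1) * exp (- a * x) * poly p x) = c * (x powr b * exp (- a * x) * poly p x)" by simp
      then show ?thesis by (simp add: f_def CIR c_def mult_ac)
    qed
    have "((\<lambda>x. c * (x powr b * exp (- a * x) * poly p x)) \<longlongrightarrow> c * (0 powr b * exp (- a * 0) * poly p 0)) (at_right 0)"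
    proof (intro tendsto_mult tendsto_const)
      show "((\<lambda>x. x powr b) \<longlongrightarrow> 0 powr b) (at_right 0)"
        by (rule tendsto_powr2) (use ab in \<open>auto simp: eventually_at_filter\<close>)
      show "((\<lambda>x. exp (- a * x)) \<longlongrightarrow> exp (- a * 0)) (at_right 0)" by (intro tendsto_intros)
      show "(poly p \<longlongrightarrow> poly p 0) (at_right 0)" by (intro tendsto_intros)
    qed
    then have 1: "(f p \<longlongrightarrow> 0) (at_right 0)"
      by (subst tendsto_cong[of _ "\<lambda>x. c * (x powr b * exp (- a * x) * poly p x)"])
         (use f in \<open>auto simp: eventually_at_filter\<close>)
    have "((\<lambda>x. x powr b * exp (- (a / 2) * x)) \<longlongrightarrow> 0) at_top" using ab by real_asymp
    moreover have "((\<lambda>x. poly p x * exp (- (a / 2) * x)) \<longlongrightarrow> 0) at_top" using ab by (intro poly_exp_tendsto_0) auto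
    ultimately have "((\<lambda>x. c * ((x powr b * exp (- (a / 2) * x)) * (poly p x * exp (- (a / 2) * x)))) \<longlongrightarrow> c * (0 * 0)) at_top"
      by (intro tendsto_mult tendsto_const)
    moreover have "\<forall>\<^sub>F x in at_top. c * ((x powr b * exp (- (a / 2) * x)) * (poly p x * exp (- (a / 2) * x))) = f p x"
      using eventually_gt_at_top[of 0]
    proof (rule eventually_mono)
      fix x :: real assume "0 < x"
      have "exp (- a * x) = exp (- (a / 2) * x) * exp (- (a / 2) * x)" by (simp add: exp_add[symmetric])
      then show "c * ((x powr b * exp (- (a / 2) * x)) * (poly p x * exp (- (a / 2) * x))) = f p x"
        unfolding f[OF \<open>0 < x\<close>] by (simp add: mult_ac)
    qed
    ultimately have 2: "(f p \<longlongrightarrow> 0) at_top" by (simp add: tendsto_cong)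
    show ?thesis using 1 2 by (simp add: CIR ereal_tendsto_simps)
  next
    case (Jacobi a b)
    have ab: "a > -1" "b > -1" using adm Jacobi by auto
    define c where "c = 1 / (Beta (a + 1) (b + 1) * 2 powr (a + b + 1))"
    have f: "f p x = (1 - x) powr (a + 1) * (1 + x) powr (b + 1) * (c * poly p x)" if "-1 < x" "x < 1" for x
    proof -
      have "1 - x\<^sup>2 = (1 - x) * (1 + x)" by (simp add: power2_eq_square algebra_simps)
      moreover have "(1 - x) powr (a + 1) = (1 - x) * (1 - x) powr a" "(1 + x) powr (b + 1) = (1 + x) * (1 + x) powr b"
        using that by (simp_all add: powr_add mult.commute)
      ultimately show ?thesis by (simp add: f_def Jacobi c_def)
    qed
    have g: "((\<lambda>x. (1 - x) powr (a + 1) * (1 + x) powr (b + 1) * (c * poly p x)) \<longlongrightarrow>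
        (1 - x0) powr (a + 1) * (1 + x0) powr (b + 1) * (c * poly p x0)) (at x0 within T)"
      if "\<forall>\<^sub>F x in at x0 within T. 0 \<le> 1 - x" "\<forall>\<^sub>F x in at x0 within T. 0 \<le> 1 + x" for x0 T
      using ab that by (intro tendsto_mult tendsto_const tendsto_powr' tendsto_intros) auto
    have 1: "(f p \<longlongrightarrow> 0) (at_right (-1))"
    proof -
      have ev: "\<forall>\<^sub>F x in at_right (-1::real). -1 < x \<and> x < 1"
        by (auto simp: eventually_at_right_field intro!: exI[of _ 1])
      have "((\<lambda>x. (1 - x) powr (a + 1) * (1 + x) powr (b + 1) * (c * poly p x)) \<longlongrightarrow> 0) (at_right (-1))"
        using g[where T="{-1<..}", of "-1"] eventually_mono[OF ev] by simp
      then show ?thesis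
        by (rule Lim_transform_eventually) (use f in \<open>auto intro!: eventually_mono[OF ev]\<close>)
    qed
    have 2: "(f p \<longlongrightarrow> 0) (at_left 1)"
    proof -
      have ev: "\<forall>\<^sub>F x in at_left (1::real). -1 < x \<and> x < 1"
        by (auto simp: eventually_at_left_field intro!: exI[of _ 0])
      have "((\<lambda>x. (1 - x) powr (a + 1) * (1 + x) powr (b + 1) * (c * poly p x)) \<longlongrightarrow> 0) (at_left 1)"
        using g[where T="{..<1}", of 1] eventually_mono[OF ev] by simp
      then show ?thesis
        by (rule Lim_transform_eventually) (use f in \<open>auto intro!: eventually_mono[OF ev]\<close>)
    qed
    show ?thesis using 1 2 by (simp add: Jacobi ereal_tendsto_simps del: ereal.simps)
  qed
  then show "((f p \<circ> real_of_ereal) \<longlongrightarrow> 0) (at_right (lower_end d))"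
    and "((f p \<circ> real_of_ereal) \<longlongrightarrow> 0) (at_left (upper_end d))" by blast+
qed

section \<open>Eigenvalues and the generator on polynomials\<close>

lemma eigenvalue_0: "eigenvalue d 0 = 0"
  by (cases d) auto

text \<open>In the Jacobi case the increment is 2 n + a + b + 2, positive even when a + b + 1 is
  negative.\<close>

lemma eigenvalue_Suc: "admissible d \<Longrightarrow> eigenvalue d n < eigenvalue d (Suc n)"
proof (cases d)
  case (Jacobi a b)
  assume "admissible d"
  then have "a + b > -2" using Jacobi by auto
  then have "real n * (real n + a + b + 1) + (2 * real n + a + b + 2) > real n * (real n + a + b + 1)" by auto
  also have "real n * (real n + a + b + 1) + (2 * real n + a + b + 2) = real (Suc n) * (real (Suc n) + a + b + 1)"
    by (simp add: algebra_simps)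
  finally show ?thesis by (simp add: Jacobi)
qed auto

lemma eigenvalue_strict_mono: "admissible d \<Longrightarrow> strict_mono (eigenvalue d)"
  by (intro strict_monoI_Suc eigenvalue_Suc)

lemma eigenvalue_nonneg: "admissible d \<Longrightarrow> 0 \<le> eigenvalue d n"
  using strict_mono_less_eq[OF eigenvalue_strict_mono, of d 0 n] by (simp add: eigenvalue_0)

fun drift_p :: "pearson \<Rightarrow> real poly" where
  "drift_p (OU \<theta> v \<mu>\<^sub>0) = [:\<theta> * \<mu>\<^sub>0, - \<theta>:]"
| "drift_p (CIR \<theta> a b) = [:\<theta> * (b / a), - \<theta>:]"
| "drift_p (Jacobi a b) = [:b - a, - (a + b + 2):]"

fun diffusion_p :: "pearson \<Rightarrow> real poly" where
  "diffusion_p (OU \<theta> v \<mu>\<^sub>0) = [:\<theta> * v:]"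
| "diffusion_p (CIR \<theta> a b) = [:0, \<theta> / a:]"
| "diffusion_p (Jacobi a b) = [:1, 0, -1:]"

lemma poly_drift_p: "poly (drift_p d) x = drift d x"
  by (cases d) (simp_all add: algebra_simps)

lemma poly_diffusion_p: "poly (diffusion_p d) x = diffusion_coeff d x"
  by (cases d) (simp_all add: algebra_simps power2_eq_square)

definition generator_p :: "pearson \<Rightarrow> real poly \<Rightarrow> real poly" where
  "generator_p d p = drift_p d * pderiv p + diffusion_p d * pderiv (pderiv p)"

lemma generator_p_sum_smult:
  "generator_p d (\<Sum>n\<in>A. smult (c n) (q n)) = (\<Sum>n\<in>A. smult (c n) (generator_p d (q n)))"
  by (induction A rule: infinite_finite_induct)
     (simp_all add: generator_p_def pderiv_add pderiv_smult distrib_left smult_add_right)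

text \<open>The L2 inner product of two polynomials is the value of this functional at their
  product, which turns orthogonality into algebra.\<close>

definition density_functional :: "pearson \<Rightarrow> real poly \<Rightarrow> real" where
  "density_functional d p = (LINT x:state_space d|lborel. poly p x * stationary_density d x)"

section \<open>Green's formula, orthonormality and continuity of point evaluation\<close>

locale admissible_pearson =
  fixes d :: pearson
  assumes adm: "admissible d"
begin

abbreviation "I \<equiv> density_functional d"

lemma functional_integrable: "set_integrable lborel (state_space d) (\<lambda>x. poly p x * stationary_density d x)"
  by (rule poly_density_integrable[OF adm])

lemma functional_add: "I (p + q) = I p + I q"
  unfolding density_functional_def using set_integral_add(2)[OF functional_integrable[of p] functional_integrable[of q]]
  by (simp add: distrib_right)

lemma functional_smult: "I (smult c p) = c * I p"
  unfolding density_functional_def by (simp add: mult.assoc)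

lemma functional_sum: "I (\<Sum>n\<in>A. f n) = (\<Sum>n\<in>A. I (f n))"
proof (induction A rule: infinite_finite_induct)
  case (infinite A)
  then show ?case using functional_smult[of 0 0] by simp
next
  case empty
  then show ?case using functional_smult[of 0 0] by simp
qed (simp add: functional_add)

lemma state_space_Icc:
  assumes "y \<in> state_space d"
  obtains r where "r > 0" "{y - r..y + r} \<subseteq> state_space d"
proof -
  obtain r where "r > 0" "cball y r \<subseteq> state_space d"
    using state_space_open[of d] assms open_contains_cball by blast
  then show ?thesis using that[of r] by (simp add: cball_eq_atLeastAtMost)
qed

lemma state_space_nonempty: "state_space d \<noteq> {}"
  by (cases d) (auto intro: exI[of _ 0] exI[of _ 1])

lemma stationary_density_nonneg: "x \<in> state_space d \<Longrightarrow> 0 \<le> stationary_density d x"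
  using density_pos[OF adm] by (rule less_imp_le)

lemma functional_square_nonneg: "0 \<le> I (p * p)"
  unfolding density_functional_def set_lebesgue_integral_def
  by (intro integral_nonneg_AE AE_I2) (auto simp: indicator_def intro!: mult_nonneg_nonneg[OF zero_le_square] stationary_density_nonneg)

text \<open>A vanishing integral would make p zero almost everywhere on an interval, against its
  finitely many roots. Hence the normalising constants of the polynomials are positive.\<close>

lemma functional_square_pos:
  assumes "p \<noteq> 0"
  shows "0 < I (p * p)"
proof (rule ccontr)
  let ?f = "\<lambda>x. indicator (state_space d) x *\<^sub>R (poly (p * p) x * stationary_density d x)"
  assume "\<not> 0 < I (p * p)"
  then have "I (p * p) = 0" using functional_square_nonneg[of p] by simp
  then have "(LINT x|lborel. ?f x) = 0" by (simp add: density_functional_def set_lebesgue_integral_def)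
  moreover have "integrable lborel ?f" using functional_integrable[of "p * p"] by (simp add: set_integrable_def)
  moreover have "AE x in lborel. 0 \<le> ?f x"
    by (intro AE_I2) (auto simp: indicator_def intro!: mult_nonneg_nonneg[OF zero_le_square] stationary_density_nonneg)
  ultimately have "AE x in lborel. ?f x = 0" by (simp add: integral_nonneg_eq_0_iff_AE)
  moreover have "AE x in lborel. x \<notin> {x. poly p x = 0}"
    using poly_roots_finite[OF assms] by (intro AE_not_in finite_imp_null_set_lborel)
  ultimately have "AE x in lborel. x \<notin> state_space d"
  proof eventually_elim
    fix x assume "?f x = 0" "x \<notin> {x. poly p x = 0}"
    then show "x \<notin> state_space d" using density_pos[OF adm, of x] by (auto simp: indicator_def split: if_splits)
  qed
  then have null: "state_space d \<in> null_sets lborel"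
    by (subst (asm) AE_iff_null_sets[symmetric]) auto
  obtain y r where "r > 0" "{y - r..y + r} \<subseteq> state_space d"
    using state_space_nonempty state_space_Icc by blast
  then have "{y - r..y + r} \<in> null_sets lborel" by (intro null_sets_subset[OF null]) simp_all
  then show False using \<open>r > 0\<close> by (simp add: null_sets_def)
qed

text \<open>By the zero-flux identity the sum of both integrands is the derivative of D m p' q,
  whose boundary values vanish. The right side is symmetric in p and q.\<close>

lemma green: "I (generator_p d p * q) = - I (diffusion_p d * (pderiv p * pderiv q))"
proof -
  define F where "F x = diffusion_coeff d x * stationary_density d x * poly (pderiv p * q) x" for x
  define s where "s = generator_p d p * q + diffusion_p d * (pderiv p * pderiv q)"
  let ?f = "\<lambda>x. poly s x * stationary_density d x"
  have eint: "einterval (lower_end d) (upper_end d) = state_space d" by (simp add: state_space_eq_einterval)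
  have memb: "x \<in> state_space d" if "lower_end d < ereal x" "ereal x < upper_end d" for x
    using that by (simp add: eint[symmetric] einterval_def)
  have "(LBINT x=lower_end d..upper_end d. ?f x) = 0 - 0"
  proof (rule interval_integral_FTC_integrable[OF lower_less_upper])
    show "set_integrable lborel (einterval (lower_end d) (upper_end d)) ?f"
      unfolding eint by (rule functional_integrable)
    show "((F \<circ> real_of_ereal) \<longlongrightarrow> 0) (at_right (lower_end d))" "((F \<circ> real_of_ereal) \<longlongrightarrow> 0) (at_left (upper_end d))"
      unfolding F_def by (rule poly_density_boundary[OF adm])+
    fix x assume x: "lower_end d < ereal x" "ereal x < upper_end d"
    have "(F has_real_derivative drift d x * stationary_density d x * poly (pderiv p * q) x
        + poly (pderiv (pderiv p * q)) x * (diffusion_coeff d x * stationary_density d x)) (at x)"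
      unfolding F_def by (intro DERIV_mult diffusion_density_deriv[OF adm memb[OF x]] poly_DERIV)
    moreover have "drift d x * stationary_density d x * poly (pderiv p * q) x
        + poly (pderiv (pderiv p * q)) x * (diffusion_coeff d x * stationary_density d x) = ?f x"
      by (simp add: s_def generator_p_def pderiv_mult poly_drift_p poly_diffusion_p algebra_simps)
    ultimately show "(F has_vector_derivative ?f x) (at x)"
      by (simp add: has_real_derivative_iff_has_vector_derivative)
    have "isCont (stationary_density d) x" by (rule DERIV_isCont[OF density_deriv[OF adm memb[OF x]]])
    then show "isCont ?f x" by (intro continuous_intros)
  qed
  then have "I s = 0"
    using less_imp_le[OF lower_less_upper[of d]] by (simp add: density_functional_def interval_lebesgue_integral_def eint)
  then show ?thesis by (simp add: s_def functional_add)
qed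

definition Qp :: "nat \<Rightarrow> real poly" where
  "Qp n = smult (1 / sqrt (I (classical_p d n * classical_p d n))) (classical_p d n)"

lemma poly_Qp: "poly (Qp n) x = Q_poly d n x"
proof -
  have "I (classical_p d n * classical_p d n) = (LINT z:state_space d|lborel. (classical_poly d n z)\<^sup>2 * stationary_density d z)"
    unfolding density_functional_def by (simp add: poly_classical_p power2_eq_square)
  then show ?thesis by (simp add: Qp_def Q_poly_def poly_classical_p)
qed

lemma generator_Qp: "generator_p d (Qp n) = smult (- eigenvalue d n) (Qp n)"
proof -
  have "poly (generator_p d (classical_p d n)) x = poly (smult (- eigenvalue d n) (classical_p d n)) x" for x
    using classical_p_ode[OF adm, of x n] by (simp add: generator_p_def poly_drift_p poly_diffusion_p)
  then have "generator_p d (classical_p d n) = smult (- eigenvalue d n) (classical_p d n)"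
    unfolding poly_eq_poly_eq_iff[symmetric] by (intro ext)
  then show ?thesis unfolding Qp_def generator_p_def by (simp add: pderiv_smult smult_add_right[symmetric] mult.commute)
qed

text \<open>Symmetry of the generator forces eigenfunctions with different eigenvalues to be
  orthogonal, and the eigenvalues are strictly increasing.\<close>

lemma Qp_orthonormal: "I (Qp n * Qp k) = (if n = k then 1 else 0)"
proof (cases "n = k")
  case True
  have pos: "0 < I (classical_p d n * classical_p d n)"
    by (rule functional_square_pos[OF classical_p_nonzero[OF adm]])
  then show ?thesis using True by (simp add: Qp_def functional_smult)
next
  case False
  have "- eigenvalue d n * I (Qp n * Qp k) = I (generator_p d (Qp n) * Qp k)"
    by (simp add: generator_Qp functional_smult del: smult_minus_left)
  also have "\<dots> = I (generator_p d (Qp k) * Qp n)"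
    unfolding green by (simp add: mult.commute)
  also have "\<dots> = - eigenvalue d k * I (Qp n * Qp k)"
    by (simp add: generator_Qp functional_smult mult.commute del: smult_minus_left)
  finally have "(eigenvalue d n - eigenvalue d k) * I (Qp n * Qp k) = 0" by (simp add: algebra_simps)
  then show ?thesis using False strict_mono_eq[OF eigenvalue_strict_mono[OF adm], of n k] by simp
qed

lemma functional_Qp_sums:
  "I ((\<Sum>n<N. smult (a n) (Qp n)) * (\<Sum>n<N. smult (b n) (Qp n))) = (\<Sum>n<N. a n * b n)"
proof -
  have "I ((\<Sum>n<N. smult (a n) (Qp n)) * (\<Sum>n<N. smult (b n) (Qp n))) =
    (\<Sum>n<N. \<Sum>k<N. a n * (b k * I (Qp n * Qp k)))"
    by (simp add: sum_product functional_sum functional_smult mult_ac)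
  also have "\<dots> = (\<Sum>n<N. a n * b n)"
    by (intro sum.cong refl) (simp add: Qp_orthonormal if_distrib cong: if_cong)
  finally show ?thesis .
qed

text \<open>Write p(y)^2 as the integral over {y..y + r} of the derivative of -\<rho> p^2, where
  \<rho> falls linearly from 1 to 0. On this compact part of the state space the density and the
  diffusion coefficient are bounded below, so the integral is controlled by the energy.\<close>

lemma sobolev:
  assumes y: "y \<in> state_space d"
  obtains C where "C > 0" "\<And>p. (poly p y)\<^sup>2 \<le> C * (I (p * p) + I (diffusion_p d * (pderiv p * pderiv p)))"
proof -
  obtain r where r: "r > 0" "{y - r..y + r} \<subseteq> state_space d" using state_space_Icc[OF y] by blast
  let ?J = "{y..y + r}"
  have J: "?J \<subseteq> state_space d" "?J \<noteq> {}" using r by auto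
  have mc: "continuous_on ?J (stationary_density d)" using density_continuous[OF adm] J(1) by (rule continuous_on_subset)
  \<comment> \<open>A common lower bound for the density m and for D m, the weights of p^2 and of
    p'^2 in the energy.\<close>
  define k where "k x = min 1 (diffusion_coeff d x) * stationary_density d x" for x
  have kc: "continuous_on ?J k" unfolding k_def by (intro continuous_intros mc diffusion_continuous)
  obtain x0 where x0: "x0 \<in> ?J" "\<And>x. x \<in> ?J \<Longrightarrow> k x0 \<le> k x"
    using continuous_attains_inf[OF compact_Icc J(2) kc] by blast
  have k0: "k x0 > 0" using x0(1) J(1) density_pos[OF adm, of x0] diffusion_pos[OF adm, of x0] by (auto simp: k_def)
  have k1: "k x \<le> stationary_density d x" "k x \<le> diffusion_coeff d x * stationary_density d x" if "x \<in> ?J" for x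
  proof -
    have "x \<in> state_space d" using that J(1) by blast
    then have "0 \<le> stationary_density d x" by (rule stationary_density_nonneg)
    then show "k x \<le> stationary_density d x" "k x \<le> diffusion_coeff d x * stationary_density d x"
      using mult_right_mono[of "min 1 (diffusion_coeff d x)" 1 "stationary_density d x"]
      by (auto simp: k_def intro!: mult_right_mono)
  qed
  \<comment> \<open>1 / r is the slope of \<rho>, 1 comes from the cross term p p', and the minimum
    of \<open>k\<close> converts Lebesgue measure into the weights of the energy.\<close>
  define C where "C = (1 / r + 1) / k x0"
  have C: "C > 0" using r k0 by (simp add: C_def add_pos_pos)
  have "(poly p y)\<^sup>2 \<le> C * (I (p * p) + I (diffusion_p d * (pderiv p * pderiv p)))" for p
  proof -
    \<comment> \<open>The derivative of -((y + r - x) / r) p(x)^2, a function that is -p(y)^2 at y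
      and 0 at y + r.\<close>
    define f where "f x = poly p x * poly p x / r - 2 * ((y + r - x) / r) * (poly p x * poly (pderiv p) x)" for x
    let ?s = "p * p + diffusion_p d * (pderiv p * pderiv p)"
    have fcont: "continuous_on UNIV f" unfolding f_def using r by (intro continuous_intros) auto
    have "(LINT x|lborel. f x * indicator {y..y + r} x) =
      (- ((y + r - (y + r)) / r) * (poly p (y + r) * poly p (y + r))) - (- ((y + r - y) / r) * (poly p y * poly p y))"
    proof (rule integral_FTC_Icc_real)
      show "((\<lambda>x. - ((y + r - x) / r) * (poly p x * poly p x)) has_real_derivative f x) (at x)" for x
        unfolding f_def using r by (auto intro!: derivative_eq_intros simp: field_simps)
      show "isCont f x" for x using fcont by (simp add: continuous_on_eq_continuous_at)
    qed (use r in auto)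
    then have eq: "(LINT x|lborel. f x * indicator {y..y + r} x) = (poly p y)\<^sup>2" using r by (simp add: power2_eq_square)
    have "(LINT x|lborel. f x * indicator {y..y + r} x) \<le>
      (LINT x|lborel. C * (indicator (state_space d) x *\<^sub>R (poly ?s x * stationary_density d x)))"
    proof (rule integral_mono)
      show "integrable lborel (\<lambda>x. f x * indicator {y..y + r} x)"
        using borel_integrable_atLeastAtMost[of y "y + r" f] fcont r by (simp add: continuous_on_eq_continuous_at)
      show "integrable lborel (\<lambda>x. C * (indicator (state_space d) x *\<^sub>R (poly ?s x * stationary_density d x)))"
        using functional_integrable[of ?s] unfolding set_integrable_def by (rule integrable_mult_right)
      fix x :: real
      show "f x * indicator {y..y + r} x \<le> C * (indicator (state_space d) x *\<^sub>R (poly ?s x * stationary_density d x))"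
      proof (cases "x \<in> ?J")
        case True
        define P P' where "P = poly p x" and "P' = poly (pderiv p) x"
        define \<rho> where "\<rho> = (y + r - x) / r"
        have \<rho>: "0 \<le> \<rho>" "\<rho> \<le> 1" using True r by (auto simp: \<rho>_def field_simps)
        have "- 2 * \<rho> * (P * P') \<le> \<rho> * (P * P + P' * P')"
          using mult_left_mono[OF sum_squares_ge_zero[of "P + P'" 0] \<rho>(1)] by (simp add: algebra_simps)
        also have "\<dots> \<le> 1 * (P * P + P' * P')" using \<rho> by (intro mult_right_mono) auto
        finally have le: "- 2 * \<rho> * (P * P') \<le> 1 * (P * P + P' * P')" .
        have "f x = P * P / r + - 2 * \<rho> * (P * P')"
          unfolding f_def P_def[symmetric] P'_def[symmetric] \<rho>_def[symmetric] by simp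
        also have "\<dots> \<le> P * P / r + 1 * (P * P + P' * P')" using le by (rule add_left_mono)
        also have "\<dots> \<le> (P * P / r + P' * P' / r) + 1 * (P * P + P' * P')" using r by (intro add_right_mono) simp
        also have "\<dots> = (1 / r + 1) * (P * P + P' * P')" by (simp add: distrib_right add_divide_distrib)
        also have "\<dots> = C * (k x0 * (P * P) + k x0 * (P' * P'))" using k0 by (simp add: C_def distrib_left[symmetric])
        also have "\<dots> \<le> C * (stationary_density d x * (P * P) + (diffusion_coeff d x * stationary_density d x) * (P' * P'))"
          using C k1[OF True] x0(2)[OF True] by (intro mult_left_mono add_mono mult_right_mono) auto
        finally show ?thesis using True J(1)
          by (auto simp: P_def P'_def poly_diffusion_p algebra_simps)
      next
        case False
        have "0 \<le> indicator (state_space d) x *\<^sub>R (poly ?s x * stationary_density d x)"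
        proof (cases "x \<in> state_space d")
          case True
          then have "0 \<le> diffusion_coeff d x" using diffusion_pos[OF adm] by (blast intro: less_imp_le)
          then have "0 \<le> poly p x * poly p x + diffusion_coeff d x * (poly (pderiv p) x * poly (pderiv p) x)"
            by (intro add_nonneg_nonneg mult_nonneg_nonneg[of "diffusion_coeff d x"] zero_le_square)
          then show ?thesis using stationary_density_nonneg[OF True] by (simp add: poly_diffusion_p)
        qed simp
        then show ?thesis using False C by simp
      qed
    qed
    also have "\<dots> = C * I ?s" by (simp add: density_functional_def set_lebesgue_integral_def)
    finally show ?thesis unfolding eq functional_add .
  qed
  then show ?thesis using C that by blast
qed

text \<open>The polynomial \<open>p = \<Sum>\<^sub>n Q\<^sub>n(y) Q\<^sub>n / (1 + \<lambda>\<^sub>n)\<close> has energy \<open>p(y)\<close>, so the Sobolev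
  inequality reads \<open>p(y)\<^sup>2 \<le> C p(y)\<close>.\<close>

lemma resolvent_diagonal_bound:
  assumes y: "y \<in> state_space d"
  obtains C where "C > 0" "\<And>N. (\<Sum>n<N. (Q_poly d n y)\<^sup>2 / (1 + eigenvalue d n)) \<le> C"
proof -
  obtain C where C: "C > 0" "\<And>p. (poly p y)\<^sup>2 \<le> C * (I (p * p) + I (diffusion_p d * (pderiv p * pderiv p)))"
    using sobolev[OF y] by blast
  have "(\<Sum>n<N. (Q_poly d n y)\<^sup>2 / (1 + eigenvalue d n)) \<le> C" for N
  proof -
    define c where "c n = Q_poly d n y / (1 + eigenvalue d n)" for n
    define p where "p = (\<Sum>n<N. smult (c n) (Qp n))"
    let ?s = "\<Sum>n<N. (Q_poly d n y)\<^sup>2 / (1 + eigenvalue d n)"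
    have l: "1 + eigenvalue d n > 0" for n using eigenvalue_nonneg[OF adm, of n] by simp
    have e: "poly p y = ?s" unfolding p_def by (simp add: poly_sum poly_Qp c_def power2_eq_square)
    have "generator_p d p = (\<Sum>n<N. smult (- (c n * eigenvalue d n)) (Qp n))"
      unfolding p_def generator_p_sum_smult by (simp add: generator_Qp)
    then have "I (diffusion_p d * (pderiv p * pderiv p)) = - (\<Sum>n<N. - (c n * eigenvalue d n) * c n)"
      using green[of p p] functional_Qp_sums[where N=N and a="\<lambda>n. - (c n * eigenvalue d n)" and b=c] by (simp only: p_def[symmetric])
    then have "I (p * p) + I (diffusion_p d * (pderiv p * pderiv p)) = (\<Sum>n<N. c n * c n + eigenvalue d n * (c n * c n))"
      unfolding p_def functional_Qp_sums by (simp add: sum_negf sum.distrib mult_ac)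
    also have "\<dots> = ?s"
    proof (intro sum.cong refl)
      fix n
      have "c n * c n + eigenvalue d n * (c n * c n) = (1 + eigenvalue d n) * (c n * c n)" by (simp add: algebra_simps)
      also have "\<dots> = (Q_poly d n y)\<^sup>2 / (1 + eigenvalue d n)"
        using l[of n] by (simp add: c_def power2_eq_square)
      finally show "c n * c n + eigenvalue d n * (c n * c n) = (Q_poly d n y)\<^sup>2 / (1 + eigenvalue d n)" .
    qed
    finally have "?s\<^sup>2 \<le> C * ?s" using C(2)[of p] unfolding e by simp
    moreover have "0 \<le> ?s" using l by (intro sum_nonneg divide_nonneg_nonneg) (auto intro: less_imp_le)
    ultimately show ?thesis using C(1)
      by (cases "?s = 0") (auto simp: power2_eq_square mult_le_cancel_right)
  qed
  then show ?thesis using C(1) that by blast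
qed

end

section \<open>Expectations along the diffusion\<close>

text \<open>Both l u and 1 are at most exp (l u). This compares the heat weights at a fixed positive
  time with the resolvent weights, for which summability is known.\<close>

lemma exp_le_resolvent:
  assumes "0 \<le> l" "0 < (u::real)"
  shows "exp (- l * u) \<le> (1 + 1 / u) / (1 + l)"
proof -
  have "l * u \<le> exp (l * u)" using exp_ge_add_one_self[of "l * u"] by linarith
  then have "l \<le> (1 / u) * exp (l * u)" using assms by (simp add: field_simps)
  moreover have "1 \<le> exp (l * u)" using assms by simp
  ultimately have "1 + l \<le> (1 + 1 / u) * exp (l * u)" unfolding distrib_right mult_1_left by linarith
  then have "(1 + l) * exp (- l * u) \<le> (1 + 1 / u) * exp (l * u) * exp (- l * u)" by (intro mult_right_mono) auto
  also have "\<dots> = 1 + 1 / u" by (simp add: mult.assoc exp_add[symmetric])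
  finally show ?thesis using assms by (simp add: pos_le_divide_eq mult.commute)
qed

lemma (in prob_space) distr_pair_if_indep:
  assumes [measurable]: "U \<in> measurable M S" "V \<in> measurable M T"
    and ind: "\<And>A B. A \<in> sets S \<Longrightarrow> B \<in> sets T \<Longrightarrow>
      prob ((U -` A \<inter> space M) \<inter> (V -` B \<inter> space M)) = prob (U -` A \<inter> space M) * prob (V -` B \<inter> space M)"
  shows "distr M S U \<Otimes>\<^sub>M distr M T V = distr M (S \<Otimes>\<^sub>M T) (\<lambda>x. (U x, V x))"
proof -
  interpret U: prob_space "distr M S U" by (rule prob_space_distr) simp
  interpret V: prob_space "distr M T V" by (rule prob_space_distr) simp
  show ?thesis
  proof (rule pair_measure_eqI)
    fix A B assume "A \<in> sets (distr M S U)" "B \<in> sets (distr M T V)"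
    then have [measurable]: "A \<in> sets S" "B \<in> sets T" by auto
    have "(\<lambda>x. (U x, V x)) -` (A \<times> B) \<inter> space M = (U -` A \<inter> space M) \<inter> (V -` B \<inter> space M)" by auto
    then show "emeasure (distr M S U) A * emeasure (distr M T V) B = emeasure (distr M (S \<Otimes>\<^sub>M T) (\<lambda>x. (U x, V x))) (A \<times> B)"
      using ind[of A B] by (simp add: emeasure_distr emeasure_eq_measure ennreal_mult)
  qed (auto intro: U.sigma_finite_measure_axioms V.sigma_finite_measure_axioms)
qed

lemma (in prob_space) integral_indep_pair:
  fixes f :: "'b \<times> 'c \<Rightarrow> real"
  assumes [measurable]: "U \<in> measurable M S" "V \<in> measurable M T" "f \<in> borel_measurable (S \<Otimes>\<^sub>M T)"
    and eq: "distr M S U \<Otimes>\<^sub>M distr M T V = distr M (S \<Otimes>\<^sub>M T) (\<lambda>x. (U x, V x))"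
    and int: "integrable M (\<lambda>\<omega>. f (U \<omega>, V \<omega>))"
  shows "(LINT \<omega>|M. f (U \<omega>, V \<omega>)) = (LINT \<omega>|M. LINT \<omega>'|M. f (U \<omega>, V \<omega>'))"
proof -
  interpret U: prob_space "distr M S U" by (rule prob_space_distr) simp
  interpret V: prob_space "distr M T V" by (rule prob_space_distr) simp
  interpret P: pair_sigma_finite "distr M S U" "distr M T V" ..
  have "integrable (distr M (S \<Otimes>\<^sub>M T) (\<lambda>x. (U x, V x))) f" using int by (subst integrable_distr_eq) auto
  then have i: "integrable (distr M S U \<Otimes>\<^sub>M distr M T V) f" unfolding eq .
  have "(LINT \<omega>|M. f (U \<omega>, V \<omega>)) = (LINT p|(distr M S U \<Otimes>\<^sub>M distr M T V). f p)"
    unfolding eq by (subst integral_distr) auto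
  also have "\<dots> = (LINT u|distr M S U. LINT v|distr M T V. f (u, v))"
    by (rule P.integral_fst'[OF i, symmetric])
  also have "\<dots> = (LINT \<omega>|M. LINT v|distr M T V. f (U \<omega>, v))"
    by (rule integral_distr) measurable
  also have "\<dots> = (LINT \<omega>|M. LINT \<omega>'|M. f (U \<omega>, V \<omega>'))"
    by (intro Bochner_Integration.integral_cong refl integral_distr) measurable
  finally show ?thesis .
qed

section \<open>The heat kernel and its expansion\<close>

context admissible_pearson begin

lemma Q_poly_measurable [measurable]: "Q_poly d n \<in> borel_measurable borel"
proof -
  have "Q_poly d n = poly (Qp n)" by (simp add: poly_Qp fun_eq_iff)
  then show ?thesis by (simp add: borel_measurable_continuous_onI continuous_on_poly)
qed

lemma summable_resolvent: "y \<in> state_space d \<Longrightarrow> summable (\<lambda>n. (Q_poly d n y)\<^sup>2 / (1 + eigenvalue d n))"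
proof -
  assume "y \<in> state_space d"
  then obtain C where "\<And>N. (\<Sum>n<N. (Q_poly d n y)\<^sup>2 / (1 + eigenvalue d n)) \<le> C" using resolvent_diagonal_bound by blast
  then show ?thesis
    by (intro summableI_nonneg_bounded) (auto intro!: divide_nonneg_nonneg add_nonneg_nonneg eigenvalue_nonneg adm)
qed

lemma summable_heat_diagonal:
  assumes "y \<in> state_space d" "u > 0"
  shows "summable (\<lambda>n. exp (- eigenvalue d n * u) * (Q_poly d n y)\<^sup>2)"
proof (rule summable_comparison_test')
  show "summable (\<lambda>n. (1 + 1 / u) * ((Q_poly d n y)\<^sup>2 / (1 + eigenvalue d n)))"
    by (intro summable_mult summable_resolvent assms)
  fix n
  have "exp (- eigenvalue d n * u) * (Q_poly d n y)\<^sup>2 \<le> (1 + 1 / u) / (1 + eigenvalue d n) * (Q_poly d n y)\<^sup>2"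
    by (intro mult_right_mono exp_le_resolvent eigenvalue_nonneg adm assms) auto
  then show "norm (exp (- eigenvalue d n * u) * (Q_poly d n y)\<^sup>2) \<le> (1 + 1 / u) * ((Q_poly d n y)\<^sup>2 / (1 + eigenvalue d n))"
    by simp
qed

text \<open>The coefficients in the polynomials of the transition density relative to the stationary
  density.\<close>

definition kernel_coeff :: "real \<Rightarrow> real \<Rightarrow> nat \<Rightarrow> real" where
  "kernel_coeff u y n = exp (- eigenvalue d n * u) * Q_poly d n y"

definition heat_kernel :: "real \<Rightarrow> real \<Rightarrow> real \<Rightarrow> real" where
  "heat_kernel u y x = (\<Sum>n. kernel_coeff u y n * Q_poly d n x)"

lemma heat_kernel_measurable [measurable]: "heat_kernel u y \<in> borel_measurable borel"
  unfolding heat_kernel_def[abs_def] by measurable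

lemma transition_density_eq: "transition_density d x u y = stationary_density d x * heat_kernel u y x"
  by (simp add: transition_density_def heat_kernel_def kernel_coeff_def mult_ac)

text \<open>The product of two polynomial values is bounded by their squares, so the diagonal series
  at x and at y dominate.\<close>

lemma heat_kernel_summable:
  assumes "y \<in> state_space d" "x \<in> state_space d" "u > 0"
  shows "summable (\<lambda>n. kernel_coeff u y n * Q_poly d n x)"
proof (rule summable_comparison_test')
  show "summable (\<lambda>n. exp (- eigenvalue d n * u) * (Q_poly d n y)\<^sup>2 + exp (- eigenvalue d n * u) * (Q_poly d n x)\<^sup>2)"
    by (intro summable_add summable_heat_diagonal assms)
  fix n
  have "2 * \<bar>Q_poly d n y * Q_poly d n x\<bar> \<le> (Q_poly d n y)\<^sup>2 + (Q_poly d n x)\<^sup>2"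
    using sum_squares_bound[of "\<bar>Q_poly d n y\<bar>" "\<bar>Q_poly d n x\<bar>"] by (simp add: abs_mult)
  then have "\<bar>Q_poly d n y * Q_poly d n x\<bar> \<le> (Q_poly d n y)\<^sup>2 + (Q_poly d n x)\<^sup>2"
    using abs_ge_zero[of "Q_poly d n y * Q_poly d n x"] by linarith
  then have "exp (- eigenvalue d n * u) * \<bar>Q_poly d n y * Q_poly d n x\<bar> \<le>
    exp (- eigenvalue d n * u) * ((Q_poly d n y)\<^sup>2 + (Q_poly d n x)\<^sup>2)"
    by (intro mult_left_mono) auto
  then show "norm (kernel_coeff u y n * Q_poly d n x) \<le>
    exp (- eigenvalue d n * u) * (Q_poly d n y)\<^sup>2 + exp (- eigenvalue d n * u) * (Q_poly d n x)\<^sup>2"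
    by (simp add: kernel_coeff_def abs_mult distrib_left mult.assoc)
qed

lemma summable_kernel_coeff:
  assumes "y \<in> state_space d" "u > 0"
  shows "summable (\<lambda>n. (kernel_coeff u y n)\<^sup>2)"
proof -
  have "(kernel_coeff u y n)\<^sup>2 = exp (- eigenvalue d n * (2 * u)) * (Q_poly d n y)\<^sup>2" for n
    by (simp add: kernel_coeff_def power_mult_distrib power2_eq_square exp_add[symmetric])
  then show ?thesis using summable_heat_diagonal[of y "2 * u"] assms by simp
qed

text \<open>Fatou's lemma gives the inequality that suffices here; completeness of the polynomials
  is not used.\<close>

lemma heat_kernel_remainder:
  assumes y: "y \<in> state_space d" and u: "u > 0"
  shows "(\<integral>\<^sup>+x. ennreal (indicator (state_space d) x * ((heat_kernel u y x - (\<Sum>n<N. kernel_coeff u y n * Q_poly d n x))\<^sup>2 * stationary_density d x)) \<partial>lborel)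
    \<le> ennreal (\<Sum>n. (kernel_coeff u y (n + N))\<^sup>2)"
proof -
  let ?S = "\<lambda>N x. \<Sum>n<N. kernel_coeff u y n * Q_poly d n x"
  let ?f = "\<lambda>k x. ennreal (indicator (state_space d) x * ((?S k x - ?S N x)\<^sup>2 * stationary_density d x))"
  have le: "(\<integral>\<^sup>+x. ?f k x \<partial>lborel) \<le> ennreal (\<Sum>n. (kernel_coeff u y (n + N))\<^sup>2)" if "N \<le> k" for k
  proof -
    \<comment> \<open>Zeroing the first N coefficients writes the difference of partial sums as one
      sum over n < k, to which orthonormality applies.\<close>
    define c where "c n = (if N \<le> n then kernel_coeff u y n else 0)" for n
    define p where "p = (\<Sum>n<k. smult (c n) (Qp n))"
    have "poly p x = ?S k x - ?S N x" for x
    proof -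
      have "?S k x = (\<Sum>n\<in>{..<N} \<union> {N..<k}. kernel_coeff u y n * Q_poly d n x)"
        using that by (simp add: ivl_disj_un_one)
      also have "\<dots> = ?S N x + (\<Sum>n=N..<k. kernel_coeff u y n * Q_poly d n x)"
        by (subst sum.union_disjoint) auto
      also have "(\<Sum>n=N..<k. kernel_coeff u y n * Q_poly d n x) = (\<Sum>n<k. c n * Q_poly d n x)"
        unfolding c_def by (intro sum.mono_neutral_cong_left) auto
      finally show ?thesis by (simp add: p_def poly_sum poly_Qp)
    qed
    then have f: "?f k x = ennreal (indicator (state_space d) x *\<^sub>R (poly (p * p) x * stationary_density d x))" for x
      by (simp add: power2_eq_square)
    have "(\<integral>\<^sup>+x. ?f k x \<partial>lborel) = ennreal (I (p * p))"
      unfolding f density_functional_def set_lebesgue_integral_def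
      using functional_integrable[of "p * p"] unfolding set_integrable_def
      by (intro nn_integral_eq_integral) (auto simp: indicator_def intro!: mult_nonneg_nonneg[OF zero_le_square] stationary_density_nonneg)
    also have "I (p * p) = (\<Sum>n<k. c n * c n)" unfolding p_def by (rule functional_Qp_sums)
    also have "\<dots> = (\<Sum>n=N..<k. (kernel_coeff u y n)\<^sup>2)"
      unfolding c_def by (intro sum.mono_neutral_cong_right) (auto simp: power2_eq_square)
    also have "\<dots> = (\<Sum>n<k - N. (kernel_coeff u y (n + N))\<^sup>2)"
      using sum.shift_bounds_nat_ivl[of "\<lambda>n. (kernel_coeff u y n)\<^sup>2" 0 N "k - N"] that by (simp add: atLeast0LessThan)
    also have "\<dots> \<le> (\<Sum>n. (kernel_coeff u y (n + N))\<^sup>2)"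
      using summable_ignore_initial_segment[OF summable_kernel_coeff[OF y u]] by (intro sum_le_suminf) auto
    finally show ?thesis by (simp add: ennreal_leI)
  qed
  have "(\<integral>\<^sup>+x. ennreal (indicator (state_space d) x * ((heat_kernel u y x - ?S N x)\<^sup>2 * stationary_density d x)) \<partial>lborel) =
    (\<integral>\<^sup>+x. liminf (\<lambda>k. ?f k x) \<partial>lborel)"
  proof (rule nn_integral_cong)
    fix x :: real
    have "(\<lambda>k. ?f k x) \<longlonglongrightarrow> ennreal (indicator (state_space d) x * ((heat_kernel u y x - ?S N x)\<^sup>2 * stationary_density d x))"
    proof (cases "x \<in> state_space d")
      case True
      have "(\<lambda>k. ?S k x) \<longlonglongrightarrow> heat_kernel u y x"
        unfolding heat_kernel_def by (intro summable_LIMSEQ heat_kernel_summable y u True)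
      then show ?thesis by (intro tendsto_ennrealI tendsto_intros)
    qed simp
    then show "ennreal (indicator (state_space d) x * ((heat_kernel u y x - ?S N x)\<^sup>2 * stationary_density d x)) = liminf (\<lambda>k. ?f k x)"
      by (rule lim_imp_Liminf[OF sequentially_bot, symmetric])
  qed
  also have "\<dots> \<le> liminf (\<lambda>k. \<integral>\<^sup>+x. ?f k x \<partial>lborel)"
    by (rule nn_integral_liminf) measurable
  also have "\<dots> \<le> liminf (\<lambda>k. ennreal (\<Sum>n. (kernel_coeff u y (n + N))\<^sup>2))"
    by (intro Liminf_mono eventually_mono[OF eventually_ge_at_top[of N] le])
  also have "\<dots> = ennreal (\<Sum>n. (kernel_coeff u y (n + N))\<^sup>2)" by (simp add: Liminf_const)
  finally show ?thesis .
qed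

lemma heat_kernel_remainder_integral:
  assumes y: "y \<in> state_space d" and u: "u > 0"
  shows "set_integrable lborel (state_space d) (\<lambda>x. (heat_kernel u y x - (\<Sum>n<N. kernel_coeff u y n * Q_poly d n x))\<^sup>2 * stationary_density d x)"
    and "(LINT x:state_space d|lborel. (heat_kernel u y x - (\<Sum>n<N. kernel_coeff u y n * Q_poly d n x))\<^sup>2 * stationary_density d x)
      \<le> (\<Sum>n. (kernel_coeff u y (n + N))\<^sup>2)"
proof -
  let ?g = "\<lambda>x. indicator (state_space d) x * ((heat_kernel u y x - (\<Sum>n<N. kernel_coeff u y n * Q_poly d n x))\<^sup>2 * stationary_density d x)"
  have nn: "0 \<le> ?g x" for x
    by (auto simp: indicator_def intro!: mult_nonneg_nonneg[OF zero_le_power2] stationary_density_nonneg)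
  have [measurable]: "?g \<in> borel_measurable lborel" by measurable
  have int: "integrable lborel ?g"
  proof (rule integrableI_bounded)
    have "(\<integral>\<^sup>+x. ennreal (norm (?g x)) \<partial>lborel) = (\<integral>\<^sup>+x. ennreal (?g x) \<partial>lborel)" using nn by simp
    also have "\<dots> < \<infinity>" using heat_kernel_remainder[OF y u, of N] by (simp add: order_le_less_trans)
    finally show "(\<integral>\<^sup>+x. ennreal (norm (?g x)) \<partial>lborel) < \<infinity>" .
  qed simp
  then show "set_integrable lborel (state_space d) (\<lambda>x. (heat_kernel u y x - (\<Sum>n<N. kernel_coeff u y n * Q_poly d n x))\<^sup>2 * stationary_density d x)"
    by (simp add: set_integrable_def)
  have "ennreal (LINT x|lborel. ?g x) \<le> ennreal (\<Sum>n. (kernel_coeff u y (n + N))\<^sup>2)"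
    using heat_kernel_remainder[OF y u, of N] nn int by (subst nn_integral_eq_integral[symmetric]) auto
  moreover have "0 \<le> (\<Sum>n. (kernel_coeff u y (n + N))\<^sup>2)"
    using summable_ignore_initial_segment[OF summable_kernel_coeff[OF y u]] by (intro suminf_nonneg) auto
  ultimately show "(LINT x:state_space d|lborel. (heat_kernel u y x - (\<Sum>n<N. kernel_coeff u y n * Q_poly d n x))\<^sup>2 * stationary_density d x)
      \<le> (\<Sum>n. (kernel_coeff u y (n + N))\<^sup>2)"
    by (simp add: set_lebesgue_integral_def ennreal_le_iff)
qed

text \<open>The Cauchy-Schwarz inequality in Young's form with a free weight e, which avoids square
  roots of integrals. Measurability is asked only after multiplication with the indicator, because h
  is constrained on the state space alone.\<close>

lemma L2_product:
  fixes f g :: "real \<Rightarrow> real"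
  assumes [measurable]: "(\<lambda>x. indicator (state_space d) x * f x) \<in> borel_measurable borel"
      "(\<lambda>x. indicator (state_space d) x * g x) \<in> borel_measurable borel"
    and f: "set_integrable lborel (state_space d) (\<lambda>x. (f x)\<^sup>2 * stationary_density d x)"
    and g: "set_integrable lborel (state_space d) (\<lambda>x. (g x)\<^sup>2 * stationary_density d x)" and e: "e > 0"
  shows "set_integrable lborel (state_space d) (\<lambda>x. f x * g x * stationary_density d x)"
    and "(LINT x:state_space d|lborel. \<bar>f x * g x\<bar> * stationary_density d x) \<le>
      e / 2 * (LINT x:state_space d|lborel. (f x)\<^sup>2 * stationary_density d x)
      + 1 / (2 * e) * (LINT x:state_space d|lborel. (g x)\<^sup>2 * stationary_density d x)"
    and "set_integrable lborel (state_space d) (\<lambda>x. \<bar>f x * g x\<bar> * stationary_density d x)"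
proof -
  let ?S = "state_space d" and ?m = "stationary_density d"
  let ?b = "\<lambda>x. e / 2 * ((f x)\<^sup>2 * ?m x) + 1 / (2 * e) * ((g x)\<^sup>2 * ?m x)"
  have b: "set_integrable lborel ?S ?b"
    by (intro set_integral_add(1) set_integrable_mult_right f g)
  have le: "\<bar>f x * g x\<bar> * ?m x \<le> ?b x" if "x \<in> ?S" for x
  proof -
    have "0 \<le> (e * \<bar>f x\<bar> - \<bar>g x\<bar>)\<^sup>2" by simp
    then have "2 * e * \<bar>f x * g x\<bar> \<le> e * e * (f x)\<^sup>2 + (g x)\<^sup>2"
      by (simp add: power2_diff power_mult_distrib power2_eq_square[of e] abs_mult mult_ac)
    then have "\<bar>f x * g x\<bar> \<le> e / 2 * (f x)\<^sup>2 + 1 / (2 * e) * (g x)\<^sup>2" using e by (simp add: field_simps)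
    then have "\<bar>f x * g x\<bar> * ?m x \<le> (e / 2 * (f x)\<^sup>2 + 1 / (2 * e) * (g x)\<^sup>2) * ?m x"
      by (intro mult_right_mono stationary_density_nonneg that)
    then show ?thesis by (simp add: distrib_right mult.assoc)
  qed
  have m1: "(\<lambda>x. indicator ?S x *\<^sub>R (f x * g x * ?m x)) = (\<lambda>x. (indicator ?S x * f x) * (indicator ?S x * g x) * ?m x)"
    by (auto simp: indicator_def fun_eq_iff)
  have m2: "(\<lambda>x. indicator ?S x *\<^sub>R (\<bar>f x * g x\<bar> * ?m x)) = (\<lambda>x. \<bar>(indicator ?S x * f x) * (indicator ?S x * g x)\<bar> * ?m x)"
    by (auto simp: indicator_def fun_eq_iff)
  show 1: "set_integrable lborel ?S (\<lambda>x. \<bar>f x * g x\<bar> * ?m x)"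
    unfolding set_integrable_def
  proof (rule Bochner_Integration.integrable_bound[OF b[unfolded set_integrable_def]])
    show "(\<lambda>x. indicator ?S x *\<^sub>R (\<bar>f x * g x\<bar> * ?m x)) \<in> borel_measurable lborel" unfolding m2 by measurable
    show "AE x in lborel. norm (indicator ?S x *\<^sub>R (\<bar>f x * g x\<bar> * ?m x)) \<le> norm (indicator ?S x *\<^sub>R ?b x)"
    proof (intro AE_I2)
      fix x show "norm (indicator ?S x *\<^sub>R (\<bar>f x * g x\<bar> * ?m x)) \<le> norm (indicator ?S x *\<^sub>R ?b x)"
      proof (cases "x \<in> ?S")
        case True
        then show ?thesis using le[OF True] stationary_density_nonneg[OF True] by (simp add: abs_mult)
      qed simp
    qed
  qed
  show "set_integrable lborel ?S (\<lambda>x. f x * g x * ?m x)"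
    unfolding set_integrable_def
  proof (rule Bochner_Integration.integrable_bound[OF 1[unfolded set_integrable_def]])
    show "(\<lambda>x. indicator ?S x *\<^sub>R (f x * g x * ?m x)) \<in> borel_measurable lborel" unfolding m1 by measurable
  qed (auto intro!: AE_I2 simp: abs_mult indicator_def)
  have "(LINT x:?S|lborel. \<bar>f x * g x\<bar> * ?m x) \<le> (LINT x:?S|lborel. ?b x)"
    by (rule set_integral_mono[OF 1 b]) (rule le)
  also have "\<dots> = e / 2 * (LINT x:?S|lborel. (f x)\<^sup>2 * ?m x) + 1 / (2 * e) * (LINT x:?S|lborel. (g x)\<^sup>2 * ?m x)"
    using f g by (subst set_integral_add(2)) (auto intro!: set_integrable_mult_right)
  finally show "(LINT x:?S|lborel. \<bar>f x * g x\<bar> * ?m x) \<le>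
      e / 2 * (LINT x:?S|lborel. (f x)\<^sup>2 * ?m x) + 1 / (2 * e) * (LINT x:?S|lborel. (g x)\<^sup>2 * ?m x)" .
qed

text \<open>h is integrated against the remainder of the kernel series. In Young's inequality a
  small e first controls the norm of h, and then N is taken so large that the tail of the squared
  coefficients compensates for 1 / e.\<close>

lemma heat_kernel_expansion:
  assumes y: "y \<in> state_space d" and u: "u > 0" and h: "L2_stationary d h"
  shows "(\<lambda>n. fourier_coeff d h n * kernel_coeff u y n) sums (LINT x:state_space d|lborel. h x * heat_kernel u y x * stationary_density d x)"
proof -
  let ?S = "state_space d" and ?m = "stationary_density d"
  let ?K = "heat_kernel u y" and ?s = "\<lambda>N x. \<Sum>n<N. kernel_coeff u y n * Q_poly d n x"
  have hm[measurable]: "(\<lambda>x. indicator ?S x * h x) \<in> borel_measurable borel"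
    and hi: "set_integrable lborel ?S (\<lambda>x. (h x)\<^sup>2 * ?m x)"
    using h by (auto simp: L2_stationary_def set_borel_measurable_def)
  define A where "A = (LINT x:?S|lborel. (h x)\<^sup>2 * ?m x)"
  define T where "T N = (\<Sum>n. (kernel_coeff u y (n + N))\<^sup>2)" for N
  have A0: "0 \<le> A" unfolding A_def set_lebesgue_integral_def
    by (intro integral_nonneg_AE AE_I2) (auto simp: indicator_def intro!: mult_nonneg_nonneg stationary_density_nonneg)
  have T: "T \<longlonglongrightarrow> 0"
    using suminf_exist_split2[OF summable_kernel_coeff[OF y u]] unfolding T_def .
  have K2: "set_integrable lborel ?S (\<lambda>x. (?K x)\<^sup>2 * ?m x)" using heat_kernel_remainder_integral(1)[OF y u, of 0] by simp
  have Km: "(\<lambda>x. indicator ?S x * ?K x) \<in> borel_measurable borel" by measurable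
  have hK: "set_integrable lborel ?S (\<lambda>x. h x * ?K x * ?m x)"
    by (rule L2_product(1)[OF hm Km hi K2 zero_less_one])
  have hQ: "set_integrable lborel ?S (\<lambda>x. h x * Q_poly d n x * ?m x)" for n
  proof (rule L2_product(1)[OF hm _ hi _ zero_less_one])
    show "set_integrable lborel ?S (\<lambda>x. (Q_poly d n x)\<^sup>2 * ?m x)"
      using functional_integrable[of "Qp n * Qp n"] by (simp add: poly_Qp power2_eq_square)
  qed measurable
  have sN: "(LINT x:?S|lborel. h x * ?s N x * ?m x) = (\<Sum>n<N. fourier_coeff d h n * kernel_coeff u y n)"
    and siN: "set_integrable lborel ?S (\<lambda>x. h x * ?s N x * ?m x)" for N
  proof -
    have e: "indicator ?S x *\<^sub>R (h x * ?s N x * ?m x) = (\<Sum>n<N. kernel_coeff u y n * (indicator ?S x *\<^sub>R (h x * Q_poly d n x * ?m x)))" for x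
      by (simp add: sum_distrib_left sum_distrib_right mult_ac)
    show "set_integrable lborel ?S (\<lambda>x. h x * ?s N x * ?m x)"
      unfolding set_integrable_def e using hQ unfolding set_integrable_def
      by (intro Bochner_Integration.integrable_sum integrable_mult_right)
    show "(LINT x:?S|lborel. h x * ?s N x * ?m x) = (\<Sum>n<N. fourier_coeff d h n * kernel_coeff u y n)"
      unfolding set_lebesgue_integral_def e fourier_coeff_def using hQ unfolding set_integrable_def
      by (subst Bochner_Integration.integral_sum) (auto simp: mult.commute)
  qed
  have bound: "\<bar>(LINT x:?S|lborel. h x * ?K x * ?m x) - (\<Sum>n<N. fourier_coeff d h n * kernel_coeff u y n)\<bar> \<le> e / 2 * A + 1 / (2 * e) * T N"
    if e: "e > 0" for e N
  proof -
    have rm: "(\<lambda>x. indicator ?S x * (?K x - ?s N x)) \<in> borel_measurable borel" by measurable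
    note r = heat_kernel_remainder_integral[OF y u, of N]
    note L = L2_product[OF hm rm hi r(1) e]
    have "(LINT x:?S|lborel. h x * ?K x * ?m x) - (\<Sum>n<N. fourier_coeff d h n * kernel_coeff u y n) =
      (LINT x:?S|lborel. h x * (?K x - ?s N x) * ?m x)"
      unfolding sN[symmetric] using set_integral_diff(2)[OF hK siN[of N]] by (simp add: algebra_simps)
    also have "\<bar>\<dots>\<bar> \<le> (LINT x:?S|lborel. \<bar>h x * (?K x - ?s N x)\<bar> * ?m x)"
    proof -
      have "norm (LINT x:?S|lborel. h x * (?K x - ?s N x) * ?m x) \<le> (LINT x:?S|lborel. norm (h x * (?K x - ?s N x) * ?m x))"
        using L(1) by (rule set_integral_norm_bound)
      also have "\<dots> = (LINT x:?S|lborel. \<bar>h x * (?K x - ?s N x)\<bar> * ?m x)"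
        using stationary_density_nonneg by (intro set_lebesgue_integral_cong) (auto simp: abs_mult)
      finally show ?thesis by simp
    qed
    also have "\<dots> \<le> e / 2 * A + 1 / (2 * e) * (LINT x:?S|lborel. (?K x - ?s N x)\<^sup>2 * ?m x)"
      using L(2) unfolding A_def .
    also have "\<dots> \<le> e / 2 * A + 1 / (2 * e) * T N"
      using r(2) e unfolding T_def by (intro add_left_mono mult_left_mono) auto
    finally show ?thesis .
  qed
  show ?thesis unfolding sums_def
  proof (rule LIMSEQ_I)
    fix r :: real assume r: "r > 0"
    \<comment> \<open>Then e A / 2 is at most r / 2, and T N < e r makes T N / (2 e) less than r /
      2.\<close>
    define e where "e = r / (A + 1)"
    have e: "e > 0" using r A0 by (simp add: e_def)
    have "\<forall>\<^sub>F N in sequentially. T N < e * r" using T e r by (intro order_tendstoD(2)) auto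
    then obtain N0 where N0: "\<And>N. N \<ge> N0 \<Longrightarrow> T N < e * r" by (auto simp: eventually_sequentially)
    have "norm ((\<Sum>n<N. fourier_coeff d h n * kernel_coeff u y n) - (LINT x:?S|lborel. h x * ?K x * ?m x)) < r" if "N \<ge> N0" for N
    proof -
      have "e / 2 * A \<le> r / 2" using A0 r by (simp add: e_def field_simps)
      moreover have "1 / (2 * e) * T N < r / 2" using N0[OF that] e by (simp add: field_simps)
      ultimately show ?thesis using bound[OF e, of N] by (simp add: abs_minus_commute)
    qed
    then show "\<exists>N0. \<forall>N\<ge>N0. norm ((\<Sum>n<N. fourier_coeff d h n * kernel_coeff u y n) - (LINT x:?S|lborel. h x * ?K x * ?m x)) < r" by blast
  qed
qed

end

lemma generated_algebra_subset:
  assumes "\<And>u. u \<in> I \<Longrightarrow> X u \<in> borel_measurable M"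
  shows "space (generated_algebra M I X) = space M" "sets (generated_algebra M I X) \<subseteq> sets M"
proof -
  have [measurable]: "(\<lambda>\<omega>. \<lambda>u\<in>I. X u \<omega>) \<in> measurable M (PiM I (\<lambda>_. borel))"
    using assms by (intro measurable_restrict)
  show "space (generated_algebra M I X) = space M" by (simp add: generated_algebra_def)
  have "(\<lambda>\<omega>. \<lambda>u\<in>I. X u \<omega>) \<in> space M \<rightarrow> space (PiM I (\<lambda>_. borel :: real measure))"
    by (auto simp: space_PiM)
  then show "sets (generated_algebra M I X) \<subseteq> sets M"
    unfolding generated_algebra_def by (auto simp: sets_vimage_algebra2 intro!: measurable_sets)
qed

section \<open>Expectations at fixed and at random times\<close>

context admissible_pearson begin

lemma transition_density_integrable:
  assumes y: "y \<in> state_space d" and u: "u > 0"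
  shows "integrable lborel (\<lambda>x. indicator (state_space d) x * transition_density d x u y)"
proof -
  have m1: "(\<lambda>x. indicator (state_space d) x * (1::real)) \<in> borel_measurable borel" by measurable
  have m2: "(\<lambda>x. indicator (state_space d) x * heat_kernel u y x) \<in> borel_measurable borel" by measurable
  have i1: "set_integrable lborel (state_space d) (\<lambda>x. 1\<^sup>2 * stationary_density d x)"
    using functional_integrable[of 1] by simp
  have i2: "set_integrable lborel (state_space d) (\<lambda>x. (heat_kernel u y x)\<^sup>2 * stationary_density d x)"
    using heat_kernel_remainder_integral(1)[OF y u, of 0] by simp
  show ?thesis using L2_product(1)[OF m1 m2 i1 i2 zero_less_one]
    by (simp add: set_integrable_def transition_density_eq mult_ac)
qed

text \<open>The Markov property from time 0: the process starts at y, so the conditional probability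
  is almost surely constant and equals the marginal one. That the series for the transition density
  is nonnegative is not visible from its terms; it follows almost everywhere because its integrals
  are probabilities.\<close>

lemma marginal_law:
  assumes pd: "pearson_diffusion d P X" and y: "y \<in> state_space d" and u: "u > 0"
  defines "p \<equiv> \<lambda>x. indicator (state_space d) x * transition_density d x u y"
  shows "AE x in lborel. 0 \<le> p x"
    and "distr (P y) borel (X u) = density lborel (\<lambda>x. ennreal (p x))"
proof -
  interpret prob_space "P y" using pd y by (auto simp: pearson_diffusion_def)
  have X[measurable]: "X t \<in> borel_measurable (P y)" if "0 \<le> t" for t
    using pd y that by (auto simp: pearson_diffusion_def)
  have Xu[measurable]: "X u \<in> borel_measurable (P y)" using u by (intro X) simp
  let ?G = "generated_algebra (P y) {0..0} X"
  have sub: "subalgebra (P y) ?G"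
    using generated_algebra_subset[of "{0..0}" X "P y"] X by (auto simp: subalgebra_def)
  interpret finite_measure_subalgebra "P y" ?G by unfold_locales (rule sub)
  have pint: "integrable lborel p" unfolding p_def by (rule transition_density_integrable[OF y u])
  have [measurable]: "p \<in> borel_measurable borel" using borel_measurable_integrable[OF pint] by simp
  have prob: "prob (X u -` B \<inter> space (P y)) = (LINT x:B|lborel. p x)" if B: "B \<in> sets borel" for B
  proof -
    note [measurable] = B
    let ?i = "indicator (X u -` B \<inter> space (P y)) :: 'a \<Rightarrow> real"
    have i: "integrable (P y) ?i" by (auto intro!: integrable_real_indicator simp: emeasure_eq_measure)
    have "AE \<omega> in P y. real_cond_exp (P y) ?G ?i \<omega> = (LINT x:B \<inter> state_space d|lborel. transition_density d x (u - 0) (X 0 \<omega>))"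
      using pd y u B unfolding pearson_diffusion_def by blast
    moreover have "AE \<omega> in P y. X 0 \<omega> = y" using pd y by (auto simp: pearson_diffusion_def)
    ultimately have ae: "AE \<omega> in P y. real_cond_exp (P y) ?G ?i \<omega> = (LINT x:B \<inter> state_space d|lborel. transition_density d x u y)"
      by eventually_elim simp
    have "prob (X u -` B \<inter> space (P y)) = (LINT \<omega>|P y. real_cond_exp (P y) ?G ?i \<omega>)"
      using real_cond_exp_int(2)[OF i] by simp
    also have "\<dots> = (LINT \<omega>|P y. (LINT x:B \<inter> state_space d|lborel. transition_density d x u y))"
      using ae by (intro integral_cong_AE borel_measurable_cond_exp2) auto
    also have "\<dots> = (LINT x:B|lborel. p x)"
      by (simp add: prob_space set_lebesgue_integral_def p_def indicator_inter_arith mult.assoc)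
    finally show ?thesis .
  qed
  show nn: "AE x in lborel. 0 \<le> p x"
    by (rule sigma_finite_measure.density_nonneg[OF lborel.sigma_finite_measure_axioms pint]) (simp add: prob[symmetric])
  show "distr (P y) borel (X u) = density lborel (\<lambda>x. ennreal (p x))"
  proof (rule measure_eqI)
    fix B assume "B \<in> sets (distr (P y) borel (X u))"
    then have [measurable]: "B \<in> sets borel" by simp
    have ip: "integrable lborel (\<lambda>x. indicator B x *\<^sub>R p x)" by (intro integrable_mult_indicator pint) simp
    have "emeasure (distr (P y) borel (X u)) B = ennreal (LINT x|lborel. indicator B x *\<^sub>R p x)"
      using prob[of B] by (simp add: emeasure_distr emeasure_eq_measure set_lebesgue_integral_def)
    also have "\<dots> = (\<integral>\<^sup>+x. ennreal (indicator B x *\<^sub>R p x) \<partial>lborel)"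
      using nn by (intro nn_integral_eq_integral[symmetric] ip) (auto simp: indicator_def)
    also have "\<dots> = emeasure (density lborel (\<lambda>x. ennreal (p x))) B"
      by (subst emeasure_density) (auto intro!: nn_integral_cong simp: indicator_def)
    finally show "emeasure (distr (P y) borel (X u)) B = emeasure (density lborel (\<lambda>x. ennreal (p x))) B" .
  qed simp
qed

text \<open>The bound in the second claim depends on the time only through the squared kernel
  coefficients. This is the quantity whose mean over the random time is shown finite in
  \<open>randomised_diagonal_finite\<close>.\<close>

lemma marginal_expectation:
  assumes pd: "pearson_diffusion d P X" and y: "y \<in> state_space d" and u: "u > 0" and h: "L2_stationary d h"
  defines "hS \<equiv> \<lambda>x. indicator (state_space d) x * h x"
  shows "(LINT \<omega>|P y. hS (X u \<omega>)) = (\<Sum>n. fourier_coeff d h n * kernel_coeff u y n)"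
    and "(\<integral>\<^sup>+\<omega>. ennreal \<bar>hS (X u \<omega>)\<bar> \<partial>P y) \<le>
      ennreal ((LINT x:state_space d|lborel. (h x)\<^sup>2 * stationary_density d x) + (\<Sum>n. (kernel_coeff u y n)\<^sup>2))"
proof -
  let ?S = "state_space d" and ?m = "stationary_density d"
  define p where "p x = indicator ?S x * transition_density d x u y" for x
  have hm[measurable]: "hS \<in> borel_measurable borel"
    and hi: "set_integrable lborel ?S (\<lambda>x. (h x)\<^sup>2 * ?m x)"
    using h by (auto simp: L2_stationary_def set_borel_measurable_def hS_def)
  have [measurable]: "X u \<in> borel_measurable (P y)" using pd y u by (auto simp: pearson_diffusion_def)
  have nn: "AE x in lborel. 0 \<le> p x" and law: "distr (P y) borel (X u) = density lborel (\<lambda>x. ennreal (p x))"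
    using marginal_law[OF pd y u] by (auto simp: p_def[abs_def])
  have [measurable]: "p \<in> borel_measurable borel"
    using borel_measurable_integrable[OF transition_density_integrable[OF y u]] by (simp add: p_def[abs_def])
  have "(LINT \<omega>|P y. hS (X u \<omega>)) = (LINT x|distr (P y) borel (X u). hS x)" by (simp add: integral_distr)
  also have "\<dots> = (LINT x|lborel. p x *\<^sub>R hS x)" unfolding law using nn by (intro integral_density) auto
  also have "\<dots> = (LINT x:?S|lborel. h x * heat_kernel u y x * ?m x)"
    unfolding set_lebesgue_integral_def
    by (intro Bochner_Integration.integral_cong) (auto simp: p_def hS_def transition_density_eq indicator_def)
  also have "\<dots> = (\<Sum>n. fourier_coeff d h n * kernel_coeff u y n)"
    using sums_unique[OF heat_kernel_expansion[OF y u h]] .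
  finally show "(LINT \<omega>|P y. hS (X u \<omega>)) = (\<Sum>n. fourier_coeff d h n * kernel_coeff u y n)" .
  have Km: "(\<lambda>x. indicator ?S x * heat_kernel u y x) \<in> borel_measurable borel" by measurable
  have K2: "set_integrable lborel ?S (\<lambda>x. (heat_kernel u y x)\<^sup>2 * ?m x)"
    using heat_kernel_remainder_integral(1)[OF y u, of 0] by simp
  note L = L2_product[OF hm[unfolded hS_def] Km hi K2 zero_less_one]
  have T0: "(LINT x:?S|lborel. (heat_kernel u y x)\<^sup>2 * ?m x) \<le> (\<Sum>n. (kernel_coeff u y n)\<^sup>2)"
    using heat_kernel_remainder_integral(2)[OF y u, of 0] by simp
  have A0: "0 \<le> (LINT x:?S|lborel. (f x)\<^sup>2 * ?m x)" for f :: "real \<Rightarrow> real"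
    unfolding set_lebesgue_integral_def
    by (intro integral_nonneg_AE AE_I2) (auto simp: indicator_def intro!: mult_nonneg_nonneg stationary_density_nonneg)
  have "(\<integral>\<^sup>+\<omega>. ennreal \<bar>hS (X u \<omega>)\<bar> \<partial>P y) = (\<integral>\<^sup>+x. ennreal \<bar>hS x\<bar> \<partial>distr (P y) borel (X u))"
    by (simp add: nn_integral_distr)
  also have "\<dots> = (\<integral>\<^sup>+x. ennreal (p x) * ennreal \<bar>hS x\<bar> \<partial>lborel)" unfolding law by (rule nn_integral_density) auto
  also have "\<dots> = (\<integral>\<^sup>+x. ennreal (indicator ?S x *\<^sub>R (\<bar>h x * heat_kernel u y x\<bar> * ?m x)) \<partial>lborel)"
  proof (rule nn_integral_cong_AE, rule AE_mp[OF nn], intro AE_I2 impI)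
    fix x assume px: "0 \<le> p x"
    show "ennreal (p x) * ennreal \<bar>hS x\<bar> = ennreal (indicator ?S x *\<^sub>R (\<bar>h x * heat_kernel u y x\<bar> * ?m x))"
    proof (cases "x \<in> ?S")
      case True
      have e: "p x * \<bar>hS x\<bar> = \<bar>p x * hS x\<bar>" using px by (simp add: abs_mult)
      have "p x * \<bar>hS x\<bar> = \<bar>h x * heat_kernel u y x\<bar> * ?m x"
        unfolding e using True stationary_density_nonneg[OF True] by (simp add: p_def hS_def transition_density_eq abs_mult mult_ac)
      then show ?thesis using True px by (simp add: ennreal_mult[symmetric])
    qed (simp add: p_def)
  qed
  also have "\<dots> = ennreal (LINT x:?S|lborel. \<bar>h x * heat_kernel u y x\<bar> * ?m x)"
    unfolding set_lebesgue_integral_def using L(3) unfolding set_integrable_def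
    by (intro nn_integral_eq_integral) (auto simp: indicator_def stationary_density_nonneg)
  also have "\<dots> \<le> ennreal ((LINT x:?S|lborel. (h x)\<^sup>2 * ?m x) + (\<Sum>n. (kernel_coeff u y n)\<^sup>2))"
    using L(2) T0 A0[of h] A0[of "heat_kernel u y"] by (intro ennreal_leI) simp
  finally show "(\<integral>\<^sup>+\<omega>. ennreal \<bar>hS (X u \<omega>)\<bar> \<partial>P y) \<le>
      ennreal ((LINT x:?S|lborel. (h x)\<^sup>2 * ?m x) + (\<Sum>n. (kernel_coeff u y n)\<^sup>2))" .
qed

text \<open>Averaging replaces exp (-2 c \<lambda> Z) by its expectation, at most C / (1 + 2 c
  \<lambda>), and this is comparable with the resolvent weight 1 / (1 + \<lambda>).\<close>

lemma randomised_diagonal_finite: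
  assumes y: "y \<in> state_space d" and "prob_space M" and [measurable]: "Z \<in> borel_measurable M"
    and Z0: "\<And>\<omega>. 0 \<le> Z \<omega>" and C: "\<And>z. z \<ge> 0 \<Longrightarrow> (LINT \<omega>|M. exp (- z * Z \<omega>)) \<le> C / (1 + z)" and c: "c > 0"
    and Zpos: "AE \<omega> in M. 0 < Z \<omega>"
  shows "(\<integral>\<^sup>+\<omega>. ennreal (\<Sum>n. (kernel_coeff (c * Z \<omega>) y n)\<^sup>2) \<partial>M) < \<infinity>"
proof -
  interpret prob_space M by fact
  have C0: "0 \<le> C" using C[of 0] by (simp add: prob_space)
  have k2: "(kernel_coeff (c * z) y n)\<^sup>2 = (Q_poly d n y)\<^sup>2 * exp (- (2 * c * eigenvalue d n) * z)" for n z
    by (simp add: kernel_coeff_def power_mult_distrib power2_eq_square[of "exp _"] exp_add[symmetric] mult_ac)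
  \<comment> \<open>The factor 1 + 1 / (2 c) gives 1 + \<lambda> \<le> (1 + 1 / (2 c)) (1 + 2 c
    \<lambda>).\<close>
  define C' where "C' = C * (1 + 1 / (2 * c))"
  have C': "0 \<le> C'" using C0 c by (simp add: C'_def)
  have le: "ennreal ((Q_poly d n y)\<^sup>2 * (LINT \<omega>|M. exp (- (2 * c * eigenvalue d n) * Z \<omega>))) \<le>
    ennreal (C' * ((Q_poly d n y)\<^sup>2 / (1 + eigenvalue d n)))" for n
  proof (rule ennreal_leI)
    let ?l = "eigenvalue d n"
    have l: "0 \<le> ?l" by (rule eigenvalue_nonneg[OF adm])
    have "(LINT \<omega>|M. exp (- (2 * c * ?l) * Z \<omega>)) \<le> C / (1 + 2 * c * ?l)" using C[of "2 * c * ?l"] l c by simp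
    also have "\<dots> \<le> C' / (1 + ?l)"
    proof -
      have "1 + ?l \<le> (1 + 1 / (2 * c)) * (1 + 2 * c * ?l)" using l c by (simp add: field_simps)
      then have "C * (1 + ?l) \<le> C * ((1 + 1 / (2 * c)) * (1 + 2 * c * ?l))" using C0 by (rule mult_left_mono)
      then have "C * (1 + ?l) \<le> C' * (1 + 2 * c * ?l)" by (simp only: C'_def mult.assoc)
      moreover have "0 < 1 + ?l" "0 < 1 + 2 * c * ?l" using l c by (auto intro: add_pos_nonneg)
      ultimately show ?thesis by (simp add: pos_divide_le_eq pos_le_divide_eq)
    qed
    finally have "(Q_poly d n y)\<^sup>2 * (LINT \<omega>|M. exp (- (2 * c * ?l) * Z \<omega>)) \<le> (Q_poly d n y)\<^sup>2 * (C' / (1 + ?l))"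
      by (intro mult_left_mono) auto
    then show "(Q_poly d n y)\<^sup>2 * (LINT \<omega>|M. exp (- (2 * c * ?l) * Z \<omega>)) \<le> C' * ((Q_poly d n y)\<^sup>2 / (1 + ?l))"
      by (simp add: mult.commute)
  qed
  have "(\<integral>\<^sup>+\<omega>. ennreal (\<Sum>n. (kernel_coeff (c * Z \<omega>) y n)\<^sup>2) \<partial>M) =
    (\<integral>\<^sup>+\<omega>. (\<Sum>n. ennreal ((kernel_coeff (c * Z \<omega>) y n)\<^sup>2)) \<partial>M)"
  proof (rule nn_integral_cong_AE, rule AE_mp[OF Zpos], intro AE_I2 impI)
    fix \<omega> assume "0 < Z \<omega>"
    then have "0 < c * Z \<omega>" using c by simp
    then show "ennreal (\<Sum>n. (kernel_coeff (c * Z \<omega>) y n)\<^sup>2) = (\<Sum>n. ennreal ((kernel_coeff (c * Z \<omega>) y n)\<^sup>2))"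
      by (intro suminf_ennreal2[symmetric] summable_kernel_coeff y) auto
  qed
  also have "\<dots> = (\<Sum>n. \<integral>\<^sup>+\<omega>. ennreal ((kernel_coeff (c * Z \<omega>) y n)\<^sup>2) \<partial>M)"
    unfolding kernel_coeff_def by (rule nn_integral_suminf) measurable
  also have "\<dots> = (\<Sum>n. ennreal ((Q_poly d n y)\<^sup>2 * (LINT \<omega>|M. exp (- (2 * c * eigenvalue d n) * Z \<omega>))))"
  proof (rule suminf_cong)
    fix n
    have "integrable M (\<lambda>\<omega>. exp (- (2 * c * eigenvalue d n) * Z \<omega>))"
      by (rule integrable_const_bound[of _ 1]) (use c Z0 eigenvalue_nonneg[OF adm, of n] in auto)
    then show "(\<integral>\<^sup>+\<omega>. ennreal ((kernel_coeff (c * Z \<omega>) y n)\<^sup>2) \<partial>M) = ennreal ((Q_poly d n y)\<^sup>2 * (LINT \<omega>|M. exp (- (2 * c * eigenvalue d n) * Z \<omega>)))"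
      unfolding k2 by (subst nn_integral_eq_integral) (auto intro: integrable_mult_right)
  qed
  also have "\<dots> \<le> (\<Sum>n. ennreal (C' * ((Q_poly d n y)\<^sup>2 / (1 + eigenvalue d n))))"
    using le by (intro suminf_le) auto
  also have "\<dots> = ennreal (\<Sum>n. C' * ((Q_poly d n y)\<^sup>2 / (1 + eigenvalue d n)))"
    using C' eigenvalue_nonneg[OF adm] by (intro suminf_ennreal2 summable_mult summable_resolvent y) auto
  also have "\<dots> < \<infinity>" by simp
  finally show ?thesis .
qed

text \<open>Given Z, the process is evaluated at a frozen positive time and the formula for fixed
  times applies. Fubini is licensed by first carrying out the same computation for the absolute
  value, with the finite bound of \<open>randomised_diagonal_finite\<close>.\<close>

lemma randomised_expectation:
  assumes pd: "pearson_diffusion d P X" and y: "y \<in> state_space d" and h: "L2_stationary d h"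
    and ind: "independent_of_process (P y) X Z"
    and Z0: "\<And>\<omega>. 0 \<le> Z \<omega>" and C: "\<And>z. z \<ge> 0 \<Longrightarrow> (LINT \<omega>|P y. exp (- z * Z \<omega>)) \<le> C / (1 + z)" and c: "c > 0"
    and Zpos: "AE \<omega> in P y. 0 < Z \<omega>"
  shows "integrable (P y) (\<lambda>\<omega>. h (X (c * Z \<omega>) \<omega>))"
    and "(LINT \<omega>|P y. h (X (c * Z \<omega>) \<omega>)) = (LINT \<omega>|P y. (\<Sum>n. fourier_coeff d h n * kernel_coeff (c * Z \<omega>) y n))"
proof -
  let ?S = "state_space d" and ?M = "P y"
  let ?G = "generated_algebra (P y) {0..} X"
  interpret prob_space ?M using pd y by (auto simp: pearson_diffusion_def)
  have X: "X t \<in> borel_measurable ?M" "\<And>\<omega>. \<omega> \<in> space ?M \<Longrightarrow> X t \<omega> \<in> ?S" if "0 \<le> t" for t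
    using pd y that by (auto simp: pearson_diffusion_def)
  have XG: "(\<lambda>(t, \<omega>). X t \<omega>) \<in> borel_measurable (restrict_space borel {0..} \<Otimes>\<^sub>M ?G)"
    using pd y by (auto simp: pearson_diffusion_def)
  define hS where "hS x = indicator ?S x * h x" for x
  have [measurable]: "hS \<in> borel_measurable borel"
    using h by (auto simp: L2_stationary_def set_borel_measurable_def hS_def[abs_def])
  have inds: "indep_set (sets ?G) (sets (vimage_algebra (space ?M) Z borel))"
    using ind by (simp add: independent_of_process_def)
  have Gsp: "space ?G = space ?M" "sets ?G \<subseteq> sets ?M"
    using generated_algebra_subset[of "{0..}" X ?M] X by auto
  have [measurable]: "(\<lambda>\<omega>. \<omega>) \<in> measurable ?M ?G"
    using Gsp by (auto intro!: measurableI dest: sets.sets_into_space simp: Int_absorb2)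
  have Zv: "Z -` B \<inter> space ?M \<in> sets (vimage_algebra (space ?M) Z borel)" if "B \<in> sets borel" for B
    using that by (auto simp: sets_vimage_algebra2)
  have [measurable]: "Z \<in> borel_measurable ?M"
    using Zv indep_setD_ev2[OF inds] by (intro measurableI) auto
  \<comment> \<open>The outcome, seen through the sigma-algebra of the process, is a random element
    independent of Z; thus Z and the whole path have a product law.\<close>
  have pair: "distr ?M borel Z \<Otimes>\<^sub>M distr ?M ?G (\<lambda>\<omega>. \<omega>) = distr ?M (borel \<Otimes>\<^sub>M ?G) (\<lambda>\<omega>. (Z \<omega>, \<omega>))"
  proof (rule distr_pair_if_indep)
    fix A B assume A: "A \<in> sets (borel :: real measure)" and B: "B \<in> sets ?G"
    have "(\<lambda>\<omega>. \<omega>) -` B \<inter> space ?M = B" using sets.sets_into_space[OF B] Gsp by auto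
    then show "prob ((Z -` A \<inter> space ?M) \<inter> ((\<lambda>\<omega>. \<omega>) -` B \<inter> space ?M)) =
        prob (Z -` A \<inter> space ?M) * prob ((\<lambda>\<omega>. \<omega>) -` B \<inter> space ?M)"
      using indep_setD[OF inds B Zv[OF A]] by (simp add: Int_commute mult.commute)
  qed measurable
  \<comment> \<open>The maximum and the indicator in \<open>hS\<close> make f measurable on the full
    product; they change nothing, because Z is nonnegative and the paths stay in the state
    space.\<close>
  define f where "f = (\<lambda>(z, \<omega>). hS (X (max 0 (c * z)) \<omega>))"
  have fm[measurable]: "f \<in> borel_measurable (borel \<Otimes>\<^sub>M ?G)"
  proof -
    have "(\<lambda>p. (max 0 (c * fst p), snd p)) \<in> measurable (borel \<Otimes>\<^sub>M ?G) (restrict_space borel {0..} \<Otimes>\<^sub>M ?G)"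
      by (intro measurable_Pair measurable_restrict_space2) auto
    from measurable_compose[OF measurable_compose[OF this XG], of hS borel]
    show ?thesis by (simp add: f_def split_beta)
  qed
  have fm'[measurable]: "(\<lambda>(\<omega>, \<omega>'). f (Z \<omega>, \<omega>')) \<in> borel_measurable (?M \<Otimes>\<^sub>M ?M)" by measurable
  have fZ: "f (Z \<omega>, \<omega>) = h (X (c * Z \<omega>) \<omega>)" if "\<omega> \<in> space ?M" for \<omega>
  proof -
    have "0 \<le> c * Z \<omega>" using Z0 c by simp
    then show ?thesis using X(2)[OF _ that] by (simp add: f_def hS_def max_def)
  qed
  define A where "A = (LINT x:?S|lborel. (h x)\<^sup>2 * stationary_density d x)"
  have A0: "0 \<le> A" unfolding A_def set_lebesgue_integral_def
    by (intro integral_nonneg_AE AE_I2) (auto simp: indicator_def intro!: mult_nonneg_nonneg stationary_density_nonneg)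
  have "(\<integral>\<^sup>+\<omega>. ennreal \<bar>f (Z \<omega>, \<omega>)\<bar> \<partial>?M) = (\<integral>\<^sup>+\<omega>. \<integral>\<^sup>+\<omega>'. ennreal \<bar>f (Z \<omega>, \<omega>')\<bar> \<partial>?M \<partial>?M)"
    by (rule nn_integral_indep_pair[OF _ _ _ pair, where f="\<lambda>p. ennreal \<bar>f p\<bar>"]) measurable
  also have "\<dots> \<le> (\<integral>\<^sup>+\<omega>. ennreal A + ennreal (\<Sum>n. (kernel_coeff (c * Z \<omega>) y n)\<^sup>2) \<partial>?M)"
  proof (rule nn_integral_mono_AE, rule AE_mp[OF Zpos], intro AE_I2 impI)
    fix \<omega> assume "0 < Z \<omega>"
    then have u: "0 < c * Z \<omega>" using c by simp
    have s0: "0 \<le> (\<Sum>n. (kernel_coeff (c * Z \<omega>) y n)\<^sup>2)" by (intro suminf_nonneg summable_kernel_coeff y u) auto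
    have "(\<integral>\<^sup>+\<omega>'. ennreal \<bar>f (Z \<omega>, \<omega>')\<bar> \<partial>?M) = (\<integral>\<^sup>+\<omega>'. ennreal \<bar>hS (X (c * Z \<omega>) \<omega>')\<bar> \<partial>?M)"
      using u by (simp add: f_def max_def)
    also have "\<dots> \<le> ennreal (A + (\<Sum>n. (kernel_coeff (c * Z \<omega>) y n)\<^sup>2))"
      unfolding hS_def A_def by (rule marginal_expectation(2)[OF pd y u h])
    also have "\<dots> = ennreal A + ennreal (\<Sum>n. (kernel_coeff (c * Z \<omega>) y n)\<^sup>2)"
      using A0 s0 by (rule ennreal_plus)
    finally show "(\<integral>\<^sup>+\<omega>'. ennreal \<bar>f (Z \<omega>, \<omega>')\<bar> \<partial>?M) \<le> ennreal A + ennreal (\<Sum>n. (kernel_coeff (c * Z \<omega>) y n)\<^sup>2)" .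
  qed
  also have "\<dots> = ennreal A + (\<integral>\<^sup>+\<omega>. ennreal (\<Sum>n. (kernel_coeff (c * Z \<omega>) y n)\<^sup>2) \<partial>?M)"
    unfolding kernel_coeff_def by (subst nn_integral_add) (auto simp: emeasure_space_1)
  also have "\<dots> < \<infinity>"
    using randomised_diagonal_finite[OF y prob_space_axioms _ Z0 C c Zpos] by simp
  finally have fin: "(\<integral>\<^sup>+\<omega>. ennreal \<bar>f (Z \<omega>, \<omega>)\<bar> \<partial>?M) < \<infinity>" .
  have int: "integrable ?M (\<lambda>\<omega>. f (Z \<omega>, \<omega>))"
    by (rule integrableI_bounded) (use fin in simp_all)
  then show "integrable ?M (\<lambda>\<omega>. h (X (c * Z \<omega>) \<omega>))"
    by (subst Bochner_Integration.integrable_cong[OF refl fZ[symmetric]]) auto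
  have "(LINT \<omega>|?M. h (X (c * Z \<omega>) \<omega>)) = (LINT \<omega>|?M. f (Z \<omega>, \<omega>))"
    by (intro Bochner_Integration.integral_cong refl) (simp add: fZ)
  also have "\<dots> = (LINT \<omega>|?M. LINT \<omega>'|?M. f (Z \<omega>, \<omega>'))"
    by (rule integral_indep_pair[OF _ _ fm pair int]) measurable
  also have "\<dots> = (LINT \<omega>|?M. (\<Sum>n. fourier_coeff d h n * kernel_coeff (c * Z \<omega>) y n))"
  proof (rule integral_cong_AE)
    show "AE \<omega> in ?M. (LINT \<omega>'|?M. f (Z \<omega>, \<omega>')) = (\<Sum>n. fourier_coeff d h n * kernel_coeff (c * Z \<omega>) y n)"
    proof (rule AE_mp[OF Zpos], intro AE_I2 impI)
      fix \<omega> assume "0 < Z \<omega>"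
      then have u: "0 < c * Z \<omega>" using c by simp
      then have "(LINT \<omega>'|?M. f (Z \<omega>, \<omega>')) = (LINT \<omega>'|?M. hS (X (c * Z \<omega>) \<omega>'))" by (simp add: f_def max_def)
      then show "(LINT \<omega>'|?M. f (Z \<omega>, \<omega>')) = (\<Sum>n. fourier_coeff d h n * kernel_coeff (c * Z \<omega>) y n)"
        using marginal_expectation(1)[OF pd y u h] by (simp add: hS_def)
    qed
    show "(\<lambda>\<omega>. \<Sum>n. fourier_coeff d h n * kernel_coeff (c * Z \<omega>) y n) \<in> borel_measurable ?M"
      unfolding kernel_coeff_def by measurable
  qed measurable
  finally show "(LINT \<omega>|?M. h (X (c * Z \<omega>) \<omega>)) = (LINT \<omega>|?M. (\<Sum>n. fourier_coeff d h n * kernel_coeff (c * Z \<omega>) y n))" .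
qed

text \<open>Time 0 is treated separately, since the transition density concerns positive times
  only.\<close>

lemma initial_expectation:
  assumes pd: "pearson_diffusion d P X" and y: "y \<in> state_space d" and h: "L2_stationary d h"
  shows "integrable (P y) (\<lambda>\<omega>. h (X 0 \<omega>))" "(LINT \<omega>|P y. h (X 0 \<omega>)) = h y"
proof -
  interpret prob_space "P y" using pd y by (auto simp: pearson_diffusion_def)
  have [measurable]: "X 0 \<in> borel_measurable (P y)" and XS: "\<And>\<omega>. \<omega> \<in> space (P y) \<Longrightarrow> X 0 \<omega> \<in> state_space d"
    and ae: "AE \<omega> in P y. X 0 \<omega> = y"
    using pd y by (auto simp: pearson_diffusion_def)
  define hS where "hS x = indicator (state_space d) x * h x" for x
  have [measurable]: "hS \<in> borel_measurable borel"
    using h by (auto simp: L2_stationary_def set_borel_measurable_def hS_def[abs_def])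
  have eq: "h (X 0 \<omega>) = hS (X 0 \<omega>)" if "\<omega> \<in> space (P y)" for \<omega> using XS[OF that] by (simp add: hS_def)
  have "(\<lambda>\<omega>. hS (X 0 \<omega>)) \<in> borel_measurable (P y)" by measurable
  then have [measurable]: "(\<lambda>\<omega>. h (X 0 \<omega>)) \<in> borel_measurable (P y)"
    by (subst measurable_cong[OF eq])
  show "integrable (P y) (\<lambda>\<omega>. h (X 0 \<omega>))"
    by (rule integrable_const_bound[of _ "\<bar>h y\<bar>"]) (use ae in \<open>auto elim: eventually_mono\<close>)
  have "(LINT \<omega>|P y. h (X 0 \<omega>)) = (LINT \<omega>|P y. h y)"
    by (rule integral_cong_AE) (use ae in \<open>auto elim: eventually_mono\<close>)
  then show "(LINT \<omega>|P y. h (X 0 \<omega>)) = h y" by (simp add: prob_space)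
qed

end

section \<open>The stretched process\<close>

locale stretched_pearson = admissible_pearson d for d :: pearson +
  fixes \<alpha> \<gamma> :: real and h :: "real \<Rightarrow> real" and P :: "real \<Rightarrow> 'a measure" and X \<sigma> :: "real \<Rightarrow> 'a \<Rightarrow> real"
  assumes \<alpha>: "0 < \<alpha>" "\<alpha> < 1" and \<gamma>: "0 \<le> \<gamma>"
    and pd: "pearson_diffusion d P X"
    and sub: "\<And>y. y \<in> state_space d \<Longrightarrow> stable_subordinator \<alpha> (P y) \<sigma>"
    and ind: "\<And>y. y \<in> state_space d \<Longrightarrow> independent_of_process (P y) X (Z_var \<gamma> \<sigma>)"
    and h2: "L2_stationary d h"
    and unif: "\<And>u v. {u..v} \<subseteq> state_space d \<Longrightarrow>
      uniform_limit {u..v} (\<lambda>N y. \<Sum>n<N. fourier_coeff d h n * Q_poly d n y) h sequentially"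
begin

text \<open>Each starting point has its own measure, but the modes must not depend on y. They are
  defined under one reference measure and carried to the others by
  \<open>occ_laplace_unique\<close>.\<close>

definition base :: real where "base = (SOME y. y \<in> state_space d)"

lemma base: "base \<in> state_space d"
  using state_space_nonempty some_in_eq[of "state_space d"] unfolding base_def by simp

lemma subordinator_at: "y \<in> state_space d \<Longrightarrow> subordinator (P y) \<alpha> \<sigma>"
  using sub[of y] \<alpha> unfolding subordinator_def subordinator_axioms_def by (simp add: stable_subordinator_def)

sublocale B: subordinator "P base" \<alpha> \<sigma>
  by (rule subordinator_at[OF base])

abbreviation "c n \<equiv> fourier_coeff d h n"
abbreviation "lam n \<equiv> eigenvalue d n"
abbreviation "f n \<equiv> B.mode \<gamma> (lam n)"

lemma lam: "0 \<le> lam n" "lam n \<le> lam (Suc n)"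
  using eigenvalue_nonneg[OF adm] eigenvalue_Suc[OF adm, of n] by (auto intro: less_imp_le)

section \<open>The expansion of g and of its time derivative\<close>

definition g :: "real \<Rightarrow> real \<Rightarrow> real" where
  "g t y = (LINT \<omega>|P y. h (stretched_process \<alpha> \<gamma> X \<sigma> t \<omega>))"

definition part :: "nat \<Rightarrow> real \<Rightarrow> real \<Rightarrow> real" where
  "part N s y = (\<Sum>n<N. c n * Q_poly d n y * f n s)"

definition dpart :: "nat \<Rightarrow> real \<Rightarrow> real \<Rightarrow> real" where
  "dpart N s y = (\<Sum>n<N. c n * Q_poly d n y * - B.mode_rate \<gamma> (lam n) s)"

lemma F_independent: "y \<in> state_space d \<Longrightarrow> 0 \<le> z \<Longrightarrow> (LINT \<omega>|P y. exp (- z * Z_var \<gamma> \<sigma> \<omega>)) = B.F \<gamma> z"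
  using B.occ_laplace_unique[OF subordinator_at \<gamma>, of y z 1]
  by (simp add: Z_var_eq_occupation B.F_eq_occ_laplace)

lemma series_at: "y \<in> state_space d \<Longrightarrow> (\<lambda>N. \<Sum>n<N. c n * Q_poly d n y) \<longlonglongrightarrow> h y"
  using tendsto_uniform_limitI[OF unif[of y y]] by simp

text \<open>At the positive random time the kernel expansion holds almost surely; dominated
  convergence interchanges it with the expectation, and each term integrates to a mode.\<close>

lemma expectation_positive_time:
  assumes y: "y \<in> state_space d" and t: "t > 0"
  shows "integrable (P y) (\<lambda>\<omega>. h (stretched_process \<alpha> \<gamma> X \<sigma> t \<omega>))"
    and "(\<lambda>N. part N t y) \<longlonglongrightarrow> g t y"
proof -
  interpret Y: subordinator "P y" \<alpha> \<sigma> by (rule subordinator_at[OF y])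
  define a where "a = t powr (\<alpha> + \<gamma>)"
  have a: "a > 0" using t by (simp add: a_def)
  let ?Z = "Z_var \<gamma> \<sigma>"
  have [measurable]: "?Z \<in> borel_measurable (P y)" unfolding Z_var_eq_occupation by measurable
  have Z0: "0 \<le> ?Z \<omega>" for \<omega> unfolding Z_var_eq_occupation by (rule Y.occupation_nonneg)
  have Zpos: "AE \<omega> in P y. 0 < ?Z \<omega>" unfolding Z_var_eq_occupation by (rule Y.AE_occupation_pos[OF \<gamma>])
  obtain C where "\<And>z. z \<ge> 0 \<Longrightarrow> Y.F \<gamma> z \<le> C / (1 + z)" using Y.F_decay[OF \<gamma>] by blast
  then have C: "\<And>z. z \<ge> 0 \<Longrightarrow> (LINT \<omega>|P y. exp (- z * ?Z \<omega>)) \<le> C / (1 + z)"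
    by (simp add: Y.F_def Z_var_eq_occupation)
  note R = randomised_expectation[OF pd y h2 ind[OF y] Z0 C a Zpos]
  show "integrable (P y) (\<lambda>\<omega>. h (stretched_process \<alpha> \<gamma> X \<sigma> t \<omega>))"
    using R(1) by (simp add: stretched_process_def a_def)
  have gt: "g t y = (LINT \<omega>|P y. (\<Sum>n. c n * kernel_coeff (a * ?Z \<omega>) y n))"
    using R(2) by (simp add: g_def stretched_process_def a_def)
  have "Bseq (\<lambda>N. \<Sum>n<N. c n * Q_poly d n y)"
    using series_at[OF y] by (intro convergent_imp_Bseq convergentI)
  then obtain B where B: "\<And>N. \<bar>\<Sum>n<N. c n * Q_poly d n y\<bar> \<le> B" unfolding Bseq_def by auto
  \<comment> \<open>The dominating constant: exponentials decrease in n, so by Abel summation the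
    partial sums at every nonnegative time obey the bound for the series of h at y.\<close>
  have bnd: "\<bar>\<Sum>n<N. c n * kernel_coeff (a * z) y n\<bar> \<le> B" if z: "0 \<le> z" for z N
  proof -
    have "\<bar>\<Sum>n=0..<N. (c n * Q_poly d n y) * exp (- lam n * (a * z))\<bar> \<le> B"
    proof (rule abel_summation_bound)
      show "\<bar>\<Sum>n=0..<k. c n * Q_poly d n y\<bar> \<le> B" for k using B[of k] by (simp add: atLeast0LessThan)
      show "exp (- lam (Suc n) * (a * z)) \<le> exp (- lam n * (a * z))" for n
        using lam(2)[of n] a z by (auto intro!: mult_right_mono)
      show "exp (- lam n * (a * z)) \<le> 1" for n using lam(1)[of n] a z by simp
    qed auto
    then show ?thesis by (simp add: kernel_coeff_def atLeast0LessThan mult_ac)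
  qed
  have "(\<lambda>N. LINT \<omega>|P y. (\<Sum>n<N. c n * kernel_coeff (a * ?Z \<omega>) y n)) \<longlonglongrightarrow> (LINT \<omega>|P y. (\<Sum>n. c n * kernel_coeff (a * ?Z \<omega>) y n))"
  proof (rule integral_dominated_convergence[where w="\<lambda>_. B"])
    show "AE \<omega> in P y. (\<lambda>N. \<Sum>n<N. c n * kernel_coeff (a * ?Z \<omega>) y n) \<longlonglongrightarrow> (\<Sum>n. c n * kernel_coeff (a * ?Z \<omega>) y n)"
    proof (rule AE_mp[OF Zpos], intro AE_I2 impI)
      fix \<omega> assume "0 < ?Z \<omega>"
      then have "0 < a * ?Z \<omega>" using a by simp
      from heat_kernel_expansion[OF y this h2]
      show "(\<lambda>N. \<Sum>n<N. c n * kernel_coeff (a * ?Z \<omega>) y n) \<longlonglongrightarrow> (\<Sum>n. c n * kernel_coeff (a * ?Z \<omega>) y n)"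
        by (intro summable_LIMSEQ sums_summable)
    qed
    show "AE \<omega> in P y. norm (\<Sum>n<N. c n * kernel_coeff (a * ?Z \<omega>) y n) \<le> B" for N
      using bnd[OF Z0] by (intro AE_I2) simp
    show "(\<lambda>\<omega>. \<Sum>n<N. c n * kernel_coeff (a * ?Z \<omega>) y n) \<in> borel_measurable (P y)" for N
      unfolding kernel_coeff_def by measurable
    show "(\<lambda>\<omega>. \<Sum>n. c n * kernel_coeff (a * ?Z \<omega>) y n) \<in> borel_measurable (P y)"
      unfolding kernel_coeff_def by measurable
  qed simp
  moreover have "(LINT \<omega>|P y. (\<Sum>n<N. c n * kernel_coeff (a * ?Z \<omega>) y n)) = part N t y" for N
  proof -
    have i: "integrable (P y) (\<lambda>\<omega>. exp (- (lam n * a) * ?Z \<omega>))" for n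
      unfolding Z_var_eq_occupation using lam(1)[of n] a by (intro Y.integrable_exp_occupation) simp
    have e: "c n * kernel_coeff (a * ?Z \<omega>) y n = (c n * Q_poly d n y) * exp (- (lam n * a) * ?Z \<omega>)" for n \<omega>
      by (simp add: kernel_coeff_def mult_ac)
    have m: "(LINT \<omega>|P y. exp (- (lam n * a) * ?Z \<omega>)) = f n t" for n
      using F_independent[OF y, of "lam n * a"] lam(1)[of n] a by (simp add: B.mode_def a_def)
    have "(LINT \<omega>|P y. (\<Sum>n<N. c n * kernel_coeff (a * ?Z \<omega>) y n)) =
      (\<Sum>n<N. LINT \<omega>|P y. (c n * Q_poly d n y) * exp (- (lam n * a) * ?Z \<omega>))"
      unfolding e by (intro Bochner_Integration.integral_sum integrable_mult_right i)
    also have "\<dots> = part N t y" unfolding part_def by (simp only: integral_mult_right_zero m)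
    finally show ?thesis .
  qed
  ultimately show "(\<lambda>N. part N t y) \<longlonglongrightarrow> g t y" unfolding gt by simp
qed

lemma expectation_at_0:
  assumes y: "y \<in> state_space d"
  shows "integrable (P y) (\<lambda>\<omega>. h (stretched_process \<alpha> \<gamma> X \<sigma> 0 \<omega>))" "g 0 y = h y"
  using initial_expectation[OF pd y h2] by (simp_all add: g_def stretched_process_def)

lemma part_tendsto: "y \<in> state_space d \<Longrightarrow> 0 \<le> t \<Longrightarrow> (\<lambda>N. part N t y) \<longlonglongrightarrow> g t y"
  using expectation_positive_time(2)[of y t] series_at[of y] expectation_at_0(2)[of y]
  by (cases "t = 0") (auto simp: part_def B.mode_0)

lemma mode_arg_mono: "lam n * s powr (\<alpha> + \<gamma>) \<le> lam (Suc n) * s powr (\<alpha> + \<gamma>)" "0 \<le> lam n * s powr (\<alpha> + \<gamma>)"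
  using lam by (auto intro: mult_right_mono)

text \<open>The modes decrease in n and lie between 0 and 1 for every time, including 0, so Abel
  summation is uniform in t. The limit is identified with g pointwise afterwards.\<close>

lemma part_uniform:
  assumes uv: "{u..v} \<subseteq> state_space d"
  shows "uniform_limit ({0..} \<times> {u..v}) (\<lambda>N p. part N (fst p) (snd p)) (\<lambda>p. g (fst p) (snd p)) sequentially"
proof -
  have "uniformly_convergent_on ({0..} \<times> {u..v}) (\<lambda>N p. \<Sum>n<N. c n * Q_poly d n (snd p) * f n (fst p))"
    by (rule abel_uniformly_convergent[OF unif[OF uv]])
       (auto simp: B.mode_def intro!: B.F_antimono B.F_nonneg B.F_le_1 mode_arg_mono)
  then obtain l where l: "uniform_limit ({0..} \<times> {u..v}) (\<lambda>N p. part N (fst p) (snd p)) l sequentially"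
    unfolding uniformly_convergent_on_def part_def by blast
  have eq: "l p = g (fst p) (snd p)" if "p \<in> {0..} \<times> {u..v}" for p
    using LIMSEQ_unique[OF tendsto_uniform_limitI[OF l that] part_tendsto[of "snd p" "fst p"]] that uv by auto
  show ?thesis using l unfolding uniform_limit_iff by (auto simp: eq)
qed

text \<open>The time derivatives are controlled by Abel summation only after multiplication by \<open>s\<close>.\<close>

lemma dpart_eq:
  "s > 0 \<Longrightarrow> dpart N s y = - ((\<alpha> + \<gamma>) / s) *
    ((\<Sum>n<N. c n * Q_poly d n y * (f n s + lam n * s powr (\<alpha> + \<gamma>) * B.K \<gamma> (lam n * s powr (\<alpha> + \<gamma>)))) - part N s y)"
proof -
  assume s: "s > 0"
  have "- B.mode_rate \<gamma> l s = - ((\<alpha> + \<gamma>) / s) * (l * s powr (\<alpha> + \<gamma>) * B.K \<gamma> (l * s powr (\<alpha> + \<gamma>)))" for l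
    unfolding B.mode_rate_def using s by (simp add: powr_diff)
  then show ?thesis
    unfolding dpart_def part_def sum_subtractf[symmetric] sum_distrib_left
    by (intro sum.cong refl) (simp add: algebra_simps)
qed

text \<open>The weights in \<open>H\<close> are F(z) + z K(z), which decrease in z and equal 1 at 0.
  Subtracting \<open>part\<close> leaves s times the time derivative up to a constant factor;
  dividing by s confines uniformity to times bounded away from 0.\<close>

lemma dpart_uniform:
  assumes uv: "{u..v} \<subseteq> state_space d"
  obtains G where "\<And>e. e > 0 \<Longrightarrow> uniform_limit ({e..} \<times> {u..v}) (\<lambda>N p. dpart N (fst p) (snd p)) G sequentially"
proof -
  define H where "H N p = (\<Sum>n<N. c n * Q_poly d n (snd p) *
    (f n (fst p) + lam n * fst p powr (\<alpha> + \<gamma>) * B.K \<gamma> (lam n * fst p powr (\<alpha> + \<gamma>))))" for N p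
  have "uniformly_convergent_on ({0..} \<times> {u..v}) H"
    unfolding H_def
  proof (rule abel_uniformly_convergent[OF unif[OF uv]])
    fix n and s :: real assume "s \<in> {0..}"
    let ?b = "\<lambda>n. f n s + lam n * s powr (\<alpha> + \<gamma>) * B.K \<gamma> (lam n * s powr (\<alpha> + \<gamma>))"
    show "?b (Suc n) \<le> ?b n"
      unfolding B.mode_def by (intro B.F_plus_K_antimono \<gamma> mode_arg_mono)
    show "0 \<le> ?b n"
      unfolding B.mode_def by (intro add_nonneg_nonneg mult_nonneg_nonneg[OF mode_arg_mono(2)] B.F_nonneg B.K_nonneg)
    show "?b n \<le> 1"
      using B.F_plus_K_antimono[OF \<gamma> order_refl mode_arg_mono(2)[of n s]] by (simp add: B.mode_def B.F_0)
  qed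
  then obtain l where l: "uniform_limit ({0..} \<times> {u..v}) H l sequentially" unfolding uniformly_convergent_on_def by blast
  have L: "uniform_limit ({0..} \<times> {u..v}) (\<lambda>N p. H N p - part N (fst p) (snd p)) (\<lambda>p. l p - g (fst p) (snd p)) sequentially"
    by (rule uniform_limit_minus[OF l part_uniform[OF uv]])
  show ?thesis
  proof (rule that)
    fix e :: real assume e: "e > 0"
    have L': "uniform_limit ({e..} \<times> {u..v}) (\<lambda>N p. H N p - part N (fst p) (snd p)) (\<lambda>p. l p - g (fst p) (snd p)) sequentially"
      by (rule uniform_limit_on_subset[OF L]) (use e in auto)
    have "uniform_limit ({e..} \<times> {u..v}) (\<lambda>N p. - ((\<alpha> + \<gamma>) / fst p) * (H N p - part N (fst p) (snd p)))
      (\<lambda>p. - ((\<alpha> + \<gamma>) / fst p) * (l p - g (fst p) (snd p))) sequentially"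
    proof (rule uniform_limit_bounded_mult[OF L'])
      fix p :: "real \<times> real" assume "p \<in> {e..} \<times> {u..v}"
      then show "\<bar>- ((\<alpha> + \<gamma>) / fst p)\<bar> \<le> (\<alpha> + \<gamma>) / e"
        using e \<alpha> \<gamma> by (auto simp: mem_Times_iff intro!: divide_left_mono)
    qed
    then show "uniform_limit ({e..} \<times> {u..v}) (\<lambda>N p. dpart N (fst p) (snd p)) (\<lambda>p. - ((\<alpha> + \<gamma>) / fst p) * (l p - g (fst p) (snd p))) sequentially"
      unfolding uniform_limit_iff using e by (auto simp: dpart_eq H_def)
  qed
qed

lemma part_deriv: "s > 0 \<Longrightarrow> ((\<lambda>s. part N s y) has_real_derivative dpart N s y) (at s)"
  unfolding part_def dpart_def
  by (intro DERIV_sum DERIV_cmult B.mode_deriv \<gamma> lam)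

lemma part_continuous: "continuous_on {0..} (\<lambda>s. part N s y)"
  unfolding part_def by (intro continuous_intros B.mode_continuous \<gamma> lam)

lemma dpart_continuous: "continuous_on {0<..} (\<lambda>s. dpart N s y)"
proof -
  have k: "continuous_on {0<..} (\<lambda>s. B.K \<gamma> (lam n * s powr (\<alpha> + \<gamma>)))" for n
    by (rule continuous_on_compose2[OF B.K_continuous[OF \<gamma>]])
       (auto intro!: continuous_intros mult_nonneg_nonneg lam)
  show ?thesis unfolding dpart_def B.mode_rate_def by (intro continuous_intros k) auto
qed

lemma part_caputo:
  assumes t: "t > 0"
  shows "((\<lambda>s. dpart N s y / (t - s) powr \<alpha>) has_integral
    Gamma (1 - \<alpha>) * t powr \<gamma> * (\<Sum>n<N. c n * f n t * (- lam n) * Q_poly d n y)) {0..t}"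
proof -
  have "((\<lambda>s. \<Sum>n<N. c n * Q_poly d n y * (- B.mode_rate \<gamma> (lam n) s / (t - s) powr \<alpha>)) has_integral
    (\<Sum>n<N. c n * Q_poly d n y * (- lam n * Gamma (1 - \<alpha>) * t powr \<gamma> * f n t))) {0..t}"
    by (intro has_integral_sum has_integral_mult_right B.mode_fractional_ode \<gamma> lam t) auto
  moreover have "(\<Sum>n<N. c n * Q_poly d n y * (- B.mode_rate \<gamma> (lam n) s / (t - s) powr \<alpha>)) = dpart N s y / (t - s) powr \<alpha>" for s
    unfolding dpart_def sum_divide_distrib by (intro sum.cong refl) simp
  moreover have "(\<Sum>n<N. c n * Q_poly d n y * (- lam n * Gamma (1 - \<alpha>) * t powr \<gamma> * f n t)) =
    Gamma (1 - \<alpha>) * t powr \<gamma> * (\<Sum>n<N. c n * f n t * (- lam n) * Q_poly d n y)"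
    unfolding sum_distrib_left by (intro sum.cong refl) simp
  ultimately show ?thesis by simp
qed

section \<open>Time regularity of g, its Caputo derivative and the equation\<close>

definition dt_g :: "real \<Rightarrow> real \<Rightarrow> real" where
  "dt_g s y = deriv (\<lambda>s. g s y) s"

lemma g_time_regular:
  assumes uv: "{u..v} \<subseteq> state_space d"
  shows "\<And>y s. y \<in> {u..v} \<Longrightarrow> s > 0 \<Longrightarrow> ((\<lambda>s. g s y) has_real_derivative dt_g s y) (at s)"
    and "\<And>y. y \<in> {u..v} \<Longrightarrow> continuous_on {0..} (\<lambda>s. g s y)"
    and "\<And>y. y \<in> {u..v} \<Longrightarrow> continuous_on {0<..} (\<lambda>s. dt_g s y)"
    and "\<And>e. e > 0 \<Longrightarrow> uniform_limit ({e..} \<times> {u..v}) (\<lambda>N p. dpart N (fst p) (snd p)) (\<lambda>p. dt_g (fst p) (snd p)) sequentially"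
proof -
  obtain G where G: "\<And>e. e > 0 \<Longrightarrow> uniform_limit ({e..} \<times> {u..v}) (\<lambda>N p. dpart N (fst p) (snd p)) G sequentially"
    using dpart_uniform[OF uv] by blast
  have slice: "uniform_limit A (\<lambda>N s. F N (s, y)) (\<lambda>s. L (s, y)) sequentially"
    if "uniform_limit (A \<times> {u..v}) F L sequentially" "y \<in> {u..v}" for A :: "real set" and y F and L :: "real \<times> real \<Rightarrow> real"
    using that unfolding uniform_limit_iff by (auto elim!: eventually_mono)
  have d: "((\<lambda>s. g s y) has_real_derivative G (s, y)) (at s)" if y: "y \<in> {u..v}" and s: "s > 0" for y s
  proof -
    \<comment> \<open>On {s/2..} the derivatives converge uniformly, and s is an interior point of
      it.\<close>
    have "((\<lambda>s. g s y) has_real_derivative G (s, y)) (at s within {s/2..})"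
    proof (rule has_real_derivative_uniform_limit[where f="\<lambda>N s. part N s y" and f'="\<lambda>N s. dpart N s y" and g'="\<lambda>s. G (s, y)"])
      show "uniform_limit {s/2..} (\<lambda>N s. dpart N s y) (\<lambda>s. G (s, y)) sequentially"
        using slice[OF G[of "s/2"] y] s by simp
      show "((\<lambda>s. part N s y) has_real_derivative dpart N x y) (at x within {s/2..})" if "x \<in> {s/2..}" for N x
        using that s by (intro has_field_derivative_at_within[OF part_deriv]) auto
      show "(\<lambda>N. part N x y) \<longlonglongrightarrow> g x y" if "x \<in> {s/2..}" for x
        using that s y uv by (intro part_tendsto) auto
    qed (use s in auto)
    moreover have "at s within {s/2..} = at s" using s by (intro at_within_interior) (auto simp: interior_real_atLeast)
    ultimately show ?thesis by simp
  qed
  then have eq: "dt_g s y = G (s, y)" if "y \<in> {u..v}" "s > 0" for y s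
    unfolding dt_g_def using that by (intro DERIV_imp_deriv) auto
  show "\<And>y s. y \<in> {u..v} \<Longrightarrow> s > 0 \<Longrightarrow> ((\<lambda>s. g s y) has_real_derivative dt_g s y) (at s)"
    using d eq by simp
  show U: "uniform_limit ({e..} \<times> {u..v}) (\<lambda>N p. dpart N (fst p) (snd p)) (\<lambda>p. dt_g (fst p) (snd p)) sequentially" if e: "e > 0" for e
  proof -
    have q: "G p = dt_g (fst p) (snd p)" if "p \<in> {e..} \<times> {u..v}" for p
      using eq[of "snd p" "fst p"] that e by auto
    show ?thesis using G[OF e] unfolding uniform_limit_iff by (simp add: q)
  qed
  show "continuous_on {0..} (\<lambda>s. g s y)" if y: "y \<in> {u..v}" for y
    using slice[OF part_uniform[OF uv] y] part_continuous
    by (intro uniform_limit_theorem[where F=sequentially and f="\<lambda>N s. part N s y"]) auto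
  show "continuous_on {0<..} (\<lambda>s. dt_g s y)" if y: "y \<in> {u..v}" for y
  proof (rule continuous_at_imp_continuous_on, intro ballI)
    fix s :: real assume s: "s \<in> {0<..}"
    then have s2: "s / 2 > 0" by simp
    have dc: "continuous_on {s/2..} (\<lambda>s. dpart N s y)" for N
      by (rule continuous_on_subset[OF dpart_continuous]) (use s in auto)
    have "continuous_on {s/2..} (\<lambda>s. dt_g s y)"
      using slice[OF U[OF s2] y] dc
      by (intro uniform_limit_theorem[where F=sequentially and f="\<lambda>N s. dpart N s y"]) auto
    then show "isCont (\<lambda>s. dt_g s y) s"
      using s by (intro continuous_on_interior[of "{s/2..}"]) (auto simp: interior_real_atLeast)
  qed
qed

text \<open>\<open>caputo_integral_bound\<close> is applied to \<open>part N\<close> minus g: it is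
  uniformly small on {0..t}, and its time derivative is uniformly small on {t/2..t}. As the constant
  does not depend on y, the Caputo integrals of the partial sums, which are known explicitly,
  converge uniformly in y.\<close>

lemma g_caputo:
  assumes uv: "{u..v} \<subseteq> state_space d" and t: "t > 0"
  shows "\<And>y. y \<in> {u..v} \<Longrightarrow> (\<lambda>s. dt_g s y / (t - s) powr \<alpha>) integrable_on {0..t}"
    and "uniform_limit {u..v} (\<lambda>N y. \<Sum>n<N. c n * f n t * (- lam n) * Q_poly d n y)
      (\<lambda>y. t powr (- \<gamma>) / Gamma (1 - \<alpha>) * integral {0..t} (\<lambda>s. dt_g s y / (t - s) powr \<alpha>)) sequentially"
proof -
  obtain C where C: "C \<ge> 0"
    "\<And>e e' A B. continuous_on {0..t} e \<Longrightarrow> (\<And>s. 0 < s \<Longrightarrow> s \<le> t \<Longrightarrow> (e has_real_derivative e' s) (at s)) \<Longrightarrow>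
      continuous_on {0<..t} e' \<Longrightarrow> (\<And>s. s \<in> {0..t} \<Longrightarrow> \<bar>e s\<bar> \<le> A) \<Longrightarrow> (\<And>s. s \<in> {t/2..t} \<Longrightarrow> \<bar>e' s\<bar> \<le> B) \<Longrightarrow>
      (\<lambda>s. e' s / (t - s) powr \<alpha>) integrable_on {0..t} \<and>
      \<bar>integral {0..t} (\<lambda>s. e' s / (t - s) powr \<alpha>)\<bar> \<le> C * (A + B)"
    using caputo_integral_bound[OF \<alpha> t] by blast
  note R = g_time_regular[OF uv]
  define k where "k N y = integral {0..t} (\<lambda>s. dpart N s y / (t - s) powr \<alpha>)" for N y
  have kN: "k N y = Gamma (1 - \<alpha>) * t powr \<gamma> * (\<Sum>n<N. c n * f n t * (- lam n) * Q_poly d n y)" for N y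
    unfolding k_def by (rule integral_unique[OF part_caputo[OF t]])
  have ki: "(\<lambda>s. dpart N s y / (t - s) powr \<alpha>) integrable_on {0..t}" for N y
    using part_caputo[OF t] by blast
  let ?I = "\<lambda>y. integral {0..t} (\<lambda>s. dt_g s y / (t - s) powr \<alpha>)"
  have main: "\<forall>\<^sub>F N in sequentially. \<forall>y\<in>{u..v}. (\<lambda>s. dt_g s y / (t - s) powr \<alpha>) integrable_on {0..t} \<and> \<bar>k N y - ?I y\<bar> \<le> C * (e + e)"
    if e: "e > 0" for e
  proof -
    have t2: "t / 2 > 0" using t by simp
    have "\<forall>\<^sub>F N in sequentially. \<forall>p\<in>{0..} \<times> {u..v}. dist (part N (fst p) (snd p)) (g (fst p) (snd p)) < e"
      using part_uniform[OF uv] e by (rule uniform_limitD)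
    moreover have "\<forall>\<^sub>F N in sequentially. \<forall>p\<in>{t/2..} \<times> {u..v}. dist (dpart N (fst p) (snd p)) (dt_g (fst p) (snd p)) < e"
      using R(4)[OF t2] e by (rule uniform_limitD)
    ultimately show ?thesis
    proof eventually_elim
      case (elim N)
      show ?case
      proof (intro ballI)
        fix y assume y: "y \<in> {u..v}"
        have "(\<lambda>s. (dpart N s y - dt_g s y) / (t - s) powr \<alpha>) integrable_on {0..t} \<and>
          \<bar>integral {0..t} (\<lambda>s. (dpart N s y - dt_g s y) / (t - s) powr \<alpha>)\<bar> \<le> C * (e + e)"
        proof (rule C(2)[of "\<lambda>s. part N s y - g s y"])
          show "continuous_on {0..t} (\<lambda>s. part N s y - g s y)"
            by (intro continuous_intros continuous_on_subset[OF part_continuous] continuous_on_subset[OF R(2)[OF y]]) auto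
          show "((\<lambda>s. part N s y - g s y) has_real_derivative dpart N s y - dt_g s y) (at s)" if "0 < s" for s
            by (intro DERIV_diff part_deriv R(1) y that)
          show "continuous_on {0<..t} (\<lambda>s. dpart N s y - dt_g s y)"
            by (intro continuous_intros continuous_on_subset[OF dpart_continuous] continuous_on_subset[OF R(3)[OF y]]) auto
          show "\<bar>part N s y - g s y\<bar> \<le> e" if "s \<in> {0..t}" for s
            using elim(1) that y by (auto simp: dist_real_def intro: less_imp_le)
          show "\<bar>dpart N s y - dt_g s y\<bar> \<le> e" if "s \<in> {t/2..t}" for s
            using elim(2) that y by (auto simp: dist_real_def intro: less_imp_le)
        qed
        then have i: "(\<lambda>s. (dpart N s y - dt_g s y) / (t - s) powr \<alpha>) integrable_on {0..t}"
          and b: "\<bar>integral {0..t} (\<lambda>s. (dpart N s y - dt_g s y) / (t - s) powr \<alpha>)\<bar> \<le> C * (e + e)" by auto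
        have eq: "(\<lambda>s. dpart N s y / (t - s) powr \<alpha> - (dpart N s y - dt_g s y) / (t - s) powr \<alpha>) = (\<lambda>s. dt_g s y / (t - s) powr \<alpha>)"
          by (simp add: diff_divide_distrib)
        \<comment> \<open>Integrability for g is obtained as a difference: the partial sum is
          integrable by the equation for the modes, and the error by the bound.\<close>
        have gi: "(\<lambda>s. dt_g s y / (t - s) powr \<alpha>) integrable_on {0..t}"
          using integrable_diff[OF ki[of N y] i] unfolding eq .
        have "?I y = k N y - integral {0..t} (\<lambda>s. (dpart N s y - dt_g s y) / (t - s) powr \<alpha>)"
          unfolding k_def eq[symmetric] by (rule Henstock_Kurzweil_Integration.integral_diff[OF ki[of N y] i])
        then show "(\<lambda>s. dt_g s y / (t - s) powr \<alpha>) integrable_on {0..t} \<and> \<bar>k N y - ?I y\<bar> \<le> C * (e + e)"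
          using gi b by simp
      qed
    qed
  qed
  show "(\<lambda>s. dt_g s y / (t - s) powr \<alpha>) integrable_on {0..t}" if "y \<in> {u..v}" for y
    using main[of 1] that eventually_happens'[OF sequentially_bot] by fastforce
  have lim: "uniform_limit {u..v} k ?I sequentially"
  proof (rule uniform_limitI)
    fix e :: real assume e: "e > 0"
    define e' where "e' = e / (4 * (C + 1))"
    have e': "e' > 0" using e C(1) by (simp add: e'_def)
    have "C * (e' + e') < e"
    proof -
      have "C * (e' + e') \<le> (C + 1) * (2 * e')" using C(1) e' by (simp add: algebra_simps)
      also have "\<dots> = e / 2" using C(1) by (simp add: e'_def field_simps)
      also have "\<dots> < e" using e by simp
      finally show ?thesis .
    qed
    then show "\<forall>\<^sub>F N in sequentially. \<forall>y\<in>{u..v}. dist (k N y) (?I y) < e"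
      by (intro eventually_mono[OF main[OF e']]) (auto simp: dist_real_def)
  qed
  have G: "Gamma (1 - \<alpha>) > 0" using \<alpha> by (auto intro!: Gamma_real_pos)
  define r where "r = t powr (- \<gamma>) / Gamma (1 - \<alpha>)"
  have r: "r * (Gamma (1 - \<alpha>) * t powr \<gamma>) = 1" using G t by (simp add: r_def powr_minus field_simps)
  have "uniform_limit {u..v} (\<lambda>N y. r * k N y) (\<lambda>y. r * ?I y) sequentially"
    by (rule uniform_limit_bounded_mult[OF lim order_refl])
  moreover have "r * k N y = (\<Sum>n<N. c n * f n t * (- lam n) * Q_poly d n y)" for N y
    unfolding kN mult.assoc[symmetric] r[unfolded mult.assoc[symmetric]] by simp
  ultimately show "uniform_limit {u..v} (\<lambda>N y. \<Sum>n<N. c n * f n t * (- lam n) * Q_poly d n y)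
      (\<lambda>y. t powr (- \<gamma>) / Gamma (1 - \<alpha>) * ?I y) sequentially"
    by (simp add: r_def)
qed

text \<open>The partial sums in y are polynomials. They converge to g and their images under the
  generator converge to the Caputo side, so \<open>sturm_liouville_closed\<close> yields both
  derivatives of g and the equation at once.\<close>

lemma g_solves:
  assumes t: "t > 0" and y: "y \<in> state_space d"
  shows "g t differentiable (at y)" "deriv (g t) differentiable (at y)"
    and "generator d (g t) y = t powr (- \<gamma>) / Gamma (1 - \<alpha>) * integral {0..t} (\<lambda>s. dt_g s y / (t - s) powr \<alpha>)"
proof -
  obtain r where r: "r > 0" "{y - r..y + r} \<subseteq> state_space d" using state_space_Icc[OF y] by blast
  \<comment> \<open>y lies in the interior of {u..v}, so the derivatives within the closed interval
    become ordinary ones at y.\<close>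
  define u v where "u = y - r" and "v = y + r"
  have uv: "{u..v} \<subseteq> state_space d" "u < y" "y < v" using r by (auto simp: u_def v_def)
  let ?w = "\<lambda>y. t powr (- \<gamma>) / Gamma (1 - \<alpha>) * integral {0..t} (\<lambda>s. dt_g s y / (t - s) powr \<alpha>)"
  define p where "p N = (\<Sum>n<N. smult (c n * f n t) (Qp n))" for N
  have pp: "poly (p N) x = part N t x" for N x
    unfolding p_def part_def by (simp add: poly_sum poly_Qp mult_ac)
  have lim1: "uniform_limit {u..v} (\<lambda>N. poly (p N)) (g t) sequentially"
    using part_uniform[OF uv(1)] t unfolding uniform_limit_iff pp by (auto elim!: eventually_mono)
  have gen: "drift d x * poly (pderiv (p N)) x + diffusion_coeff d x * poly (pderiv (pderiv (p N))) x =
      (\<Sum>n<N. c n * f n t * (- lam n) * Q_poly d n x)" for N x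
  proof -
    have "drift d x * poly (pderiv (p N)) x + diffusion_coeff d x * poly (pderiv (pderiv (p N))) x = poly (generator_p d (p N)) x"
      by (simp add: generator_p_def poly_drift_p poly_diffusion_p)
    also have "\<dots> = (\<Sum>n<N. c n * f n t * (- lam n) * Q_poly d n x)"
      unfolding p_def generator_p_sum_smult by (simp add: generator_Qp poly_sum poly_Qp mult_ac)
    finally show ?thesis .
  qed
  have dens: "continuous_on {u..v} (stationary_density d)"
    by (rule continuous_on_subset[OF density_continuous[OF adm] uv(1)])
  have G: "uniform_limit {u..v} (\<lambda>N x. drift d x * poly (pderiv (p N)) x + diffusion_coeff d x * poly (pderiv (pderiv (p N))) x) ?w sequentially"
    unfolding gen by (rule g_caputo(2)[OF uv(1) t])
  have Dm: "((\<lambda>x. diffusion_coeff d x * stationary_density d x) has_real_derivative drift d x * stationary_density d x) (at x)" if "x \<in> {u..v}" for x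
    using that uv(1) by (intro diffusion_density_deriv[OF adm]) auto
  have pos: "0 < diffusion_coeff d x" "0 < stationary_density d x" if "x \<in> {u..v}" for x
    using that uv(1) diffusion_pos[OF adm] density_pos[OF adm] by auto
  have cont: "continuous_on {u..v} (diffusion_coeff d)" "continuous_on {u..v} (drift d)"
    by (rule diffusion_continuous drift_continuous)+
  obtain g1 g2 where g12: "\<And>x. x \<in> {u..v} \<Longrightarrow> (g t has_real_derivative g1 x) (at x within {u..v})"
    "\<And>x. x \<in> {u..v} \<Longrightarrow> (g1 has_real_derivative g2 x) (at x within {u..v})"
    "\<And>x. x \<in> {u..v} \<Longrightarrow> drift d x * g1 x + diffusion_coeff d x * g2 x = ?w x"
    by (rule sturm_liouville_closed[OF less_trans[OF uv(2,3)] poly_DERIV poly_DERIV cont dens pos Dm lim1 G]) (assumption | rule that)+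
  have d1: "(g t has_real_derivative g1 x) (at x)" "(g1 has_real_derivative g2 x) (at x)" if "x \<in> {u<..<v}" for x
    using g12(1,2)[of x] that at_within_interior[of x "{u..v}"] by auto
  have dg: "deriv (g t) x = g1 x" if "x \<in> {u<..<v}" for x using d1(1)[OF that] by (rule DERIV_imp_deriv)
  have yI: "y \<in> {u<..<v}" using uv by simp
  have d2: "(deriv (g t) has_real_derivative g2 y) (at y)"
    using d1(2)[OF yI] by (rule has_field_derivative_transform_within_open[of _ _ _ "{u<..<v}"]) (use yI dg in auto)
  show "g t differentiable (at y)" using d1(1)[OF yI] by (auto simp: real_differentiable_def)
  show "deriv (g t) differentiable (at y)" using d2 by (auto simp: real_differentiable_def)
  have "generator d (g t) y = drift d y * g1 y + diffusion_coeff d y * g2 y"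
    unfolding generator_def dg[OF yI] DERIV_imp_deriv[OF d2] ..
  also have "\<dots> = ?w y" using g12(3)[of y] uv by simp
  finally show "generator d (g t) y = ?w y" .
qed

lemma g_solves_fractional_cauchy: "solves_fractional_cauchy \<alpha> \<gamma> d h g"
  unfolding solves_fractional_cauchy_def stretched_caputo_def
proof (intro conjI allI ballI impI)
  show "g 0 y = h y" if "y \<in> state_space d" for y by (rule expectation_at_0(2)[OF that])
  fix t y :: real assume t: "t > 0" and y: "y \<in> state_space d"
  have yy: "{y..y} \<subseteq> state_space d" using y by simp
  show "(\<lambda>s. g s y) differentiable (at t)"
    using g_time_regular(1)[OF yy, of y t] t by (auto simp: real_differentiable_def)
  show "(\<lambda>s. deriv (\<lambda>r. g r y) s / (t - s) powr \<alpha>) integrable_on {0..t}"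
    using g_caputo(1)[OF yy t, of y] by (simp add: dt_g_def)
  show "g t differentiable (at y)" "deriv (g t) differentiable (at y)" by (rule g_solves[OF t y])+
  show "t powr (- \<gamma>) / Gamma (1 - \<alpha>) * integral {0..t} (\<lambda>s. deriv (\<lambda>s. g s y) s / (t - s) powr \<alpha>) = generator d (g t) y"
    using g_solves(3)[OF t y] by (simp add: dt_g_def)
qed

lemma integrable_stretched: "y \<in> state_space d \<Longrightarrow> 0 \<le> t \<Longrightarrow> integrable (P y) (\<lambda>\<omega>. h (stretched_process \<alpha> \<gamma> X \<sigma> t \<omega>))"
  using expectation_positive_time(1)[of y t] expectation_at_0(1)[of y] by (cases "t = 0") auto

end

theorem theorem6p2:
  fixes \<alpha> \<gamma> :: real and d :: pearson and h :: "real \<Rightarrow> real"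
    and P :: "real \<Rightarrow> 'a measure" and X \<sigma> :: "real \<Rightarrow> 'a \<Rightarrow> real"
  assumes "0 < \<alpha>" and "\<alpha> < 1" and "0 \<le> \<gamma>" and "0 < \<alpha> + \<gamma>" and "\<alpha> + \<gamma> \<le> 1"
    and "admissible d"
    and "pearson_diffusion d P X"
    and "\<And>y. y \<in> state_space d \<Longrightarrow> stable_subordinator \<alpha> (P y) \<sigma>"
    and "\<And>y. y \<in> state_space d \<Longrightarrow> independent_of_process (P y) X (Z_var \<gamma> \<sigma>)"
    and "L2_stationary d h"
    and "\<And>u v. {u..v} \<subseteq> state_space d \<Longrightarrow>
           uniform_limit {u..v} (\<lambda>N y. \<Sum>n<N. fourier_coeff d h n * Q_poly d n y) h sequentially"
  shows "(\<forall>t\<ge>0. \<forall>y\<in>state_space d.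
            integrable (P y) (\<lambda>\<omega>. h (stretched_process \<alpha> \<gamma> X \<sigma> t \<omega>))) \<and>
         solves_fractional_cauchy \<alpha> \<gamma> d h
           (\<lambda>t y. LINT \<omega>|P y. h (stretched_process \<alpha> \<gamma> X \<sigma> t \<omega>))"
proof -
  interpret stretched_pearson d \<alpha> \<gamma> h P X \<sigma>
    by unfold_locales (use assms in auto)
  show ?thesis
    using integrable_stretched g_solves_fractional_cauchy unfolding g_def by blast
qed

end
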